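(* Let $X$ be a complex Banach space, let $\omega\in[0,\pi)$, let $A\in\mathrm{Sect}_\omega(X)$, let $\alpha\in\mathbb{C}$ with $0<\operatorname{Re}\alpha<1$, and let $x\in X$. For $z\in S_{(\pi-\omega)/2}$ put $$U(z):=\frac{z^{2\alpha}}{2\,\Gamma(2\alpha)}\int_0^\infty s^{\alpha-\frac12}\,e^{-z\sqrt{A+s}}\,(A+s)^{-\frac12}\,ds\in L(X).$$ If $\mathcal{D}(A)$ is dense in $X$, then the function $u$ given by $u(t):=U(t)x$ for $t>0$ and $u(0):=x$ is a solution of $$u''(t)+\frac{1-2\alpha}{t}u'(t)=Au(t)\quad(t>0),\qquad u(0)=x .$$
   Context: Solution: a solution of the initial value problem $u''(t)+\frac{1-2\alpha}{t}u'(t)=Au(t)$ $(t>0)$, $u(0)=x$, is a function $u\in C_{\mathrm b}([0,\infty);X)$ (bounded and continuous) such that $u(0)=x$, $u(t)\in\mathcal{D}(A)$ for all $t>0$, $Au\in L^1_{\mathrm{loc}}((0,\infty);X)$, and for all $\phi\in C_{\mathrm c}^\infty((0,\infty))$ $$\int_0^\infty\Bigl(u(t)\phi''(t)-u(t)\frac{d}{dt}\Bigl(\frac{1-2\alpha}{t}\phi(t)\Bigr)\Bigr)dt=\int_0^\infty Au(t)\,\phi(t)\,dt .$$ Sectorial operators: for $\theta\in(0,\pi)$, $S_\theta:=\{z\in\mathbb{C}\setminus(-\infty,0]:|\arg z|<\theta\}$ with $\arg z\in(-\pi,\pi)$; $S_0:=(0,\infty)$. A linear operator $A$ in $X$ is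 sectorial if $(-\infty,0)\subseteq\rho(A)$ and $\sup_{\lambda>0}\|\lambda(\lambda+A)^{-1}\|<\infty$. Its angle of sectoriality is the infimum of all $\theta\in[0,\pi)$ such that $\sigma(A)\subseteq\overline{S_\theta}$ and $\sup_{z\in\mathbb{C}\setminus S_\phi,\,z\ne0}\|z(z-A)^{-1}\|<\infty$ for every $\phi\in(\theta,\pi)$. $\mathrm{Sect}_\omega(X)$ is the set of sectorial operators with angle of sectoriality $\omega$. Powers and semigroups: complex powers of numbers use the principal branch. For a sectorial operator $B$, $\sqrt B$ is its square root in the sense of the sectorial functional calculus (the usual fractional power $B^{1/2}$). For $s\ge0$, $A+s$ is sectorial with angle at most $\omega$, so $\sqrt{A+s}$ is sectorial with angle at most $\omega/2<\pi/2$, and $e^{-z\sqrt{A+s}}$, $z\in S_{(\pi-\omega)/2}$, is the bounded holomorphic semigroup generated by $-\sqrt{A+s}$. For $s>0$, $(A+s)^{-1/2}:=(\sqrt{A+s})^{-1}\in L(X)$. $L(X)$ is the space of bounded linear operators on $X$. The integral is a Bochner integral in $L(X)$. *)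

theory Defs
  imports "HOL-Analysis.Analysis"
begin

section \<open>Complex Banach spaces\<close>

class complex_normed_vector = real_normed_vector +
  fixes scaleC :: "complex \<Rightarrow> 'a \<Rightarrow> 'a"  (infixr "*\<^sub>C" 75)
  assumes scaleC_add_right: "c *\<^sub>C (x + y) = c *\<^sub>C x + c *\<^sub>C y"
    and scaleC_add_left: "(c + d) *\<^sub>C x = c *\<^sub>C x + d *\<^sub>C x"
    and scaleC_scaleC: "c *\<^sub>C d *\<^sub>C x = (c * d) *\<^sub>C x"
    and scaleC_of_real: "complex_of_real r *\<^sub>C x = r *\<^sub>R x"
    and norm_scaleC: "norm (c *\<^sub>C x) = cmod c * norm x"

class complex_banach = complex_normed_vector + complete_space

subclass (in complex_banach) banach ..

instantiation complex :: complex_banach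
begin
definition scaleC_complex :: "complex \<Rightarrow> complex \<Rightarrow> complex" where
  "scaleC_complex c x = c * x"
instance
  by standard (auto simp: scaleC_complex_def algebra_simps norm_mult scaleR_conv_of_real)
end

lemma bounded_linear_scaleC:
  "bounded_linear (\<lambda>x::'a::complex_normed_vector. c *\<^sub>C x)"
proof (rule bounded_linear_intro[where K = "cmod c"])
  fix r :: real and x :: 'a
  show "c *\<^sub>C r *\<^sub>R x = r *\<^sub>R c *\<^sub>C x"
    by (metis scaleC_of_real scaleC_scaleC mult.commute)
qed (auto simp: scaleC_add_right norm_scaleC mult.commute)

instantiation blinfun :: (real_normed_vector, complex_normed_vector) complex_normed_vector
begin
lift_definition scaleC_blinfun :: "complex \<Rightarrow> 'a \<Rightarrow>\<^sub>L 'b \<Rightarrow> 'a \<Rightarrow>\<^sub>L 'b"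
  is "\<lambda>c T x. c *\<^sub>C T x"
  by (rule bounded_linear_compose[OF bounded_linear_scaleC])
instance
proof
  fix c d :: complex and r :: real and S T :: "'a \<Rightarrow>\<^sub>L 'b"
  show "c *\<^sub>C (S + T) = c *\<^sub>C S + c *\<^sub>C T"
    by transfer (simp add: scaleC_add_right)
  show "(c + d) *\<^sub>C T = c *\<^sub>C T + d *\<^sub>C T"
    by transfer (simp add: scaleC_add_left)
  show "c *\<^sub>C d *\<^sub>C T = (c * d) *\<^sub>C T"
    by transfer (simp add: scaleC_scaleC)
  show "complex_of_real r *\<^sub>C T = r *\<^sub>R T"
    by transfer (simp add: scaleC_of_real)
  have le: "norm (c *\<^sub>C T) \<le> cmod c * norm T" for c and T :: "'a \<Rightarrow>\<^sub>L 'b"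
  proof (rule norm_blinfun_bound)
    fix x
    have "norm (blinfun_apply (c *\<^sub>C T) x) = cmod c * norm (blinfun_apply T x)"
      by (simp add: scaleC_blinfun.rep_eq norm_scaleC)
    also have "\<dots> \<le> cmod c * (norm T * norm x)"
      by (intro mult_left_mono norm_blinfun) auto
    finally show "norm (blinfun_apply (c *\<^sub>C T) x) \<le> cmod c * norm T * norm x"
      by (simp add: mult.assoc)
  qed auto
  show "norm (c *\<^sub>C T) = cmod c * norm T"
  proof (cases "c = 0")
    case True
    then show ?thesis using le[of c T] by simp
  next
    case False
    have "inverse c *\<^sub>C c *\<^sub>C T = 1 *\<^sub>R T"
      using False by transfer (simp add: scaleC_scaleC flip: scaleC_of_real)
    then have "cmod c * norm T \<le> norm (c *\<^sub>C T)"
      using le[of "inverse c" "c *\<^sub>C T"] False by (simp add: norm_inverse norm_divide field_simps)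
    with le[of c T] show ?thesis by simp
  qed
qed
end

instance blinfun :: (real_normed_vector, complex_banach) complex_banach ..

text \<open>
  The space L(X) of bounded complex-linear operators, as a norm-closed subspace of the Banach
  space \<open>'a \<Rightarrow>\<^sub>L 'a\<close> of bounded real-linear ones. Being closed and isometrically embedded, it
  may be replaced by the latter when integrating or differentiating L(X)-valued functions.
\<close>

definition cblinfuns :: "('a::complex_normed_vector \<Rightarrow>\<^sub>L 'a) set" where
  "cblinfuns = {T. \<forall>c x. blinfun_apply T (c *\<^sub>C x) = c *\<^sub>C blinfun_apply T x}"


section \<open>Bochner integral\<close>

text \<open>
  The library's \<^const>\<open>has_bochner_integral\<close> is restricted to second-countable spaces, which
  excludes L(X) and non-separable X. This is its defining condition on an arbitrary normed
  space. The \<open>L\<^sup>1\<close>-approximation by simple functions forces f to be almost everywhere a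
  pointwise limit of simple functions, so over a complete measure (such as
  \<^const>\<open>lebesgue\<close>) this is the usual Bochner integral of strongly measurable functions.
\<close>

definition has_bochner ::
    "'m measure \<Rightarrow> ('m \<Rightarrow> 'b::real_normed_vector) \<Rightarrow> 'b \<Rightarrow> bool" where
  "has_bochner M f I \<longleftrightarrow>
     f \<in> borel_measurable M \<and>
     (\<exists>s. (\<forall>i. Bochner_Integration.simple_bochner_integrable M (s i)) \<and>
          (\<lambda>i. \<integral>\<^sup>+ t. ennreal (norm (f t - s i t)) \<partial>M) \<longlonglongrightarrow> 0 \<and>
          (\<lambda>i. Bochner_Integration.simple_bochner_integral M (s i)) \<longlonglongrightarrow> I)"

definition bochner_integrable ::
    "'m measure \<Rightarrow> ('m \<Rightarrow> 'b::real_normed_vector) \<Rightarrow> bool" where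
  "bochner_integrable M f \<longleftrightarrow> (\<exists>I. has_bochner M f I)"

definition bochner ::
    "'m measure \<Rightarrow> ('m \<Rightarrow> 'b::real_normed_vector) \<Rightarrow> 'b" where
  "bochner M f = (if bochner_integrable M f then THE I. has_bochner M f I else 0)"


section \<open>Unbounded linear operators\<close>

text \<open>An operator in X is a partial map; its domain is \<^const>\<open>dom\<close>.\<close>

definition app :: "('a \<rightharpoonup> 'a) \<Rightarrow> 'a \<Rightarrow> 'a" where
  "app A x = the (A x)"

definition linear_operator :: "('a::complex_normed_vector \<rightharpoonup> 'a) \<Rightarrow> bool" where
  "linear_operator A \<longleftrightarrow>
     0 \<in> dom A \<and>
     (\<forall>x\<in>dom A. \<forall>y\<in>dom A. x + y \<in> dom A \<and> app A (x + y) = app A x + app A y) \<and>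
     (\<forall>c. \<forall>x\<in>dom A. c *\<^sub>C x \<in> dom A \<and> app A (c *\<^sub>C x) = c *\<^sub>C app A x)"

definition op_plus :: "('a::complex_normed_vector \<rightharpoonup> 'a) \<Rightarrow> complex \<Rightarrow> ('a \<rightharpoonup> 'a)" where
  "op_plus A c = (\<lambda>x. map_option (\<lambda>y. y + c *\<^sub>C x) (A x))"

definition minus_op :: "complex \<Rightarrow> ('a::complex_normed_vector \<rightharpoonup> 'a) \<Rightarrow> ('a \<rightharpoonup> 'a)" where
  "minus_op c A = (\<lambda>x. map_option (\<lambda>y. c *\<^sub>C x - y) (A x))"

definition boundedly_invertible :: "('a::complex_normed_vector \<rightharpoonup> 'a) \<Rightarrow> bool" where
  "boundedly_invertible B \<longleftrightarrow>
     bij_betw (app B) (dom B) UNIV \<and> bounded_linear (inv_into (dom B) (app B))"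

definition inv_op :: "('a::complex_normed_vector \<rightharpoonup> 'a) \<Rightarrow> 'a \<Rightarrow>\<^sub>L 'a" where
  "inv_op B = Blinfun (inv_into (dom B) (app B))"

definition resolvent_set :: "('a::complex_normed_vector \<rightharpoonup> 'a) \<Rightarrow> complex set" where
  "resolvent_set A = {z. boundedly_invertible (minus_op z A)}"

definition spectrum :: "('a::complex_normed_vector \<rightharpoonup> 'a) \<Rightarrow> complex set" where
  "spectrum A = - resolvent_set A"

definition resolvent :: "complex \<Rightarrow> ('a::complex_normed_vector \<rightharpoonup> 'a) \<Rightarrow> 'a \<Rightarrow>\<^sub>L 'a" where
  "resolvent z A = inv_op (minus_op z A)"


section \<open>Sectorial operators\<close>

definition sector :: "real \<Rightarrow> complex set" where
  "sector \<theta> = (if \<theta> = 0 then complex_of_real ` {0<..}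
               else {z. z \<notin> \<real>\<^sub>\<le>\<^sub>0 \<and> \<bar>Arg z\<bar> < \<theta>})"

definition sectorial :: "('a::complex_normed_vector \<rightharpoonup> 'a) \<Rightarrow> bool" where
  "sectorial A \<longleftrightarrow>
     linear_operator A \<and>
     (\<forall>r<0. complex_of_real r \<in> resolvent_set A) \<and>
     bdd_above ((\<lambda>r. norm (complex_of_real r *\<^sub>C inv_op (op_plus A (complex_of_real r)))) ` {0<..})"

definition sect_angle :: "('a::complex_normed_vector \<rightharpoonup> 'a) \<Rightarrow> real" where
  "sect_angle A = Inf {\<theta>. 0 \<le> \<theta> \<and> \<theta> < pi \<and> spectrum A \<subseteq> closure (sector \<theta>) \<and>
     (\<forall>\<phi>. \<theta> < \<phi> \<and> \<phi> < pi \<longrightarrow>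
        bdd_above ((\<lambda>z. norm (z *\<^sub>C resolvent z A)) ` {z. z \<notin> sector \<phi> \<and> z \<noteq> 0}))}"

definition Sect :: "real \<Rightarrow> ('a::complex_normed_vector \<rightharpoonup> 'a) set" where
  "Sect \<omega> = {A. sectorial A \<and> sect_angle A = \<omega>}"


section \<open>Square roots and holomorphic semigroups\<close>

text \<open>
  The primary sectorial functional calculus: \<open>f(A) = (2\<pi>i)\<^sup>-\<^sup>1 \<integral> f(z) R(z,A) dz\<close> over the
  boundary of the sector of half-angle \<theta>, running from \<open>\<infinity>e\<^sup>i\<^sup>\<theta>\<close> through 0 to \<open>\<infinity>e\<^sup>-\<^sup>i\<^sup>\<theta>\<close>.
\<close>

definition sect_calc ::
    "('a::complex_normed_vector \<rightharpoonup> 'a) \<Rightarrow> real \<Rightarrow> (complex \<Rightarrow> complex) \<Rightarrow> 'a \<Rightarrow>\<^sub>L 'a" where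
  "sect_calc A \<theta> f = (1 / (2 * of_real pi * \<i>)) *\<^sub>C
     (bochner (lebesgue_on {0<..})
        (\<lambda>r. (f (rcis r (-\<theta>)) * cis (-\<theta>)) *\<^sub>C resolvent (rcis r (-\<theta>)) A) -
      bochner (lebesgue_on {0<..})
        (\<lambda>r. (f (rcis r \<theta>) * cis \<theta>) *\<^sub>C resolvent (rcis r \<theta>) A))"

text \<open>
  The function \<open>\<surd>z\<close> lies in the extended calculus with regulariser \<open>1/(1+z)\<close>, since
  \<open>\<surd>z/(1+z)\<close> decays like \<open>|z|\<^sup>1\<^sup>/\<^sup>2\<close> at 0 and like \<open>|z|\<^sup>-\<^sup>1\<^sup>/\<^sup>2\<close> at infinity. Hence
  \<open>\<surd>B = (1 + B) (\<surd>z/(1+z))(B)\<close> with its natural domain. Any \<theta> strictly between the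
  sectoriality angle and \<pi> gives the same contour integral.
\<close>

definition sqrt_op :: "('a::complex_normed_vector \<rightharpoonup> 'a) \<Rightarrow> ('a \<rightharpoonup> 'a)" where
  "sqrt_op B = (\<lambda>x.
     let y = blinfun_apply (sect_calc B ((sect_angle B + pi) / 2) (\<lambda>z. csqrt z / (1 + z))) x
     in map_option (\<lambda>w. y + w) (B y))"

definition vector_holomorphic_on ::
    "(complex \<Rightarrow> 'b::complex_normed_vector) \<Rightarrow> complex set \<Rightarrow> bool" where
  "vector_holomorphic_on f S \<longleftrightarrow>
     (\<forall>z\<in>S. \<exists>D. (f has_derivative (\<lambda>h. h *\<^sub>C D)) (at z within S))"

text \<open>
  T is the bounded holomorphic semigroup of angle \<phi> generated by \<open>-B\<close>. Neither B nor the
  semigroup is assumed to be densely defined resp. strongly continuous at 0, so "generated"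
  is meant in the sense that the Laplace transform of T is the resolvent of \<open>-B\<close>.
\<close>

definition bdd_holo_semigroup ::
    "('a::complex_normed_vector \<rightharpoonup> 'a) \<Rightarrow> real \<Rightarrow> (complex \<Rightarrow> 'a \<Rightarrow>\<^sub>L 'a) \<Rightarrow> bool" where
  "bdd_holo_semigroup B \<phi> T \<longleftrightarrow>
     (\<forall>z\<in>sector \<phi>. T z \<in> cblinfuns) \<and>
     (\<forall>z\<in>sector \<phi>. \<forall>w\<in>sector \<phi>. T (z + w) = T z o\<^sub>L T w) \<and>
     vector_holomorphic_on T (sector \<phi>) \<and>
     (\<forall>\<theta>. 0 < \<theta> \<and> \<theta> < \<phi> \<longrightarrow> bounded (T ` sector \<theta>)) \<and>
     (\<forall>r>0. boundedly_invertible (op_plus B (complex_of_real r)) \<and>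
            has_bochner (lebesgue_on {0<..}) (\<lambda>t. exp (- r * t) *\<^sub>R T (complex_of_real t))
              (inv_op (op_plus B (complex_of_real r))))"

text \<open>
  The operator \<open>e\<^sup>-\<^sup>z\<^sup>B\<close> for z in the sector of half-angle \<phi>. On that sector T is determined
  by B, by uniqueness of Laplace transforms and of analytic continuation.
\<close>

definition holo_exp :: "real \<Rightarrow> ('a::complex_normed_vector \<rightharpoonup> 'a) \<Rightarrow> complex \<Rightarrow> 'a \<Rightarrow>\<^sub>L 'a" where
  "holo_exp \<phi> B = (SOME T. bdd_holo_semigroup B \<phi> T)"


section \<open>The initial value problem\<close>

definition vderiv :: "(real \<Rightarrow> 'b::real_normed_vector) \<Rightarrow> real \<Rightarrow> 'b" where
  "vderiv f t = vector_derivative f (at t)"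

text \<open>Test functions on \<open>(0,\<infinity>)\<close>, extended by 0 to the real line.\<close>

definition test_function :: "(real \<Rightarrow> complex) \<Rightarrow> bool" where
  "test_function \<phi> \<longleftrightarrow>
     (\<forall>n t. (vderiv ^^ n) \<phi> differentiable (at t)) \<and>
     (\<exists>K. compact K \<and> K \<subseteq> {0<..} \<and> (\<forall>t. t \<notin> K \<longrightarrow> \<phi> t = 0))"

definition is_solution ::
    "('a::complex_banach \<rightharpoonup> 'a) \<Rightarrow> complex \<Rightarrow> 'a \<Rightarrow> (real \<Rightarrow> 'a) \<Rightarrow> bool" where
  "is_solution A \<alpha> x u \<longleftrightarrow>
     bounded (u ` {0..}) \<and> continuous_on {0..} u \<and> u 0 = x \<and>
     (\<forall>t>0. u t \<in> dom A) \<and>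
     (\<forall>K. compact K \<and> K \<subseteq> {0<..} \<longrightarrow> bochner_integrable (lebesgue_on K) (\<lambda>t. app A (u t))) \<and>
     (\<forall>\<phi>. test_function \<phi> \<longrightarrow>
        bochner (lebesgue_on {0<..})
          (\<lambda>t. vderiv (vderiv \<phi>) t *\<^sub>C u t -
               vderiv (\<lambda>t. (1 - 2 * \<alpha>) / complex_of_real t * \<phi> t) t *\<^sub>C u t) =
        bochner (lebesgue_on {0<..}) (\<lambda>t. \<phi> t *\<^sub>C app A (u t)))"

definition U_integrand ::
    "('a::complex_banach \<rightharpoonup> 'a) \<Rightarrow> real \<Rightarrow> complex \<Rightarrow> complex \<Rightarrow> real \<Rightarrow> 'a \<Rightarrow>\<^sub>L 'a" where
  "U_integrand A \<omega> \<alpha> z s =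
     (let R = sqrt_op (op_plus A (complex_of_real s))
      in (complex_of_real s powr (\<alpha> - 1/2)) *\<^sub>C (holo_exp ((pi - \<omega>) / 2) R z o\<^sub>L inv_op R))"

definition U_op ::
    "('a::complex_banach \<rightharpoonup> 'a) \<Rightarrow> real \<Rightarrow> complex \<Rightarrow> complex \<Rightarrow> 'a \<Rightarrow>\<^sub>L 'a" where
  "U_op A \<omega> \<alpha> z =
     (z powr (2 * \<alpha>) / (2 * Gamma (2 * \<alpha>))) *\<^sub>C
       bochner (lebesgue_on {0<..}) (U_integrand A \<omega> \<alpha> z)"

end

theory Submission
 imports Defs "HOL-Complex_Analysis.Complex_Analysis"
begin

text \<open>
 For \<open>s > 0\<close> the operator \<open>A + s\<close> is invertible, so contour integrals \<open>\<Phi>\<^sub>s(f)\<close> of its resolvent over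
 the boundary of a sector need no decay of \<open>f\<close> at 0. With \<open>E\<^sub>j(\<lambda>) = \<lambda>\<^sup>j\<^sup>/\<^sup>2 exp(-z \<surd>\<lambda>)\<close> one has
 \<open>exp(-z \<surd>(A+s)) (A+s)\<^sup>-\<^sup>1\<^sup>/\<^sup>2 = \<Phi>\<^sub>s(E\<^sub>-\<^sub>1)\<close>, the semigroup being determined by its Laplace transform.
 The resolvent bound \<open>C / (s + |\<lambda>|)\<close> and scaling give
 \<open>|\<Phi>\<^sub>s(E\<^sub>j)| \<le> C |z|\<^sup>-\<^sup>j min((|z|\<^sup>2s)\<^sup>-\<^sup>p, (|z|\<^sup>2s)\<^sup>-\<^sup>3)\<close> for \<open>1/2 < p \<le> 1\<close>; the fast decay comes from
 writing \<open>z\<close> as a sum of three equal parts. So \<open>w(t) = \<integral> s\<^sup>\<alpha>\<^sup>-\<^sup>1\<^sup>/\<^sup>2 \<Phi>\<^sub>s(E\<^sub>-\<^sub>1) ds\<close> converges, and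
 \<open>(A+s) \<Phi>\<^sub>s(E\<^sub>-\<^sub>1) = \<Phi>\<^sub>s(E\<^sub>1)\<close> gives \<open>w'' - A w = \<integral> s\<^sup>\<alpha>\<^sup>+\<^sup>1\<^sup>/\<^sup>2 \<Phi>\<^sub>s(E\<^sub>-\<^sub>1) ds\<close>. Since
 \<open>d/ds \<Phi>\<^sub>s(E\<^sub>0) = -(t/2) \<Phi>\<^sub>s(E\<^sub>-\<^sub>1)\<close>, integration by parts in \<open>s\<close> turns this into
 \<open>w'' + ((2\<alpha>+1)/t) w' = A w\<close>, which is the equation for \<open>u = c t\<^sup>2\<^sup>\<alpha> w\<close>. For \<open>x\<close> in the domain of \<open>A\<close>,
 splitting off the pole at \<open>\<lambda> = s\<close> from the resolvent shows \<open>u(t) \<rightarrow> x\<close>; the uniform bound on \<open>U\<close>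
 extends this to all \<open>x\<close> by density.
\<close>

text \<open>The space X is arbitrary, so operator-valued integrals cannot be handled as integrals
  into a separable space. Two devices replace separability. A continuous function on a set of reals
  has separable range, so a scalar majorant already makes it integrable; and bounded complex
  functionals separate points, so an identity between operators may be checked after applying one
  functional, where only scalar integrals and holomorphic functions remain. The third power in the
  decay is forced by the weight: \<open>s^(\<alpha> + 1/2)\<close> has an exponent with real part up
  to 3/2, so convergence at infinity needs decay of order above 5/2, while the resolvent bound
  inside a single contour integral yields only one power of \<open>1 / s\<close>. At the other end
  only an order above 1/2 and below \<open>Re \<alpha> + 1/2\<close> is useful, whence the free
  parameter \<open>p\<close>. The constant \<open>c\<close> comes from the scalar integral of
  \<open>s^(\<alpha> - 1) * exp (- t * sqrt s)\<close> over \<open>s > 0\<close>, which equals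
  \<open>2 * Gamma (2 * \<alpha>) * t^(- 2 * \<alpha>)\<close>; it is the contribution of the pole
  at \<lambda> = s.\<close>

lemmas integrable_le = Bochner_Integration.integrable_bound
lemmas LINT_diff = Bochner_Integration.integral_diff
lemmas integrable_sub = Bochner_Integration.integrable_diff
lemmas LINT_cong = Bochner_Integration.integral_cong
lemmas LINT_nonneg = Bochner_Integration.integral_nonneg
lemmas LINT_add = Bochner_Integration.integral_add

abbreviation "leb_pos \<equiv> lebesgue_on {0::real<..}"
abbreviation "ray th t \<equiv> t = th \<or> t = - (th::real)"
abbreviation "cexp x t \<equiv> exp (Complex x t)"
abbreviation "half_sector th \<equiv> sector ((pi - th) / 2)"

section \<open>Separation of points by bounded complex functionals\<close>

text \<open>Linear functionals arise below as the minimal elements of this class under the pointwise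
  order. The constant 1 in the bound by the norm gives the common lower bound
  \<open>- norm x\<close> that infima need.\<close>

definition sublinear :: "('a::real_normed_vector => real) => bool" where
 "sublinear p \<longleftrightarrow> (\<forall>x. p x <= norm x) \<and> (\<forall>x y. p (x + y) <= p x + p y) \<and>
  (\<forall>c\<ge>0. \<forall>x. p (c *\<^sub>R x) = c * p x)"

lemma sublinearD:
 assumes "sublinear p"
 shows "p x <= norm x" "p (x + y) <= p x + p y" "c >= 0 ==> p (c *\<^sub>R x) = c * p x"
  "p 0 = 0" "- p (- x) <= p x" "- norm x <= p x"
proof -
 show 1: "p x <= norm x" for x using assms by (auto simp: sublinear_def)
 show "p (x + y) <= p x + p y" using assms by (auto simp: sublinear_def)
 show 3: "c >= 0 ==> p (c *\<^sub>R x) = c * p x" for c x using assms by (auto simp: sublinear_def)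
 show 4: "p 0 = 0" using 3[of 0 0] by simp
 have "p (x + - x) <= p x + p (- x)" using assms unfolding sublinear_def by blast
 then show 5: "- p (- x) <= p x" using 4 by simp
 show "- norm x <= p x" using 1[of "-x"] 5 by simp
qed

lemma sublinear_norm: "sublinear norm"
 by (auto simp: sublinear_def norm_triangle_ineq)

text \<open>The standard way to lower a sublinear functional without leaving the class: move
  \<open>x\<close> along the ray in direction \<open>y\<close> and subtract what linearity would
  have added. A functional that no direction lowers is additive.\<close>

definition sub_descent :: "('a::real_normed_vector => real) => 'a => 'a => real" where
 "sub_descent p y x = (INF t\<in>{0..}. p (x + t *\<^sub>R y) - t * p y)"

lemma sub_descent:
 assumes p: "sublinear p"
 shows "sublinear (sub_descent p y)" "t >= 0 ==> sub_descent p y x <= p (x + t *\<^sub>R y) - t * p y"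
  "sub_descent p y x <= p x"
proof -
 \<comment> \<open>Writing \<open>t y\<close> as \<open>(x + t y) + (- x)\<close> bounds the values
   below independently of \<open>t\<close>, so the infimum is finite.\<close>
 have low: "- p (- x) <= p (x + t *\<^sub>R y) - t * p y" if "t >= 0" for t x
 proof -
  have "t * p y = p ((x + t *\<^sub>R y) + (- x))" using sublinearD(3)[OF p that] by simp
  also have "... <= p (x + t *\<^sub>R y) + p (- x)" by (rule sublinearD(2)[OF p])
  finally show ?thesis by simp
 qed
 have bdd: "bdd_below ((%t. p (x + t *\<^sub>R y) - t * p y) ` {0..})" for x
  using low by (auto intro!: bdd_belowI)
 have le: "sub_descent p y x <= p (x + t *\<^sub>R y) - t * p y" if "t >= 0" for t x
  unfolding sub_descent_def using that by (intro cINF_lower bdd) auto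
 show "t >= 0 ==> sub_descent p y x <= p (x + t *\<^sub>R y) - t * p y" by (rule le)
 show le0: "sub_descent p y x <= p x" for x using le[of 0 x] by simp
 have ge: "a <= sub_descent p y x" if "!!t. t >= 0 ==> a <= p (x + t *\<^sub>R y) - t * p y" for a x
  unfolding sub_descent_def using that by (intro cINF_greatest) auto
 have add: "sub_descent p y (x + x') <= sub_descent p y x + sub_descent p y x'" for x x'
 proof -
  have "sub_descent p y (x + x') - (p (x + t *\<^sub>R y) - t * p y) <= p (x' + t' *\<^sub>R y) - t' * p y"
   if "t >= 0" "t' >= 0" for t t'
  proof -
   have "sub_descent p y (x + x') <= p ((x + x') + (t + t') *\<^sub>R y) - (t + t') * p y"
    using that by (intro le) auto
   also have "p ((x + x') + (t + t') *\<^sub>R y) <= p (x + t *\<^sub>R y) + p (x' + t' *\<^sub>R y)"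
    using sublinearD(2)[OF p, of "x + t *\<^sub>R y" "x' + t' *\<^sub>R y"] by (simp add: algebra_simps)
   finally show ?thesis by (simp add: algebra_simps)
  qed
  then have "sub_descent p y (x + x') - (p (x + t *\<^sub>R y) - t * p y) <= sub_descent p y x'"
   if "t >= 0" for t
   using that by (intro ge) auto
  then have "sub_descent p y (x + x') - sub_descent p y x' <= sub_descent p y x"
   by (intro ge) (simp add: algebra_simps)
  then show ?thesis by simp
 qed
 have scl: "sub_descent p y (c *\<^sub>R x) <= c * sub_descent p y x" if c: "c > 0" for c x
 proof -
  have "sub_descent p y (c *\<^sub>R x) / c <= sub_descent p y x"
  proof (rule ge)
   fix t :: real assume t: "t >= 0"
   have "sub_descent p y (c *\<^sub>R x) <= p (c *\<^sub>R x + (c * t) *\<^sub>R y) - (c * t) * p y"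
    using c t by (intro le) auto
   also have "c *\<^sub>R x + (c * t) *\<^sub>R y = c *\<^sub>R (x + t *\<^sub>R y)" by (simp add: algebra_simps)
   finally show "sub_descent p y (c *\<^sub>R x) / c <= p (x + t *\<^sub>R y) - t * p y"
    using c sublinearD(3)[OF p, of c "x + t *\<^sub>R y"] by (simp add: field_simps)
  qed
  then show ?thesis using c by (simp add: field_simps)
 qed
 have z: "sub_descent p y 0 = 0"
  using le0[of 0] ge[of 0 0] sublinearD(3)[OF p] sublinearD(4)[OF p] by force
 have "sub_descent p y (c *\<^sub>R x) = c * sub_descent p y x" if "c >= 0" for c x
 proof (cases "c = 0")
  case False
  then have c: "c > 0" using that by simp
  have "sub_descent p y x <= inverse c * sub_descent p y (c *\<^sub>R x)"
   using scl[of "inverse c" "c *\<^sub>R x"] c by simp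
  with scl[OF c, of x] c show ?thesis by (simp add: field_simps)
 qed (simp add: z)
 moreover have "sub_descent p y x <= norm x" for x
  using le0[of x] sublinearD(1)[OF p, of x] by simp
 ultimately show "sublinear (sub_descent p y)" using add unfolding sublinear_def by blast
qed

text \<open>Provides the lower bounds of chains for Zorn's lemma. An infimum of subadditive
  functions need not be subadditive; here two members of the chain always have a member below both,
  at which both summands can be estimated together.\<close>

lemma sublinear_INF:
 assumes ne: "C ~= {}" and sub: "!!p. p \<in> C ==> sublinear p"
  and chain: "!!p q. p \<in> C ==> q \<in> C ==> p <= q \<or> q <= p"
 shows "sublinear (%x. INF p\<in>C. p x)" "p \<in> C ==> (%x. INF p\<in>C. p x) <= p"
proof -
 have bdd: "bdd_below ((%p. p x) ` C)" for x
  using sublinearD(6)[OF sub] by (intro bdd_belowI[of _ "- norm x"]) auto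
 let ?q = "%x. INF p\<in>C. p x"
 have le: "?q x <= p x" if "p \<in> C" for p x
  using that by (intro cINF_lower bdd)
 then show "p \<in> C ==> ?q <= p" by (auto simp: le_fun_def)
 have ge: "a <= ?q x" if "!!p. p \<in> C ==> a <= p x" for a x
  using that ne by (intro cINF_greatest) auto
 obtain p0 where p0: "p0 \<in> C" using ne by auto
 have add: "?q (x + y) <= ?q x + ?q y" for x y
 proof -
  have "?q (x + y) - p x <= p' y" if pp: "p \<in> C" "p' \<in> C" for p p'
  proof -
   obtain r where r: "r \<in> C" "r <= p" "r <= p'" using chain[OF pp] pp by blast
   have "?q (x + y) <= r (x + y)" by (rule le[OF r(1)])
   also have "... <= r x + r y" by (rule sublinearD(2)[OF sub[OF r(1)]])
   also have "... <= p x + p' y" using r by (auto simp: le_fun_def intro: add_mono)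
   finally show ?thesis by simp
  qed
  then have "?q (x + y) - p x <= ?q y" if "p \<in> C" for p using that by (intro ge) auto
  then have "?q (x + y) - ?q y <= ?q x" by (intro ge) (simp add: algebra_simps)
  then show ?thesis by simp
 qed
 have scl: "?q (c *\<^sub>R x) = c * ?q x" if "c >= 0" for c x
 proof (cases "c = 0")
  case True
  have "?q 0 = (INF p\<in>C. 0)" using sublinearD(4)[OF sub] by (intro INF_cong) auto
  also have "... = 0" using ne by simp
  finally have "?q 0 = 0" .
  then show ?thesis using True by simp
 next
  case False
  then have c: "c > 0" using that by simp
  have eq: "p (c *\<^sub>R x) = c * p x" if "p \<in> C" for p using sublinearD(3)[OF sub[OF that]] c by simp
  have "?q (c *\<^sub>R x) / c <= ?q x"
  proof (rule ge)
   fix p assume p: "p \<in> C"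
   have "?q (c *\<^sub>R x) <= c * p x" using le[OF p, of "c *\<^sub>R x"] unfolding eq[OF p] .
   then show "?q (c *\<^sub>R x) / c <= p x" using c by (simp add: divide_le_eq mult.commute)
  qed
  moreover have "c * ?q x <= ?q (c *\<^sub>R x)"
  proof (rule ge)
   fix p assume p: "p \<in> C"
   show "c * ?q x <= p (c *\<^sub>R x)"
    unfolding eq[OF p] using le[OF p, of x] c by (intro mult_left_mono) auto
  qed
  ultimately show ?thesis using c by (simp add: field_simps)
 qed
 have "?q x <= norm x" for x using le[OF p0] sublinearD(1)[OF sub[OF p0]] order_trans by blast
 with add scl show "sublinear ?q" unfolding sublinear_def by blast
qed

text \<open>Hahn-Banach by minimality: a minimal sublinear functional below \<open>p0\<close> is
  linear. Starting from \<open>p0 = sub_descent norm x0\<close> instead of the norm forces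
  \<open>f (- x0) <= - norm x0\<close>, so \<open>f\<close> cannot vanish at
  \<open>x0\<close>.\<close>

lemma bounded_functional_exists:
 fixes x0 :: "'a::real_normed_vector"
 assumes "x0 ~= 0"
 shows "\<exists>f. bounded_linear f \<and> f x0 ~= (0::real)"
proof -
 define p0 where "p0 = sub_descent norm x0"
 have p0: "sublinear p0" unfolding p0_def by (intro sub_descent sublinear_norm)
 define S where "S = {p. sublinear p \<and> p <= p0}"
 have "\<exists>m\<in>S. \<forall>p\<in>S. p <= m --> p = m"
 \<comment> \<open>The order is reversed, so that Zorn's lemma delivers a minimal element.\<close>
 proof (rule predicate_Zorn[where P = "(>=)" and A = S, simplified])
  show "partial_order_on S (relation_of (>=) S)"
   by (rule partial_order_on_relation_ofI) auto
  fix C assume C: "C \<in> Chains (relation_of (>=) S)"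
  then have CS: "C \<subseteq> S" unfolding Chains_def relation_of_def by auto
  have ch: "p <= q \<or> q <= p" if "p \<in> C" "q \<in> C" for p q
   using C that unfolding Chains_def relation_of_def by auto
  show "\<exists>u\<in>S. \<forall>p\<in>C. u <= p"
  proof (cases "C = {}")
   case True
   then show ?thesis using p0 unfolding S_def by auto
  next
   case False
   have "sublinear (%x. INF p\<in>C. p x)" "!!p. p \<in> C ==> (%x. INF p\<in>C. p x) <= p"
    using sublinear_INF[OF False, OF _ ch] CS unfolding S_def by blast+
   then show ?thesis using False CS unfolding S_def by (blast intro: order_trans)
  qed
 qed
 then obtain f where f: "sublinear f" "f <= p0" and min: "!!p. sublinear p ==> p <= f ==> p = f"
  unfolding S_def using order_trans by blast
 have "sub_descent f y = f" for y
  by (intro min sub_descent f le_funI)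
 \<comment> \<open>Equality with the descent, read at \<open>t = 1\<close>, is superadditivity;
   together with subadditivity it gives additivity.\<close>
 then have "f x <= f (x + 1 *\<^sub>R y) - 1 * f y" for x y
  using sub_descent(2)[OF f(1), of 1 y x] by simp
 then have add: "f (x + y) = f x + f y" for x y
  using sublinearD(2)[OF f(1), of x y] by (simp add: add.commute antisym le_diff_eq)
 have neg: "f (- x) = - f x" for x using add[of x "-x"] sublinearD(4)[OF f(1)] by simp
 have scl: "f (c *\<^sub>R x) = c * f x" for c x
 proof (cases "c >= 0")
  case False
  then have "f ((- c) *\<^sub>R x) = - c * f x" using sublinearD(3)[OF f(1)] by (metis linear neg_0_le_iff_le)
  then show ?thesis using neg[of "c *\<^sub>R x"] by simp
 qed (use sublinearD(3)[OF f(1)] in auto)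
 have "\<bar>f x\<bar> <= norm x" for x
  using sublinearD(1)[OF f(1), of x] sublinearD(6)[OF f(1), of x] by simp
 then have "bounded_linear f"
  by (intro bounded_linear_intro[where K = 1]) (auto simp: add scl)
 moreover have "f (- x0) <= p0 (- x0)" using f(2) by (auto simp: le_fun_def)
 moreover have "p0 (- x0) <= - norm x0"
  unfolding p0_def using sub_descent(2)[OF sublinear_norm, of 1 x0 "-x0"] by simp
 moreover have "norm x0 > 0" using assms by simp
 ultimately show ?thesis using neg[of x0] by (intro exI[of _ f] conjI) linarith+
qed

section \<open>Complex scalars and complex functionals\<close>

lemma scaleC_simps [simp]:
 fixes x :: "'a::complex_normed_vector"
 shows "0 *\<^sub>C x = 0" "c *\<^sub>C (0::'a) = 0" "1 *\<^sub>C x = x" "(- c) *\<^sub>C x = - (c *\<^sub>C x)"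
  "c *\<^sub>C (- x) = - (c *\<^sub>C x)"
proof -
 interpret bounded_linear "%x::'a. c *\<^sub>C x" by (rule bounded_linear_scaleC)
 show "0 *\<^sub>C x = 0" using scaleC_of_real[of 0 x] by simp
 show "1 *\<^sub>C x = x" using scaleC_of_real[of 1 x] by simp
 show "c *\<^sub>C (0::'a) = 0" "c *\<^sub>C (- x) = - (c *\<^sub>C x)" by (simp_all add: zero neg)
 show "(- c) *\<^sub>C x = - (c *\<^sub>C x)"
  using scaleC_add_left[of "-c" c x] scaleC_of_real[of 0 x] by (simp add: eq_neg_iff_add_eq_0)
qed

lemma scaleC_diff_right: "c *\<^sub>C (x - y) = c *\<^sub>C x - c *\<^sub>C (y::'a::complex_normed_vector)"
 using scaleC_add_right[of c x "-y"] by simp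

lemma scaleC_diff_left: "(c - d) *\<^sub>C x = c *\<^sub>C x - d *\<^sub>C (x::'a::complex_normed_vector)"
 using scaleC_add_left[of c "-d" x] by simp

lemma scaleR_scaleC: "r *\<^sub>R x = complex_of_real r *\<^sub>C (x::'a::complex_normed_vector)"
 by (simp add: scaleC_of_real)

definition cfunctional :: "('a::complex_normed_vector => complex) => bool" where
 "cfunctional m \<longleftrightarrow> bounded_linear m \<and> (\<forall>c x. m (c *\<^sub>C x) = c * m x)"

lemma cfunctionalD:
 assumes "cfunctional m"
 shows "bounded_linear m" "m (c *\<^sub>C x) = c * m x" "m (x + y) = m x + m y" "m (x - y) = m x - m y"
  "m 0 = 0" "m (- x) = - m x"
proof -
 show bl: "bounded_linear m" and "m (c *\<^sub>C x) = c * m x" using assms by (auto simp: cfunctional_def)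
 interpret bounded_linear m by (rule bl)
 show "m (x + y) = m x + m y" "m (x - y) = m x - m y" "m 0 = 0" "m (- x) = - m x"
  by (simp_all add: add diff zero neg)
qed

text \<open>Complexification of a real functional: \<open>f x - \<i> * f (\<i> x)\<close> is
  complex-linear, and its real part \<open>f\<close> is already nonzero at
  \<open>x0\<close>.\<close>

lemma cfunctional_exists:
 fixes x0 :: "'a::complex_normed_vector"
 assumes "x0 ~= 0"
 shows "\<exists>m. cfunctional m \<and> m x0 ~= 0"
proof -
 obtain f where f: "bounded_linear f" "f x0 ~= (0::real)" using bounded_functional_exists[OF assms] by auto
 interpret f: bounded_linear f by fact
 let ?m = "%x. Complex (f x) (- f (\<i> *\<^sub>C x))"
 have bl: "bounded_linear (%x. f (\<i> *\<^sub>C x))"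
  using bounded_linear_compose[OF f(1) bounded_linear_scaleC[of \<i>]] .
 have "bounded_linear (%x. of_real (f x) - \<i> * of_real (f (\<i> *\<^sub>C x)))"
  by (intro bounded_linear_sub bounded_linear_compose[OF bounded_linear_of_real f(1)]
    bounded_linear_compose[OF bounded_linear_mult_right]
    bounded_linear_compose[OF bounded_linear_of_real bl])
 moreover have "?m = (%x. of_real (f x) - \<i> * of_real (f (\<i> *\<^sub>C x)))"
  by (auto simp: complex_eq_iff)
 ultimately have "bounded_linear ?m" by simp
 moreover have "?m (c *\<^sub>C x) = c * ?m x" for c x
 proof -
  have 1: "c *\<^sub>C x = Re c *\<^sub>R x + Im c *\<^sub>R (\<i> *\<^sub>C x)"
   unfolding scaleR_scaleC scaleC_scaleC scaleC_add_left[symmetric]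
   by (rule arg_cong[of _ _ "%c. c *\<^sub>C x"]) (simp add: complex_eq_iff)
  have 2: "\<i> *\<^sub>C c *\<^sub>C x = Re c *\<^sub>R (\<i> *\<^sub>C x) - Im c *\<^sub>R x"
   unfolding scaleR_scaleC scaleC_scaleC scaleC_diff_left[symmetric]
   by (rule arg_cong[of _ _ "%c. c *\<^sub>C x"]) (simp add: complex_eq_iff)
  have "f (c *\<^sub>C x) = Re c * f x + Im c * f (\<i> *\<^sub>C x)"
   by (subst 1) (simp only: f.add f.scaleR real_scaleR_def)
  moreover have "f (\<i> *\<^sub>C c *\<^sub>C x) = Re c * f (\<i> *\<^sub>C x) - Im c * f x"
   by (subst 2) (simp only: f.diff f.scaleR real_scaleR_def)
  ultimately show ?thesis by (simp add: complex_eq_iff algebra_simps)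
 qed
 ultimately have "cfunctional ?m" unfolding cfunctional_def by blast
 moreover have "?m x0 ~= 0" using f(2) by (simp add: complex_eq_iff)
 ultimately show ?thesis by blast
qed

text \<open>The form in which separation is used: identities of vectors, and of operators regarded
  as vectors, reduce to scalar identities.\<close>

lemma cfunctional_eqI:
 fixes x y :: "'a::complex_normed_vector"
 assumes "!!m. cfunctional m ==> m x = m y"
 shows "x = y"
 using cfunctional_exists[of "x - y"] assms cfunctionalD(4) by fastforce

section \<open>Bochner integrals in non-separable spaces\<close>

abbreviation "simple_bochner_integrable \<equiv> Bochner_Integration.simple_bochner_integrable"
abbreviation "simple_bochner_integral \<equiv> Bochner_Integration.simple_bochner_integral"

text \<open>A difference of Borel functions into a nonseparable space need not be Borel. Since
  \<open>s\<close> takes finitely many values, it is enough that \<open>norm (f x - y)\<close> is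
  measurable for each fixed \<open>y\<close>.\<close>

lemma borel_measurable_norm_diff_simple:
 fixes f :: "'m => 'b::real_normed_vector"
 assumes f: "f \<in> borel_measurable M" and s: "simple_function M s"
 shows "(%x. norm (f x - s x)) \<in> borel_measurable M"
proof -
 have "s \<in> measurable M (count_space (s ` space M))"
  using s by (auto simp: simple_function_def measurable_count_space_eq2)
 moreover have "(%x. norm (f x - y)) \<in> borel_measurable M" for y
  by (rule measurable_compose[OF f borel_measurable_continuous_onI]) (intro continuous_intros)
 moreover have "countable (s ` space M)" using s by (auto simp: simple_function_def countable_finite)
 ultimately show ?thesis
  by (intro measurable_compose_countable'[where f = "%y x. norm (f x - y)" and g = s and I = "s ` space M"])
qed

lemma simple_bochner_integrable_simple: "simple_bochner_integrable M s ==> simple_function M s"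
 by (auto elim: simple_bochner_integrable.cases)

text \<open>The triangle inequality through \<open>f\<close>. It yields both the uniqueness of the
  integral and the Cauchy property of approximating sequences.\<close>

lemma simple_bochner_integral_diff_le:
 fixes f :: "'m => 'b::real_normed_vector"
 assumes f: "f \<in> borel_measurable M"
  and s: "simple_bochner_integrable M s" and t: "simple_bochner_integrable M t"
 shows "ennreal (norm (simple_bochner_integral M s - simple_bochner_integral M t)) <=
  (\<integral>\<^sup>+ x. norm (f x - s x) \<partial>M) + (\<integral>\<^sup>+ x. norm (f x - t x) \<partial>M)"
proof -
 note [measurable] = borel_measurable_norm_diff_simple[OF f simple_bochner_integrable_simple[OF s]]
  borel_measurable_norm_diff_simple[OF f simple_bochner_integrable_simple[OF t]]
 have "ennreal (norm (simple_bochner_integral M s - simple_bochner_integral M t)) =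
   norm (simple_bochner_integral M (%x. s x - t x))"
  using s t by (subst simple_bochner_integral_diff) auto
 also have "... <= simple_bochner_integral M (%x. norm (s x - t x))"
  using simple_bochner_integrable_compose2[of "(-)" M "s" "t"] s t
  by (auto intro!: simple_bochner_integral_norm_bound)
 also have "... = (\<integral>\<^sup>+x. norm (s x - t x) \<partial>M)"
  using simple_bochner_integrable_compose2[of "%x y. norm (x - y)" M "s" "t"] s t
  by (auto intro!: simple_bochner_integral_eq_nn_integral)
 also have "... <= (\<integral>\<^sup>+x. ennreal (norm (f x - s x)) + ennreal (norm (f x - t x)) \<partial>M)"
 proof (rule nn_integral_mono)
  fix x
  have "norm (s x - t x) <= norm (f x - s x) + norm (f x - t x)"
   by (metis dual_order.refl norm_diff_triangle_le norm_minus_commute)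
  then show "ennreal (norm (s x - t x)) <= ennreal (norm (f x - s x)) + ennreal (norm (f x - t x))"
   by (simp flip: ennreal_plus)
 qed
 also have "... = (\<integral>\<^sup>+ x. norm (f x - s x) \<partial>M) + (\<integral>\<^sup>+ x. norm (f x - t x) \<partial>M)"
  by (rule nn_integral_add) auto
 finally show ?thesis .
qed

lemma has_bochner_unique:
 assumes "has_bochner M f I" "has_bochner M f J"
 shows "I = J"
proof -
 obtain s where f: "f \<in> borel_measurable M" and s: "!!i. simple_bochner_integrable M (s i)"
   "(%i. \<integral>\<^sup>+ x. norm (f x - s i x) \<partial>M) \<longlonglongrightarrow> 0" "(%i. simple_bochner_integral M (s i)) \<longlonglongrightarrow> I"
  using assms(1) unfolding has_bochner_def by blast
 obtain t where t: "!!i. simple_bochner_integrable M (t i)"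
   "(%i. \<integral>\<^sup>+ x. norm (f x - t i x) \<partial>M) \<longlonglongrightarrow> 0" "(%i. simple_bochner_integral M (t i)) \<longlonglongrightarrow> J"
  using assms(2) unfolding has_bochner_def by blast
 have "(%i. ennreal (norm (simple_bochner_integral M (s i) - simple_bochner_integral M (t i))))
     \<longlonglongrightarrow> ennreal (norm (I - J))"
  by (intro tendsto_intros tendsto_ennrealI s t)
 moreover have "(%i. ennreal (norm (simple_bochner_integral M (s i) - simple_bochner_integral M (t i))))
     \<longlonglongrightarrow> ennreal 0"
 proof (rule tendsto_sandwich[where f = "%_. 0"])
  show "(%i. (\<integral>\<^sup>+ x. norm (f x - s i x) \<partial>M) + (\<integral>\<^sup>+ x. norm (f x - t i x) \<partial>M)) \<longlonglongrightarrow> ennreal 0"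
   using tendsto_add[OF s(2) t(2)] by simp
  show "\<forall>\<^sub>F i in sequentially. ennreal (norm (simple_bochner_integral M (s i) - simple_bochner_integral M (t i)))
   <= (\<integral>\<^sup>+ x. norm (f x - s i x) \<partial>M) + (\<integral>\<^sup>+ x. norm (f x - t i x) \<partial>M)"
   by (intro always_eventually allI simple_bochner_integral_diff_le f s t)
 qed auto
 ultimately have "ennreal (norm (I - J)) = ennreal 0" by (rule LIMSEQ_unique)
 then show ?thesis by (simp add: ennreal_eq_0_iff)
qed

lemma bochner_eqI: "has_bochner M f I ==> bochner M f = I"
 unfolding bochner_def bochner_integrable_def by (auto intro: the_equality has_bochner_unique)

lemma has_bochner_bochner: "bochner_integrable M f ==> has_bochner M f (bochner M f)"
 unfolding bochner_integrable_def using bochner_eqI by metis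

lemma has_bochner_cong:
 assumes "!!x. x \<in> space M ==> f x = g x"
 shows "has_bochner M f I \<longleftrightarrow> has_bochner M g I"
proof -
 have "f \<in> borel_measurable M \<longleftrightarrow> g \<in> borel_measurable M" using assms by (rule measurable_cong)
 moreover have "(\<integral>\<^sup>+ t. ennreal (norm (f t - s t)) \<partial>M) = (\<integral>\<^sup>+ t. ennreal (norm (g t - s t)) \<partial>M)" for s
  using assms by (intro nn_integral_cong) simp
 ultimately show ?thesis unfolding has_bochner_def by simp
qed

lemma bochner_cong:
 assumes "!!x. x \<in> space M ==> f x = g x"
 shows "bochner M f = bochner M g" "bochner_integrable M f \<longleftrightarrow> bochner_integrable M g"
proof -
 have "has_bochner M f = has_bochner M g" using has_bochner_cong[of M f g, OF assms] by blast
 then show "bochner M f = bochner M g" "bochner_integrable M f \<longleftrightarrow> bochner_integrable M g"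
  by (simp_all add: bochner_def bochner_integrable_def)
qed

lemma has_bochner_bounded_linear:
 assumes T: "bounded_linear T" and f: "has_bochner M f I"
 shows "has_bochner M (%x. T (f x)) (T I)"
proof -
 interpret T: bounded_linear T by fact
 obtain s where fm: "f \<in> borel_measurable M" and s: "!!i. simple_bochner_integrable M (s i)"
   "(%i. \<integral>\<^sup>+ x. norm (f x - s i x) \<partial>M) \<longlonglongrightarrow> 0" "(%i. simple_bochner_integral M (s i)) \<longlonglongrightarrow> I"
  using f unfolding has_bochner_def by blast
 note meas [measurable] = borel_measurable_norm_diff_simple[OF fm simple_bochner_integrable_simple[OF s(1)]]
 obtain K where K: "K > 0" "!!x i. norm (T (f x) - T (s i x)) <= norm (f x - s i x) * K"
  using T.pos_bounded by (auto simp: T.diff[symmetric])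
 have "(%x. T (f x)) \<in> borel_measurable M"
  by (rule measurable_compose[OF fm borel_measurable_continuous_onI]) (intro T.continuous_on continuous_on_id)
 moreover have "simple_bochner_integrable M (%x. T (s i x))" for i
  using simple_bochner_integrable_compose2[of "%x y. T x", OF T.zero s(1)[of i] s(1)[of i]] .
 moreover have "(%i. \<integral>\<^sup>+ x. norm (T (f x) - T (s i x)) \<partial>M) \<longlonglongrightarrow> 0"
 proof (rule tendsto_sandwich[where f = "%_. 0"])
  show "\<forall>\<^sub>F i in sequentially. (\<integral>\<^sup>+ x. norm (T (f x) - T (s i x)) \<partial>M) <= K * (\<integral>\<^sup>+ x. norm (f x - s i x) \<partial>M)"
  proof (intro always_eventually allI)
   fix i have "(\<integral>\<^sup>+ x. norm (T (f x) - T (s i x)) \<partial>M) <= (\<integral>\<^sup>+ x. ennreal K * norm (f x - s i x) \<partial>M)"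
    using K by (intro nn_integral_mono) (auto simp: ac_simps ennreal_mult[symmetric])
   also have "... = K * (\<integral>\<^sup>+ x. norm (f x - s i x) \<partial>M)"
    using K by (intro nn_integral_cmult) auto
   finally show "(\<integral>\<^sup>+ x. norm (T (f x) - T (s i x)) \<partial>M) <= K * (\<integral>\<^sup>+ x. norm (f x - s i x) \<partial>M)" .
  qed
  show "(%i. K * (\<integral>\<^sup>+ x. norm (f x - s i x) \<partial>M)) \<longlonglongrightarrow> 0"
   using ennreal_tendsto_cmult[OF _ s(2)] by simp
 qed auto
 moreover have "(%i. simple_bochner_integral M (%x. T (s i x))) \<longlonglongrightarrow> T I"
  using T.tendsto[OF s(3)] by (simp add: simple_bochner_integral_linear T.linear_axioms s(1))
 ultimately show ?thesis unfolding has_bochner_def by (intro conjI exI[of _ "%i x. T (s i x)"]) auto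
qed

lemma bochner_bounded_linear:
 assumes "bounded_linear T" "bochner_integrable M f"
 shows "bochner_integrable M (%x. T (f x))" "bochner M (%x. T (f x)) = T (bochner M f)"
 using has_bochner_bounded_linear[OF assms(1) has_bochner_bochner[OF assms(2)]] bochner_eqI
 by (auto simp: bochner_integrable_def)

text \<open>Measurability of the difference is assumed because for a nonseparable target it does not
  follow from that of \<open>f\<close> and \<open>g\<close>. In the applications it comes from
  continuity.\<close>

lemma has_bochner_diff:
 fixes f g :: "'m => 'b::real_normed_vector"
 assumes f: "has_bochner M f I" and g: "has_bochner M g J" and
  fg: "(%x. f x - g x) \<in> borel_measurable M"
 shows "has_bochner M (%x. f x - g x) (I - J)"
proof -
 obtain s where fm: "f \<in> borel_measurable M" and s: "!!i. simple_bochner_integrable M (s i)"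
   "(%i. \<integral>\<^sup>+ x. norm (f x - s i x) \<partial>M) \<longlonglongrightarrow> 0" "(%i. simple_bochner_integral M (s i)) \<longlonglongrightarrow> I"
  using f unfolding has_bochner_def by blast
 obtain t where gm: "g \<in> borel_measurable M" and t: "!!i. simple_bochner_integrable M (t i)"
   "(%i. \<integral>\<^sup>+ x. norm (g x - t i x) \<partial>M) \<longlonglongrightarrow> 0" "(%i. simple_bochner_integral M (t i)) \<longlonglongrightarrow> J"
  using g unfolding has_bochner_def by blast
 note meas [measurable] = borel_measurable_norm_diff_simple[OF fm simple_bochner_integrable_simple[OF s(1)]]
  borel_measurable_norm_diff_simple[OF gm simple_bochner_integrable_simple[OF t(1)]]
 have "(%i. \<integral>\<^sup>+ x. norm (f x - g x - (s i x - t i x)) \<partial>M) \<longlonglongrightarrow> 0"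
 proof (rule tendsto_sandwich[where f = "%_. 0"])
  show "\<forall>\<^sub>F i in sequentially. (\<integral>\<^sup>+ x. norm (f x - g x - (s i x - t i x)) \<partial>M)
    <= (\<integral>\<^sup>+ x. norm (f x - s i x) \<partial>M) + (\<integral>\<^sup>+ x. norm (g x - t i x) \<partial>M)"
  proof (intro always_eventually allI)
   fix i have "(\<integral>\<^sup>+ x. norm (f x - g x - (s i x - t i x)) \<partial>M)
    <= (\<integral>\<^sup>+ x. ennreal (norm (f x - s i x)) + ennreal (norm (g x - t i x)) \<partial>M)"
   proof (rule nn_integral_mono)
    fix x
    have "norm (f x - g x - (s i x - t i x)) <= norm (f x - s i x) + norm (g x - t i x)"
     using norm_triangle_ineq4[of "f x - s i x" "g x - t i x"] by (simp add: algebra_simps)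
    then show "ennreal (norm (f x - g x - (s i x - t i x))) <= ennreal (norm (f x - s i x)) + ennreal (norm (g x - t i x))"
     by (simp flip: ennreal_plus)
   qed
   also have "... = (\<integral>\<^sup>+ x. norm (f x - s i x) \<partial>M) + (\<integral>\<^sup>+ x. norm (g x - t i x) \<partial>M)"
    by (rule nn_integral_add) auto
   finally show "(\<integral>\<^sup>+ x. norm (f x - g x - (s i x - t i x)) \<partial>M)
    <= (\<integral>\<^sup>+ x. norm (f x - s i x) \<partial>M) + (\<integral>\<^sup>+ x. norm (g x - t i x) \<partial>M)" .
  qed
  show "(%i. (\<integral>\<^sup>+ x. norm (f x - s i x) \<partial>M) + (\<integral>\<^sup>+ x. norm (g x - t i x) \<partial>M)) \<longlonglongrightarrow> 0"
   using tendsto_add[OF s(2) t(2)] by simp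
 qed auto
 moreover have "simple_bochner_integrable M (%x. s i x - t i x)" for i
  using simple_bochner_integrable_compose2[of "(-)" M "s i" "t i"] s(1) t(1) by simp
 moreover have "(%i. simple_bochner_integral M (%x. s i x - t i x)) \<longlonglongrightarrow> I - J"
  using tendsto_diff[OF s(3) t(3)] by (simp add: simple_bochner_integral_diff s(1) t(1))
 ultimately show ?thesis using fg unfolding has_bochner_def by (intro conjI exI[of _ "%i x. s i x - t i x"]) auto
qed

text \<open>The bridge to scalar integration: after applying a functional the values are complex
  numbers, and the standard convergence and Fubini theorems apply.\<close>

lemma has_bochner_iff_has_bochner_integral:
 fixes f :: "'m => 'b::{real_normed_vector, second_countable_topology}"
 shows "has_bochner M f I \<longleftrightarrow> has_bochner_integral M f I"
 unfolding has_bochner_def has_bochner_integral.simps by blast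

lemma bochner_functional:
 assumes "bochner_integrable M f" "cfunctional m"
 shows "integrable M (%x. m (f x))" "m (bochner M f) = (LINT x|M. m (f x))"
 using has_bochner_bounded_linear[OF cfunctionalD(1)[OF assms(2)] has_bochner_bochner[OF assms(1)]]
 unfolding has_bochner_iff_has_bochner_integral has_bochner_integral_iff by auto

text \<open>A single simple function at \<open>L1\<close>-distance below 1 bounds the integral of
  the norm. The norm inequality then passes to the limit along the approximating sequence.\<close>

lemma has_bochner_norm:
 fixes f :: "'m => 'b::real_normed_vector"
 assumes "has_bochner M f I"
 shows "integrable M (%x. norm (f x))" "norm I <= (LINT x|M. norm (f x))"
proof -
 obtain s where fm: "f \<in> borel_measurable M" and s: "!!i. simple_bochner_integrable M (s i)"
   "(%i. \<integral>\<^sup>+ x. norm (f x - s i x) \<partial>M) \<longlonglongrightarrow> 0" "(%i. simple_bochner_integral M (s i)) \<longlonglongrightarrow> I"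
  using assms unfolding has_bochner_def by blast
 note meas [measurable] = borel_measurable_norm_diff_simple[OF fm simple_bochner_integrable_simple[OF s(1)]]
 have fn [measurable]: "(%x. norm (f x)) \<in> borel_measurable M"
  by (rule measurable_compose[OF fm borel_measurable_continuous_onI]) (intro continuous_intros)
 have sn: "simple_bochner_integrable M (%x. norm (s i x))" for i
  using simple_bochner_integrable_compose2[of "%x y. norm x", OF _ s(1)[of i] s(1)[of i]] by simp
 have sn2 [measurable]: "(%x. norm (s i x)) \<in> borel_measurable M" for i
  using sn[of i] by (intro borel_measurable_simple_function simple_bochner_integrable_simple)
 have sn3: "(\<integral>\<^sup>+ x. norm (s i x) \<partial>M) = simple_bochner_integral M (%x. norm (s i x))" for i
  by (rule simple_bochner_integral_eq_nn_integral[OF sn, symmetric]) auto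
 have "\<forall>\<^sub>F i in sequentially. (\<integral>\<^sup>+ x. norm (f x - s i x) \<partial>M) < 1"
  using s(2) by (rule order_tendstoD) auto
 then obtain i where i: "(\<integral>\<^sup>+ x. norm (f x - s i x) \<partial>M) < 1" by (auto simp: eventually_sequentially)
 have "(\<integral>\<^sup>+ x. norm (f x) \<partial>M) <= (\<integral>\<^sup>+ x. ennreal (norm (f x - s i x)) + ennreal (norm (s i x)) \<partial>M)"
 proof (rule nn_integral_mono)
  fix x have "norm (f x) <= norm (f x - s i x) + norm (s i x)"
   using norm_triangle_sub[of "f x" "s i x"] by simp
  then show "ennreal (norm (f x)) <= ennreal (norm (f x - s i x)) + ennreal (norm (s i x))"
   by (simp flip: ennreal_plus)
 qed
 also have "... = (\<integral>\<^sup>+ x. norm (f x - s i x) \<partial>M) + (\<integral>\<^sup>+ x. norm (s i x) \<partial>M)"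
  by (rule nn_integral_add) auto
 also have "... < \<infinity>" unfolding sn3 using i by (auto simp: less_top[symmetric] top_unique)
 finally show int: "integrable M (%x. norm (f x))"
  by (intro integrableI_bounded) auto
 have eq: "(\<integral>\<^sup>+ x. norm (f x) \<partial>M) = ennreal (LINT x|M. norm (f x))"
  by (rule nn_integral_eq_integral[OF int]) auto
 have "ennreal (norm I) <= 0 + ennreal (LINT x|M. norm (f x))"
 proof (rule LIMSEQ_le)
  show "(%i. ennreal (norm (simple_bochner_integral M (s i)))) \<longlonglongrightarrow> ennreal (norm I)"
   by (intro tendsto_intros tendsto_ennrealI s)
  show "(%i. (\<integral>\<^sup>+ x. norm (f x - s i x) \<partial>M) + (\<integral>\<^sup>+ x. norm (f x) \<partial>M)) \<longlonglongrightarrow> 0 + ennreal (LINT x|M. norm (f x))"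
   unfolding eq by (intro tendsto_add tendsto_const s)
  have "ennreal (norm (simple_bochner_integral M (s i))) <= (\<integral>\<^sup>+ x. norm (f x - s i x) \<partial>M) + (\<integral>\<^sup>+ x. norm (f x) \<partial>M)" for i
  proof -
   have "ennreal (norm (simple_bochner_integral M (s i))) <= (\<integral>\<^sup>+ x. norm (s i x) \<partial>M)"
    unfolding sn3 by (intro ennreal_leI simple_bochner_integral_norm_bound s)
   also have "... <= (\<integral>\<^sup>+ x. ennreal (norm (f x - s i x)) + ennreal (norm (f x)) \<partial>M)"
   proof (rule nn_integral_mono)
    fix x have "norm (s i x) <= norm (f x - s i x) + norm (f x)"
     using norm_triangle_sub[of "s i x" "f x"] by (simp add: norm_minus_commute add.commute)
    then show "ennreal (norm (s i x)) <= ennreal (norm (f x - s i x)) + ennreal (norm (f x))"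
     by (simp flip: ennreal_plus)
   qed
   also have "... = (\<integral>\<^sup>+ x. norm (f x - s i x) \<partial>M) + (\<integral>\<^sup>+ x. norm (f x) \<partial>M)"
    by (rule nn_integral_add) auto
   finally show ?thesis .
  qed
  then show "\<exists>N. \<forall>n\<ge>N. ennreal (norm (simple_bochner_integral M (s n))) <= (\<integral>\<^sup>+ x. norm (f x - s n x) \<partial>M) + (\<integral>\<^sup>+ x. norm (f x) \<partial>M)"
   by blast
 qed
 then show "norm I <= (LINT x|M. norm (f x))" by (simp add: integral_nonneg_AE)
qed

lemma bochner_norm_le:
 fixes f :: "'m => 'b::real_normed_vector"
 assumes "bochner_integrable M f" "integrable M g" "!!x. x \<in> space M ==> norm (f x) <= g x"
 shows "norm (bochner M f) <= (LINT x|M. g x)"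
proof -
 note h = has_bochner_norm[OF has_bochner_bochner[OF assms(1)]]
 have "norm (bochner M f) <= (LINT x|M. norm (f x))" by (rule h)
 also have "... <= (LINT x|M. g x)" using assms by (intro integral_mono h) auto
 finally show ?thesis .
qed

text \<open>The approximation picks a point nearest to \<open>f x\<close> among an initial segment
  of a sequence whose range contains \<open>D\<close>. The sequence starts with 0, so the error
  never exceeds \<open>norm (f x)\<close>, and dominated convergence sends it to 0 in
  \<open>L1\<close>.\<close>

lemma bochner_integrableI:
 fixes f :: "'m => 'b::banach"
 assumes f [measurable]: "f \<in> borel_measurable M" and D: "countable D" "f ` space M \<subseteq> closure D"
  and int: "integrable M (%x. norm (f x))"
 shows "bochner_integrable M f"
proof -
 define e where "e n = (case n of 0 => 0 | Suc k => from_nat_into (insert 0 D) k)" for n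
 have e0: "e 0 = 0" by (simp add: e_def)
 have dense: "\<exists>n. norm (f x - e n) < r" if "x \<in> space M" "r > 0" for x r
 proof -
  have "f x \<in> closure D" using D(2) that by auto
  then obtain y where y: "y \<in> D" "dist y (f x) < r" using \<open>r > 0\<close> unfolding closure_approachable by blast
  have "y \<in> range (from_nat_into (insert 0 D))" using y D(1) by (subst range_from_nat_into) auto
  then obtain k where "y = e (Suc k)" by (auto simp: e_def)
  then show ?thesis using y by (metis dist_commute dist_norm)
 qed
 have nm: "(%x. norm (f x - y)) \<in> borel_measurable M" for y
  by (rule measurable_compose[OF f borel_measurable_continuous_onI]) (intro continuous_intros)
 \<comment> \<open>Taking the least minimising index makes the choice of a nearest point
   measurable.\<close>
 define idx where "idx n x = (LEAST i. i <= n \<and> (\<forall>j\<in>{..n}. norm (f x - e i) <= norm (f x - e j)))" for n x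
 have idx: "idx n x <= n \<and> (\<forall>j\<in>{..n}. norm (f x - e (idx n x)) <= norm (f x - e j))" for n x
 proof -
  let ?i = "arg_min_on (%j. norm (f x - e j)) {..n}"
  have "?i \<in> {..n}" "\<not> (\<exists>j\<in>{..n}. norm (f x - e j) < norm (f x - e ?i))"
   by (intro arg_min_if_finite; simp)+
  then have "?i <= n \<and> (\<forall>j\<in>{..n}. norm (f x - e ?i) <= norm (f x - e j))"
   by (meson atMost_iff not_less)
  then show ?thesis unfolding idx_def by (rule LeastI)
 qed
 have idx_meas: "idx n \<in> measurable M (count_space UNIV)" for n
  unfolding idx_def
 proof (rule measurable_Least)
  fix i
  have "Measurable.pred M (%x. norm (f x - e i) <= norm (f x - e j))" for j
   using borel_measurable_le[OF nm nm] by (simp add: pred_def)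
  then show "Measurable.pred M (%x. i <= n \<and> (\<forall>j\<in>{..n}. norm (f x - e i) <= norm (f x - e j)))"
   by (intro pred_intros_logic pred_intros_finite) auto
 qed
 have "simple_function M (idx n)" for n
  unfolding simple_function_def
 proof safe
  have "idx n ` space M \<subseteq> {..n}" using conjunct1[OF idx] by blast
  then show "finite (idx n ` space M)" by (rule finite_subset) simp
 qed (rule measurable_sets[OF idx_meas], simp)
 then have sf: "simple_function M (%x. e (idx n x))" for n by (rule simple_function_compose1)
 have le: "norm (f x - e (idx n x)) <= norm (f x)" for n x
  using idx[of n x] e0 by (metis atMost_iff diff_zero le0)
 have fin: "(\<integral>\<^sup>+ x. norm (f x) \<partial>M) < \<infinity>" using int unfolding integrable_iff_bounded by simp
 note [measurable] = borel_measurable_norm_diff_simple[OF f sf]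
 have conv: "(%n. \<integral>\<^sup>+ x. norm (f x - e (idx n x)) \<partial>M) \<longlonglongrightarrow> (\<integral>\<^sup>+ x. ennreal 0 \<partial>M)"
 proof (rule nn_integral_dominated_convergence[where w = "%x. ennreal (norm (f x))"])
  show "AE x in M. (%i. ennreal (norm (f x - e (idx i x)))) \<longlonglongrightarrow> ennreal 0"
  proof (rule AE_I2, rule tendsto_ennrealI, rule LIMSEQ_I)
   fix x and r :: real assume x: "x \<in> space M" "0 < r"
   then obtain N where N: "norm (f x - e N) < r" using dense by blast
   have "norm (f x - e (idx n x)) < r" if "n >= N" for n
    using idx[of n x] N that by (meson atMost_iff le_less_trans)
   then show "\<exists>N. \<forall>n\<ge>N. norm (norm (f x - e (idx n x)) - 0) < r" by auto
  qed
 qed (use le fin in \<open>auto intro!: ennreal_leI\<close>)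
 then have conv: "(%n. \<integral>\<^sup>+ x. norm (f x - e (idx n x)) \<partial>M) \<longlonglongrightarrow> 0" by simp
 have sbi: "simple_bochner_integrable M (%x. e (idx n x))" for n
 proof (rule simple_bochner_integrableI_bounded[OF sf])
  have "(\<integral>\<^sup>+ x. norm (e (idx n x)) \<partial>M) <= (\<integral>\<^sup>+ x. 2 * ennreal (norm (f x)) \<partial>M)"
  proof (rule nn_integral_mono)
   fix x
   have "norm (e (idx n x)) <= 2 * norm (f x)"
    using le[of x n] norm_triangle_ineq2[of "e (idx n x)" "f x"] by (simp add: norm_minus_commute)
   then show "ennreal (norm (e (idx n x))) <= 2 * ennreal (norm (f x))"
    by (metis ennreal_leI ennreal_mult ennreal_numeral norm_ge_zero zero_le_numeral)
  qed
  also have "... < \<infinity>" using fin by (subst nn_integral_cmult) (auto simp: ennreal_mult_less_top)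
  finally show "(\<integral>\<^sup>+ x. norm (e (idx n x)) \<partial>M) < \<infinity>" .
 qed
 have "Cauchy (%n. simple_bochner_integral M (%x. e (idx n x)))"
 proof (rule metric_CauchyI)
  fix r :: real assume r: "r > 0"
  have "\<forall>\<^sub>F n in sequentially. (\<integral>\<^sup>+ x. norm (f x - e (idx n x)) \<partial>M) < ennreal (r/2)"
   using conv r by (intro order_tendstoD) auto
  then obtain N where N: "!!n. n >= N ==> (\<integral>\<^sup>+ x. norm (f x - e (idx n x)) \<partial>M) < ennreal (r/2)"
   by (auto simp: eventually_sequentially)
  have "dist (simple_bochner_integral M (%x. e (idx n x))) (simple_bochner_integral M (%x. e (idx k x))) < r"
   if "n >= N" "k >= N" for n k
  proof -
   have "ennreal (dist (simple_bochner_integral M (%x. e (idx n x))) (simple_bochner_integral M (%x. e (idx k x))))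
     <= (\<integral>\<^sup>+ x. norm (f x - e (idx n x)) \<partial>M) + (\<integral>\<^sup>+ x. norm (f x - e (idx k x)) \<partial>M)"
    unfolding dist_norm by (rule simple_bochner_integral_diff_le[OF f sbi sbi])
   also have "... < ennreal (r/2) + ennreal (r/2)"
    by (intro add_strict_mono N that)
   also have "... = ennreal r" using r by (simp flip: ennreal_plus)
   finally show ?thesis by (simp add: ennreal_less_iff)
  qed
  then show "\<exists>N. \<forall>n\<ge>N. \<forall>k\<ge>N. dist (simple_bochner_integral M (%x. e (idx n x)))
    (simple_bochner_integral M (%x. e (idx k x))) < r" by blast
 qed
 then obtain I where "(%n. simple_bochner_integral M (%x. e (idx n x))) \<longlonglongrightarrow> I"
  unfolding Cauchy_convergent_iff convergent_def by blast
 then show ?thesis unfolding bochner_integrable_def has_bochner_def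
  using f sbi conv by (intro exI[of _ I] conjI exI[of _ "%n x. e (idx n x)"] allI) simp_all
qed

text \<open>Continuity on a set of reals supplies the countable set required by
  \<open>bochner_integrableI\<close>, because the domain is separable.\<close>

lemma continuous_image_separable:
 fixes f :: "real => 'b::metric_space"
 assumes "continuous_on S f"
 shows "\<exists>D. countable D \<and> f ` S \<subseteq> closure D"
proof -
 obtain T where T: "countable T" "T \<subseteq> S" "S \<subseteq> closure T" using separable by blast
 have "f ` (closure T \<inter> S) \<subseteq> closure (f ` T)"
 proof
  fix y assume "y \<in> f ` (closure T \<inter> S)"
  then obtain x where x: "x \<in> closure T" "x \<in> S" "y = f x" by auto
  then obtain z where z: "!!n. z n \<in> T" "z \<longlonglongrightarrow> x" by (auto simp: closure_sequential)
  have "(%n. f (z n)) \<longlonglongrightarrow> f x"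
   using assms x z T(2) by (intro continuous_on_tendsto_compose[OF assms z(2)]) (auto simp: subset_iff)
  then show "y \<in> closure (f ` T)"
   unfolding closure_sequential using x(3) z(1) by (intro exI[of _ "%n. f (z n)"]) simp
 qed
 moreover have "closure T \<inter> S = S" using T by auto
 ultimately show ?thesis using T(1) by (intro exI[of _ "f ` T"]) auto
qed

lemma bochner_integrable_continuous_lborel:
 fixes f :: "real => 'b::banach"
 assumes f: "continuous_on UNIV f" and g: "integrable lborel g" and le: "!!x. norm (f x) <= g x"
 shows "bochner_integrable lborel f"
proof -
 have fm: "f \<in> borel_measurable lborel" using borel_measurable_continuous_onI[OF f] by simp
 obtain D where "countable D" "range f \<subseteq> closure D" using continuous_image_separable[OF f] by auto
 moreover have "(%x. norm (f x)) \<in> borel_measurable lborel"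
  using borel_measurable_continuous_onI[OF continuous_on_norm[OF f]] by simp
 then have "integrable lborel (%x. norm (f x))"
  using le by (intro integrable_le[OF g]) (auto intro!: AE_I2 intro: order_trans[OF le abs_ge_self])
 ultimately show ?thesis using fm by (intro bochner_integrableI) auto
qed

lemma borel_measurable_continuous_lebesgue_on:
 fixes f :: "real => 'c::topological_space"
 assumes "continuous_on S f" "S \<in> sets borel"
 shows "f \<in> borel_measurable (lebesgue_on S)"
proof -
 have "f \<in> borel_measurable (restrict_space borel S)" by (rule borel_measurable_continuous_on_restrict[OF assms(1)])
 moreover have "measurable (restrict_space borel S) borel \<subseteq> (measurable (lebesgue_on S) borel :: (real => 'c) set)"
  by (rule measurable_mono) (use assms(2) in \<open>auto simp: sets_restrict_space space_restrict_space intro: sets_completionI_sets\<close>)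
 ultimately show ?thesis by blast
qed

lemma bochner_integrable_continuous_lebesgue_on:
 fixes f :: "real => 'b::banach"
 assumes f: "continuous_on S f" and S: "S \<in> sets borel" and g: "integrable (lebesgue_on S) g"
  and le: "!!x. x \<in> S ==> norm (f x) <= g x"
 shows "bochner_integrable (lebesgue_on S) f"
proof -
 note borel_imp = borel_measurable_continuous_lebesgue_on[OF _ S]
 obtain D where "countable D" "f ` S \<subseteq> closure D" using continuous_image_separable[OF f] by auto
 moreover have "integrable (lebesgue_on S) (%x. norm (f x))"
  using le by (intro integrable_le[OF g] borel_imp continuous_on_norm f)
   (auto intro!: AE_I2 intro: order_trans[OF le abs_ge_self])
 ultimately show ?thesis using borel_imp[OF f] by (intro bochner_integrableI) auto
qed

lemma bochner_diff:
 assumes f: "bochner_integrable M f" and g: "bochner_integrable M g"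
  and fg: "bochner_integrable M (%x. f x - g x)"
 shows "bochner M (%x. f x - g x) = bochner M f - bochner M g"
proof -
 have "(%x. f x - g x) \<in> borel_measurable M" using fg by (auto simp: bochner_integrable_def has_bochner_def)
 from bochner_eqI[OF has_bochner_diff[OF has_bochner_bochner[OF f] has_bochner_bochner[OF g] this]] show ?thesis .
qed

lemma bochner_tendsto:
 fixes f :: "'m => 'b::real_normed_vector"
 assumes F: "!!n. bochner_integrable M (F n)" and f: "bochner_integrable M f"
  and g: "integrable M g" and le: "!!n x. x \<in> space M ==> norm (F n x - f x) <= g x"
  and lim: "!!x. x \<in> space M ==> (%n. F n x) \<longlonglongrightarrow> f x"
  and meas: "!!n. (%x. F n x - f x) \<in> borel_measurable M"
 shows "(%n. bochner M (F n)) \<longlonglongrightarrow> bochner M f"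
proof -
 have h: "has_bochner M (%x. F n x - f x) (bochner M (F n) - bochner M f)" for n
  by (intro has_bochner_diff has_bochner_bochner F f meas)
 have "(%n. LINT x|M. norm (F n x - f x)) \<longlonglongrightarrow> (LINT x|M. 0)"
 proof (rule integral_dominated_convergence[OF _ _ g])
  show "AE x in M. (%i. norm (F i x - f x)) \<longlonglongrightarrow> 0"
   using lim by (intro AE_I2 tendsto_norm_zero) (auto simp: LIM_zero_iff)
 qed (use has_bochner_norm(1)[OF h] le in \<open>auto intro!: AE_I2\<close>)
 then have "(%n. LINT x|M. norm (F n x - f x)) \<longlonglongrightarrow> 0" by simp
 then have "(%n. norm (bochner M (F n) - bochner M f)) \<longlonglongrightarrow> 0"
  by (rule Lim_null_comparison[rotated]) (use has_bochner_norm(2)[OF h] in auto)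
 then show ?thesis by (simp add: LIM_zero_iff tendsto_norm_zero_iff)
qed

lemma bochner_integrable_diff:
 fixes f g :: "'m => 'b::banach"
 assumes "bochner_integrable M f" "bochner_integrable M g" "(%x. f x - g x) \<in> borel_measurable M"
 shows "bochner_integrable M (%x. f x - g x)"
 using has_bochner_diff[OF has_bochner_bochner[OF assms(1)] has_bochner_bochner[OF assms(2)] assms(3)]
 by (auto simp: bochner_integrable_def)

lemma bochner_add:
 fixes f g :: "'m => 'b::real_normed_vector"
 assumes f: "bochner_integrable M f" and g: "bochner_integrable M g"
  and fg: "(%x. f x + g x) \<in> borel_measurable M"
 shows "bochner_integrable M (%x. f x + g x)" "bochner M (%x. f x + g x) = bochner M f + bochner M g"
proof -
 have "bounded_linear (%x::'b. - x)" using bounded_linear_minus[OF bounded_linear_ident] .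
 from has_bochner_bounded_linear[OF this has_bochner_bochner[OF g]]
 have "has_bochner M (%x. - g x) (- bochner M g)" .
 from has_bochner_diff[OF has_bochner_bochner[OF f] this] fg
 have "has_bochner M (%x. f x + g x) (bochner M f + bochner M g)" by simp
 then show "bochner_integrable M (%x. f x + g x)" "bochner M (%x. f x + g x) = bochner M f + bochner M g"
  by (auto simp: bochner_integrable_def bochner_eqI)
qed

text \<open>Dominated convergence for difference quotients. By the mean value inequality the
  increment of \<open>F\<close> is at most \<open>g x\<close> times the distance, so the normalised
  remainder is at most \<open>2 * g x\<close>. The measurability conditions stand for what
  separability of the target would give.\<close>

lemma bochner_has_derivative:
 fixes F :: "'p::real_normed_vector => 'm => 'b::banach"
 assumes U: "open U" "convex U" "p0 \<in> U"
  and F: "!!p. p \<in> U ==> bochner_integrable M (F p)"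
  and D: "!!h. bochner_integrable M (%x. D p0 x h)"
  and meas: "!!p h. p \<in> U ==> (%x. (F p x - F p0 x) - D p0 x h) \<in> borel_measurable M"
   "!!p. p \<in> U ==> (%x. F p x - F p0 x) \<in> borel_measurable M"
   "!!h k. (%x. D p0 x h + D p0 x k) \<in> borel_measurable M"
  and der: "!!p x. p \<in> U ==> x \<in> space M ==> ((%p. F p x) has_derivative D p x) (at p)"
  and le: "!!p x h. p \<in> U ==> x \<in> space M ==> norm (D p x h) <= g x * norm h"
  and g: "integrable M g"
 shows "((%p. bochner M (F p)) has_derivative (%h. bochner M (%x. D p0 x h))) (at p0)"
proof -
 have bl: "bounded_linear (D p0 x)" if "x \<in> space M" for x
  using der[OF U(3) that] by (rule has_derivative_bounded_linear)
 have "bounded_linear (%h. bochner M (%x. D p0 x h))"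
 proof (rule bounded_linear_intro[where K = "LINT x|M. g x"])
  fix h k :: 'p and r :: real
  have "bochner M (%x. D p0 x (h + k)) = bochner M (%x. D p0 x h + D p0 x k)"
   by (intro bochner_cong linear_add bounded_linear.linear bl)
  then show "bochner M (%x. D p0 x (h + k)) = bochner M (%x. D p0 x h) + bochner M (%x. D p0 x k)"
   using bochner_add(2)[OF D D meas(3)] by simp
  have "bochner M (%x. D p0 x (r *\<^sub>R h)) = bochner M (%x. r *\<^sub>R D p0 x h)"
   by (intro bochner_cong linear_cmul bounded_linear.linear bl)
  then show "bochner M (%x. D p0 x (r *\<^sub>R h)) = r *\<^sub>R bochner M (%x. D p0 x h)"
   using bochner_bounded_linear(2)[OF bounded_linear_scaleR_right D] by simp
  have "norm (bochner M (%x. D p0 x h)) <= (LINT x|M. g x * norm h)"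
   using g le[OF U(3)] by (intro bochner_norm_le D) auto
  then show "norm (bochner M (%x. D p0 x h)) <= norm h * (LINT x|M. g x)"
   by (simp add: mult.commute)
 qed
 moreover have "((%p. (1 / norm (p - p0)) *\<^sub>R (bochner M (F p) - (bochner M (F p0) + bochner M (%x. D p0 x (p - p0))))) \<longlongrightarrow> 0) (at p0 within U)"
  unfolding tendsto_at_iff_sequentially o_def
 proof (intro allI impI)
  fix p assume "\<forall>i. p i \<in> U - {p0}" and lim: "p \<longlonglongrightarrow> p0"
  then have p: "p i \<in> U" "p i ~= p0" for i by auto
  \<comment> \<open>The normalised Taylor remainder along a sequence tending to
    \<open>p0\<close>.\<close>
  define Q where "Q i x = (1 / norm (p i - p0)) *\<^sub>R ((F (p i) x - F p0 x) - D p0 x (p i - p0))" for i x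
  have hQ: "has_bochner M (Q i) ((1 / norm (p i - p0)) *\<^sub>R ((bochner M (F (p i)) - bochner M (F p0)) - bochner M (%x. D p0 x (p i - p0))))" for i
   unfolding Q_def
   by (intro has_bochner_bounded_linear[OF bounded_linear_scaleR_right] has_bochner_diff has_bochner_bochner
     F D meas p U)
  have Qle: "norm (Q i x) <= 2 * g x" if x: "x \<in> space M" for i x
  proof -
   have "norm (F (p i) x - F p0 x) <= g x * norm (p i - p0)"
   proof (rule differentiable_bound[OF U(2)])
    fix q assume q: "q \<in> U"
    show "((%p. F p x) has_derivative D q x) (at q within U)"
     using der[OF q x] by (rule has_derivative_at_withinI)
    have "0 <= g x * norm (p i - p0)" using le[OF U(3) x, of "p i - p0"] norm_ge_zero order_trans by blast
    then have "0 <= g x" using p(2)[of i] by (simp add: zero_le_mult_iff)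
    then show "onorm (D q x) <= g x" by (rule onorm_bound) (rule le[OF q x])
   qed (use p U in auto)
   then have "norm ((F (p i) x - F p0 x) - D p0 x (p i - p0)) <= 2 * g x * norm (p i - p0)"
    using norm_triangle_ineq4[of "F (p i) x - F p0 x" "D p0 x (p i - p0)"] le[OF U(3) x, of "p i - p0"] by simp
   then show ?thesis using p(2)[of i] by (simp add: Q_def divide_le_eq)
  qed
  have Qlim: "(%i. Q i x) \<longlonglongrightarrow> 0" if x: "x \<in> space M" for x
  proof -
   have "((%q. (1 / norm (q - p0)) *\<^sub>R (F q x - (F p0 x + D p0 x (q - p0)))) \<longlongrightarrow> 0) (at p0)"
    using der[OF U(3) x] unfolding has_derivative_within by simp
   from this[unfolded tendsto_at_iff_sequentially o_def, rule_format, OF _ lim] p(2)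
   show ?thesis by (simp add: Q_def diff_diff_eq)
  qed
  have "(%i. bochner M (Q i)) \<longlonglongrightarrow> bochner M (%x. 0)"
  proof (rule bochner_tendsto)
   show "bochner_integrable M (Q i)" for i using hQ by (auto simp: bochner_integrable_def)
   have "has_bochner M (%x. Q 0 x - Q 0 x) (bochner M (Q 0) - bochner M (Q 0))"
    using hQ by (intro has_bochner_diff) (auto simp: bochner_eqI[OF hQ])
   then show "bochner_integrable M (%x. 0::'b)" by (auto simp: bochner_integrable_def)
   show "(%x. Q n x - 0) \<in> borel_measurable M" for n using hQ[of n] by (simp add: has_bochner_def)
   show "integrable M (%x. 2 * g x)" using g by simp
  qed (use Qle Qlim in auto)
  moreover have "has_bochner M (%x. Q 0 x - Q 0 x) (bochner M (Q 0) - bochner M (Q 0))"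
   using hQ by (intro has_bochner_diff) (auto simp: bochner_eqI[OF hQ])
  then have "bochner M (%x. 0::'b) = 0" by (auto dest: bochner_eqI)
  ultimately show "(%i. (1 / norm (p i - p0)) *\<^sub>R (bochner M (F (p i)) - (bochner M (F p0) + bochner M (%x. D p0 x (p i - p0))))) \<longlonglongrightarrow> 0"
   by (simp add: bochner_eqI[OF hQ] diff_diff_eq)
 qed
 ultimately have "((%p. bochner M (F p)) has_derivative (%h. bochner M (%x. D p0 x h))) (at p0 within U)"
  unfolding has_derivative_within by blast
 then show ?thesis unfolding at_within_open[OF U(3,1)] .
qed

section \<open>Line integrals in strips\<close>

lemma integrable_exp_abs:
 assumes c: "c > 0"
 shows "integrable lborel (%x::real. exp (- c * \<bar>x\<bar>))"
proof -
 let ?h = "%x::real. indicator {0..} x * exp (- c * x)"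
 have "(%x::real. exp (- c * x)) absolutely_integrable_on {0..}"
  using has_integral_exp_minus_to_infinity[OF c, of 0]
  by (intro nonnegative_absolutely_integrable_1) (auto simp: integrable_on_def)
 then have "integrable lebesgue ?h" by (simp add: set_integrable_def)
 then have h: "integrable lborel ?h" by (subst (asm) integrable_completion) auto
 have "integrable lborel (%x. ?h x + ?h (0 + (- 1) * x))"
  by (intro Bochner_Integration.integrable_add h lborel_integrable_real_affine) auto
 then show ?thesis
  by (rule integrable_le) (auto intro!: AE_I2 simp: indicator_def)
qed

text \<open>The substitution \<open>r = exp x\<close> carries the half-line to the whole line; power
  bounds at 0 and infinity become exponential decay on both sides.\<close>

lemma exp_subst:
 fixes f :: "real => 'a::euclidean_space"
 assumes int: "integrable lborel (%x. exp x *\<^sub>R f (exp x))"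
 shows "integrable leb_pos f"
  "(LINT r|leb_pos. f r) = (LINT x|lborel. exp x *\<^sub>R f (exp x))"
proof -
 let ?F = "%x. exp x *\<^sub>R f (exp x)"
 have [measurable]: "?F \<in> borel_measurable borel" using int by auto
 have leb: "integrable lebesgue ?F" "(LINT x|lebesgue. ?F x) = (LINT x|lborel. ?F x)"
  using int by (auto simp: integrable_completion integral_completion)
 have abs: "?F absolutely_integrable_on UNIV" using leb by (simp add: set_integrable_def)
 have int: "integral UNIV ?F = (LINT x|lborel. ?F x)"
  using set_lebesgue_integral_eq_integral(2)[OF abs] leb by (simp add: set_lebesgue_integral_def)
 have rng: "range exp = {0::real<..}"
 proof (intro equalityI subsetI)
  fix x :: real assume "x \<in> {0<..}"
  then show "x \<in> range exp" by (intro range_eqI[of _ _ "ln x"]) simp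
 qed auto
 have "f absolutely_integrable_on (exp ` UNIV) \<and> integral (exp ` UNIV) f = (LINT x|lborel. ?F x)"
  using abs int
  by (subst has_absolute_integral_change_of_variables_real[where h = exp, symmetric])
   (auto intro!: derivative_eq_intros inj_onI simp: abs_of_pos)
 then have f: "f absolutely_integrable_on {0<..}" "integral {0<..} f = (LINT x|lborel. ?F x)"
  unfolding rng by auto
 show "integrable leb_pos f"
  using f(1) by (subst integrable_restrict_space) (auto simp: set_integrable_def)
 show "(LINT r|leb_pos. f r) = (LINT x|lborel. ?F x)"
  using f set_lebesgue_integral_eq_integral(2)[OF f(1)]
  by (subst integral_restrict_space) (auto simp: set_lebesgue_integral_def)
qed

lemma integrable_exp_abs_ln:
 assumes "c > 0"
 shows "integrable leb_pos (%r::real. exp (- c * \<bar>ln r\<bar>) / r)"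
 using integrable_exp_abs[OF assms] by (intro exp_subst(1)) simp

lemma LINT_limit:
 fixes f :: "real => complex"
 assumes "integrable lborel f"
 shows "(%n. integral {- real n..real n} f) \<longlonglongrightarrow> (LINT x|lborel. f x)"
proof -
 have "(%n. LINT x|lborel. indicator {- real n..real n} x *\<^sub>R f x) \<longlonglongrightarrow> (LINT x|lborel. f x)"
 proof (rule integral_dominated_convergence[where w = "%x. norm (f x)"])
  show "AE x in lborel. (%n. indicator {- real n..real n} x *\<^sub>R f x) \<longlonglongrightarrow> f x"
  proof (rule AE_I2, rule tendsto_eventually)
   fix x :: real
   obtain N where "\<bar>x\<bar> <= real N" using real_arch_simple by blast
   then have "indicator {- real n..real n} x *\<^sub>R f x = f x" if "n >= N" for n
    using that by (auto simp: indicator_def abs_le_iff)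
   then show "\<forall>\<^sub>F n in sequentially. indicator {- real n..real n} x *\<^sub>R f x = f x"
    by (auto simp: eventually_sequentially)
  qed
 qed (use assms in \<open>auto intro!: AE_I2 simp: indicator_def\<close>)
 moreover have "(LINT x|lborel. indicator {- real n..real n} x *\<^sub>R f x) = integral {- real n..real n} f" for n
 proof -
  have "set_integrable lborel {- real n..real n} f"
   using assms unfolding set_integrable_def by (intro integrable_mult_indicator) auto
  from set_borel_integral_eq_integral(2)[OF this] show ?thesis by (simp add: set_lebesgue_integral_def)
 qed
 ultimately show ?thesis by simp
qed

lemma has_contour_integral_linepath_horizontal:
 assumes "p < q"
 shows "(f has_contour_integral I) (linepath (Complex p t) (Complex q t)) \<longleftrightarrow>
  ((%x. f (Complex x t)) has_integral I) {p..q}"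
proof -
 have lp: "linepath (complex_of_real p) (of_real q) x + \<i> * of_real t = linepath (Complex p t) (Complex q t) x" for x
  by (simp add: linepath_def complex_eq_iff algebra_simps)
 have pq: "of_real q - complex_of_real p = Complex q t - Complex p t" by (simp add: complex_eq_iff)
 have "(f has_contour_integral I) (linepath (Complex p t) (Complex q t)) \<longleftrightarrow>
   ((%z. f (z + \<i> * of_real t)) has_contour_integral I) (linepath (of_real p) (of_real q))"
  unfolding has_contour_integral_linepath lp pq ..
 also have "... \<longleftrightarrow> ((%x. f (of_real x + \<i> * of_real t)) has_integral I) {p..q}"
  using assms by (subst has_contour_integral_linepath_Reals_iff) auto
 finally show ?thesis by (simp add: Complex_eq)
qed

lemma continuous_on_Complex [continuous_intros]:
 assumes "continuous_on S f" "continuous_on S g"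
 shows "continuous_on S (%x. Complex (f x) (g x))"
 unfolding Complex_eq by (intro continuous_intros assms)

lemma exp_decay_bound:
 fixes f :: "real => 'b::real_normed_vector"
 assumes f: "continuous_on UNIV f" and c: "c > 0" and le: "!!x. \<bar>x\<bar> >= N ==> norm (f x) <= C * exp (- c * \<bar>x\<bar>)"
 obtains K where "!!x. norm (f x) <= K * exp (- c * \<bar>x\<bar>)"
proof -
 have "compact ((%x. exp (c * \<bar>x\<bar>) * norm (f x)) ` {- N..N})"
  by (intro compact_continuous_image continuous_intros continuous_on_subset[OF f]) auto
 then obtain B where B: "!!x. x \<in> {- N..N} ==> \<bar>exp (c * \<bar>x\<bar>) * norm (f x)\<bar> <= B"
  by (force dest: compact_imp_bounded simp: bounded_iff)
 have "norm (f x) <= max B C * exp (- c * \<bar>x\<bar>)" for x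
 proof (cases "\<bar>x\<bar> >= N")
  case True
  show ?thesis using le[OF True] by (rule order_trans) (intro mult_right_mono; simp)
 next
  case False
  then have "x \<in> {- N..N}" by auto
  then have "exp (c * \<bar>x\<bar>) * norm (f x) <= B" using B[of x] by linarith
  also have "... <= max B C" by simp
  finally show ?thesis by (simp add: exp_minus field_simps)
 qed
 then show ?thesis using that by blast
qed

lemma integrable_exp_decay:
 fixes f :: "real => complex"
 assumes f: "continuous_on UNIV f" and c: "c > 0" and le: "!!x. \<bar>x\<bar> >= N ==> norm (f x) <= C * exp (- c * \<bar>x\<bar>)"
 shows "integrable lborel f"
proof -
 obtain K where K: "!!x. norm (f x) <= K * exp (- c * \<bar>x\<bar>)" using exp_decay_bound[OF assms] by blast
 have "integrable lborel (%x. K * exp (- c * \<bar>x\<bar>))" by (intro integrable_mult_right integrable_exp_abs c)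
 then show ?thesis
  by (rule integrable_le)
   (use borel_measurable_continuous_onI[OF f] K in \<open>auto intro!: AE_I2 intro: order_trans[OF _ abs_ge_self]\<close>)
qed

text \<open>Cauchy's formula on the rectangle with real parts between \<open>- n\<close> and
  \<open>n\<close>: the horizontal sides tend to the two line integrals, and the exponential bound
  makes the vertical sides vanish.\<close>

lemma strip_cauchy:
 assumes H: "H holomorphic_on {w. a < Im w \<and> Im w < b}"
  and ord: "a < th1" "th1 < Im w0" "Im w0 < th2" "th2 < b" and c: "c > 0"
  and bnd: "!!w. th1 <= Im w ==> Im w <= th2 ==> \<bar>Re w\<bar> >= N ==> norm (H w / (w - w0)) <= C * exp (- c * \<bar>Re w\<bar>)"
 shows "(LINT x|lborel. H (Complex x th1) / (Complex x th1 - w0)) -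
   (LINT x|lborel. H (Complex x th2) / (Complex x th2 - w0)) = 2 * pi * \<i> * H w0" (is "?I1 - ?I2 = _")
proof -
 let ?S = "{w. a < Im w \<and> Im w < b}"
 let ?F = "%w. H w / (w - w0)"
 have contH: "continuous_on ?S H" by (rule holomorphic_on_imp_continuous_on[OF H])
 have contF: "continuous_on T ?F" if "T \<subseteq> ?S - {w0}" for T
  using that by (intro continuous_intros continuous_on_subset[OF contH]) auto
 have int: "integrable lborel (%x. ?F (Complex x t))" if t: "t = th1 \<or> t = th2" for t
 proof (rule integrable_exp_decay[where c = c and C = C and N = N])
  have "continuous_on UNIV (?F \<circ> (%x. Complex x t))"
   using t ord by (intro continuous_on_compose continuous_intros contF) (auto simp: complex_eq_iff)
  then show "continuous_on UNIV (%x. ?F (Complex x t))" by (simp add: o_def)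
  show "norm (?F (Complex x t)) <= C * exp (- c * \<bar>x\<bar>)" if "N <= \<bar>x\<bar>" for x
   using bnd[of "Complex x t"] t ord that by auto
 qed (rule c)
 define J where "J n = integral {- real n..real n} (%x. ?F (Complex x th1)) - integral {- real n..real n} (%x. ?F (Complex x th2))" for n
 have J: "J \<longlonglongrightarrow> ?I1 - ?I2" unfolding J_def by (intro tendsto_diff LINT_limit int) auto
 obtain M where M: "max (\<bar>Re w0\<bar> + 1) N <= real M" using real_arch_simple by blast
 have est: "norm (J n - 2 * pi * \<i> * H w0) <= 2 * (th2 - th1) * (C * exp (- c * real n))" if n: "n >= M" for n
 proof -
  have nM: "real n >= real M" using n by simp
  then have npos: "- real n < real n" and nw: "\<bar>Re w0\<bar> < real n" and nN: "N <= real n" using M by auto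
  let ?a1 = "Complex (- real n) th1" and ?a2 = "Complex (real n) th1" and ?a3 = "Complex (real n) th2" and ?a4 = "Complex (- real n) th2"
  have rp: "rectpath ?a1 ?a3 = linepath ?a1 ?a2 +++ linepath ?a2 ?a3 +++ linepath ?a3 ?a4 +++ linepath ?a4 ?a1"
   by (simp add: rectpath_def Let_def)
  have seg: "closed_segment z z' \<subseteq> {w. th1 <= Im w \<and> Im w <= th2}" if "z \<in> {?a1,?a2,?a3,?a4}" "z' \<in> {?a1,?a2,?a3,?a4}" for z z'
  proof (rule closed_segment_subset)
   have "{w. th1 <= Im w \<and> Im w <= th2} = {w. Im w >= th1} \<inter> {w. Im w <= th2}" by auto
   then show "convex {w. th1 <= Im w \<and> Im w <= th2}"
    by (simp add: convex_Int convex_halfspace_Im_ge convex_halfspace_Im_le)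
  qed (use that ord in auto)
  have hor: "w \<in> closed_segment (Complex p t) (Complex q t) ==> Im w = t" for w p q t
   by (auto simp: closed_segment_def) (simp add: algebra_simps)
  have ver: "w \<in> closed_segment (Complex p t) (Complex p s) ==> Re w = p" for w p s t
   by (auto simp: closed_segment_def) (simp add: algebra_simps)
  have ci: "?F contour_integrable_on linepath z z'"
   if "z \<in> {?a1,?a2,?a3,?a4}" "z' \<in> {?a1,?a2,?a3,?a4}" "w0 \<notin> closed_segment z z'" for z z'
  proof (intro contour_integrable_continuous_linepath contF)
   have "{w. th1 <= Im w \<and> Im w <= th2} \<subseteq> ?S" using ord by auto
   then show "closed_segment z z' \<subseteq> ?S - {w0}" using seg[OF that(1,2)] that(3) by blast
  qed
  have "w0 \<notin> closed_segment ?a1 ?a2" "w0 \<notin> closed_segment ?a4 ?a3" "w0 \<notin> closed_segment ?a3 ?a4"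
   "w0 \<notin> closed_segment ?a2 ?a3" "w0 \<notin> closed_segment ?a4 ?a1"
   using hor[of w0] ver[of w0] ord nw by (metis less_irrefl abs_minus_cancel abs_of_nat)+
  then have c1: "?F contour_integrable_on linepath ?a1 ?a2" "?F contour_integrable_on linepath ?a4 ?a3"
    "?F contour_integrable_on linepath ?a3 ?a4"
   and c2: "?F contour_integrable_on linepath ?a2 ?a3" "?F contour_integrable_on linepath ?a4 ?a1"
   by - (rule ci; simp)+
  define I2 I4 where "I2 = contour_integral (linepath ?a2 ?a3) ?F" and "I4 = contour_integral (linepath ?a4 ?a1) ?F"
  have "contour_integral (rectpath ?a1 ?a3) ?F = contour_integral (linepath ?a1 ?a2) ?F + (I2 + (contour_integral (linepath ?a3 ?a4) ?F + I4))"
   unfolding rp I2_def I4_def using c1 c2 by (simp add: contour_integrable_joinI)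
  moreover have "contour_integral (linepath ?a3 ?a4) ?F = - contour_integral (linepath ?a4 ?a3) ?F"
   using contour_integral_reversepath[of "linepath ?a4 ?a3" ?F] by simp
  moreover have "contour_integral (linepath (Complex (- real n) t) (Complex (real n) t)) ?F = integral {- real n..real n} (%x. ?F (Complex x t))"
   if "?F contour_integrable_on linepath (Complex (- real n) t) (Complex (real n) t)" for t
   using has_contour_integral_linepath_horizontal[OF npos, of ?F _ t] has_contour_integral_integral[OF that]
   by (metis integral_unique)
  ultimately have "contour_integral (rectpath ?a1 ?a3) ?F = J n + (I2 + I4)"
   using c1 unfolding J_def by simp
  moreover have "(?F has_contour_integral (2*pi * \<i> * winding_number (rectpath ?a1 ?a3) w0 * H w0)) (rectpath ?a1 ?a3)"
  proof (rule Cauchy_integral_formula_convex_simple)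
   have S_eq: "?S = {w. Im w > a} \<inter> {w. Im w < b}" by auto
   show "convex ?S" unfolding S_eq by (intro convex_Int convex_halfspace_Im_gt convex_halfspace_Im_lt)
   have "open ?S" unfolding S_eq by (intro open_Int open_halfspace_Im_gt open_halfspace_Im_lt)
   then show "w0 \<in> interior ?S" using ord by (simp add: interior_open)
   have "w0 \<in> box ?a1 ?a3" using ord nw by (auto simp: in_box_complex_iff)
   moreover have "path_image (rectpath ?a1 ?a3) = cbox ?a1 ?a3 - box ?a1 ?a3"
    using ord npos by (intro path_image_rectpath_cbox_minus_box) auto
   moreover have "cbox ?a1 ?a3 \<subseteq> ?S" using ord by (auto simp: in_cbox_complex_iff)
   ultimately show "path_image (rectpath ?a1 ?a3) \<subseteq> ?S - {w0}" by blast
  qed (use H in auto)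
  moreover have "winding_number (rectpath ?a1 ?a3) w0 = 1"
   using ord nw by (intro winding_number_rectpath) (auto simp: in_box_complex_iff)
  ultimately have Jn: "J n - 2 * pi * \<i> * H w0 = - (I2 + I4)"
   by (auto dest!: contour_integral_unique simp: algebra_simps)
  have nb: "norm (?F w) <= C * exp (- c * real n)" if "w \<in> closed_segment ?a2 ?a3 \<or> w \<in> closed_segment ?a4 ?a1" for w
  proof -
   have "\<bar>Re w\<bar> = real n" using that ver by force
   moreover have "th1 <= Im w \<and> Im w <= th2" using seg that by blast
   ultimately show ?thesis using bnd[of w] nN by auto
  qed
  have nn: "0 <= C * exp (- c * real n)"
   using nb[of ?a2] norm_ge_zero order_trans by blast
  have "norm I2 <= C * exp (- c * real n) * norm (?a3 - ?a2)" "norm I4 <= C * exp (- c * real n) * norm (?a1 - ?a4)"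
   unfolding I2_def I4_def using c2 nn nb by (intro contour_integral_bound_linepath; blast)+
  moreover have "norm (?a3 - ?a2) = th2 - th1" "norm (?a1 - ?a4) = th2 - th1"
   using ord by (simp_all add: cmod_def)
  ultimately show ?thesis
   unfolding Jn norm_minus_cancel using norm_triangle_ineq[of I2 I4] by (simp add: algebra_simps)
 qed
 have "(%n. exp (- c * real n)) \<longlonglongrightarrow> 0"
 proof -
  have "(%n. exp (- c) ^ n) \<longlonglongrightarrow> 0" using c by (intro LIMSEQ_power_zero) simp
  then show ?thesis by (simp add: exp_of_nat_mult[symmetric] mult.commute)
 qed
 then have "(%n. 2 * (th2 - th1) * (C * exp (- c * real n))) \<longlonglongrightarrow> 2 * (th2 - th1) * (C * 0)"
  by (intro tendsto_intros)
 then have "(%n. 2 * (th2 - th1) * (C * exp (- c * real n))) \<longlonglongrightarrow> 0" by simp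
 then have "(%n. J n - 2 * pi * \<i> * H w0) \<longlonglongrightarrow> 0"
  by (rule Lim_null_comparison[rotated]) (use est in \<open>auto simp: eventually_sequentially\<close>)
 then have "J \<longlonglongrightarrow> 2 * pi * \<i> * H w0" by (simp add: LIM_zero_iff)
 then show ?thesis using J by (rule LIMSEQ_unique[rotated])
qed

text \<open>The case of \<open>strip_cauchy\<close> with numerator \<open>F w * (w - w0)\<close>:
  the quotient is \<open>F\<close> itself, and the numerator vanishes at the auxiliary point
  \<open>w0\<close>.\<close>

lemma strip_shift:
 assumes F: "F holomorphic_on {w. a < Im w \<and> Im w < b}"
  and ord: "a < th1" "th1 < th2" "th2 < b" and c: "c > 0"
  and bnd: "!!w. th1 <= Im w ==> Im w <= th2 ==> \<bar>Re w\<bar> >= N ==> norm (F w) <= C * exp (- c * \<bar>Re w\<bar>)"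
 shows "(LINT x|lborel. F (Complex x th1)) = (LINT x|lborel. F (Complex x th2))"
proof -
 define w0 where "w0 = Complex 0 ((th1 + th2) / 2)"
 have [simp]: "Complex x th1 ~= w0" "Complex x th2 ~= w0" for x
  using ord by (auto simp: w0_def complex_eq_iff)
 have "(LINT x|lborel. F (Complex x th1) * (Complex x th1 - w0) / (Complex x th1 - w0)) -
   (LINT x|lborel. F (Complex x th2) * (Complex x th2 - w0) / (Complex x th2 - w0)) = 2 * pi * \<i> * (F w0 * (w0 - w0))"
 proof (rule strip_cauchy[where a = a and b = b and c = c and C = C and N = "max N 1" and H = "%w. F w * (w - w0)"])
  fix w assume "th1 <= Im w" "Im w <= th2" "\<bar>Re w\<bar> >= max N 1"
  moreover from this have "w ~= w0" by (auto simp: w0_def)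
  ultimately show "norm (F w * (w - w0) / (w - w0)) <= C * exp (- c * \<bar>Re w\<bar>)" using bnd[of w] by simp
 qed (use ord c in \<open>auto simp: w0_def intro!: holomorphic_intros F\<close>)
 then show ?thesis by simp
qed

text \<open>To the right the fraction \<open>exp w / (exp w - exp w0)\<close> has norm at most 2 and
  the decay of \<open>k\<close> remains. To the left it is of size \<open>exp (Re w)\<close>, which
  outweighs the growth \<open>exp (- Re w / 2)\<close> allowed for \<open>k\<close>. Distance 1 from
  \<open>Re w0\<close> suffices because \<open>exp (- 1) <= 1/2\<close>.\<close>

lemma cauchy_kernel_bound:
 assumes k: "norm k <= C * exp (- Re w / 2)" and x: "\<bar>Re w\<bar> >= \<bar>Re w0\<bar> + 1"
 shows "norm (k * exp w / (exp w - exp w0)) <= (2 * C * exp \<bar>Re w0\<bar>) * exp (- (1/2) * \<bar>Re w\<bar>)"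
proof -
 have C: "C >= 0" using k by (smt (verit) exp_gt_zero mult_le_cancel_right norm_ge_zero mult_neg_pos)
 have e1: "exp (- 1::real) <= 1/2" using exp_ge_add_one_self[of "1::real"] by (simp add: exp_minus field_simps)
 have low: "\<bar>exp (Re w) - exp (Re w0)\<bar> <= norm (exp w - exp w0)"
  using norm_triangle_ineq3[of "exp w" "exp w0"] by simp
 show ?thesis
 proof (cases "Re w >= 0")
  case True
  then have "Re w0 <= Re w + - 1" using x by linarith
  then have "exp (Re w0) <= exp (Re w) * exp (- 1)" by (subst exp_add[symmetric]) simp
  also have "... <= exp (Re w) * (1/2)" using e1 by (intro mult_left_mono) auto
  finally have h: "exp (Re w) / 2 <= norm (exp w - exp w0)" using low by simp
  have "norm (exp w / (exp w - exp w0)) <= 2"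
   using h by (simp add: norm_divide divide_le_eq)
  then have "norm (k * exp w / (exp w - exp w0)) <= (C * exp (- Re w / 2)) * 2"
   unfolding times_divide_eq_right[symmetric] norm_mult using C k by (intro mult_mono) auto
  also have "... = (2 * C * 1) * exp (- (1/2) * \<bar>Re w\<bar>)" using True by simp
  also have "... <= (2 * C * exp \<bar>Re w0\<bar>) * exp (- (1/2) * \<bar>Re w\<bar>)"
   using C by (intro mult_right_mono mult_left_mono) auto
  finally show ?thesis .
 next
  case False
  then have "Re w <= Re w0 + - 1" using x by linarith
  then have "exp (Re w) <= exp (Re w0) * exp (- 1)" by (subst exp_add[symmetric]) simp
  also have "... <= exp (Re w0) * (1/2)" using e1 by (intro mult_left_mono) auto
  finally have h: "exp (Re w0) / 2 <= norm (exp w - exp w0)" using low by simp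
  have "norm (exp w / (exp w - exp w0)) <= exp (Re w) / (exp (Re w0) / 2)"
  proof -
   have "norm (exp w - exp w0) > 0" using h exp_gt_zero[of "Re w0"] by linarith
   then show ?thesis unfolding norm_divide norm_exp_eq_Re using h by (intro divide_left_mono) auto
  qed
  also have "... = 2 * exp (Re w - Re w0)" by (simp add: exp_diff)
  finally have "norm (k * exp w / (exp w - exp w0)) <= (C * exp (- Re w / 2)) * (2 * exp (Re w - Re w0))"
   unfolding times_divide_eq_right[symmetric] norm_mult using C k by (intro mult_mono) auto
  also have "... = 2 * C * exp (- Re w0) * exp (- (1/2) * \<bar>Re w\<bar>)"
   using False by (simp add: exp_add[symmetric] exp_diff[symmetric] mult_exp_exp)
  also have "... <= (2 * C * exp \<bar>Re w0\<bar>) * exp (- (1/2) * \<bar>Re w\<bar>)"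
   using C by (intro mult_right_mono mult_left_mono) auto
  finally show ?thesis .
 qed
qed

lemma cauchy_kernel_integrable:
 assumes cont: "continuous_on UNIV (%x. k (Complex x t))"
  and bnd: "!!x. norm (k (Complex x t)) <= C * exp (- x / 2)"
  and ne: "!!x. cexp x t ~= exp w0"
 shows "integrable lborel (%x. k (Complex x t) * cexp x t / (cexp x t - exp w0))"
proof (rule integrable_exp_decay[where c = "1/2" and N = "\<bar>Re w0\<bar> + 1" and C = "2 * C * exp \<bar>Re w0\<bar>"])
 show "continuous_on UNIV (%x. k (Complex x t) * cexp x t / (cexp x t - exp w0))"
  using ne by (intro continuous_intros cont) auto
 fix x :: real assume "\<bar>Re w0\<bar> + 1 <= \<bar>x\<bar>"
 then show "norm (k (Complex x t) * cexp x t / (cexp x t - exp w0))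
   <= 2 * C * exp \<bar>Re w0\<bar> * exp (- (1 / 2) * \<bar>x\<bar>)"
  using cauchy_kernel_bound[of "k (Complex x t)" C "Complex x t" w0] bnd[of x] by simp
qed simp

text \<open>For \<lambda> = \<open>exp w\<close> this is the Cauchy kernel of the \<lambda>-plane.
  Written as \<open>H w / (w - w0)\<close> it falls under \<open>strip_cauchy\<close>; the
  difference quotient \<open>d\<close> of the exponential has no zero because the strip has width at
  most \<open>2 * pi\<close>.\<close>

lemma cauchy_exp:
 assumes k: "k holomorphic_on {w. a < Im w \<and> Im w < b}" and ab: "b - a <= 2 * pi"
  and ord: "a < th1" "th1 < Im w0" "Im w0 < th2" "th2 < b"
  and bnd: "!!w. th1 <= Im w ==> Im w <= th2 ==> norm (k w) <= C * exp (- Re w / 2)"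
 shows "(LINT x|lborel. k (Complex x th1) * cexp x th1 / (cexp x th1 - exp w0)) -
   (LINT x|lborel. k (Complex x th2) * cexp x th2 / (cexp x th2 - exp w0)) = 2 * pi * \<i> * k w0"
proof -
 let ?S = "{w. a < Im w \<and> Im w < b}"
 define d where "d w = (if w = w0 then deriv exp w0 else (exp w - exp w0) / (w - w0))" for w
 have "d holomorphic_on UNIV" unfolding d_def by (rule pole_lemma) (auto intro: holomorphic_intros)
 then have dh: "d holomorphic_on ?S" by (rule holomorphic_on_subset) simp
 have d0: "d w ~= 0" if "w \<in> ?S" for w
 proof (cases "w = w0")
  case False
  have "\<bar>Im w - Im w0\<bar> < 2 * pi" unfolding abs_less_iff using that ord ab by auto
  then have "exp w ~= exp w0" using False exp_complex_eqI by blast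
  then show ?thesis using False by (simp add: d_def)
 qed (simp add: d_def DERIV_imp_deriv[OF DERIV_exp])
 define H where "H w = k w * exp w / d w" for w
 have "H holomorphic_on ?S" unfolding H_def using d0 by (intro holomorphic_intros k dh) auto
 moreover have Heq: "H w / (w - w0) = k w * exp w / (exp w - exp w0)" if "w ~= w0" for w
 proof -
  have "x / (y / z) / z = x / y" if "z ~= 0" for x y z :: complex using that by simp
  then show ?thesis using that by (simp add: H_def d_def)
 qed
 moreover have "norm (H w / (w - w0)) <= (2 * C * exp \<bar>Re w0\<bar>) * exp (- (1/2) * \<bar>Re w\<bar>)"
  if "th1 <= Im w" "Im w <= th2" "\<bar>Re w\<bar> >= \<bar>Re w0\<bar> + 1" for w
  using that cauchy_kernel_bound[OF bnd, of w w0] by (subst Heq) auto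
 ultimately have "(LINT x|lborel. H (Complex x th1) / (Complex x th1 - w0)) -
   (LINT x|lborel. H (Complex x th2) / (Complex x th2 - w0)) = 2 * pi * \<i> * H w0"
  using ord by (intro strip_cauchy[where c = "1/2"]) auto
 moreover have "Complex x th1 ~= w0" "Complex x th2 ~= w0" for x using ord by auto
 moreover have "H w0 = k w0" by (simp add: H_def d_def DERIV_imp_deriv[OF DERIV_exp])
 ultimately show ?thesis by (simp add: Heq)
qed

text \<open>No point of the strip is mapped to \<open>exp w0\<close>, so the kernel is holomorphic
  there and the line may be shifted freely.\<close>

lemma cauchy_exp_out:
 assumes k: "k holomorphic_on {w. a < Im w \<and> Im w < b}"
  and ord: "a < th1" "th1 < th2" "th2 < b"
  and bnd: "!!w. th1 <= Im w ==> Im w <= th2 ==> norm (k w) <= C * exp (- Re w / 2)"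
  and ne: "!!w. a < Im w ==> Im w < b ==> exp w ~= exp w0"
 shows "(LINT x|lborel. k (Complex x th1) * cexp x th1 / (cexp x th1 - exp w0)) =
   (LINT x|lborel. k (Complex x th2) * cexp x th2 / (cexp x th2 - exp w0))"
proof (rule strip_shift[where a = a and b = b and c = "1/2" and N = "\<bar>Re w0\<bar> + 1" and C = "2 * C * exp \<bar>Re w0\<bar>"
  and F = "%w. k w * exp w / (exp w - exp w0)"])
 show "(%w. k w * exp w / (exp w - exp w0)) holomorphic_on {w. a < Im w \<and> Im w < b}"
  using ne by (intro holomorphic_intros k) auto
qed (use ord cauchy_kernel_bound[OF bnd] in auto)

section \<open>Fubini's theorem and uniqueness of the Laplace transform\<close>

lemma fubini_dominated:
 fixes F :: "real => real => complex"
 assumes F [measurable]: "(%(x, y). F x y) \<in> borel_measurable (lborel \<Otimes>\<^sub>M lborel)"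
  and g: "integrable lborel g" and h: "integrable lborel h"
  and le: "!!x y. norm (F x y) <= g x * h y"
 shows "(LINT x|lborel. LINT y|lborel. F x y) = (LINT y|lborel. LINT x|lborel. F x y)"
proof -
 have [measurable]: "g \<in> borel_measurable borel" "h \<in> borel_measurable borel" using g h by auto
 have gh: "integrable (lborel \<Otimes>\<^sub>M lborel) (%(x, y). g x * h y)"
 proof (rule lborel_pair.Fubini_integrable)
  have "integrable lborel (%x. \<bar>g x\<bar> * (LINT y|lborel. \<bar>h y\<bar>))" using g by (intro integrable_mult_left integrable_abs)
  then show "integrable lborel (%x. LINT y|lborel. norm (case (x, y) of (x, y) => g x * h y))"
   by (simp add: abs_mult)
 qed (use h in \<open>auto intro!: AE_I2\<close>)
 have "integrable (lborel \<Otimes>\<^sub>M lborel) (%(x, y). F x y)"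
  by (rule integrable_le[OF gh]) (use le in \<open>auto intro!: AE_I2 intro: order_trans[OF _ abs_ge_self]\<close>)
 from lborel_pair.Fubini_integral[OF this] show ?thesis by simp
qed

text \<open>In the variable \<open>u = exp (- t)\<close> the values at positive integers are
  moments. Their vanishing makes \<open>h\<close>, with weight \<open>exp (- t)\<close>, orthogonal
  to all polynomials in \<open>u\<close>, hence by Weierstrass approximation to the continuous
  function \<open>c\<close>, which is \<open>h\<close> times a positive weight. So the square of
  \<open>h\<close> integrates to 0 against a positive weight.\<close>

lemma laplace_unique_real:
 fixes h :: "real => real"
 assumes cont: "continuous_on {0<..} h" and B: "!!t. t > 0 ==> \<bar>h t\<bar> <= B"
  and L: "!!n::nat. n >= 1 ==> (LINT t|leb_pos. exp (- real n * t) * h t) = 0"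
  and t: "t > 0"
 shows "h t = 0"
proof -
 let ?M = "lebesgue_on {0::real<..}"
 have meas: "\<phi> \<in> borel_measurable ?M" if "continuous_on {0<..} \<phi>" for \<phi> :: "real => real"
  using that by (intro continuous_imp_measurable_on_sets_lebesgue) auto
 have B0: "B >= 0" using B[OF t] by linarith
 have inte: "integrable ?M (%t. exp (- real n * t))" if "n >= 1" for n :: nat
 proof -
  have "(%x::real. exp (- real n * x)) absolutely_integrable_on {0..}"
   using has_integral_exp_minus_to_infinity[of "real n" 0] that
   by (intro nonnegative_absolutely_integrable_1) (auto simp: integrable_on_def)
  then have "(%x::real. exp (- real n * x)) absolutely_integrable_on {0<..}"
   by (rule set_integrable_subset) auto
  then show ?thesis by (subst integrable_restrict_space) (auto simp: set_integrable_def)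
 qed
 have intb: "integrable ?M (%t. exp (- real n * t) * \<phi> t)"
  if "n >= 1" "continuous_on {0<..} \<phi>" "!!t. t > 0 ==> \<bar>\<phi> t\<bar> <= K" for n :: nat and \<phi> K
 proof (rule integrable_le)
  show "integrable ?M (%t. K * exp (- real n * t))" using inte[OF that(1)] by simp
  show "(%t. exp (- real n * t) * \<phi> t) \<in> borel_measurable ?M" by (intro meas continuous_intros that)
  show "AE t in ?M. norm (exp (- real n * t) * \<phi> t) <= norm (K * exp (- real n * t))"
   using that(3) by (intro AE_I2) (auto simp: abs_mult mult.commute intro!: mult_left_mono intro: order_trans[OF _ abs_ge_self])
 qed
 \<comment> \<open>\<open>h\<close> need not have limits at 0 or at infinity; the factor
   \<open>u * (1 - u)\<close> makes \<open>c\<close> continuous on \<open>{0..1}\<close> with value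
   0 at both ends.\<close>
 define c where "c u = (if u <= 0 \<or> u >= 1 then 0 else u * (1 - u) * h (- ln u))" for u :: real
 have cexp: "c (exp (- t)) = exp (- t) * (1 - exp (- t)) * h t" if "t > 0" for t
  using that by (simp add: c_def)
 have cle: "\<bar>c u\<bar> <= B * (\<bar>u\<bar> * \<bar>1 - u\<bar>)" for u
 proof (cases "u <= 0 \<or> u >= 1")
  case False
  then have "\<bar>h (- ln u)\<bar> <= B" using ln_less_zero[of u] by (intro B) auto
  then have "\<bar>u * (1 - u)\<bar> * \<bar>h (- ln u)\<bar> <= \<bar>u * (1 - u)\<bar> * B" by (intro mult_left_mono) auto
  then show ?thesis using False by (simp add: c_def abs_mult mult_ac)
 qed (use B0 in \<open>auto simp: c_def\<close>)
 have ccont: "continuous_on {0..1} c"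
  unfolding continuous_on_eq_continuous_within
 proof
  fix u :: real assume u: "u \<in> {0..1}"
  show "continuous (at u within {0..1}) c"
  proof (cases "u = 0 \<or> u = 1")
   case True
   have "((%v. B * (\<bar>v\<bar> * \<bar>1 - v\<bar>)) \<longlongrightarrow> B * (\<bar>u\<bar> * \<bar>1 - u\<bar>)) (at u within {0..1})"
    by (intro tendsto_intros)
   then have "((%v. B * (\<bar>v\<bar> * \<bar>1 - v\<bar>)) \<longlongrightarrow> 0) (at u within {0..1})" using True by auto
   then have "(c \<longlongrightarrow> 0) (at u within {0..1})"
    by (rule Lim_null_comparison[rotated]) (use cle in auto)
   then show ?thesis using True by (auto simp: continuous_within c_def)
  next
   case False
   then have u: "u \<in> {0<..<1}" using u by auto
   have "continuous_on {0<..<1} (%u. u * (1 - u) * h (- ln u))"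
    by (intro continuous_intros continuous_on_compose2[OF cont]) auto
   then have "continuous_on {0<..<1} c"
    by (rule continuous_on_eq) (auto simp: c_def)
   then show ?thesis using u by (simp add: continuous_on_eq_continuous_at continuous_at_imp_continuous_within)
  qed
 qed
 have zero_poly: "(LINT t|?M. exp (- t) * h t * p (exp (- t))) = 0" if pp: "real_polynomial_function p" for p
 proof -
  obtain a n where p: "p = (%x. \<Sum>i\<le>n. a i * x ^ i)" using pp unfolding real_polynomial_function_iff_sum by blast
  have e: "exp (- real (Suc i) * t) = exp (- t) ^ Suc i" for i t
   using exp_of_nat_mult[of "Suc i" "- t"] unfolding mult_minus_left mult_minus_right .
  have "(LINT t|?M. exp (- t) * h t * p (exp (- t))) = (LINT t|?M. (\<Sum>i\<le>n. a i * (exp (- real (Suc i) * t) * h t)))"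
   unfolding p e by (intro LINT_cong) (auto simp: sum_distrib_left mult_ac)
  also have "... = (\<Sum>i\<le>n. LINT t|?M. a i * (exp (- real (Suc i) * t) * h t))"
   by (intro Bochner_Integration.integral_sum integrable_mult_right intb[OF _ cont B]) auto
  also have "... = 0"
  proof (rule sum.neutral, rule ballI)
   fix i
   have "(LINT t|?M. a i * (exp (- real (Suc i) * t) * h t)) = a i * (LINT t|?M. exp (- real (Suc i) * t) * h t)"
    by (rule integral_mult_right_zero)
   then show "(LINT t|?M. a i * (exp (- real (Suc i) * t) * h t)) = 0" using L[of "Suc i"] by simp
  qed
  finally show ?thesis .
 qed
 define \<psi> where "\<psi> t = exp (- t) * h t * c (exp (- t))" for t
 have cpc: "continuous_on {0<..} (%t. c (exp (- t)))"
  by (rule continuous_on_compose2[OF ccont]) (auto intro!: continuous_intros)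
 have psic: "continuous_on {0<..} \<psi>" unfolding \<psi>_def by (intro continuous_intros cont cpc)
 have hc: "continuous_on {0<..} (%t. h t * c (exp (- t)))" by (intro continuous_intros cont cpc)
 obtain K where "\<forall>y\<in>c ` {0..1}. norm y <= K"
  using compact_imp_bounded[OF compact_continuous_image[OF ccont compact_Icc]] unfolding bounded_iff by blast
 then have K: "\<bar>c u\<bar> <= K" if "u \<in> {0..1}" for u using that by auto
 have ep: "exp (- t) \<in> {0..1}" if "t > 0" for t :: real using that by auto
 have intpsi: "integrable ?M \<psi>"
 proof -
  have "\<bar>h t * c (exp (- t))\<bar> <= B * K" if "t > 0" for t
   unfolding abs_mult using B[OF that] K[OF ep[OF that]] B0 by (intro mult_mono) auto
  then have "integrable ?M (%t. exp (- real 1 * t) * (h t * c (exp (- t))))" by (intro intb hc) auto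
  then show ?thesis by (simp add: \<psi>_def[abs_def] mult.assoc)
 qed
 have small: "\<bar>LINT t|?M. \<psi> t\<bar> <= e" if e: "e > 0" for e
 proof -
  define J where "J = (LINT t|?M. exp (- real 1 * t))"
  have J: "J >= 0" unfolding J_def by (intro integral_nonneg_AE) auto
  \<comment> \<open>The final error is \<open>B * J * d\<close>; the summand 1 keeps the denominator
    positive when \<open>B * J\<close> is 0.\<close>
  define d where "d = e / (B * J + 1)"
  have BJ: "B * J >= 0" using B0 J by simp
  then have d: "d > 0" using e by (simp add: d_def)
  obtain p where p: "real_polynomial_function p" "!!u. u \<in> {0..1} ==> \<bar>c u - p u\<bar> < d"
   using Stone_Weierstrass_real_polynomial_function[OF compact_Icc ccont d] by blast
  have pc: "continuous_on {0<..} (%t. p (exp (- t)))"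
  proof (rule continuous_on_compose2[of UNIV p])
   show "continuous_on UNIV p"
    using continuous_real_polymonial_function[OF p(1)] by (simp add: continuous_at_imp_continuous_on)
  qed (auto intro!: continuous_intros)
  have hpc: "continuous_on {0<..} (%t. h t * p (exp (- t)))" by (intro continuous_intros cont pc)
  have intp: "integrable ?M (%t. exp (- t) * h t * p (exp (- t)))"
  proof -
   have "\<bar>p (exp (- t))\<bar> <= K + d" if "t > 0" for t
    using p(2)[OF ep[OF that]] K[OF ep[OF that]] by linarith
   then have "\<bar>h t * p (exp (- t))\<bar> <= B * (K + d)" if "t > 0" for t
    unfolding abs_mult using B[OF that] B0 that by (intro mult_mono) auto
   then have "integrable ?M (%t. exp (- real 1 * t) * (h t * p (exp (- t))))" by (intro intb hpc) auto
   then show ?thesis by (simp add: mult.assoc)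
  qed
  have "(LINT t|?M. \<psi> t) = (LINT t|?M. \<psi> t) - (LINT t|?M. exp (- t) * h t * p (exp (- t)))"
   using zero_poly[OF p(1)] by simp
  also have "... = (LINT t|?M. \<psi> t - exp (- t) * h t * p (exp (- t)))"
   by (intro LINT_diff[symmetric] intpsi intp)
  also have "\<bar>...\<bar> <= (LINT t|?M. (B * d) * exp (- real 1 * t))"
  proof (rule integral_abs_bound_integral)
   show "integrable ?M (%t. (B * d) * exp (- real 1 * t))" using inte[of 1] by simp
   fix t assume "t \<in> space ?M"
   then have t: "t > 0" by simp
   have "\<psi> t - exp (- t) * h t * p (exp (- t)) = exp (- t) * (h t * (c (exp (- t)) - p (exp (- t))))"
    by (simp add: \<psi>_def algebra_simps)
   also have "\<bar>...\<bar> <= exp (- t) * (B * d)"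
    using B[OF t] p(2)[OF ep[OF t]] B0 by (auto simp: abs_mult intro!: mult_left_mono mult_mono)
   finally show "\<bar>\<psi> t - exp (- t) * h t * p (exp (- t))\<bar> <= (B * d) * exp (- real 1 * t)" by (simp add: mult_ac)
  qed (intro integrable_sub intpsi intp)
  also have "... = (B * d) * (LINT t|?M. exp (- real 1 * t))" by (rule integral_mult_right_zero)
  also have "... = e * (B * J / (B * J + 1))" by (simp add: J_def d_def mult_ac)
  also have "... <= e * 1" using BJ e by (intro mult_left_mono) auto
  also have "e * 1 = e" by simp
  finally show ?thesis .
 qed
 have psi0: "(LINT t|?M. \<psi> t) = 0"
 proof (rule ccontr)
  assume "(LINT t|?M. \<psi> t) ~= 0"
  then have "\<bar>LINT t|?M. \<psi> t\<bar> > 0" by linarith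
  then show False using small[of "\<bar>LINT t|?M. \<psi> t\<bar> / 2"] by linarith
 qed
 have psieq: "\<psi> t = exp (- t) * (exp (- t) * (1 - exp (- t))) * (h t)\<^sup>2" if "t > 0" for t
  using cexp[OF that] by (simp add: \<psi>_def power2_eq_square)
 have "AE t in ?M. 0 <= \<psi> t"
  by (rule AE_I2) (simp add: psieq)
 then have "AE t in ?M. \<psi> t = 0" using psi0 integral_nonneg_eq_0_iff_AE[OF intpsi] by blast
 then have "AE t in lebesgue. t \<in> {0<..} --> \<psi> t = 0" by (subst (asm) AE_restrict_space_iff) auto
 then have neg: "negligible {t. \<not> (t \<in> {0<..} --> \<psi> t = 0)}"
 proof -
  from \<open>AE t in lebesgue. t \<in> {0<..} --> \<psi> t = 0\<close>
  obtain N where "N \<in> null_sets lebesgue" "{t. \<not> (t \<in> {0<..} --> \<psi> t = 0)} \<subseteq> N"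
   by (auto simp: eventually_ae_filter)
  then show ?thesis by (metis negligible_iff_null_sets negligible_subset)
 qed
 have "open ({0<..} \<inter> \<psi> -` (- {0}))" by (intro continuous_open_preimage psic) auto
 moreover have "{0<..} \<inter> \<psi> -` (- {0}) = {t. \<not> (t \<in> {0<..} --> \<psi> t = 0)}" by auto
 ultimately have "{t. \<not> (t \<in> {0<..} --> \<psi> t = 0)} = {}" using neg open_not_negligible by metis
 then have "\<psi> t = 0" using t by auto
 then show ?thesis using psieq[OF t] t by auto
qed

section \<open>A sectorial functional calculus in logarithmic coordinates\<close>

text \<open>The squared norm on the right equals \<open>(1 - q)^2 + 4 * q * cos (y / 2)^2\<close>,
  so cancellation in the sum costs no more than the factor \<open>cos (y / 2)\<close>.\<close>

lemma cos_half_bound: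
 assumes "q >= 0"
 shows "\<bar>cos (y / 2)\<bar> * (1 + q) <= norm (1 + of_real q * cis y)"
proof -
 have cy: "cos y = 2 * (cos (y / 2))\<^sup>2 - 1" using cos_double_cos[of "y / 2"] by simp
 have "(norm (1 + of_real q * cis y))\<^sup>2 = (1 + q * cos y)\<^sup>2 + (q * sin y)\<^sup>2"
  by (simp add: cmod_power2)
 also have "... = 1 + 2 * q * cos y + q\<^sup>2 * ((cos y)\<^sup>2 + (sin y)\<^sup>2)"
  by algebra
 also have "... = 1 + 2 * q * cos y + q\<^sup>2" by simp
 also have "... = (1 - q)\<^sup>2 + 4 * q * (cos (y / 2))\<^sup>2"
  unfolding cy by (simp add: power2_eq_square algebra_simps)
 finally have eq: "(norm (1 + of_real q * cis y))\<^sup>2 = (1 - q)\<^sup>2 + 4 * q * (cos (y / 2))\<^sup>2" .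
 have "(\<bar>cos (y / 2)\<bar> * (1 + q))\<^sup>2 = (cos (y / 2))\<^sup>2 * (1 - q)\<^sup>2 + 4 * q * (cos (y / 2))\<^sup>2"
  by (simp add: power_mult_distrib power2_eq_square algebra_simps)
 also have "... <= 1 * (1 - q)\<^sup>2 + 4 * q * (cos (y / 2))\<^sup>2"
  by (intro add_right_mono mult_right_mono) (auto simp: abs_square_le_1)
 finally have "(\<bar>cos (y / 2)\<bar> * (1 + q))\<^sup>2 <= (norm (1 + of_real q * cis y))\<^sup>2" using eq by simp
 then show ?thesis by (rule power2_le_imp_le) simp
qed

text \<open>\<open>cos_half_bound\<close> after a rotation by \<open>pi\<close>. Points on two rays
  at different angles stay apart by a fixed multiple of the sum of their moduli.\<close>

lemma exp_diff_sin_bound: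
 "\<bar>sin ((Im u - Im v) / 2)\<bar> * (exp (Re u) + exp (Re v)) <= norm (exp u - exp v)"
proof -
 have "exp u - exp v = - exp v * (1 + of_real (exp (Re u - Re v)) * cis (Im u - Im v + pi))"
  by (simp add: exp_eq_polar[of u] exp_eq_polar[of v] exp_diff algebra_simps of_real_divide
    cis_mult[symmetric] cis_divide[symmetric] flip: exp_of_real) 
 then have "norm (exp u - exp v) = exp (Re v) * norm (1 + of_real (exp (Re u - Re v)) * cis (Im u - Im v + pi))"
  by (simp add: norm_mult)
 moreover have "\<bar>cos ((Im u - Im v + pi) / 2)\<bar> * (1 + exp (Re u - Re v)) <= norm (1 + of_real (exp (Re u - Re v)) * cis (Im u - Im v + pi))"
  by (rule cos_half_bound) simp
 moreover have "cos ((Im u - Im v + pi) / 2) = - sin ((Im u - Im v) / 2)"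
  using sin_cos_eq[of "- ((Im u - Im v) / 2)"] by (simp add: add_divide_distrib add.commute)
 ultimately have "exp (Re v) * (\<bar>sin ((Im u - Im v) / 2)\<bar> * (1 + exp (Re u - Re v))) <= norm (exp u - exp v)"
  by (metis abs_minus_cancel exp_ge_zero mult_left_mono)
 then show ?thesis by (simp add: exp_diff algebra_simps)
qed

text \<open>The source of convergence along a ray: \<open>\<lambda>^(1/2) / (s + \<lambda>)\<close>
  decays with order 1/2 at both ends.\<close>

lemma exp_half_le:
 fixes s x :: real
 assumes s: "s > 0"
 shows "exp (x / 2) / (s + exp x) <= max 1 (1 / s) * exp (- (1/2) * \<bar>x\<bar>)"
proof -
 show ?thesis
 proof (cases "x >= 0")
  case True
  have "exp (x / 2) / (s + exp x) <= exp (x / 2) / exp x" using s by (intro divide_left_mono) (auto simp: add_pos_pos)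
  also have "... = 1 * exp (- (1/2) * \<bar>x\<bar>)" using True by (simp flip: exp_diff)
  also have "... <= max 1 (1 / s) * exp (- (1/2) * \<bar>x\<bar>)" by (intro mult_right_mono) auto
  finally show ?thesis .
 next
  case False
  have "exp (x / 2) / (s + exp x) <= exp (x / 2) / s" using s by (intro divide_left_mono) (auto simp: add_pos_pos)
  also have "... = (1 / s) * exp (- (1/2) * \<bar>x\<bar>)" using False by simp
  also have "... <= max 1 (1 / s) * exp (- (1/2) * \<bar>x\<bar>)" by (intro mult_right_mono) auto
  finally show ?thesis .
 qed
qed

text \<open>The vanishing half of the product formula for contour integrals. The contours have
  angles \<open>th < th'\<close>, and \<open>f\<close> runs over the inner one while the pole lies
  on the outer one. Fubini puts the integration of \<open>f\<close> inside, where Cauchy's theorem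
  gives 0.\<close>

lemma cauchy_swap_zero:
 fixes p1 p2 :: "real => complex"
 assumes ang: "0 < th" "th < th'" "th' < pi" and f: "f holomorphic_on {w. \<bar>Im w\<bar> < th'}"
  and fb: "!!w. \<bar>Im w\<bar> <= th ==> norm (f w) <= c * exp (- Re w / 2)" and s: "s > 0"
  and p: "continuous_on UNIV p1" "continuous_on UNIV p2"
  and pb: "!!y. norm (p1 y) <= B * (exp y / (s + exp y))" "!!y. norm (p2 y) <= B * (exp y / (s + exp y))"
 defines "Q \<equiv> %v. LINT y|lborel. p1 y / (cexp y (- th') - exp v) - p2 y / (cexp y th' - exp v)"
 shows "(LINT x|lborel. f (Complex x (- th)) * cexp x (- th) * Q (Complex x (- th))
   - f (Complex x th) * cexp x th * Q (Complex x th)) = 0"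
proof -
 \<comment> \<open>Up to sign, half the angle between an inner and an outer ray is one of these two
   numbers, and both sines are positive.\<close>
 define d where "d = min (sin ((th' - th) / 2)) (sin ((th' + th) / 2))"
 have d: "d > 0" unfolding d_def using ang by (auto intro!: sin_gt_zero)
 have far: "d * (exp x + exp y) <= norm (cexp y t' - cexp x t)"
  if "ray th t" "ray th' t'" for x y t t'
 proof -
  have "d <= \<bar>sin ((t' - t) / 2)\<bar>"
  proof -
   have "\<bar>sin (- ((th' + th) / 2))\<bar> = \<bar>sin ((th' + th) / 2)\<bar>" "\<bar>sin (- ((th' - th) / 2))\<bar> = \<bar>sin ((th' - th) / 2)\<bar>"
    unfolding sin_minus by simp_all
   moreover have "- ((th' + th) / 2) = (- th' - th) / 2" "- ((th' - th) / 2) = (- th' + th) / 2" by (simp_all add: minus_divide_left)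
   ultimately show ?thesis using that unfolding d_def by auto
  qed
  then have "d * (exp x + exp y) <= \<bar>sin ((t' - t) / 2)\<bar> * (exp y + exp x)"
   unfolding add.commute[of "exp x"] by (intro mult_right_mono) auto
  also have "... <= norm (cexp y t' - cexp x t)"
   using exp_diff_sin_bound[of "Complex y t'" "Complex x t"] by simp
  finally show ?thesis .
 qed
 have ne: "cexp y t' - cexp x t ~= 0"
  if "ray th t" "ray th' t'" for x y t t'
 proof -
  have "d * (exp x + exp y) > 0" using d by (simp add: add_pos_pos)
  then show ?thesis using far[OF that, of x y] by auto
 qed
 define k where "k t x = f (Complex x t) * cexp x t" for t x
 define E where "E t t' x y = cexp y t' - cexp x t" for t t' x y
 define K where "K x y = k (- th) x * (p1 y / E (- th) (- th') x y - p2 y / E (- th) th' x y)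
   - k th x * (p1 y / E th (- th') x y - p2 y / E th th' x y)" for x y
 have E0: "E t t' x y ~= 0" if "ray th t" "ray th' t'" for x y t t'
  unfolding E_def by (rule ne[OF that])
 have fc: "continuous_on {w. \<bar>Im w\<bar> < th'} f" by (rule holomorphic_on_imp_continuous_on[OF f])
 have kc: "continuous_on UNIV (k t)" if "ray th t" for t
  unfolding k_def using that ang
  by (intro continuous_intros continuous_on_compose2[OF fc]) auto
 have c0: "c >= 0" using fb[of 0] ang by (smt (verit) exp_gt_zero norm_ge_zero zero_le_mult_iff zero_complex.simps)
 have B0: "B >= 0"
 proof -
  have "0 <= B * (exp 0 / (s + exp 0))" using pb(1)[of 0] norm_ge_zero order_trans by blast
  then show ?thesis using s by (simp add: zero_le_mult_iff zero_le_divide_iff)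
 qed
 define A where "A = c * B / d"
 have A0: "A >= 0" using c0 B0 d by (simp add: A_def)
 \<comment> \<open>A product of a function of \<open>x\<close> and a function of \<open>y\<close>,
   as Fubini requires. The estimate first gives decay in \<open>y\<close> and in
   \<open>x - y\<close>; the triangle inequality trades part of it for decay in \<open>x\<close>,
   which lowers the rate from 1/2 to 1/4.\<close>
 define g where "g x y = A * max 1 (1 / s) * (exp (- (1/4) * \<bar>x\<bar>) * exp (- (1/4) * \<bar>y\<bar>))" for x y :: real
 have term_bound: "norm (k t x * (pp / E t t' x y)) <= g x y"
  if t: "ray th t" "ray th' t'" and pp: "norm pp <= B * (exp y / (s + exp y))" for x y t t' pp
 proof -
  have ft: "norm (f (Complex x t)) <= c * exp (- x / 2)" using fb[of "Complex x t"] t ang by auto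
  have "norm (k t x) = norm (f (Complex x t)) * exp x" by (simp add: k_def norm_mult)
  also have "... <= c * exp (- x / 2) * exp x" using ft by (intro mult_right_mono) auto
  also have "... = c * exp (x / 2)" by (simp add: mult.assoc flip: exp_add)
  finally have kb: "norm (k t x) <= c * exp (x / 2)" .
  have Eb: "d * (exp x + exp y) <= norm (E t t' x y)" unfolding E_def by (rule far[OF t])
  have pos: "d * (exp x + exp y) > 0" using d by (simp add: add_pos_pos)
  have "norm (pp / E t t' x y) <= (B * (exp y / (s + exp y))) / (d * (exp x + exp y))"
   unfolding norm_divide using pp Eb pos s by (intro frac_le) (auto intro: order_trans[OF norm_ge_zero])
  then have "norm (k t x * (pp / E t t' x y)) <= c * exp (x / 2) * ((B * (exp y / (s + exp y))) / (d * (exp x + exp y)))"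
   unfolding norm_mult using kb c0 by (intro mult_mono) auto
  also have "... = A * (exp (y / 2) / (s + exp y)) * (exp (y / 2) * exp (x / 2) / (exp x + exp y))"
  proof -
   have "exp y = exp (y / 2) * exp (y / 2)" by (simp flip: exp_add)
   then have "c * a * ((B * (exp y / S)) / (d * T)) = A * (exp (y / 2) / S) * (exp (y / 2) * a / T)" for a S T :: real
    by (simp add: A_def mult_ac)
   then show ?thesis .
  qed
  also have "... <= A * (max 1 (1 / s) * exp (- (1/2) * \<bar>y\<bar>)) * exp (- (1/2) * \<bar>x - y\<bar>)"
  proof (intro mult_mono mult_left_mono)
   show "exp (y / 2) / (s + exp y) <= max 1 (1 / s) * exp (- (1/2) * \<bar>y\<bar>)" by (rule exp_half_le[OF s])
   have "exp ((x - y) / 2) / (1 + exp (x - y)) <= exp (- (1/2) * \<bar>x - y\<bar>)" using exp_half_le[of 1 "x - y"] by simp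
   moreover have "exp ((x - y) / 2) / (1 + exp (x - y)) = exp (y / 2) * exp (x / 2) / (exp x + exp y)"
   proof -
    have "exp ((x - y) / 2) = exp (x / 2) * exp (y / 2) / exp y"
     by (simp add: diff_divide_distrib exp_diff) (simp flip: exp_add exp_diff)
    then show ?thesis by (simp add: exp_diff field_simps)
   qed
   ultimately show "exp (y / 2) * exp (x / 2) / (exp x + exp y) <= exp (- (1/2) * \<bar>x - y\<bar>)" by simp
  qed (use A0 s in \<open>auto intro!: divide_nonneg_pos add_pos_pos\<close>)
  also have "... <= g x y"
  proof -
   have "exp (- (1/2) * \<bar>y\<bar>) * exp (- (1/2) * \<bar>x - y\<bar>) <= exp (- (1/4) * \<bar>x\<bar>) * exp (- (1/4) * \<bar>y\<bar>)"
    unfolding exp_add[symmetric] exp_le_cancel_iff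
    using abs_triangle_ineq[of "x - y" y] abs_ge_zero[of "x - y"] unfolding diff_add_cancel by argo
   then have "A * max 1 (1 / s) * (exp (- (1/2) * \<bar>y\<bar>) * exp (- (1/2) * \<bar>x - y\<bar>)) <= g x y"
    unfolding g_def using A0 by (intro mult_left_mono) auto
   then show ?thesis by (simp add: mult.assoc)
  qed
  finally show ?thesis .
 qed
 have Kb: "norm (K x y) <= 4 * g x y" for x y
 proof -
  have "K x y = (k (- th) x * (p1 y / E (- th) (- th') x y) - k (- th) x * (p2 y / E (- th) th' x y))
   - (k th x * (p1 y / E th (- th') x y) - k th x * (p2 y / E th th' x y))"
   by (simp add: K_def right_diff_distrib)
  also have "norm ... <= (norm (k (- th) x * (p1 y / E (- th) (- th') x y)) + norm (k (- th) x * (p2 y / E (- th) th' x y)))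
   + (norm (k th x * (p1 y / E th (- th') x y)) + norm (k th x * (p2 y / E th th' x y)))"
   by (intro order_trans[OF norm_triangle_ineq4] add_mono order_refl)
  also have "... <= (g x y + g x y) + (g x y + g x y)" by (intro add_mono term_bound pb) auto
  finally show ?thesis by simp
 qed
 have Kc: "continuous_on UNIV (%(x, y). K x y)"
 proof -
  have "continuous_on UNIV (%z. K (fst z) (snd z))"
   unfolding K_def E_def
   by (intro continuous_intros continuous_on_compose2[OF kc] continuous_on_compose2[OF p(1)] continuous_on_compose2[OF p(2)] ballI ne) auto
  then show ?thesis by (simp add: case_prod_beta)
 qed
 have gi: "integrable lborel (%x. 4 * (A * max 1 (1 / s)) * exp (- (1/4) * \<bar>x\<bar>))" "integrable lborel (%y::real. exp (- (1/4) * \<bar>y\<bar>))"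
  by (intro integrable_mult_right integrable_exp_abs; simp)+
 have swap: "(LINT x|lborel. LINT y|lborel. K x y) = (LINT y|lborel. LINT x|lborel. K x y)"
 proof (rule fubini_dominated[OF _ gi])
  show "(%(x, y). K x y) \<in> borel_measurable (lborel \<Otimes>\<^sub>M lborel)"
   using borel_measurable_continuous_onI[OF Kc] by (simp add: lborel_prod)
  show "norm (K x y) <= 4 * (A * max 1 (1 / s)) * exp (- (1/4) * \<bar>x\<bar>) * exp (- (1/4) * \<bar>y\<bar>)" for x y
   using Kb[of x y] unfolding g_def by (simp add: mult_ac)
 qed
 have inner_y: "integrable lborel (%y. p1 y / E t (- th') x y - p2 y / E t th' x y)" if t: "ray th t" for t x
 proof -
  have 1: "integrable lborel (%y. pp y / E t t' x y)"
   if t': "ray th' t'" and pp: "continuous_on UNIV pp" "!!y. norm (pp y) <= B * (exp y / (s + exp y))" for pp t'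
  proof (rule integrable_exp_decay[where c = 1 and N = 0 and C = "max 1 (1/s) * B / d * exp (- x) + B / d"])
   show "continuous_on UNIV (%y. pp y / E t t' x y)"
    unfolding E_def using ne[OF t t'] by (intro continuous_intros pp) auto
   fix y :: real
   show "norm (pp y / E t t' x y) <= (max 1 (1/s) * B / d * exp (- x) + B / d) * exp (- 1 * \<bar>y\<bar>)"
   proof -
    have sp: "s + exp y > 0" using s by (simp add: add_pos_pos)
    have Eb: "d * (exp x + exp y) <= norm (E t t' x y)" unfolding E_def by (rule far[OF t t'])
    have pos: "d * (exp x + exp y) > 0" using d by (simp add: add_pos_pos)
    have le: "norm (pp y / E t t' x y) <= (B * (exp y / (s + exp y))) / (d * (exp x + exp y))"
     unfolding norm_divide using pp(2)[of y] Eb pos s by (intro frac_le) (auto intro: order_trans[OF norm_ge_zero])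
    show ?thesis
    proof (cases "y >= 0")
     case True
     have "(B * (exp y / (s + exp y))) / (d * (exp x + exp y)) <= (B * 1) / (d * exp y)"
      using B0 d s sp by (intro frac_le mult_left_mono) (auto simp: divide_le_eq)
     also have "... = (B / d) * exp (- 1 * \<bar>y\<bar>)" using True by (simp add: exp_minus divide_inverse mult_ac)
     also have "... <= (max 1 (1/s) * B / d * exp (- x) + B / d) * exp (- 1 * \<bar>y\<bar>)"
      using B0 d by (intro mult_right_mono) (auto intro!: mult_nonneg_nonneg divide_nonneg_pos)
     finally show ?thesis using le by simp
    next
     case False
     have "(B * (exp y / (s + exp y))) / (d * (exp x + exp y)) <= (B * (exp y / s)) / (d * exp x)"
      using B0 d s sp by (intro frac_le mult_left_mono divide_left_mono) auto
     also have "... = ((1/s) * B / d * exp (- x)) * exp (- 1 * \<bar>y\<bar>)"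
      using False by (simp add: exp_minus divide_inverse mult_ac)
     also have "... <= (max 1 (1/s) * B / d * exp (- x) + B / d) * exp (- 1 * \<bar>y\<bar>)"
      using B0 d by (intro mult_right_mono add_increasing2 divide_nonneg_pos divide_right_mono) auto
     finally show ?thesis using le by simp
    qed
   qed
  qed simp
  show ?thesis by (intro integrable_sub 1 p pb) auto
 qed
 have "(LINT x|lborel. f (Complex x (- th)) * cexp x (- th) * Q (Complex x (- th))
   - f (Complex x th) * cexp x th * Q (Complex x th)) = (LINT x|lborel. LINT y|lborel. K x y)"
 proof (rule LINT_cong[OF refl])
  fix x
  have Qe: "Q (Complex x t) = (LINT y|lborel. p1 y / E t (- th') x y - p2 y / E t th' x y)" for t
   unfolding Q_def E_def ..
  have "(LINT y|lborel. K x y) = k (- th) x * Q (Complex x (- th)) - k th x * Q (Complex x th)"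
   unfolding K_def Qe using inner_y[of "- th" x] inner_y[of th x]
   by (subst LINT_diff) auto
  then show "f (Complex x (- th)) * cexp x (- th) * Q (Complex x (- th))
   - f (Complex x th) * cexp x th * Q (Complex x th) = (LINT y|lborel. K x y)" by (simp add: k_def)
 qed
 also have "... = (LINT y|lborel. LINT x|lborel. K x y)" by (rule swap)
 also have "... = (LINT y::real|lborel. 0)"
 proof (rule LINT_cong[OF refl])
  fix y
  have int: "integrable lborel (%x. k t x / E t t' x y)" if t: "ray th t" "ray th' t'" for t t'
  proof -
   have "integrable lborel (%x. f (Complex x t) * cexp x t / (cexp x t - cexp y t'))"
   proof (rule cauchy_kernel_integrable)
    show "continuous_on UNIV (%x. f (Complex x t))"
     using t ang by (intro continuous_on_compose2[OF fc] continuous_intros) auto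
    show "norm (f (Complex x t)) <= c * exp (- x / 2)" for x using fb[of "Complex x t"] t ang by auto
    show "cexp x t ~= cexp y t'" for x using ne[OF t, of y x] by auto
   qed
   then have "integrable lborel (%x. - (f (Complex x t) * cexp x t / (cexp x t - cexp y t')))"
    by simp
   then show ?thesis
    by (simp add: k_def E_def minus_divide_right del: minus_divide_left[symmetric])
  qed
  have zero: "(LINT x|lborel. k (- th) x / E (- th) t' x y - k th x / E th t' x y) = 0" if t': "ray th' t'" for t'
  proof -
   have "(LINT x|lborel. f (Complex x (-th)) * cexp x (-th) / (cexp x (-th) - cexp y t')) =
     (LINT x|lborel. f (Complex x th) * cexp x th / (cexp x th - cexp y t'))"
   proof (rule cauchy_exp_out[where a = "- th'" and b = th' and C = c])
    show "f holomorphic_on {w. - th' < Im w \<and> Im w < th'}" using f by (rule holomorphic_on_subset) auto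
    show "norm (f w) <= c * exp (- Re w / 2)" if "- th <= Im w" "Im w <= th" for w using fb[of w] that by auto
    show "exp w ~= cexp y t'" if "- th' < Im w" "Im w < th'" for w
    proof
     assume eq: "exp w = cexp y t'"
     have "\<bar>Im w - t'\<bar> < 2 * pi" using that t' ang unfolding abs_less_iff by linarith
     then have "w = Complex y t'" using exp_complex_eqI[of w "Complex y t'"] eq by simp
     then show False using that t' by auto
    qed
   qed (use ang in auto)
   moreover have "k t x / E t t' x y = - (f (Complex x t) * cexp x t / (cexp x t - cexp y t'))" for t x
    by (simp add: k_def E_def minus_divide_right del: minus_divide_left[symmetric])
   ultimately have "(LINT x|lborel. k (- th) x / E (- th) t' x y) = (LINT x|lborel. k th x / E th t' x y)" by simp
   then show ?thesis using int t' by (subst LINT_diff) auto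
  qed
  have "(LINT x|lborel. K x y) = (LINT x|lborel. p1 y * (k (- th) x / E (- th) (- th') x y - k th x / E th (- th') x y)
    - p2 y * (k (- th) x / E (- th) th' x y - k th x / E th th' x y))"
   by (intro LINT_cong) (auto simp: K_def algebra_simps)
  also have "... = p1 y * (LINT x|lborel. k (- th) x / E (- th) (- th') x y - k th x / E th (- th') x y)
    - p2 y * (LINT x|lborel. k (- th) x / E (- th) th' x y - k th x / E th th' x y)"
   using int by (subst LINT_diff) auto
  finally show "(LINT x|lborel. K x y) = 0" using zero by simp
 qed
 finally show ?thesis by simp
qed

section \<open>Vector-valued contour integrals along two rays\<close>

lemma bounded_bilinear_scaleC: "bounded_bilinear (%c (x::'a::complex_normed_vector). c *\<^sub>C x)"
proof
 fix c d :: complex and r :: real and x y :: 'a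
 show "(c + d) *\<^sub>C x = c *\<^sub>C x + d *\<^sub>C x" by (rule scaleC_add_left)
 show "c *\<^sub>C (x + y) = c *\<^sub>C x + c *\<^sub>C y" by (rule scaleC_add_right)
 show "(r *\<^sub>R c) *\<^sub>C x = r *\<^sub>R c *\<^sub>C x" "c *\<^sub>C r *\<^sub>R x = r *\<^sub>R c *\<^sub>C x"
  by (metis scaleR_conv_of_real scaleC_of_real scaleC_scaleC mult.commute)+
 show "\<exists>K. \<forall>c (x::'a). norm (c *\<^sub>C x) <= norm c * norm x * K"
  by (intro exI[of _ 1]) (simp add: norm_scaleC)
qed

lemmas continuous_on_scaleC [continuous_intros] = bounded_bilinear.continuous_on[OF bounded_bilinear_scaleC]
lemmas tendsto_scaleC [tendsto_intros] = bounded_bilinear.tendsto[OF bounded_bilinear_scaleC]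
lemmas has_derivative_scaleC = bounded_bilinear.FDERIV[OF bounded_bilinear_scaleC]
lemmas bounded_linear_scaleC_left = bounded_bilinear.bounded_linear_left[OF bounded_bilinear_scaleC]

lemma scaleC_blinfun_compose [simp]: "(c *\<^sub>C S) o\<^sub>L T = c *\<^sub>C (S o\<^sub>L T)"
 by (rule blinfun_eqI) (simp add: scaleC_blinfun.rep_eq)

lemma cblinfuns_compose_scaleC: "S \<in> cblinfuns ==> S o\<^sub>L (c *\<^sub>C T) = c *\<^sub>C (S o\<^sub>L T)"
 by (rule blinfun_eqI) (simp add: scaleC_blinfun.rep_eq cblinfuns_def)

lemma bounded_linear_compose_left: "bounded_linear (%T. T o\<^sub>L G)"
 and bounded_linear_compose_right: "bounded_linear (%T. G o\<^sub>L T)"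
 using bounded_bilinear.bounded_linear_left[OF bounded_bilinear_blinfun_compose]
  bounded_bilinear.bounded_linear_right[OF bounded_bilinear_blinfun_compose] by auto

lemma cfunctional_compose_left:
 assumes "cfunctional m" shows "cfunctional (%T. m (T o\<^sub>L G))"
 using assms bounded_linear_compose[OF cfunctionalD(1)[OF assms] bounded_linear_compose_left]
 by (auto simp: cfunctional_def)

lemma cfunctional_compose_right:
 assumes "cfunctional m" "G \<in> cblinfuns" shows "cfunctional (%T. m (G o\<^sub>L T))"
 using assms bounded_linear_compose[OF cfunctionalD(1)[OF assms(1)] bounded_linear_compose_right]
 by (auto simp: cfunctional_def cblinfuns_compose_scaleC)

definition fc_integrand ::
  "(complex => 'b::complex_normed_vector) => real => (complex => complex) => real => 'b" where
 "fc_integrand R th f x = (1 / (2 * of_real pi * \<i>)) *\<^sub>C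
  ((f (Complex x (- th)) * cexp x (- th)) *\<^sub>C R (cexp x (- th)) -
   (f (Complex x th) * cexp x th) *\<^sub>C R (cexp x th))"

text \<open>This is \<open>(2\<pi>i)\<^sup>-\<^sup>1 \<integral> f(log \<lambda>) R(\<lambda>) d\<lambda>\<close> over the boundary of the sector of half-angle
 \<open>th\<close>, with \<open>\<lambda> = e\<^sup>w\<close>. In the coordinate \<open>w\<close> the square root is \<open>e\<^sup>w\<^sup>/\<^sup>2\<close> and rotating
 the contour becomes shifting a line in a strip.\<close>

definition fc :: "(complex => 'b::complex_normed_vector) => real => (complex => complex) => 'b" where
 "fc R th f = bochner lborel (fc_integrand R th f)"

lemma fc_integrand_continuous:
 assumes "!!t. ray th t ==> continuous_on UNIV (%x. R (cexp x t))"
  and "!!t. ray th t ==> continuous_on UNIV (%x. f (Complex x t))"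
 shows "continuous_on UNIV (fc_integrand R th f)"
 unfolding fc_integrand_def by (intro continuous_intros assms) auto

lemma norm_fc_integrand_le:
 assumes R: "!!t. ray th t ==> norm (R (cexp x t)) <= b"
  and f: "!!t. ray th t ==> norm (f (Complex x t)) <= a"
 shows "norm (fc_integrand R th f x) <= (1 / pi) * (a * exp x * b)"
proof -
 have nn: "0 <= a" "0 <= b"
  using f[of th] R[of th] norm_ge_zero order_trans by blast+
 have t: "norm ((f (Complex x t) * cexp x t) *\<^sub>C R (cexp x t)) <= a * exp x * b"
  if "ray th t" for t
  unfolding norm_scaleC norm_mult norm_exp_eq_Re complex.sel
  using R[OF that] f[OF that] nn by (intro mult_mono mult_right_mono) auto
 have "norm (fc_integrand R th f x) = (1 / (2 * pi)) * norm
  ((f (Complex x (- th)) * cexp x (- th)) *\<^sub>C R (cexp x (- th)) -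
   (f (Complex x th) * cexp x th) *\<^sub>C R (cexp x th))"
  unfolding fc_integrand_def norm_scaleC by (simp add: norm_divide norm_mult)
 also have "... <= (1 / (2 * pi)) * (a * exp x * b + a * exp x * b)"
  by (intro mult_left_mono order_trans[OF norm_triangle_ineq4] add_mono t) auto
 also have "... = (1 / pi) * (a * exp x * b)" by (simp add: field_simps)
 finally show ?thesis .
qed

lemma fc_bound:
 fixes R :: "complex => 'b::complex_banach"
 assumes Rc: "!!t. ray th t ==> continuous_on UNIV (%x. R (cexp x t))"
  and fc: "!!t. ray th t ==> continuous_on UNIV (%x. f (Complex x t))"
  and R: "!!x t. ray th t ==> norm (R (cexp x t)) <= b x"
  and f: "!!x t. ray th t ==> norm (f (Complex x t)) <= a x"
  and int: "integrable lborel (%x. a x * exp x * b x)"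
 shows "bochner_integrable lborel (fc_integrand R th f)"
  "norm (fc R th f) <= (1 / pi) * (LINT x|lborel. a x * exp x * b x)"
proof -
 have int': "integrable lborel (%x. (1 / pi) * (a x * exp x * b x))" using int by (rule integrable_mult_right)
 have le: "norm (fc_integrand R th f x) <= (1 / pi) * (a x * exp x * b x)" for x
  by (intro norm_fc_integrand_le R f)
 show bi: "bochner_integrable lborel (fc_integrand R th f)"
  by (rule bochner_integrable_continuous_lborel[OF fc_integrand_continuous[OF Rc fc] int' le])
 show "norm (fc R th f) <= (1 / pi) * (LINT x|lborel. a x * exp x * b x)"
  unfolding fc_def integral_mult_right_zero[symmetric] using le by (intro bochner_norm_le bi int') auto
qed

text \<open>In terms of \<lambda> = \<open>exp w\<close> the bound is
  \<open>|\<lambda>|^(-1/2)\<close>. Against a resolvent bounded by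
  \<open>C / (s + |\<lambda>|)\<close> this is integrable at both ends of a ray, and the class
  contains the inverse square root itself; the blow-up at 0 is paid for by the positive
  \<open>s\<close>.\<close>

definition decays :: "real => (complex => complex) => bool" where
 "decays \<psi> f \<longleftrightarrow> f holomorphic_on {w. \<bar>Im w\<bar> < \<psi>} \<and>
  (\<exists>c. \<forall>w. \<bar>Im w\<bar> < \<psi> --> norm (f w) <= c * exp (- Re w / 2))"

lemma decays_mono: "decays \<psi> f ==> \<psi>' <= \<psi> ==> decays \<psi>' f"
proof -
 assume f: "decays \<psi> f" and le: "\<psi>' <= \<psi>"
 obtain c where c: "!!w. \<bar>Im w\<bar> < \<psi> ==> norm (f w) <= c * exp (- Re w / 2)" using f by (auto simp: decays_def)
 have "norm (f w) <= c * exp (- Re w / 2)" if "\<bar>Im w\<bar> < \<psi>'" for w using c[of w] that le by simp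
 moreover have "f holomorphic_on {w. \<bar>Im w\<bar> < \<psi>'}"
  by (rule holomorphic_on_subset[of _ "{w. \<bar>Im w\<bar> < \<psi>}"]) (use f le in \<open>auto simp: decays_def\<close>)
 ultimately show ?thesis unfolding decays_def by blast
qed

lemma decays_line:
 assumes "decays \<psi> f" "\<bar>t\<bar> < \<psi>"
 shows "continuous_on UNIV (%x. f (Complex x t))"
proof (rule continuous_on_compose2[of "{w. \<bar>Im w\<bar> < \<psi>}" f])
 show "continuous_on {w. \<bar>Im w\<bar> < \<psi>} f"
  using assms(1) by (auto simp: decays_def intro: holomorphic_on_imp_continuous_on)
 show "continuous_on UNIV (%x. Complex x t)" by (intro continuous_intros)
qed (use assms in auto)

lemma decays_mult_bounded:
 assumes "decays \<psi> f" "g holomorphic_on {w. \<bar>Im w\<bar> < \<psi>}" "!!w. \<bar>Im w\<bar> < \<psi> ==> norm (g w) <= b"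
 shows "decays \<psi> (%w. f w * g w)"
proof -
 obtain c where c: "!!w. \<bar>Im w\<bar> < \<psi> ==> norm (f w) <= c * exp (- Re w / 2)" using assms(1) by (auto simp: decays_def)
 have "norm (f w * g w) <= (c * b) * exp (- Re w / 2)" if "\<bar>Im w\<bar> < \<psi>" for w
 proof -
  have "norm (f w) * norm (g w) <= (c * exp (- Re w / 2)) * b"
   using c[OF that] assms(3)[OF that] by (intro mult_mono) (auto intro: order_trans[OF norm_ge_zero])
  then show ?thesis by (simp add: norm_mult mult_ac)
 qed
 then show ?thesis using assms unfolding decays_def by (auto intro!: holomorphic_intros)
qed

lemma decays_add:
 assumes "decays \<psi> f" "decays \<psi> g"
 shows "decays \<psi> (%w. f w + g w)"
proof -
 obtain c where c: "!!w. \<bar>Im w\<bar> < \<psi> ==> norm (f w) <= c * exp (- Re w / 2)" using assms(1) by (auto simp: decays_def)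
 obtain d where d: "!!w. \<bar>Im w\<bar> < \<psi> ==> norm (g w) <= d * exp (- Re w / 2)" using assms(2) by (auto simp: decays_def)
 have "norm (f w + g w) <= (c + d) * exp (- Re w / 2)" if "\<bar>Im w\<bar> < \<psi>" for w
  using norm_triangle_ineq[of "f w" "g w"] c[OF that] d[OF that] by (simp add: distrib_right)
 then show ?thesis using assms unfolding decays_def by (auto intro!: holomorphic_intros)
qed

lemma decays_cmult:
 assumes "decays \<psi> f"
 shows "decays \<psi> (%w. a * f w)"
 using decays_mult_bounded[OF assms, of "%_. a" "norm a"] by (simp add: mult.commute)

text \<open>Logarithms of the points off the closed sector of half-angle \<omega>. Imaginary parts
  run past \<open>pi\<close>, so the negative axis is interior and contours can be moved across
  it.\<close>

definition co_strip :: "real => complex set" where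
 "co_strip \<omega> = {w. \<omega> < \<bar>Im w\<bar> \<and> \<bar>Im w\<bar> < 2 * pi - \<omega>}"

lemma open_co_strip: "open (co_strip \<omega>)"
proof -
 have "co_strip \<omega> = (%w. \<bar>Im w\<bar>) -` {\<omega><..<2 * pi - \<omega>}" by (auto simp: co_strip_def)
 moreover have "continuous_on UNIV (%w. \<bar>Im w\<bar>)" by (intro continuous_intros)
 ultimately show ?thesis by (simp add: open_vimage)
qed

text \<open>Only the resolvent identity and a bound are postulated, the bound being that of a
  sectorial operator pushed away from 0 by \<open>s\<close>. Unbounded operators enter when
  \<open>R\<close> is taken to be a resolvent.\<close>

locale sect_res =
 fixes R :: "complex => 'a::complex_banach \<Rightarrow>\<^sub>L 'a" and \<omega> s :: real
 assumes ang: "0 <= \<omega>" "\<omega> < pi" and s: "0 < s"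
  and cbl: "w \<in> co_strip \<omega> ==> R (exp w) \<in> cblinfuns"
  and bound: "\<omega> < th ==> th < pi ==>
   \<exists>C. \<forall>w. th <= \<bar>Im w\<bar> \<and> \<bar>Im w\<bar> <= 2 * pi - th --> norm (R (exp w)) <= C / (s + exp (Re w))"
  and ident: "w \<in> co_strip \<omega> ==> v \<in> co_strip \<omega> ==>
   R (exp w) - R (exp v) = (exp v - exp w) *\<^sub>C (R (exp w) o\<^sub>L R (exp v))"
begin

lemma Complex_in_co_strip: "\<omega> < th ==> th < pi ==> ray th t ==> Complex x t \<in> co_strip \<omega>"
 using ang by (auto simp: co_strip_def)

lemma R_commute: "w \<in> co_strip \<omega> ==> v \<in> co_strip \<omega> ==> R (exp w) o\<^sub>L R (exp v) = R (exp v) o\<^sub>L R (exp w)"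
proof (cases "exp w = exp v")
 case False
 assume "w \<in> co_strip \<omega>" "v \<in> co_strip \<omega>"
 from ident[OF this] ident[OF this(2,1)]
 have "(exp v - exp w) *\<^sub>C (R (exp w) o\<^sub>L R (exp v)) = - ((exp w - exp v) *\<^sub>C (R (exp v) o\<^sub>L R (exp w)))"
  by (metis minus_diff_eq)
 also have "... = (exp v - exp w) *\<^sub>C (R (exp v) o\<^sub>L R (exp w))"
  by (metis minus_diff_eq scaleC_simps(4))
 finally have "inverse (exp v - exp w) *\<^sub>C (exp v - exp w) *\<^sub>C (R (exp w) o\<^sub>L R (exp v)) =
   inverse (exp v - exp w) *\<^sub>C (exp v - exp w) *\<^sub>C (R (exp v) o\<^sub>L R (exp w))" by simp
 then show ?thesis using False by (simp add: scaleC_scaleC)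
qed simp

lemma R_isCont: assumes w: "w \<in> co_strip \<omega>" shows "isCont (%w. R (exp w)) w"
proof -
 define q where "q = min \<bar>Im w\<bar> (2 * pi - \<bar>Im w\<bar>)"
 define th where "th = (\<omega> + q) / 2"
 have "\<omega> < q" "q <= pi" using w by (auto simp: q_def co_strip_def)
 then have th: "\<omega> < th" "th < pi" and "th < q" using ang by (auto simp: th_def)
 then have wth: "w \<in> co_strip th" by (auto simp: co_strip_def q_def)
 obtain C where C: "!!w. th <= \<bar>Im w\<bar> \<and> \<bar>Im w\<bar> <= 2 * pi - th ==> norm (R (exp w)) <= C / (s + exp (Re w))"
  using bound[OF th] by blast
 have C0: "C >= 0"
 proof -
  have "0 <= norm (R (exp w))" by simp
  also have "... <= C / (s + exp (Re w))" using C[of w] wth by (auto simp: co_strip_def)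
  finally have "0 <= C / (s + exp (Re w))" .
  moreover have "s + exp (Re w) > 0" using s by (simp add: add_pos_pos)
  ultimately show ?thesis by (auto simp: zero_le_divide_iff)
 qed
 have C': "norm (R (exp v)) <= C / s" if "v \<in> co_strip th" for v
 proof -
  have "norm (R (exp v)) <= C / (s + exp (Re v))" using C[of v] that by (auto simp: co_strip_def)
  also have "... <= C / s" using C0 s by (intro divide_left_mono) (auto simp: add_pos_pos)
  finally show ?thesis .
 qed
 have sub: "co_strip th \<subseteq> co_strip \<omega>" using th by (auto simp: co_strip_def)
 have "((%v. R (exp v) - R (exp w)) \<longlongrightarrow> 0) (at w)"
 proof (rule Lim_null_comparison)
  show "((%v. norm (exp w - exp v) * (C / s * (C / s))) \<longlongrightarrow> 0) (at w)"
   by (rule tendsto_eq_intros refl | simp)+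
  have "\<forall>\<^sub>F v in at w. v \<in> co_strip th" using open_co_strip wth by (rule eventually_at_in_open')
  then show "\<forall>\<^sub>F v in at w. norm (R (exp v) - R (exp w)) <= norm (exp w - exp v) * (C / s * (C / s))"
  proof eventually_elim
   case (elim v)
   have "norm (R (exp v) - R (exp w)) = norm (exp w - exp v) * norm (R (exp v) o\<^sub>L R (exp w))"
    using elim wth sub by (subst ident) (auto simp: norm_scaleC)
   also have "... <= norm (exp w - exp v) * (norm (R (exp v)) * norm (R (exp w)))"
    by (intro mult_left_mono norm_blinfun_compose) auto
   also have "... <= norm (exp w - exp v) * (C / s * (C / s))"
    using C'[OF elim] C'[OF wth] C0 s by (intro mult_left_mono mult_mono) auto
   finally show ?case .
  qed
 qed
 then show ?thesis by (simp add: isCont_def LIM_zero_iff)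
qed

lemma R_continuous: "continuous_on (co_strip \<omega>) (%w. R (exp w))"
 using R_isCont by (simp add: continuous_at_imp_continuous_on)

lemma R_line_continuous:
 assumes "\<omega> < th" "th < pi" "ray th t"
 shows "continuous_on UNIV (%x. R (cexp x t))"
 by (rule continuous_on_compose2[OF R_continuous]) (use Complex_in_co_strip[OF assms] in \<open>auto intro!: continuous_intros\<close>)

text \<open>The resolvent identity turns the difference quotient into that of the exponential times
  a product of two resolvents, which converges by continuity. Scalar holomorphy is all that Cauchy's
  theorem asks for.\<close>

lemma R_functional_holomorphic:
 assumes m: "cfunctional m"
 shows "(%w. m (R (exp w))) holomorphic_on co_strip \<omega>"
proof (rule holomorphic_onI)
 fix w assume w: "w \<in> co_strip \<omega>"
 interpret m: bounded_linear m by (rule cfunctionalD(1)[OF m])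
 have "((%v. - ((exp v - exp w) / (v - w)) * m (R (exp v) o\<^sub>L R (exp w))) \<longlongrightarrow> - exp w * m (R (exp w) o\<^sub>L R (exp w))) (at w)"
 proof (intro tendsto_mult tendsto_minus m.tendsto)
  show "((%v. (exp v - exp w) / (v - w)) \<longlongrightarrow> exp w) (at w)"
   using DERIV_exp[of w] by (simp add: has_field_derivative_iff)
  have "((%v. R (exp v)) \<longlongrightarrow> R (exp w)) (at w)" using R_isCont[OF w] by (simp add: isCont_def)
  then show "((%v. R (exp v) o\<^sub>L R (exp w)) \<longlongrightarrow> R (exp w) o\<^sub>L R (exp w)) (at w)"
   by (rule bounded_linear.tendsto[OF bounded_linear_compose_left])
 qed
 moreover have "\<forall>\<^sub>F v in at w. - ((exp v - exp w) / (v - w)) * m (R (exp v) o\<^sub>L R (exp w)) = (m (R (exp v)) - m (R (exp w))) / (v - w)"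
 proof -
  have "\<forall>\<^sub>F v in at w. v \<in> co_strip \<omega>" using open_co_strip w by (rule eventually_at_in_open')
  then show ?thesis
  proof eventually_elim
   case (elim v)
   have "m (R (exp v)) - m (R (exp w)) = (exp w - exp v) * m (R (exp v) o\<^sub>L R (exp w))"
    unfolding m.diff[symmetric] ident[OF elim w] by (rule cfunctionalD(2)[OF m])
   moreover have "- (a / b) * M = ((- a) * M) / b" for a b M :: complex by simp
   ultimately show ?case by (simp only: minus_diff_eq)
  qed
 qed
 ultimately have "((%v. (m (R (exp v)) - m (R (exp w))) / (v - w)) \<longlongrightarrow> - exp w * m (R (exp w) o\<^sub>L R (exp w))) (at w)"
  by (rule Lim_transform_eventually)
 then have "((%w. m (R (exp w))) has_field_derivative - exp w * m (R (exp w) o\<^sub>L R (exp w))) (at w)"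
  by (simp add: has_field_derivative_iff)
 then show "(%w. m (R (exp w))) field_differentiable at w within co_strip \<omega>"
  using field_differentiable_at_within field_differentiable_def by blast
qed

lemma fc_integrable:
 assumes f: "decays \<psi> f" and th: "\<omega> < th" "th < \<psi>" "th < pi"
 shows "bochner_integrable lborel (fc_integrand R th f)"
proof -
 obtain C where C: "!!w. th <= \<bar>Im w\<bar> \<and> \<bar>Im w\<bar> <= 2 * pi - th ==> norm (R (exp w)) <= C / (s + exp (Re w))"
  using bound[OF th(1,3)] by blast
 obtain c where c: "!!w. \<bar>Im w\<bar> < \<psi> ==> norm (f w) <= c * exp (- Re w / 2)" using f by (auto simp: decays_def)
 show ?thesis
 proof (rule fc_bound(1)[where a = "%x. c * exp (- x / 2)" and b = "%x. C / (s + exp x)"])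
  have "integrable lborel (%x. exp (x / 2) / (s + exp x))"
   by (rule integrable_le[OF integrable_mult_right[OF integrable_exp_abs[of "1/2"], of "max 1 (1/s)"]])
    (use exp_half_le[OF s] s in \<open>auto intro!: AE_I2 simp: abs_mult abs_of_pos add_pos_pos\<close>)
  then have "integrable lborel (%x. (c * C) * (exp (x / 2) / (s + exp x)))" by (rule integrable_mult_right)
  moreover have "(c * C) * (exp (x / 2) / (s + exp x)) = c * exp (- x / 2) * exp x * (C / (s + exp x))" for x
  proof -
   have e: "exp (x / 2) = exp (- x / 2) * exp x" by (simp flip: exp_add)
   show ?thesis by (subst e) (simp add: mult_ac)
  qed
  ultimately show "integrable lborel (%x. c * exp (- x / 2) * exp x * (C / (s + exp x)))" by (simp only:)
  fix x t assume t: "ray th t"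
  show "norm (R (cexp x t)) <= C / (s + exp x)" using C[of "Complex x t"] t th ang by auto
  show "norm (f (Complex x t)) <= c * exp (- x / 2)" using c[of "Complex x t"] t th ang by auto
 qed (use R_line_continuous[OF th(1,3)] decays_line[OF f] th ang in auto)
qed

lemma line_bound:
 assumes f: "decays \<psi> f" and m: "cfunctional m" and th: "\<omega> < th1" "th2 < \<psi>" "th2 < pi"
 obtains B where "!!w. th1 <= \<bar>Im w\<bar> ==> \<bar>Im w\<bar> <= th2 ==>
  norm (f w * exp w * m (R (exp w))) <= B * exp (- (1/2) * \<bar>Re w\<bar>)"
proof (cases "th1 <= th2")
 case True
 then have "th1 < pi" using th by linarith
 then obtain C where C: "!!w. th1 <= \<bar>Im w\<bar> \<and> \<bar>Im w\<bar> <= 2 * pi - th1 ==> norm (R (exp w)) <= C / (s + exp (Re w))"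
  using bound[OF th(1)] by blast
 obtain c where c: "!!w. \<bar>Im w\<bar> < \<psi> ==> norm (f w) <= c * exp (- Re w / 2)" using f by (auto simp: decays_def)
 obtain K where K: "K > 0" "!!T. norm (m T) <= norm T * K"
  using bounded_linear.pos_bounded[OF cfunctionalD(1)[OF m]] by blast
 have "norm (f w * exp w * m (R (exp w))) <= (\<bar>c\<bar> * \<bar>C\<bar> * K * max 1 (1 / s)) * exp (- (1/2) * \<bar>Re w\<bar>)"
  if w: "th1 <= \<bar>Im w\<bar>" "\<bar>Im w\<bar> <= th2" for w
 proof -
  have sp: "s + exp (Re w) > 0" using s by (simp add: add_pos_pos)
  have "norm (f w) <= c * exp (- Re w / 2)" using c[of w] w th by auto
  then have 1: "norm (f w) <= \<bar>c\<bar> * exp (- Re w / 2)"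
   by (rule order_trans) (intro mult_right_mono; simp)
  have "norm (m (R (exp w))) <= norm (R (exp w)) * K" by (rule K)
  also have "... <= (\<bar>C\<bar> / (s + exp (Re w))) * K"
  proof (intro mult_right_mono)
   have "norm (R (exp w)) <= C / (s + exp (Re w))" using C[of w] w True th ang by auto
   also have "... <= \<bar>C\<bar> / (s + exp (Re w))" using sp by (intro divide_right_mono) auto
   finally show "norm (R (exp w)) <= \<bar>C\<bar> / (s + exp (Re w))" .
  qed (use K in auto)
  finally have 2: "norm (m (R (exp w))) <= (\<bar>C\<bar> / (s + exp (Re w))) * K" .
  have "norm (f w * exp w * m (R (exp w))) <= (\<bar>c\<bar> * exp (- Re w / 2)) * exp (Re w) * ((\<bar>C\<bar> / (s + exp (Re w))) * K)"
   unfolding norm_mult norm_exp_eq_Re using 1 2 by (intro mult_mono mult_right_mono) auto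
  also have "... = (\<bar>c\<bar> * \<bar>C\<bar> * K) * (exp (Re w / 2) / (s + exp (Re w)))"
  proof -
   have e: "exp (Re w / 2) = exp (- Re w / 2) * exp (Re w)" by (simp flip: exp_add)
   show ?thesis by (subst e) (simp add: mult_ac)
  qed
  also have "... <= (\<bar>c\<bar> * \<bar>C\<bar> * K) * (max 1 (1 / s) * exp (- (1/2) * \<bar>Re w\<bar>))"
   using K by (intro mult_left_mono exp_half_le s) auto
  finally show ?thesis by (simp add: mult.assoc)
 qed
 then show ?thesis using that by blast
next
 case False
 then show ?thesis using that[of 0] by auto
qed

lemma line_integrable:
 assumes f: "decays \<psi> f" and m: "cfunctional m" and th: "\<omega> < th" "th < \<psi>" "th < pi" and t: "ray th t"
 shows "integrable lborel (%x. f (Complex x t) * cexp x t * m (R (cexp x t)))"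
proof -
 obtain B where B: "!!w. th <= \<bar>Im w\<bar> ==> \<bar>Im w\<bar> <= th ==>
  norm (f w * exp w * m (R (exp w))) <= B * exp (- (1/2) * \<bar>Re w\<bar>)"
  using line_bound[OF f m th] by blast
 show ?thesis
 proof (rule integrable_exp_decay[where c = "1/2" and N = 0 and C = B])
  show "continuous_on UNIV (%x. f (Complex x t) * cexp x t * m (R (cexp x t)))"
   using t th ang
   by (intro continuous_intros decays_line[OF f] bounded_linear.continuous_on[OF cfunctionalD(1)[OF m]]
     R_line_continuous[OF th(1,3)]) auto
  show "norm (f (Complex x t) * cexp x t * m (R (cexp x t))) <= B * exp (- (1/2) * \<bar>x\<bar>)" for x
   using B[of "Complex x t"] t th ang by auto
 qed simp
qed

lemma fc_functional:
 assumes f: "decays \<psi> f" and m: "cfunctional m" and th: "\<omega> < th" "th < \<psi>" "th < pi"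
 shows "m (fc R th f) = (1 / (2 * of_real pi * \<i>)) *
  ((LINT x|lborel. f (Complex x (- th)) * cexp x (- th) * m (R (cexp x (- th)))) -
  (LINT x|lborel. f (Complex x th) * cexp x th * m (R (cexp x th))))"
proof -
 have "m (fc R th f) = (LINT x|lborel. m (fc_integrand R th f x))"
  unfolding fc_def by (rule bochner_functional(2)[OF fc_integrable[OF f th] m])
 also have "... = (LINT x|lborel. (1 / (2 * of_real pi * \<i>)) *
   (f (Complex x (- th)) * cexp x (- th) * m (R (cexp x (- th))) -
   f (Complex x th) * cexp x th * m (R (cexp x th))))"
  unfolding fc_integrand_def by (simp add: cfunctionalD(2,4)[OF m])
 also have "... = (1 / (2 * of_real pi * \<i>)) * (LINT x|lborel.
   (f (Complex x (- th)) * cexp x (- th) * m (R (cexp x (- th))) -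
   f (Complex x th) * cexp x th * m (R (cexp x th))))"
  by (rule integral_mult_right_zero)
 also have "(LINT x|lborel. (f (Complex x (- th)) * cexp x (- th) * m (R (cexp x (- th))) -
   f (Complex x th) * cexp x th * m (R (cexp x th)))) =
  (LINT x|lborel. f (Complex x (- th)) * cexp x (- th) * m (R (cexp x (- th)))) -
  (LINT x|lborel. f (Complex x th) * cexp x th * m (R (cexp x th)))"
  by (rule LINT_diff; rule line_integrable[OF f m th]; simp)
 finally show ?thesis .
qed

text \<open>Rotation of the contour: the upper line moves inside
  \<open>\<omega> < Im w < \<psi>\<close>, the lower one inside the mirror image, and in both strips
  the integrand is holomorphic once a functional is applied.\<close>

lemma fc_shift:
 assumes f: "decays \<psi> f" and \<psi>: "\<psi> <= pi" and th: "\<omega> < th" "th < \<psi>" "\<omega> < th'" "th' < \<psi>"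
 shows "fc R th f = fc R th' f"
proof -
 have main: "fc R th1 f = fc R th2 f" if th: "\<omega> < th1" "th1 < th2" "th2 < \<psi>" for th1 th2
 proof (rule cfunctional_eqI)
  fix m :: "('a \<Rightarrow>\<^sub>L 'a) => complex" assume m: "cfunctional m"
  obtain B where B: "!!w. th1 <= \<bar>Im w\<bar> ==> \<bar>Im w\<bar> <= th2 ==>
    norm (f w * exp w * m (R (exp w))) <= B * exp (- (1/2) * \<bar>Re w\<bar>)"
   using line_bound[OF f m th(1,3)] th \<psi> by auto
  have hol: "(%w. f w * exp w * m (R (exp w))) holomorphic_on S" if "S \<subseteq> {w. \<bar>Im w\<bar> < \<psi>} \<inter> co_strip \<omega>" for S
   using f that unfolding decays_def
   by (intro holomorphic_intros holomorphic_on_subset[OF R_functional_holomorphic[OF m]]) (auto intro: holomorphic_on_subset)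
  have "(LINT x|lborel. f (Complex x th1) * cexp x th1 * m (R (cexp x th1))) =
    (LINT x|lborel. f (Complex x th2) * cexp x th2 * m (R (cexp x th2)))"
  proof (rule strip_shift[where a = \<omega> and b = \<psi> and c = "1/2" and N = 0 and C = B])
   show "(%w. f w * exp w * m (R (exp w))) holomorphic_on {w. \<omega> < Im w \<and> Im w < \<psi>}"
    using ang \<psi> by (intro hol) (auto simp: co_strip_def)
  qed (use th ang B in auto)
  moreover have "(LINT x|lborel. f (Complex x (-th2)) * cexp x (-th2) * m (R (cexp x (-th2)))) =
    (LINT x|lborel. f (Complex x (-th1)) * cexp x (-th1) * m (R (cexp x (-th1))))"
  proof (rule strip_shift[where a = "-\<psi>" and b = "-\<omega>" and c = "1/2" and N = 0 and C = B])
   show "(%w. f w * exp w * m (R (exp w))) holomorphic_on {w. -\<psi> < Im w \<and> Im w < -\<omega>}"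
    using ang \<psi> by (intro hol) (auto simp: co_strip_def)
  qed (use th ang B in auto)
  ultimately show "m (fc R th1 f) = m (fc R th2 f)"
   using fc_functional[OF f m, of th1] fc_functional[OF f m, of th2] th \<psi> by simp
 qed
 show ?thesis
 proof (cases th th' rule: linorder_cases)
  case less
  show ?thesis by (rule main[OF th(1) less th(4)])
 next
  case greater
  show ?thesis by (rule main[OF th(3) greater th(2), symmetric])
 qed simp
qed

lemma fc_commute:
 assumes f: "decays \<psi> f" and th: "\<omega> < th" "th < \<psi>" "th < pi"
  and S: "S \<in> cblinfuns" "!!w. w \<in> co_strip \<omega> ==> S o\<^sub>L R (exp w) = R (exp w) o\<^sub>L S"
 shows "S o\<^sub>L fc R th f = fc R th f o\<^sub>L S"
proof -
 note bi = fc_integrable[OF f th]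
 have "S o\<^sub>L fc R th f = bochner lborel (%x. S o\<^sub>L fc_integrand R th f x)"
  unfolding fc_def by (rule bochner_bounded_linear(2)[OF bounded_linear_compose_right bi, symmetric])
 also have "... = bochner lborel (%x. fc_integrand R th f x o\<^sub>L S)"
 proof (rule bochner_cong)
  fix x
  have "S o\<^sub>L fc_integrand R th f x = fc_integrand (%v. S o\<^sub>L R v) th f x"
   by (simp add: fc_integrand_def cblinfuns_compose_scaleC[OF S(1)]
     bounded_bilinear.diff_right[OF bounded_bilinear_blinfun_compose])
  also have "... = fc_integrand (%v. R v o\<^sub>L S) th f x"
   unfolding fc_integrand_def using S(2)[OF Complex_in_co_strip[OF th(1,3)]] by simp
  also have "... = fc_integrand R th f x o\<^sub>L S"
   by (simp add: fc_integrand_def bounded_bilinear.diff_left[OF bounded_bilinear_blinfun_compose])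
  finally show "S o\<^sub>L fc_integrand R th f x = fc_integrand R th f x o\<^sub>L S" .
 qed
 also have "... = fc R th f o\<^sub>L S"
  unfolding fc_def by (rule bochner_bounded_linear(2)[OF bounded_linear_compose_left bi])
 finally show ?thesis .
qed

text \<open>Complex linearity means commuting with these multiplications, which makes the complex
  linearity of contour integrals an instance of \<open>fc_commute\<close>.\<close>

definition scaleC_op :: "complex => 'a \<Rightarrow>\<^sub>L 'a" where
 "scaleC_op c = c *\<^sub>C id_blinfun"

lemma cblinfuns_iff_commute: "T \<in> cblinfuns \<longleftrightarrow> (\<forall>c. scaleC_op c o\<^sub>L T = T o\<^sub>L scaleC_op c)"
proof -
 have "scaleC_op c o\<^sub>L T = T o\<^sub>L scaleC_op c \<longleftrightarrow> (\<forall>x. T (c *\<^sub>C x) = c *\<^sub>C T x)" for c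
 proof -
  have "(scaleC_op c o\<^sub>L T) x = c *\<^sub>C T x" "(T o\<^sub>L scaleC_op c) x = T (c *\<^sub>C x)" for x
   by (simp_all add: scaleC_op_def scaleC_blinfun.rep_eq)
  then show ?thesis by (metis blinfun_eqI)
 qed
 then show ?thesis unfolding cblinfuns_def by blast
qed

lemma scaleC_op_cblinfuns: "scaleC_op c \<in> cblinfuns"
 by (simp add: cblinfuns_def scaleC_op_def scaleC_blinfun.rep_eq scaleC_scaleC mult.commute)

lemma fc_cblinfuns:
 assumes f: "decays \<psi> f" and th: "\<omega> < th" "th < \<psi>" "th < pi"
 shows "fc R th f \<in> cblinfuns"
 unfolding cblinfuns_iff_commute
 using fc_commute[OF f th scaleC_op_cblinfuns] cbl[unfolded cblinfuns_iff_commute] by blast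

lemma fc_fc_commute:
 assumes f: "decays \<psi> f" and g: "decays \<psi>' g" and th: "\<omega> < th" "th < \<psi>" "th < pi" "\<omega> < th'" "th' < \<psi>'" "th' < pi"
 shows "fc R th f o\<^sub>L fc R th' g = fc R th' g o\<^sub>L fc R th f"
proof (rule fc_commute[OF g th(4-6) fc_cblinfuns[OF f th(1-3)]])
 fix w assume w: "w \<in> co_strip \<omega>"
 have "R (exp w) o\<^sub>L fc R th f = fc R th f o\<^sub>L R (exp w)"
  by (rule fc_commute[OF f th(1-3)]) (use w cbl R_commute in auto)
 then show "fc R th f o\<^sub>L R (exp w) = R (exp w) o\<^sub>L fc R th f" by simp
qed

lemma fc_lincomb:
 assumes f: "decays \<psi> f" and g: "decays \<psi> g" and th: "\<omega> < th" "th < \<psi>" "th < pi"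
 shows "fc R th (%w. a * f w + b * g w) = a *\<^sub>C fc R th f + b *\<^sub>C fc R th g"
proof (rule cfunctional_eqI)
 fix m :: "('a \<Rightarrow>\<^sub>L 'a) => complex" assume m: "cfunctional m"
 have fg: "decays \<psi> (%w. a * f w + b * g w)" by (intro decays_add decays_cmult f g)
 have "(LINT x|lborel. (a * f (Complex x t) + b * g (Complex x t)) * cexp x t * m (R (cexp x t))) =
   a * (LINT x|lborel. f (Complex x t) * cexp x t * m (R (cexp x t))) +
   b * (LINT x|lborel. g (Complex x t) * cexp x t * m (R (cexp x t)))" if t: "ray th t" for t
 proof -
  have "(LINT x|lborel. (a * f (Complex x t) + b * g (Complex x t)) * cexp x t * m (R (cexp x t))) =
   (LINT x|lborel. a * (f (Complex x t) * cexp x t * m (R (cexp x t))) + b * (g (Complex x t) * cexp x t * m (R (cexp x t))))"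
   by (intro LINT_cong) (auto simp: algebra_simps)
  also have "... = a * (LINT x|lborel. f (Complex x t) * cexp x t * m (R (cexp x t))) +
   b * (LINT x|lborel. g (Complex x t) * cexp x t * m (R (cexp x t)))"
   using line_integrable[OF f m th t] line_integrable[OF g m th t]
   by (subst LINT_add) auto
  finally show ?thesis .
 qed
 note l = this
 have alg: "\<kappa> * ((a * F1 + b * G1) - (a * F2 + b * G2)) = a * (\<kappa> * (F1 - F2)) + b * (\<kappa> * (G1 - G2))"
  for \<kappa> F1 G1 F2 G2 :: complex by (simp add: algebra_simps)
 show "m (fc R th (%w. a * f w + b * g w)) = m (a *\<^sub>C fc R th f + b *\<^sub>C fc R th g)"
  unfolding cfunctionalD(2,3)[OF m] fc_functional[OF fg m th] fc_functional[OF f m th] fc_functional[OF g m th]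
   l[OF disjI1[OF refl]] l[OF disjI2[OF refl]] by (rule alg)
qed

end

lemma inverse_add_exp_le:
 fixes s x :: real
 assumes s: "s > 0"
 shows "1 / (s + exp x) <= max 1 (1 / s) * exp (- x / 2)"
proof -
 have "exp (x / 2) / (s + exp x) <= max 1 (1 / s) * exp (- (1/2) * \<bar>x\<bar>)" by (rule exp_half_le[OF s])
 also have "... <= max 1 (1 / s) * 1" by (intro mult_left_mono) auto
 finally have "exp (- x / 2) * (exp (x / 2) / (s + exp x)) <= exp (- x / 2) * max 1 (1 / s)"
  by (intro mult_left_mono) auto
 moreover have "exp (- x / 2) * (exp (x / 2) / (s + exp x)) = 1 / (s + exp x)"
  unfolding times_divide_eq_right exp_add[symmetric] by simp
 ultimately have "1 / (s + exp x) <= exp (- x / 2) * max 1 (1 / s)" by (simp only:)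
 then show ?thesis by (simp only: mult.commute)
qed

section \<open>Multiplicativity of the calculus and its value at resolvent functions\<close>

context sect_res
begin

lemma functional_R_bound:
 assumes m: "cfunctional m" and th: "\<omega> < th" "th < pi"
 obtains C where "0 <= C" "!!w. th <= \<bar>Im w\<bar> ==> \<bar>Im w\<bar> <= 2 * pi - th ==> norm (m (R (exp w))) <= C * (1 / (s + exp (Re w)))"
proof -
 obtain C where C: "!!w. th <= \<bar>Im w\<bar> \<and> \<bar>Im w\<bar> <= 2 * pi - th ==> norm (R (exp w)) <= C / (s + exp (Re w))"
  using bound[OF th] by blast
 obtain K where K: "K > 0" "!!T. norm (m T) <= norm T * K"
  using bounded_linear.pos_bounded[OF cfunctionalD(1)[OF m]] by blast
 have "norm (m (R (exp w))) <= (\<bar>C\<bar> * K) * (1 / (s + exp (Re w)))" if w: "th <= \<bar>Im w\<bar>" "\<bar>Im w\<bar> <= 2 * pi - th" for w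
 proof -
  have sp: "s + exp (Re w) > 0" using s by (simp add: add_pos_pos)
  have "norm (m (R (exp w))) <= norm (R (exp w)) * K" by (rule K)
  also have "... <= (\<bar>C\<bar> / (s + exp (Re w))) * K"
  proof (intro mult_right_mono)
   have "norm (R (exp w)) <= C / (s + exp (Re w))" using C[of w] w by auto
   also have "... <= \<bar>C\<bar> / (s + exp (Re w))" using sp by (intro divide_right_mono) auto
   finally show "norm (R (exp w)) <= \<bar>C\<bar> / (s + exp (Re w))" .
  qed (use K in auto)
  finally show ?thesis by simp
 qed
 then show ?thesis using that[of "\<bar>C\<bar> * K"] K by auto
qed

lemma functional_R_line_continuous:
 assumes m: "cfunctional m" and th: "\<omega> < th" "th < pi" "ray th t"
 shows "continuous_on UNIV (%x. m (R (cexp x t)))"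
 by (rule bounded_linear.continuous_on[OF cfunctionalD(1)[OF m] R_line_continuous[OF th]])

text \<open>Move the contour of \<open>g\<close> out to a larger angle \<open>th'\<close> and insert
  the resolvent identity into the product of the integrals. In one part \<open>g\<close> is
  integrated over the outer contour, which encloses the pole, and yields the value of
  \<open>g\<close> there; in the other part \<open>f\<close> is integrated over the inner contour,
  which leaves the pole outside, and yields 0. Boundedness of \<open>g\<close> keeps
  \<open>f * g\<close> in the class \<open>decays\<close> and makes the double integral absolutely
  convergent.\<close>

lemma fc_mult:
 assumes f: "decays \<psi> f" and g: "decays \<psi> g" and gb: "!!w. \<bar>Im w\<bar> < \<psi> ==> norm (g w) <= b"
  and \<psi>: "\<psi> <= pi" and th: "\<omega> < th" "th < \<psi>"
 shows "fc R th f o\<^sub>L fc R th g = fc R th (%w. f w * g w)"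
proof -
 define th' where "th' = (th + \<psi>) / 2"
 have th': "th < th'" "th' < \<psi>" "\<omega> < th'" "th' < pi" using th \<psi> by (auto simp: th'_def)
 have thpi: "th < pi" "0 < th" using th \<psi> ang by auto
 define G where "G = fc R th' g"
 have G: "fc R th g = G" unfolding G_def by (rule fc_shift[OF g \<psi> th th'(3,2)])
 define \<kappa> where "\<kappa> = 1 / (2 * complex_of_real pi * \<i>)"
 have \<kappa>: "\<kappa> * (2 * pi * \<i> * z) = z" for z by (simp add: \<kappa>_def)
 have fg: "decays \<psi> (%w. f w * g w)"
  by (rule decays_mult_bounded[OF f _ gb]) (use g in \<open>auto simp: decays_def\<close>)
 have gh: "g holomorphic_on {w. \<bar>Im w\<bar> < \<psi>}" and fh: "f holomorphic_on {w. \<bar>Im w\<bar> < \<psi>}" using f g by (auto simp: decays_def)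
 obtain cf where cf: "!!w. \<bar>Im w\<bar> < \<psi> ==> norm (f w) <= cf * exp (- Re w / 2)" using f by (auto simp: decays_def)
 obtain cg where cg: "!!w. \<bar>Im w\<bar> < \<psi> ==> norm (g w) <= cg * exp (- Re w / 2)" using g by (auto simp: decays_def)
 have b0: "0 <= b" using order_trans[OF norm_ge_zero gb[of 0]] th ang by auto
 have "fc R th f o\<^sub>L G = fc R th (%w. f w * g w)"
 proof (rule cfunctional_eqI)
  fix m :: "('a \<Rightarrow>\<^sub>L 'a) => complex" assume m: "cfunctional m"
  obtain C where C: "0 <= C" "!!w. th' <= \<bar>Im w\<bar> ==> \<bar>Im w\<bar> <= 2 * pi - th' ==> norm (m (R (exp w))) <= C * (1 / (s + exp (Re w)))"
   using functional_R_bound[OF m th'(3,4)] by blast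
  define p where "p u = g u * exp u * m (R (exp u))" for u
  define Q where "Q v = (LINT y|lborel. p (Complex y (- th')) / (cexp y (- th') - exp v)
    - p (Complex y th') / (cexp y th' - exp v))" for v
  have gR: "norm (g (Complex y t') * m (R (cexp y t'))) <= b * (C * (1 / (s + exp y)))"
   if "ray th' t'" for y t'
   unfolding norm_mult using gb[of "Complex y t'"] C(2)[of "Complex y t'"] that th' thpi b0 C(1) by (intro mult_mono) auto
  have zero: "(LINT x|lborel. f (Complex x (- th)) * cexp x (- th) * Q (Complex x (- th))
   - f (Complex x th) * cexp x th * Q (Complex x th)) = 0"
   unfolding Q_def
  proof (rule cauchy_swap_zero[where c = cf and s = s and B = "b * C"])
   show "f holomorphic_on {w. \<bar>Im w\<bar> < th'}" using fh by (rule holomorphic_on_subset) (use th' in auto)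
   show "continuous_on UNIV (%y. p (Complex y (- th')))" "continuous_on UNIV (%y. p (Complex y th'))"
    unfolding p_def using th' thpi
    by (intro continuous_intros decays_line[OF g] functional_R_line_continuous[OF m th'(3,4)]; simp)+
   have pb: "norm (p (Complex y t')) <= b * C * (exp y / (s + exp y))" if "ray th' t'" for y t'
   proof -
    have "norm (p (Complex y t')) = norm (g (Complex y t') * m (R (cexp y t'))) * exp y"
     by (simp add: p_def norm_mult)
    also have "... <= b * (C * (1 / (s + exp y))) * exp y" using gR[OF that] by (intro mult_right_mono) auto
    finally show ?thesis by simp
   qed
   show "norm (p (Complex y (- th'))) <= b * C * (exp y / (s + exp y))" "norm (p (Complex y th')) <= b * C * (exp y / (s + exp y))" for y
    by (rule pb; simp)+
   show "norm (f w) <= cf * exp (- Re w / 2)" if "\<bar>Im w\<bar> <= th" for w using cf[of w] that th by auto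
  qed (use thpi th' s in auto)
  \<comment> \<open>The inner integration: Cauchy's formula supplies \<open>g v\<close>, and
    \<open>Q v\<close> collects the other half of the resolvent identity.\<close>
  have key: "m (R (exp v) o\<^sub>L G) = g v * m (R (exp v)) - \<kappa> * Q v"
   if v: "v = Complex x t" and t: "ray th t" for v x t
  proof -
   have vs: "v \<in> co_strip \<omega>" unfolding v using Complex_in_co_strip[OF th(1) thpi(1) t] .
   have m2: "cfunctional (%T. m (R (exp v) o\<^sub>L T))" by (rule cfunctional_compose_right[OF m cbl[OF vs]])
   have ne: "cexp y t' ~= exp v" if t': "ray th' t'" for y t'
   proof
    assume eq: "cexp y t' = exp v"
    have "\<bar>t' - t\<bar> < 2 * pi" using t t' th' thpi unfolding abs_less_iff by linarith
    then have "Complex y t' = v" using exp_complex_eqI[of "Complex y t'" v] eq v by simp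
    then show False using t t' th' thpi v by auto
   qed
   have split: "g (Complex y t') * cexp y t' * m (R (exp v) o\<^sub>L R (cexp y t')) =
     m (R (exp v)) * (g (Complex y t') * cexp y t' / (cexp y t' - exp v)) - p (Complex y t') / (cexp y t' - exp v)"
    if t': "ray th' t'" for y t'
   proof -
    let ?u = "Complex y t'"
    have us: "?u \<in> co_strip \<omega>" by (rule Complex_in_co_strip[OF th'(3,4) t'])
    have "m (R (exp v)) - m (R (exp ?u)) = (exp ?u - exp v) * m (R (exp v) o\<^sub>L R (exp ?u))"
     unfolding cfunctionalD(4)[OF m, symmetric] ident[OF vs us] by (rule cfunctionalD(2)[OF m])
    then have "m (R (exp v) o\<^sub>L R (exp ?u)) = (m (R (exp v)) - m (R (exp ?u))) / (exp ?u - exp v)"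
     using ne[OF t', of y] by (simp add: field_simps)
    moreover have "a * e * ((M - N) / d) = M * (a * e / d) - a * e * N / d" for a e M N d :: complex
     by (simp add: diff_divide_distrib algebra_simps)
    ultimately show ?thesis unfolding p_def by simp
   qed
   have i1: "integrable lborel (%y. g (Complex y t') * cexp y t' / (cexp y t' - exp v))"
    if t': "ray th' t'" for t'
   proof (rule cauchy_kernel_integrable[where C = cg])
    show "continuous_on UNIV (%x. g (Complex x t'))" by (rule decays_line[OF g]) (use t' th' thpi in auto)
    show "norm (g (Complex x t')) <= cg * exp (- x / 2)" for x using cg[of "Complex x t'"] t' th' thpi by auto
   qed (rule ne[OF t'])
   have i2: "integrable lborel (%y. p (Complex y t') / (cexp y t' - exp v))"
    if t': "ray th' t'" for t'
   proof -
    have "integrable lborel (%y. (%u. g u * m (R (exp u))) (Complex y t') * cexp y t' / (cexp y t' - exp v))"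
    proof (rule cauchy_kernel_integrable[where C = "b * C * max 1 (1 / s)"])
     show "continuous_on UNIV (%x. g (Complex x t') * m (R (cexp x t')))"
      using t' th' thpi by (intro continuous_intros decays_line[OF g] functional_R_line_continuous[OF m th'(3,4)]) auto
     fix x
     have "norm (g (Complex x t') * m (R (cexp x t'))) <= b * (C * (1 / (s + exp x)))" by (rule gR[OF t'])
     also have "... <= b * (C * (max 1 (1 / s) * exp (- x / 2)))"
      using b0 C(1) by (intro mult_left_mono inverse_add_exp_le s)
     finally show "norm (g (Complex x t') * m (R (cexp x t'))) <= b * C * max 1 (1 / s) * exp (- x / 2)"
      by (simp only: mult.assoc)
    qed (rule ne[OF t'])
    then show ?thesis by (simp add: p_def mult_ac)
   qed
   have I: "(LINT y|lborel. g (Complex y (- th')) * cexp y (- th') / (cexp y (- th') - exp v)) -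
     (LINT y|lborel. g (Complex y th') * cexp y th' / (cexp y th' - exp v)) = 2 * pi * \<i> * g v"
   proof (rule cauchy_exp[where a = "-\<psi>" and b = \<psi> and C = cg])
    show "g holomorphic_on {w. - \<psi> < Im w \<and> Im w < \<psi>}" using gh by (rule holomorphic_on_subset) auto
    show "norm (g w) <= cg * exp (- Re w / 2)" if "- th' <= Im w" "Im w <= th'" for w using cg[of w] that th' by auto
   qed (use t th' thpi v \<psi> in auto)
   have J: "Q v = (LINT y|lborel. p (Complex y (- th')) / (cexp y (- th') - exp v)) -
     (LINT y|lborel. p (Complex y th') / (cexp y th' - exp v))"
    unfolding Q_def by (rule LINT_diff; rule i2; simp)
   have L: "(LINT y|lborel. g (Complex y t') * cexp y t' * m (R (exp v) o\<^sub>L R (cexp y t'))) =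
     m (R (exp v)) * (LINT y|lborel. g (Complex y t') * cexp y t' / (cexp y t' - exp v)) -
     (LINT y|lborel. p (Complex y t') / (cexp y t' - exp v))" if t': "ray th' t'" for t'
    unfolding split[OF t'] LINT_diff[OF integrable_mult_right[OF i1[OF t']] i2[OF t']]
     integral_mult_right_zero ..
   have "m (R (exp v) o\<^sub>L G) = \<kappa> * ((LINT y|lborel. g (Complex y (- th')) * cexp y (- th') * m (R (exp v) o\<^sub>L R (cexp y (- th')))) -
     (LINT y|lborel. g (Complex y th') * cexp y th' * m (R (exp v) o\<^sub>L R (cexp y th'))))"
    unfolding G_def \<kappa>_def by (rule fc_functional[OF g m2 th'(3,2,4)])
   also have "... = \<kappa> * (m (R (exp v)) * (2 * pi * \<i> * g v) - Q v)"
    unfolding L[OF disjI1[OF refl]] L[OF disjI2[OF refl]] I[symmetric] J by (simp add: algebra_simps)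
   also have "... = m (R (exp v)) * (\<kappa> * (2 * pi * \<i> * g v)) - \<kappa> * Q v" by (simp add: algebra_simps)
   finally show ?thesis unfolding \<kappa> by (simp add: mult.commute)
  qed
  have m1: "cfunctional (%T. m (T o\<^sub>L G))" by (rule cfunctional_compose_left[OF m])
  define a where "a t x = f (Complex x t) * cexp x t" for t x
  define A where "A t x = a t x * m (R (cexp x t) o\<^sub>L G)" for t x
  define B where "B t x = a t x * g (Complex x t) * m (R (cexp x t))" for t x
  \<comment> \<open>This is \<open>key\<close> multiplied by \<open>a t x\<close>. Integrated over
    both rays, its left side vanishes by \<open>zero\<close>, which identifies the integrals of
    \<open>A\<close> and \<open>B\<close>.\<close>
  have AB: "\<kappa> * (a t x * Q (Complex x t)) = B t x - A t x" if "ray th t" for t x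
   unfolding A_def B_def key[OF refl that] by (simp add: algebra_simps)
  have Ai: "integrable lborel (A t)" if "ray th t" for t
   using line_integrable[OF f m1 th thpi(1) that] by (simp add: A_def[abs_def] a_def)
  have Bi: "integrable lborel (B t)" if "ray th t" for t
   using line_integrable[OF fg m th thpi(1) that] by (simp add: B_def[abs_def] a_def mult_ac)
  have "0 = \<kappa> * (LINT x|lborel. a (- th) x * Q (Complex x (- th)) - a th x * Q (Complex x th))"
   using zero by (simp add: a_def)
  also have "... = (LINT x|lborel. \<kappa> * (a (- th) x * Q (Complex x (- th)) - a th x * Q (Complex x th)))"
   by (rule integral_mult_right_zero[symmetric])
  also have "... = (LINT x|lborel. (B (- th) x - A (- th) x) - (B th x - A th x))"
   by (simp only: right_diff_distrib AB disjI1[OF refl] disjI2[OF refl])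
  also have "... = ((LINT x|lborel. B (- th) x) - (LINT x|lborel. A (- th) x)) - ((LINT x|lborel. B th x) - (LINT x|lborel. A th x))"
   using Ai[of th] Ai[of "-th"] Bi[of th] Bi[of "-th"] by (simp add: LINT_diff)
  finally have eq: "(LINT x|lborel. A (- th) x) - (LINT x|lborel. A th x) = (LINT x|lborel. B (- th) x) - (LINT x|lborel. B th x)"
   by (simp add: algebra_simps)
  have "m (fc R th f o\<^sub>L G) = \<kappa> * ((LINT x|lborel. A (- th) x) - (LINT x|lborel. A th x))"
   unfolding A_def a_def \<kappa>_def by (rule fc_functional[OF f m1 th thpi(1)])
  also have "... = \<kappa> * ((LINT x|lborel. B (- th) x) - (LINT x|lborel. B th x))" unfolding eq ..
  also have "... = m (fc R th (%w. f w * g w))"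
   unfolding fc_functional[OF fg m th thpi(1)] B_def a_def \<kappa>_def by (simp only: mult_ac)
  finally show "m (fc R th f o\<^sub>L G) = m (fc R th (%w. f w * g w))" .
 qed
 then show ?thesis unfolding G .
qed

text \<open>The contour is closed on the far side, across the negative axis, where \<open>R\<close>
  is holomorphic. The only pole there is \<lambda> = \<open>- 1 / \<rho>\<close>, that is
  \<open>w0\<close> on the line \<open>Im w = pi\<close>. By periodicity the line
  \<open>Im w = 2 * pi - th\<close> is the ray of angle \<open>- th\<close>.\<close>

lemma fc_resolvent:
 assumes \<rho>: "\<rho> > 0" and f: "decays \<psi> (%w. 1 / (1 + of_real \<rho> * exp w))" and th: "\<omega> < th" "th < \<psi>" "\<psi> <= pi"
 shows "fc R th (%w. 1 / (1 + of_real \<rho> * exp w)) = (- 1 / of_real \<rho>) *\<^sub>C R (of_real (- 1 / \<rho>))"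
proof (rule cfunctional_eqI)
 fix m :: "('a \<Rightarrow>\<^sub>L 'a) => complex" assume m: "cfunctional m"
 have thpi: "th < pi" "0 < th" using th ang by auto
 obtain C where C: "0 <= C" "!!w. th <= \<bar>Im w\<bar> ==> \<bar>Im w\<bar> <= 2 * pi - th ==> norm (m (R (exp w))) <= C * (1 / (s + exp (Re w)))"
  using functional_R_bound[OF m th(1) thpi(1)] by blast
 define w0 where "w0 = Complex (- ln \<rho>) pi"
 have ew0: "exp w0 = of_real (- 1 / \<rho>)"
  using \<rho> by (simp add: w0_def exp_eq_polar exp_minus divide_inverse)
 define k where "k w = m (R (exp w))" for w
 have "(LINT x|lborel. k (Complex x th) * cexp x th / (cexp x th - exp w0)) -
   (LINT x|lborel. k (Complex x (2 * pi - th)) * cexp x (2 * pi - th) / (cexp x (2 * pi - th) - exp w0)) = 2 * pi * \<i> * k w0"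
 proof (rule cauchy_exp[where a = \<omega> and b = "2 * pi - \<omega>" and C = "C * max 1 (1 / s)"])
  show "k holomorphic_on {w. \<omega> < Im w \<and> Im w < 2 * pi - \<omega>}"
   unfolding k_def using R_functional_holomorphic[OF m] by (rule holomorphic_on_subset) (use ang in \<open>auto simp: co_strip_def\<close>)
  fix w assume w: "th <= Im w" "Im w <= 2 * pi - th"
  have "norm (k w) <= C * (1 / (s + exp (Re w)))" unfolding k_def using w thpi by (intro C(2)) auto
  also have "... <= C * (max 1 (1 / s) * exp (- Re w / 2))" using C(1) by (intro mult_left_mono inverse_add_exp_le s)
  finally show "norm (k w) <= C * max 1 (1 / s) * exp (- Re w / 2)" by (simp only: mult.assoc)
 qed (use th thpi ang in \<open>auto simp: w0_def\<close>)
 moreover have "cexp x (2 * pi - th) = cexp x (- th)" for x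
  by (simp add: exp_eq_polar complex_eq_iff)
 then have "k (Complex x (2 * pi - th)) * cexp x (2 * pi - th) / (cexp x (2 * pi - th) - exp w0) =
   k (Complex x (- th)) * cexp x (- th) / (cexp x (- th) - exp w0)" for x
  by (simp add: k_def)
 ultimately have *: "(LINT x|lborel. k (Complex x (- th)) * cexp x (- th) / (cexp x (- th) - exp w0)) -
   (LINT x|lborel. k (Complex x th) * cexp x th / (cexp x th - exp w0)) = - (2 * pi * \<i> * k w0)"
  by (simp add: algebra_simps)
 have e: "1 / (1 + of_real \<rho> * exp u) * exp u * m (R (exp u)) = (1 / of_real \<rho>) * (k u * exp u / (exp u - exp w0))" for u
 proof -
  have "1 + of_real \<rho> * exp u = of_real \<rho> * (exp u - exp w0)" using \<rho> by (simp add: ew0 algebra_simps)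
  then show ?thesis by (simp add: k_def)
 qed
 show "m (fc R th (%w. 1 / (1 + of_real \<rho> * exp w))) = m ((- 1 / of_real \<rho>) *\<^sub>C R (of_real (- 1 / \<rho>)))"
  unfolding fc_functional[OF f m th(1,2) thpi(1)] e integral_mult_right_zero right_diff_distrib[symmetric] * cfunctionalD(2)[OF m]
  unfolding k_def ew0 by simp
qed

end

section \<open>Exponentials of the square root in the coordinate w\<close>

definition pexp :: "int => complex => complex => complex" where
 "pexp j z w = exp (of_int j * w / 2 - z * exp (w / 2))"

text \<open>The modulus of \<open>z\<close> reduced by the worst angle that
  \<open>z * exp (w / 2)\<close> can reach while \<open>w\<close> stays in the strip of half-width
  \<open>th\<close>. It governs the decay of \<open>pexp\<close> in \<open>w\<close>.\<close>

definition sect_mod :: "real => complex => real" where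
 "sect_mod th z = norm z * cos (\<bar>Arg z\<bar> + th / 2)"

lemma pexp_mult: "pexp i z w * pexp j z' w = pexp (i + j) (z + z') w"
 unfolding pexp_def exp_add[symmetric] by (simp add: algebra_simps add_divide_distrib)

lemma sect_mod_le:
 assumes "\<bar>Im w\<bar> <= th" "\<bar>Arg z\<bar> + th / 2 <= pi"
 shows "sect_mod th z * exp (Re w / 2) <= Re (z * exp (w / 2))"
proof -
 have "z * exp (w / 2) = of_real (norm z * exp (Re w / 2)) * cis (Arg z + Im w / 2)"
  using rcis_cmod_Arg[of z] by (simp add: exp_eq_polar rcis_def cis_mult[symmetric] mult_ac)
 then have "Re (z * exp (w / 2)) = norm z * exp (Re w / 2) * cos (\<bar>Arg z + Im w / 2\<bar>)" by simp
 moreover have "cos (\<bar>Arg z\<bar> + th / 2) <= cos \<bar>Arg z + Im w / 2\<bar>"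
  using assms by (intro cos_monotone_0_pi_le) auto
 ultimately show ?thesis unfolding sect_mod_def
  by (simp add: mult_left_mono mult.assoc mult.commute[of "exp _"])
qed

lemma norm_pexp_le:
 assumes "\<bar>Im w\<bar> <= th" "\<bar>Arg z\<bar> + th / 2 <= pi"
 shows "norm (pexp j z w) <= exp (of_int j * Re w / 2 - sect_mod th z * exp (Re w / 2))"
 using sect_mod_le[OF assms] by (simp add: pexp_def)

lemma sect_mod_pos: "z ~= 0 ==> 0 <= th ==> \<bar>Arg z\<bar> + th / 2 < pi / 2 ==> 0 < sect_mod th z"
 unfolding sect_mod_def by (intro mult_pos_pos cos_gt_zero_pi) auto

text \<open>A single term of the exponential series; used wherever exponential decay is exchanged
  for a power.\<close>

lemma power_exp_le_fact:
 fixes v k :: real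
 assumes "v >= 0" "k > 0"
 shows "v ^ n * exp (- k * v) <= fact n / k ^ n"
proof -
 have "(k * v) ^ n / fact n <= exp (k * v)"
 proof -
  have "(\<Sum>i\<in>{n}. (k * v) ^ i /\<^sub>R fact i) <= (\<Sum>i. (k * v) ^ i /\<^sub>R fact i)"
   using assms by (intro sum_le_suminf summable_exp_generic) auto
  then show ?thesis by (simp add: exp_def divide_inverse mult.commute)
 qed
 then show ?thesis using assms by (simp add: exp_minus field_simps power_mult_distrib)
qed

lemma exp_pexp_decay:
 fixes k x :: real
 assumes k: "k > 0" and j: "j >= - 1"
 shows "exp (of_int j * x / 2 - k * exp (x / 2)) <= fact (nat (j + 1)) / k ^ nat (j + 1) * exp (- x / 2)"
proof -
 have "exp (x / 2) ^ nat (j + 1) * exp (- k * exp (x / 2)) <= fact (nat (j + 1)) / k ^ nat (j + 1)"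
  by (rule power_exp_le_fact) (use k in auto)
 moreover have "exp (x / 2) ^ nat (j + 1) = exp ((of_int j + 1) * x / 2)"
  using j by (simp add: exp_of_nat_mult[symmetric])
 ultimately have "exp (- x / 2) * (exp ((of_int j + 1) * x / 2) * exp (- k * exp (x / 2))) <= exp (- x / 2) * (fact (nat (j + 1)) / k ^ nat (j + 1))"
  by (intro mult_left_mono) auto
 moreover have "exp (- x / 2) * (exp ((of_int j + 1) * x / 2) * exp (- k * exp (x / 2))) = exp (of_int j * x / 2 - k * exp (x / 2))"
  unfolding exp_add[symmetric] by (simp add: algebra_simps add_divide_distrib)
 ultimately show ?thesis by (simp add: mult.commute)
qed

text \<open>Near \<lambda> = 0 the function has size \<open>|\<lambda>|^(j/2)\<close>, which belongs
  to the class precisely for \<open>j >= - 1\<close>. At infinity the exponential beats every power,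
  because \<open>z * exp (w / 2)\<close> stays in a proper subsector of the right
  half-plane.\<close>

lemma decays_pexp:
 assumes z: "z ~= 0" and \<psi>: "0 <= \<psi>" "\<bar>Arg z\<bar> + \<psi> / 2 < pi / 2" and j: "j >= - 1"
 shows "decays \<psi> (pexp j z)"
proof -
 let ?k = "sect_mod \<psi> z"
 have k: "?k > 0" by (rule sect_mod_pos[OF z \<psi>])
 have "norm (pexp j z w) <= fact (nat (j + 1)) / ?k ^ nat (j + 1) * exp (- Re w / 2)" if "\<bar>Im w\<bar> < \<psi>" for w
 proof -
  have "\<bar>Arg z\<bar> + \<psi> / 2 <= pi" using \<psi>(2) pi_gt_zero by linarith
  then have "norm (pexp j z w) <= exp (of_int j * Re w / 2 - ?k * exp (Re w / 2))"
   using that by (intro norm_pexp_le) auto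
  also have "... <= fact (nat (j + 1)) / ?k ^ nat (j + 1) * exp (- Re w / 2)" by (rule exp_pexp_decay[OF k j])
  finally show ?thesis .
 qed
 moreover have "pexp j z holomorphic_on {w. \<bar>Im w\<bar> < \<psi>}"
  unfolding pexp_def[abs_def] by (intro holomorphic_intros) auto
 ultimately show ?thesis unfolding decays_def by blast
qed

lemma norm_pexp0_le_1:
 assumes "\<bar>Im w\<bar> < \<psi>" "0 <= \<psi>" "\<bar>Arg z\<bar> + \<psi> / 2 < pi / 2"
 shows "norm (pexp 0 z w) <= 1"
proof -
 have "0 <= sect_mod \<psi> z" unfolding sect_mod_def using assms by (intro mult_nonneg_nonneg cos_ge_zero) auto
 then have "0 <= sect_mod \<psi> z * exp (Re w / 2)" by simp
 then have "exp (of_int 0 * Re w / 2 - sect_mod \<psi> z * exp (Re w / 2)) <= 1" by simp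
 moreover have "\<bar>Arg z\<bar> + \<psi> / 2 <= pi" using assms(3) pi_gt_zero by linarith
 then have "norm (pexp 0 z w) <= exp (of_int 0 * Re w / 2 - sect_mod \<psi> z * exp (Re w / 2))"
  using assms(1) by (intro norm_pexp_le) auto
 ultimately show ?thesis by linarith
qed

lemma one_plus_exp_bound:
 assumes \<rho>: "\<rho> >= 0" and w: "\<bar>Im w\<bar> <= \<psi>" "\<psi> < pi"
 shows "cos (\<psi> / 2) * (1 + \<rho> * exp (Re w)) <= norm (1 + of_real \<rho> * exp w)"
proof -
 have "cos (\<psi> / 2) <= cos \<bar>Im w / 2\<bar>" using w by (intro cos_monotone_0_pi_le) auto
 then have "cos (\<psi> / 2) * (1 + \<rho> * exp (Re w)) <= \<bar>cos (Im w / 2)\<bar> * (1 + \<rho> * exp (Re w))"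
  unfolding cos_abs_real using \<rho> by (intro mult_right_mono order_trans[OF _ abs_ge_self]) auto
 also have "... <= norm (1 + of_real (\<rho> * exp (Re w)) * cis (Im w))" by (rule cos_half_bound) (use \<rho> in auto)
 also have "of_real (\<rho> * exp (Re w)) * cis (Im w) = of_real \<rho> * exp w" by (simp add: exp_eq_polar[of w] mult.assoc)
 finally show ?thesis .
qed

lemma decays_resolvent:
 assumes \<rho>: "\<rho> > 0" and \<psi>: "0 <= \<psi>" "\<psi> < pi"
 shows "decays \<psi> (%w. 1 / (1 + of_real \<rho> * exp w))"
  and "\<bar>Im w\<bar> < \<psi> ==> norm (1 / (1 + of_real \<rho> * exp w)) <= 1 / cos (\<psi> / 2)"
proof -
 have c: "cos (\<psi> / 2) > 0" using \<psi> by (intro cos_gt_zero_pi) auto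
 have le: "norm (1 / (1 + of_real \<rho> * exp w)) <= (1 / cos (\<psi> / 2)) * (1 / (1 + \<rho> * exp (Re w)))" if "\<bar>Im w\<bar> < \<psi>" for w
 proof -
  have "cos (\<psi> / 2) * (1 + \<rho> * exp (Re w)) <= norm (1 + of_real \<rho> * exp w)"
   by (rule one_plus_exp_bound) (use that \<rho> \<psi> in auto)
  moreover have "cos (\<psi> / 2) * (1 + \<rho> * exp (Re w)) > 0" using c \<rho> by (simp add: add_pos_pos)
  ultimately have "1 / norm (1 + of_real \<rho> * exp w) <= 1 / (cos (\<psi> / 2) * (1 + \<rho> * exp (Re w)))"
   by (intro frac_le) auto
  then show ?thesis by (simp add: norm_divide)
 qed
 have ne: "1 + of_real \<rho> * exp w ~= 0" if "\<bar>Im w\<bar> < \<psi>" for w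
 proof -
  have "cos (\<psi> / 2) * (1 + \<rho> * exp (Re w)) > 0" using c \<rho> by (simp add: add_pos_pos)
  then show ?thesis using one_plus_exp_bound[of \<rho> w \<psi>] that \<rho> \<psi> by auto
 qed
 have "norm (1 / (1 + of_real \<rho> * exp w)) <= ((1 / cos (\<psi> / 2)) * (1 / \<rho>) * max 1 \<rho>) * exp (- Re w / 2)" if w: "\<bar>Im w\<bar> < \<psi>" for w
 proof -
  have "1 / (1 + \<rho> * exp (Re w)) = (1 / \<rho>) * (1 / (1 / \<rho> + exp (Re w)))" using \<rho> by (simp add: field_simps)
  also have "... <= (1 / \<rho>) * (max 1 (1 / (1 / \<rho>)) * exp (- Re w / 2))"
   using \<rho> by (intro mult_left_mono inverse_add_exp_le) auto
  finally have "(1 / cos (\<psi> / 2)) * (1 / (1 + \<rho> * exp (Re w))) <= (1 / cos (\<psi> / 2)) * ((1 / \<rho>) * (max 1 \<rho> * exp (- Re w / 2)))"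
   using c by (intro mult_left_mono) auto
  with le[OF w] show ?thesis by (simp only: mult.assoc)
 qed
 moreover have "(%w. 1 / (1 + of_real \<rho> * exp w)) holomorphic_on {w. \<bar>Im w\<bar> < \<psi>}"
  using ne by (intro holomorphic_intros) auto
 ultimately show "decays \<psi> (%w. 1 / (1 + of_real \<rho> * exp w))" unfolding decays_def by blast
 assume w: "\<bar>Im w\<bar> < \<psi>"
 have "(1 / cos (\<psi> / 2)) * (1 / (1 + \<rho> * exp (Re w))) <= (1 / cos (\<psi> / 2)) * 1"
  using c \<rho> by (intro mult_left_mono) (auto simp: add_pos_pos divide_le_eq)
 with le[OF w] show "norm (1 / (1 + of_real \<rho> * exp w)) <= 1 / cos (\<psi> / 2)" by simp
qed

lemma decays_inv_sqrt: "decays \<psi> (%w. exp (- w / 2))"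
 unfolding decays_def by (auto intro!: holomorphic_intros exI[of _ 1])

section \<open>Resolvents of sectorial operators\<close>

lemma dom_minus_op [simp]: "dom (minus_op z A) = dom A"
 and dom_op_plus [simp]: "dom (op_plus A c) = dom A"
 by (auto simp: minus_op_def op_plus_def dom_def)

lemma app_minus_op [simp]: "x \<in> dom A ==> app (minus_op z A) x = z *\<^sub>C x - app A x"
 and app_op_plus [simp]: "x \<in> dom A ==> app (op_plus A c) x = app A x + c *\<^sub>C x"
 by (auto simp: app_def minus_op_def op_plus_def)

lemma inv_op:
 assumes "boundedly_invertible B"
 shows "blinfun_apply (inv_op B) y \<in> dom B" "app B (blinfun_apply (inv_op B) y) = y"
  "x \<in> dom B ==> blinfun_apply (inv_op B) (app B x) = x"
proof -
 have bij: "bij_betw (app B) (dom B) UNIV" and bl: "bounded_linear (inv_into (dom B) (app B))"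
  using assms by (auto simp: boundedly_invertible_def)
 have eq: "blinfun_apply (inv_op B) = inv_into (dom B) (app B)"
  unfolding inv_op_def by (rule bounded_linear_Blinfun_apply[OF bl])
 show "blinfun_apply (inv_op B) y \<in> dom B" "app B (blinfun_apply (inv_op B) y) = y"
  unfolding eq using bij by (auto simp: bij_betw_def inv_into_into f_inv_into_f)
 show "x \<in> dom B ==> blinfun_apply (inv_op B) (app B x) = x"
  unfolding eq using bij by (auto simp: bij_betw_def)
qed

lemma boundedly_invertibleI:
 assumes 1: "!!y. blinfun_apply S y \<in> dom B" "!!y. app B (blinfun_apply S y) = y"
  and 2: "!!x. x \<in> dom B ==> blinfun_apply S (app B x) = x"
 shows "boundedly_invertible B" "inv_op B = S"
proof -
 have inj: "inj_on (app B) (dom B)" by (rule inj_on_inverseI[of _ "blinfun_apply S"]) (rule 2)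
 have "app B ` dom B = UNIV" using 1 by (metis UNIV_eq_I imageI)
 with inj have bij: "bij_betw (app B) (dom B) UNIV" by (simp add: bij_betw_def)
 have eq: "inv_into (dom B) (app B) = blinfun_apply S"
  using 1 inv_into_f_f[OF inj] by (metis ext)
 show "boundedly_invertible B" unfolding boundedly_invertible_def eq using bij blinfun.bounded_linear_right by blast
 show "inv_op B = S" unfolding inv_op_def eq by (rule blinfun_apply_inverse)
qed

lemma linear_operatorD:
 assumes "linear_operator A"
 shows "0 \<in> dom A" "x \<in> dom A ==> y \<in> dom A ==> x + y \<in> dom A"
  "x \<in> dom A ==> y \<in> dom A ==> app A (x + y) = app A x + app A y"
  "x \<in> dom A ==> c *\<^sub>C x \<in> dom A" "x \<in> dom A ==> app A (c *\<^sub>C x) = c *\<^sub>C app A x"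
 using assms unfolding linear_operator_def by blast+

lemma linear_operator_op_plus:
 assumes A: "linear_operator A"
 shows "linear_operator (op_plus A c)"
 unfolding linear_operator_def dom_op_plus
 using linear_operatorD[OF A]
 by (auto simp: scaleC_add_right scaleC_scaleC mult.commute algebra_simps)

lemma resolvent:
 assumes "z \<in> resolvent_set A"
 shows "blinfun_apply (resolvent z A) y \<in> dom A"
  "z *\<^sub>C blinfun_apply (resolvent z A) y - app A (blinfun_apply (resolvent z A) y) = y"
  "x \<in> dom A ==> blinfun_apply (resolvent z A) (z *\<^sub>C x - app A x) = x"
 using inv_op[of "minus_op z A"] assms unfolding resolvent_set_def resolvent_def by auto

lemma resolvent_cblinfuns:
 assumes A: "linear_operator A" and z: "z \<in> resolvent_set A"
 shows "resolvent z A \<in> cblinfuns"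
 unfolding cblinfuns_def
proof (intro CollectI allI)
 fix c y
 let ?x = "blinfun_apply (resolvent z A) y"
 have x: "?x \<in> dom A" by (rule resolvent(1)[OF z])
 have "z *\<^sub>C c *\<^sub>C ?x - app A (c *\<^sub>C ?x) = c *\<^sub>C (z *\<^sub>C ?x - app A ?x)"
  unfolding linear_operatorD(5)[OF A x] scaleC_diff_right by (simp add: scaleC_scaleC mult.commute)
 then have "z *\<^sub>C c *\<^sub>C ?x - app A (c *\<^sub>C ?x) = c *\<^sub>C y" unfolding resolvent(2)[OF z] .
 then show "blinfun_apply (resolvent z A) (c *\<^sub>C y) = c *\<^sub>C ?x"
  using resolvent(3)[OF z linear_operatorD(4)[OF A x, of c]] by simp
qed

lemma cblinfunsD: "T \<in> cblinfuns ==> blinfun_apply T (c *\<^sub>C x) = c *\<^sub>C blinfun_apply T x"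
 by (simp add: cblinfuns_def)

lemma resolvent_identity:
 assumes A: "linear_operator A" and z: "z \<in> resolvent_set A" and w: "w \<in> resolvent_set A"
 shows "resolvent z A - resolvent w A = (w - z) *\<^sub>C (resolvent z A o\<^sub>L resolvent w A)"
proof (rule blinfun_eqI)
 fix y
 let ?x = "blinfun_apply (resolvent w A) y"
 have x: "?x \<in> dom A" by (rule resolvent(1)[OF w])
 have "z *\<^sub>C ?x - app A ?x = (w *\<^sub>C ?x - app A ?x) - (w - z) *\<^sub>C ?x" by (simp add: scaleC_diff_left)
 also have "... = y - (w - z) *\<^sub>C ?x" unfolding resolvent(2)[OF w] ..
 finally have "?x = blinfun_apply (resolvent z A) (y - (w - z) *\<^sub>C ?x)" using resolvent(3)[OF z x] by simp
 also have "... = blinfun_apply (resolvent z A) y - (w - z) *\<^sub>C blinfun_apply (resolvent z A) ?x"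
  by (simp add: blinfun.diff_right cblinfunsD[OF resolvent_cblinfuns[OF A z]])
 finally show "blinfun_apply (resolvent z A - resolvent w A) y = blinfun_apply ((w - z) *\<^sub>C (resolvent z A o\<^sub>L resolvent w A)) y"
  by (simp add: blinfun.diff_left scaleC_blinfun.rep_eq algebra_simps)
qed

text \<open>The equation \<open>z x - A x = y\<close> is rewritten as a fixed point equation whose
  map is a contraction with factor 1/2. Existence, uniqueness and the factor 2 in the norm all come
  from the fixed point, and no series is summed.\<close>

lemma resolvent_neumann:
 fixes A :: "'a::complex_banach \<rightharpoonup> 'a"
 assumes A: "linear_operator A" and w: "w \<in> resolvent_set A" and zw: "norm (resolvent w A) * norm (z - w) <= 1 / 2"
 shows "z \<in> resolvent_set A" "norm (resolvent z A) <= 2 * norm (resolvent w A)"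
proof -
 let ?R = "resolvent w A"
 define F where "F y x = blinfun_apply ?R (y - (z - w) *\<^sub>C x)" for y x
 have fix_iff: "F y x = x \<longleftrightarrow> x \<in> dom A \<and> z *\<^sub>C x - app A x = y" for x y
 proof
  assume F: "F y x = x"
  then have x: "x \<in> dom A" unfolding F_def using resolvent(1)[OF w] by metis
  have "w *\<^sub>C x - app A x = y - (z - w) *\<^sub>C x"
   using resolvent(2)[OF w, of "y - (z - w) *\<^sub>C x"] F unfolding F_def by simp
  then have "z *\<^sub>C x - app A x = y" by (simp add: scaleC_diff_left algebra_simps)
  with x show "x \<in> dom A \<and> z *\<^sub>C x - app A x = y" by simp
 next
  assume x: "x \<in> dom A \<and> z *\<^sub>C x - app A x = y"
  then have "y - (z - w) *\<^sub>C x = w *\<^sub>C x - app A x" by (auto simp: scaleC_diff_left)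
  then show "F y x = x" unfolding F_def using resolvent(3)[OF w] x by simp
 qed
 have half: "norm (blinfun_apply ?R ((z - w) *\<^sub>C x)) <= norm x / 2" for x
 proof -
  have "norm (blinfun_apply ?R ((z - w) *\<^sub>C x)) <= norm ?R * norm ((z - w) *\<^sub>C x)" by (rule norm_blinfun)
  also have "... = norm ?R * norm (z - w) * norm x" by (simp add: norm_scaleC mult.assoc)
  also have "... <= 1 / 2 * norm x" by (intro mult_right_mono zw) auto
  finally show ?thesis by simp
 qed
 have uniq: "\<exists>!x. F y x = x" for y
 proof -
  have lip: "dist (F y x) (F y x') <= 1 / 2 * dist x x'" for x x'
  proof -
   have "F y x - F y x' = - blinfun_apply ?R ((z - w) *\<^sub>C (x - x'))"
    by (simp add: F_def blinfun.diff_right scaleC_diff_right)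
   then show ?thesis using half[of "x - x'"] by (simp add: dist_norm)
  qed
  show ?thesis by (rule banach_fix_type[where c = "1/2"]) (use lip in auto)
 qed
 define S where "S y = (THE x. F y x = x)" for y
 have S: "F y (S y) = S y" for y unfolding S_def by (rule theI'[OF uniq])
 have SI: "S y = x" if "F y x = x" for x y using uniq[of y] S[of y] that by blast
 have Sd: "S y \<in> dom A" "z *\<^sub>C S y - app A (S y) = y" for y using S[of y] unfolding fix_iff by auto
 have Sb: "norm (S y) <= norm y * (2 * norm ?R)" for y
 proof -
  have "S y = blinfun_apply ?R y - blinfun_apply ?R ((z - w) *\<^sub>C S y)" using S[of y] unfolding F_def by (simp add: blinfun.diff_right)
  then have "norm (S y) <= norm (blinfun_apply ?R y) + norm (blinfun_apply ?R ((z - w) *\<^sub>C S y))"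
   by (metis norm_triangle_ineq4)
  then have "norm (S y) <= norm ?R * norm y + norm (S y) / 2" using norm_blinfun[of ?R y] half[of "S y"] by linarith
  then show ?thesis by (simp add: mult.commute)
 qed
 have bl: "bounded_linear S"
 proof (rule bounded_linear_intro[OF _ _ Sb])
  fix y y' and r :: real
  show "S (y + y') = S y + S y'"
   by (rule SI) (simp add: fix_iff linear_operatorD[OF A] Sd scaleC_add_right[of z] add_diff_add[of "z *\<^sub>C _"])
  show "S (r *\<^sub>R y) = r *\<^sub>R S y"
   unfolding scaleR_scaleC
  proof (rule SI)
   have "z *\<^sub>C complex_of_real r *\<^sub>C S y - complex_of_real r *\<^sub>C app A (S y) = complex_of_real r *\<^sub>C (z *\<^sub>C S y - app A (S y))"
    by (simp add: scaleC_diff_right scaleC_scaleC mult.commute)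
   then show "F (complex_of_real r *\<^sub>C y) (complex_of_real r *\<^sub>C S y) = complex_of_real r *\<^sub>C S y"
    by (simp add: fix_iff linear_operatorD[OF A] Sd)
  qed
 qed
 define T where "T = Blinfun S"
 have T: "blinfun_apply T = S" unfolding T_def by (rule bounded_linear_Blinfun_apply[OF bl])
 have *: "boundedly_invertible (minus_op z A)" "inv_op (minus_op z A) = T"
  by (rule boundedly_invertibleI[of T]; use Sd SI fix_iff in \<open>auto simp: T\<close>)+
 then show "z \<in> resolvent_set A" by (simp add: resolvent_set_def)
 have Tz: "resolvent z A = T" using *(2) by (simp add: resolvent_def)
 show "norm (resolvent z A) <= 2 * norm ?R"
  unfolding Tz by (rule norm_blinfun_bound) (use Sb in \<open>auto simp: T mult.commute\<close>)
qed

lemma Re_eq_norm_cos_Arg: "Re z = norm z * cos (Arg z)"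
 using rcis_cmod_Arg[of z] by (metis Re_rcis)

text \<open>This description is valid for obtuse angles too and turns questions about arguments into
  norm inequalities.\<close>

lemma sector_iff:
 assumes "0 < \<phi>" "\<phi> < pi"
 shows "z \<in> sector \<phi> \<longleftrightarrow> z ~= 0 \<and> cos \<phi> * norm z < Re z"
proof -
 have "z \<in> sector \<phi> \<longleftrightarrow> z ~= 0 \<and> \<bar>Arg z\<bar> < \<phi>"
 proof (cases "z \<in> \<real>\<^sub>\<le>\<^sub>0 \<and> z ~= 0")
  case True
  then have "Arg z = pi" by (auto simp: complex_nonpos_Reals_iff Arg_eq_pi complex_eq_iff)
  then show ?thesis using True assms by (auto simp: sector_def)
 next
  case False
  then show ?thesis using assms by (auto simp: sector_def)
 qed
 also have "... \<longleftrightarrow> z ~= 0 \<and> cos \<phi> < cos \<bar>Arg z\<bar>"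
  using assms Arg_le_pi[of z] mpi_less_Arg[of z] by (subst cos_mono_less_eq) auto
 also have "... \<longleftrightarrow> z ~= 0 \<and> cos \<phi> * norm z < Re z"
  unfolding Re_eq_norm_cos_Arg[of z] cos_abs_real by (auto simp: mult.commute mult_less_cancel_left_pos)
 finally show ?thesis .
qed

lemma sector_mono: "0 <= th ==> th <= \<phi> ==> \<phi> < pi ==> sector th \<subseteq> sector \<phi>"
 by (auto simp: sector_def complex_nonpos_Reals_iff Arg_of_real)

lemma sector_add_pos:
 assumes \<phi>: "0 < \<phi>" "\<phi> < pi" and u: "u \<in> sector \<phi>" and s: "s >= 0"
 shows "u + of_real s \<in> sector \<phi>"
proof -
 have u: "u ~= 0" "cos \<phi> * norm u < Re u" using u sector_iff[OF \<phi>] by auto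
 have "cos \<phi> * norm (u + of_real s) <= cos \<phi> * norm u + s"
 proof (cases "cos \<phi> >= 0")
  case True
  have "cos \<phi> * norm (u + of_real s) <= cos \<phi> * (norm u + s)"
   using True s norm_triangle_ineq[of u "of_real s"] by (intro mult_left_mono) auto
  also have "... <= cos \<phi> * norm u + 1 * s" unfolding distrib_left by (intro add_left_mono mult_right_mono s) auto
  finally show ?thesis by simp
 next
  case False
  have "norm u - s <= norm (u + of_real s)" using s norm_triangle_ineq4[of "u + of_real s" "of_real s"] by simp
  then have "cos \<phi> * norm (u + of_real s) <= cos \<phi> * (norm u - s)" using False by (intro mult_left_mono_neg) auto
  also have "... = cos \<phi> * norm u + (- cos \<phi>) * s" by (simp add: algebra_simps)
  also have "... <= cos \<phi> * norm u + 1 * s"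
   using cos_ge_minus_one[of \<phi>] by (intro add_left_mono mult_right_mono s) auto
  finally show ?thesis by simp
 qed
 then have less: "cos \<phi> * norm (u + of_real s) < Re (u + of_real s)" using u by simp
 moreover have "u + of_real s ~= 0"
 proof
  assume e: "u + of_real s = 0"
  show False using less unfolding e by simp
 qed
 ultimately show ?thesis using sector_iff[OF \<phi>] by blast
qed

lemma zero_in_closure_sector:
 assumes "0 <= \<phi>" "\<phi> < pi" shows "0 \<in> closure (sector \<phi>)"
proof -
 have "(%n. complex_of_real (inverse (real (Suc n)))) \<longlonglongrightarrow> of_real 0"
  by (intro tendsto_of_real LIMSEQ_inverse_real_of_nat)
 moreover have "complex_of_real r \<in> sector 0" if "r > 0" for r using that by (simp add: sector_def)
 then have "complex_of_real (inverse (real (Suc n))) \<in> sector 0" for n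
  by (metis inverse_positive_iff_positive of_nat_0_less_iff zero_less_Suc)
 then have "complex_of_real (inverse (real (Suc n))) \<in> sector \<phi>" for n using sector_mono[of 0 \<phi>] assms by blast
 ultimately show ?thesis unfolding closure_sequential
  by (intro exI[of _ "%n. complex_of_real (inverse (real (Suc n)))"]) simp
qed

lemma closure_sector_subset:
 assumes "0 <= th" "th < \<phi>" "\<phi> < pi"
 shows "closure (sector th) \<subseteq> insert 0 (sector \<phi>)"
proof -
 have "sector th \<subseteq> {z. cos th * norm z <= Re z}"
 proof (cases "th = 0")
  case True
  then show ?thesis by (auto simp: sector_def)
 next
  case False
  then have "0 < th" "th < pi" using assms by auto
  then show ?thesis using sector_iff by (blast intro: less_imp_le)
 qed
 moreover have "closed {z. cos th * norm z <= Re z}" by (intro closed_Collect_le continuous_intros)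
 ultimately have "closure (sector th) \<subseteq> {z. cos th * norm z <= Re z}" by (rule closure_minimal)
 moreover have "z \<in> sector \<phi>" if "cos th * norm z <= Re z" "z ~= 0" for z
 proof -
  have "cos \<phi> < cos th" using assms by (intro cos_monotone_0_pi) auto
  then have "cos \<phi> * norm z < cos th * norm z" using that by (intro mult_strict_right_mono) auto
  then have "cos \<phi> * norm z < Re z" using that(1) by linarith
  then show ?thesis using sector_iff[of \<phi> z] that(2) assms by linarith
 qed
 ultimately show ?thesis by blast
qed

lemma exp_notin_sector:
 assumes "0 < th" "th < pi" "th <= \<bar>Im w\<bar>" "\<bar>Im w\<bar> <= 2 * pi - th"
 shows "exp w \<notin> sector th"
proof -
 have "cos (Im w) <= cos th"
 proof (cases "\<bar>Im w\<bar> <= pi")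
  case True
  have "cos \<bar>Im w\<bar> <= cos th" using assms True by (intro cos_monotone_0_pi_le) auto
  then show ?thesis by simp
 next
  case False
  have "cos (2 * pi - \<bar>Im w\<bar>) <= cos th" using assms False by (intro cos_monotone_0_pi_le) auto
  then show ?thesis by simp
 qed
 then show ?thesis using assms sector_iff[of th "exp w"] by (simp add: Re_exp mult.commute)
qed

text \<open>The set under the infimum in \<open>sect_angle\<close>. It has to be shown nonempty
  before the infimum carries any information.\<close>

definition angles :: "('a::complex_normed_vector \<rightharpoonup> 'a) => real set" where
 "angles A = {th. 0 <= th \<and> th < pi \<and> spectrum A \<subseteq> closure (sector th) \<and>
  (\<forall>\<phi>. th < \<phi> \<and> \<phi> < pi -->
    bdd_above ((%z. norm (z *\<^sub>C resolvent z A)) ` {z. z \<notin> sector \<phi> \<and> z ~= 0}))}"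

lemma sect_angle_eq: "sect_angle A = Inf (angles A)"
 by (simp add: sect_angle_def angles_def)

lemma resolvent_bound_outside_sector:
 assumes ne: "angles A ~= {}" and \<phi>: "sect_angle A < \<phi>" "\<phi> < pi"
 shows "\<exists>M\<ge>0. \<forall>z. z ~= 0 \<and> z \<notin> sector \<phi> --> z \<in> resolvent_set A \<and> norm (resolvent z A) <= M / norm z"
proof -
 obtain th where th: "th \<in> angles A" "th < \<phi>" using cInf_lessD[OF ne] \<phi> unfolding sect_angle_eq by blast
 then have "bdd_above ((%z. norm (z *\<^sub>C resolvent z A)) ` {z. z \<notin> sector \<phi> \<and> z ~= 0})"
  using \<phi>(2) unfolding angles_def mem_Collect_eq by (elim conjE allE[of _ \<phi>]) simp
 then obtain M where "\<forall>y\<in>(%z. norm (z *\<^sub>C resolvent z A)) ` {z. z \<notin> sector \<phi> \<and> z ~= 0}. y <= M"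
  unfolding bdd_above_def by blast
 then have M: "norm (z *\<^sub>C resolvent z A) <= M" if "z \<notin> sector \<phi>" "z ~= 0" for z using that by blast
 have hth: "0 <= th" "spectrum A \<subseteq> closure (sector th)" using th by (auto simp: angles_def)
 show ?thesis
 proof (intro exI[of _ "max 0 M"] conjI allI impI)
  fix z assume z: "z ~= 0 \<and> z \<notin> sector \<phi>"
  have "z \<notin> closure (sector th)" using closure_sector_subset[OF hth(1) th(2) \<phi>(2)] z by blast
  then show "z \<in> resolvent_set A" using hth(2) by (auto simp: spectrum_def)
  have "norm z * norm (resolvent z A) <= max 0 M" using M[of z] z by (simp add: norm_scaleC max.coboundedI2)
  then show "norm (resolvent z A) <= max 0 M / norm z" using z by (simp add: field_simps)
 qed simp
qed

text \<open>The bound on the negative axis spreads to a sector around it by perturbation. A point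
  \<open>z\<close> is compared with \<open>- norm z\<close>, whose resolvent has norm at most
  \<open>M / norm z\<close>; off the sector of half-angle \<open>th\<close> their distance is at
  most \<open>2 * norm z * cos (th / 2)\<close>.\<close>

lemma sectorial_angles_nonempty:
 fixes A :: "'a::complex_banach \<rightharpoonup> 'a"
 assumes "sectorial A"
 shows "angles A ~= {}"
proof -
 have A: "linear_operator A" and neg: "!!r. r < 0 ==> complex_of_real r \<in> resolvent_set A"
  and bdd: "bdd_above ((%r. norm (complex_of_real r *\<^sub>C inv_op (op_plus A (complex_of_real r)))) ` {0<..})"
  using assms by (auto simp: sectorial_def)
 obtain M0 where M0: "!!r. r > 0 ==> norm (complex_of_real r *\<^sub>C inv_op (op_plus A (complex_of_real r))) <= M0"
  using bdd unfolding bdd_above_def by auto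
 define M where "M = max 1 M0"
 have Rneg: "norm (resolvent (of_real (- r)) A) <= M / r" if r: "r > 0" for r
 proof -
  let ?R = "resolvent (of_real (- r)) A"
  have z: "of_real (- r) \<in> resolvent_set A" using r by (intro neg) simp
  have "inv_op (op_plus A (complex_of_real r)) = - ?R"
  proof (rule boundedly_invertibleI(2))
   fix y
   have d: "blinfun_apply ?R (- y) \<in> dom A" by (rule resolvent(1)[OF z])
   have neg: "blinfun_apply (- ?R) y = blinfun_apply ?R (- y)" by (simp add: blinfun.minus_left blinfun.minus_right)
   show "blinfun_apply (- ?R) y \<in> dom (op_plus A (complex_of_real r))" unfolding neg using d by simp
   have "app A (blinfun_apply ?R (- y)) + complex_of_real r *\<^sub>C blinfun_apply ?R (- y) =
    - (of_real (- r) *\<^sub>C blinfun_apply ?R (- y) - app A (blinfun_apply ?R (- y)))"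
    by (simp add: add.commute)
   also have "... = y" unfolding resolvent(2)[OF z] by simp
   finally show "app (op_plus A (complex_of_real r)) (blinfun_apply (- ?R) y) = y"
    unfolding neg using d by simp
  next
   fix x assume x: "x \<in> dom (op_plus A (complex_of_real r))"
   moreover have "of_real (- r) *\<^sub>C x - app A x = - (app A x + of_real r *\<^sub>C x)" by simp
   ultimately have "blinfun_apply (- ?R) (app (op_plus A (complex_of_real r)) x) = blinfun_apply ?R (of_real (- r) *\<^sub>C x - app A x)"
    by (simp only: blinfun.minus_left blinfun.minus_right dom_op_plus app_op_plus)
   then show "blinfun_apply (- ?R) (app (op_plus A (complex_of_real r)) x) = x"
    using resolvent(3)[OF z] x by simp
  qed
  then have "r * norm ?R <= M" using M0[OF r] r by (simp add: norm_scaleC M_def max.coboundedI2)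
  then show ?thesis using r by (simp add: field_simps)
 qed
 \<comment> \<open>With \<open>cos (th / 2) = 1 / (4 * M)\<close> the product of the distance and
   the resolvent norm is at most 1/2, as \<open>resolvent_neumann\<close> requires.\<close>
 define th where "th = 2 * arccos (1 / (4 * M))"
 have M1: "M >= 1" by (simp add: M_def)
 then have arg: "0 < 1 / (4 * M)" "1 / (4 * M) < 1" by (auto simp: divide_less_eq)
 from this(1) have arg': "- 1 < 1 / (4 * M)" by linarith
 then have th: "0 < th" "th < pi"
  unfolding th_def using arg arccos_lt_bounded[of "1 / (4 * M)"] arccos_less_arccos[of 0 "1 / (4 * M)"]
  by (simp_all del: zero_less_divide_1_iff)
 have costh: "cos (th / 2) = 1 / (4 * M)" 
 proof -
  have half: "th / 2 = arccos (1 / (4 * M))" by (simp add: th_def)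
  show ?thesis unfolding half by (rule cos_arccos) (use arg arg' in linarith)+
 qed
 have main: "z \<in> resolvent_set A \<and> norm (z *\<^sub>C resolvent z A) <= 2 * M" if z: "z \<notin> sector th" "z ~= 0" for z
 proof -
  let ?r = "norm z"
  have r: "?r > 0" using z by simp
  have "\<not> cos th * ?r < Re z" using z sector_iff[OF th] by auto
  then have Rez: "Re z <= ?r * cos th" by (simp add: mult.commute)
  have "(norm (z - of_real (- ?r)))\<^sup>2 = 2 * ?r\<^sup>2 + 2 * ?r * Re z"
   unfolding cmod_power2[of "z - _"] using cmod_power2[of z] by (simp add: power2_eq_square algebra_simps)
  also have "... <= 2 * ?r\<^sup>2 + 2 * ?r * (?r * cos th)" using Rez by (intro add_left_mono mult_left_mono) auto
  also have "... = (2 * ?r * cos (th / 2))\<^sup>2" 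
  proof -
   have c: "cos th = 2 * (cos (th / 2))\<^sup>2 - 1" using cos_double_cos[of "th / 2"] by simp
   show ?thesis unfolding c by (simp add: power2_eq_square algebra_simps)
  qed
  finally have "norm (z - of_real (- ?r)) <= 2 * ?r * cos (th / 2)"
   by (rule power2_le_imp_le) (use arg in \<open>simp add: costh\<close>)
  then have "norm (resolvent (of_real (- ?r)) A) * norm (z - of_real (- ?r)) <= (M / ?r) * (2 * ?r * (1 / (4 * M)))"
   unfolding costh using Rneg[OF r] M1 by (intro mult_mono) auto
  also have "... = 1 / 2" using M1 r by simp
  finally have n: "norm (resolvent (of_real (- ?r)) A) * norm (z - of_real (- ?r)) <= 1 / 2" .
  have nr: "of_real (- ?r) \<in> resolvent_set A" using r by (intro neg) simp
  have "norm (resolvent z A) <= 2 * (M / ?r)" using resolvent_neumann(2)[OF A nr n] Rneg[OF r] by linarith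
  then have "?r * norm (resolvent z A) <= 2 * M" using r by (simp add: field_simps)
  then show ?thesis using resolvent_neumann(1)[OF A nr n] by (simp add: norm_scaleC)
 qed
 have "th \<in> angles A"
  unfolding angles_def
 proof (intro CollectI conjI allI impI)
  show "spectrum A \<subseteq> closure (sector th)"
  proof
   fix z assume z: "z \<in> spectrum A"
   show "z \<in> closure (sector th)"
   proof (cases "z = 0")
    case True
    then show ?thesis using zero_in_closure_sector[of th] th by simp
   next
    case False
    then have "z \<in> sector th" using main[of z] z by (auto simp: spectrum_def)
    then show ?thesis using closure_subset by blast
   qed
  qed
  fix \<phi> assume "th < \<phi> \<and> \<phi> < pi"
  then have "sector th \<subseteq> sector \<phi>" using th by (intro sector_mono) auto
  then show "bdd_above ((%z. norm (z *\<^sub>C resolvent z A)) ` {z. z \<notin> sector \<phi> \<and> z ~= 0})"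
   using main by (intro bdd_aboveI[of _ "2 * M"]) blast
 qed (use th in auto)
 then show ?thesis by blast
qed

text \<open>The geometric origin of the bound \<open>C / (s + norm z)\<close>: off the sector there
  is no cancellation in \<open>z - s\<close> beyond a factor depending on the angle.\<close>

lemma norm_diff_of_real_outside_sector:
 assumes \<phi>: "0 < \<phi>" "\<phi> < pi" and z: "z \<notin> sector \<phi>" and s: "s > 0"
 shows "sin (\<phi> / 2) * (s + norm z) <= norm (z - of_real s)"
proof -
 have "cos \<phi> * norm z >= Re z" using z sector_iff[OF \<phi>, of z] by (cases "z = 0") auto
 then have "(norm (z - of_real s))\<^sup>2 >= (norm z)\<^sup>2 - 2 * s * (norm z * cos \<phi>) + s\<^sup>2"
 proof -
  have "(norm (z - of_real s))\<^sup>2 = (norm z)\<^sup>2 - 2 * s * Re z + s\<^sup>2"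
   unfolding cmod_power2[of "z - _"] using cmod_power2[of z] by (simp add: power2_eq_square algebra_simps)
  moreover have "2 * s * Re z <= 2 * s * (norm z * cos \<phi>)"
   using s \<open>cos \<phi> * norm z >= Re z\<close> by (intro mult_left_mono) (auto simp: mult.commute)
  ultimately show ?thesis by linarith
 qed
 moreover have "(norm z)\<^sup>2 - 2 * s * (norm z * cos \<phi>) + s\<^sup>2 >= (sin (\<phi> / 2) * (s + norm z))\<^sup>2"
 proof -
  have c: "cos \<phi> = 1 - 2 * (sin (\<phi> / 2))\<^sup>2" using cos_double_sin[of "\<phi> / 2"] by simp
  have s1: "(sin (\<phi> / 2))\<^sup>2 <= 1" by (simp add: abs_square_le_1)
  have "(norm z)\<^sup>2 - 2 * s * (norm z * cos \<phi>) + s\<^sup>2 - (sin (\<phi> / 2) * (s + norm z))\<^sup>2 = (1 - (sin (\<phi> / 2))\<^sup>2) * (norm z - s)\<^sup>2"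
   unfolding c by (simp add: power2_eq_square algebra_simps)
  moreover have "... >= 0" using s1 by (intro mult_nonneg_nonneg) auto
  ultimately show ?thesis by linarith
 qed
 ultimately have "(sin (\<phi> / 2) * (s + norm z))\<^sup>2 <= (norm (z - of_real s))\<^sup>2" by linarith
 then show ?thesis by (rule power2_le_imp_le) simp
qed

section \<open>Square roots\<close>

lemma fc_cong:
 assumes "!!x t. ray th t ==> f (Complex x t) = g (Complex x t)"
 shows "fc R th f = fc R th g"
 unfolding fc_def fc_integrand_def using assms by (intro bochner_cong) simp

lemma rcis_eq_exp: "r > 0 ==> rcis r t = cexp (ln r) t"
 by (simp add: rcis_def exp_eq_polar)

lemma csqrt_exp:
 assumes "\<bar>Im w\<bar> < pi"
 shows "csqrt (exp w) = exp (w / 2)"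
proof (rule csqrt_unique)
 show "(exp (w / 2))\<^sup>2 = exp w" by (simp add: power2_eq_square flip: exp_add)
 have "cos (Im w / 2) > 0" using assms by (intro cos_gt_zero_pi) auto
 then show "0 < Re (exp (w / 2)) \<or> Re (exp (w / 2)) = 0 \<and> 0 <= Im (exp (w / 2))" by (simp add: Re_exp)
qed

context sect_res
begin

text \<open>Links \<open>sect_calc\<close>, written over rays in the variable \<open>r\<close>, with
  \<open>fc\<close>, written over lines in \<open>x = ln r\<close>: the element
  \<open>cis t dr\<close> becomes \<open>exp w dx\<close>.\<close>

lemma ray_integral:
 assumes g: "decays \<psi> g" and th: "\<omega> < th" "th < \<psi>" "th < pi" and t: "ray th t"
  and fg: "!!x. f (cexp x t) = g (Complex x t)"
 defines "h \<equiv> %r. (f (rcis r t) * cis t) *\<^sub>C R (rcis r t)"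
 shows "bochner_integrable leb_pos h"
  and "cfunctional m ==> m (bochner leb_pos h) =
   (LINT x|lborel. g (Complex x t) * cexp x t * m (R (cexp x t)))"
proof -
 define H where "H x = (g (Complex x t) * cexp x t) *\<^sub>C R (cexp x t)" for x
 have h: "h r = complex_of_real (1 / r) *\<^sub>C H (ln r)" if r: "r > 0" for r
 proof -
  have "cexp (ln r) t = of_real r * cis t" using r by (simp add: exp_eq_polar)
  then have "cis t = complex_of_real (1 / r) * cexp (ln r) t" using r by (simp add: of_real_divide)
  then show ?thesis
   unfolding h_def H_def scaleC_scaleC rcis_eq_exp[OF r] fg by (simp add: mult_ac)
 qed
 have Hc: "continuous_on UNIV H"
  unfolding H_def using t th ang by (intro continuous_intros decays_line[OF g] R_line_continuous[OF th(1,3)]) auto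
 obtain C where C: "!!w. th <= \<bar>Im w\<bar> \<and> \<bar>Im w\<bar> <= 2 * pi - th ==> norm (R (exp w)) <= C / (s + exp (Re w))"
  using bound[OF th(1,3)] by blast
 obtain c where c: "!!w. \<bar>Im w\<bar> < \<psi> ==> norm (g w) <= c * exp (- Re w / 2)" using g by (auto simp: decays_def)
 have Hb: "norm (H x) <= (\<bar>c\<bar> * \<bar>C\<bar> * max 1 (1 / s)) * exp (- (1/2) * \<bar>x\<bar>)" for x
 proof -
  have sp: "s + exp x > 0" using s by (simp add: add_pos_pos)
  have "norm (g (Complex x t)) <= c * exp (- x / 2)" using c[of "Complex x t"] t th ang by auto
  then have 1: "norm (g (Complex x t)) <= \<bar>c\<bar> * exp (- x / 2)"
   by (rule order_trans) (intro mult_right_mono; simp)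
  have "norm (R (cexp x t)) <= C / (s + exp x)" using C[of "Complex x t"] t th ang by auto
  also have "... <= \<bar>C\<bar> / (s + exp x)" using sp by (intro divide_right_mono) auto
  finally have 2: "norm (R (cexp x t)) <= \<bar>C\<bar> / (s + exp x)" .
  have "norm (H x) <= (\<bar>c\<bar> * exp (- x / 2)) * exp x * (\<bar>C\<bar> / (s + exp x))"
   unfolding H_def norm_scaleC norm_mult norm_exp_eq_Re complex.sel using 1 2 by (intro mult_mono mult_right_mono) auto
  also have "... = (\<bar>c\<bar> * \<bar>C\<bar>) * (exp (x / 2) / (s + exp x))"
  proof -
   have e: "exp (x / 2) = exp (- x / 2) * exp x" by (simp flip: exp_add)
   show ?thesis by (subst e) (simp add: mult_ac)
  qed
  also have "... <= (\<bar>c\<bar> * \<bar>C\<bar>) * (max 1 (1 / s) * exp (- (1/2) * \<bar>x\<bar>))"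
   by (intro mult_left_mono exp_half_le s) auto
  finally show ?thesis by (simp add: mult.assoc)
 qed
 have hc: "continuous_on {0<..} h"
 proof -
  have "continuous_on {0<..} (%r. complex_of_real (1 / r) *\<^sub>C H (ln r))"
   by (intro continuous_intros continuous_on_compose2[OF Hc]) auto
  then show ?thesis by (rule continuous_on_eq) (use h in simp)
 qed
 show bi: "bochner_integrable leb_pos h"
 proof (rule bochner_integrable_continuous_lebesgue_on[OF hc])
  show "integrable leb_pos (%r. (\<bar>c\<bar> * \<bar>C\<bar> * max 1 (1 / s)) * (exp (- (1/2) * \<bar>ln r\<bar>) / r))"
   by (intro integrable_mult_right integrable_exp_abs_ln) simp
  fix r :: real assume "r \<in> {0<..}"
  then show "norm (h r) <= (\<bar>c\<bar> * \<bar>C\<bar> * max 1 (1 / s)) * (exp (- (1/2) * \<bar>ln r\<bar>) / r)"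
   using h[of r] Hb[of "ln r"] by (simp add: norm_scaleC norm_divide divide_right_mono)
 qed simp
 assume m: "cfunctional m"
 have e: "exp x *\<^sub>R m (h (exp x)) = g (Complex x t) * cexp x t * m (R (cexp x t))" for x
  using h[of "exp x"] by (simp add: cfunctionalD(2)[OF m] H_def scaleR_conv_of_real flip: exp_of_real)
 have "m (bochner leb_pos h) = (LINT r|leb_pos. m (h r))"
  by (rule bochner_functional(2)[OF bi m])
 also have "... = (LINT x|lborel. exp x *\<^sub>R m (h (exp x)))"
  by (rule exp_subst(2)) (unfold e, rule line_integrable[OF g m th t])
 finally show "m (bochner leb_pos h) =
   (LINT x|lborel. g (Complex x t) * cexp x t * m (R (cexp x t)))" unfolding e .
qed

end

text \<open>The calculus for the resolvent of an actual operator. It is instantiated with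
  \<open>A + s\<close>, whose resolvent satisfies the bound with that same \<open>s\<close>.\<close>

locale inv_sect = sect_res "%z. resolvent z B" "sect_angle B" s
 for B :: "'a::complex_banach \<rightharpoonup> 'a" and s +
 assumes lin: "linear_operator B"
  and res: "w \<in> co_strip (sect_angle B) ==> exp w \<in> resolvent_set B"
begin

abbreviation "\<Phi> \<equiv> fc (%z. resolvent z B)"

text \<open>The angle at which \<open>sqrt_op\<close> evaluates its contour integral, so that the
  two calculi can be compared directly; \<open>\<psi>0\<close> leaves a margin of holomorphy around
  it.\<close>

definition th0 :: real where "th0 = (sect_angle B + pi) / 2"
definition \<psi>0 :: real where "\<psi>0 = (th0 + pi) / 2"

lemma th0: "sect_angle B < th0" "th0 < \<psi>0" "\<psi>0 < pi" "th0 < pi" "0 < \<psi>0" "0 < th0"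
proof -
 show "sect_angle B < th0" "th0 < pi" using ang by (auto simp: th0_def)
 then show "th0 < \<psi>0" "\<psi>0 < pi" "0 < th0" using ang by (auto simp: \<psi>0_def)
 then show "0 < \<psi>0" by simp
qed

text \<open>The candidate for the inverse square root of \<open>B\<close>, available directly
  because \<open>decays\<close> admits \<open>\<lambda>^(-1/2)\<close>. The next operator,
  \<open>K\<close>, is the inverse of \<open>1 + B\<close>.\<close>

definition J :: "'a \<Rightarrow>\<^sub>L 'a" where "J = \<Phi> th0 (%w. exp (- w / 2))"
definition K :: "'a \<Rightarrow>\<^sub>L 'a" where "K = \<Phi> th0 (%w. 1 / (1 + of_real 1 * exp w))"

text \<open>The regularised square root \<open>\<lambda>^(1/2) / (1 + \<lambda>)\<close>, written as
  a product so that its decay follows from that of the inverse square root.\<close>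

definition gG :: "complex => complex" where "gG w = exp (- w / 2) * (1 - 1 / (1 + of_real 1 * exp w))"
definition G :: "'a \<Rightarrow>\<^sub>L 'a" where "G = \<Phi> th0 gG"

lemma K_eq: "K = - resolvent (- 1) B"
 unfolding K_def using fc_resolvent[of 1 \<psi>0 th0] decays_resolvent(1)[of 1 \<psi>0] th0 by simp

lemma minus_one_res: "- 1 \<in> resolvent_set B"
proof -
 have "Complex 0 pi \<in> co_strip (sect_angle B)" using ang by (simp add: co_strip_def)
 moreover have "cexp 0 pi = - 1" by (simp add: exp_eq_polar)
 ultimately show ?thesis using res by metis
qed

lemma K: "blinfun_apply K y \<in> dom B" "blinfun_apply K y + app B (blinfun_apply K y) = y"
 "x \<in> dom B ==> blinfun_apply K (x + app B x) = x"
proof -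
 note r = resolvent[OF minus_one_res]
 have e: "blinfun_apply K y = blinfun_apply (resolvent (- 1) B) (- y)" for y
  by (simp add: K_eq blinfun.minus_left blinfun.minus_right)
 show "blinfun_apply K y \<in> dom B" unfolding e by (rule r)
 have "blinfun_apply K y + app B (blinfun_apply K y) = - ((- 1) *\<^sub>C blinfun_apply K y - app B (blinfun_apply K y))" by simp
 also have "... = y" unfolding e r(2) by simp
 finally show "blinfun_apply K y + app B (blinfun_apply K y) = y" .
 assume x: "x \<in> dom B"
 have "- (x + app B x) = (- 1) *\<^sub>C x - app B x" by simp
 then show "blinfun_apply K (x + app B x) = x" unfolding e using r(3)[OF x] by simp
qed

lemma K_inj: "blinfun_apply K x = blinfun_apply K y ==> x = y"
 using K(2) by metis

lemma gG_eq: assumes "\<bar>Im w\<bar> < \<psi>0" shows "gG w = exp (w / 2) / (1 + exp w)" "1 + exp w ~= 0"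
proof -
 have "cos (\<psi>0 / 2) * (1 + 1 * exp (Re w)) <= norm (1 + of_real 1 * exp w)"
  by (rule one_plus_exp_bound) (use assms th0 in auto)
 moreover have "cos (\<psi>0 / 2) * (1 + 1 * exp (Re w)) > 0"
  using th0 by (intro mult_pos_pos cos_gt_zero_pi) (auto simp: add_pos_pos)
 ultimately show ne: "1 + exp w ~= 0" by auto
 have "exp (- w / 2) * exp w = exp (w / 2)" by (simp flip: exp_add)
 then show "gG w = exp (w / 2) / (1 + exp w)" using ne by (simp add: gG_def field_simps)
qed

lemma decays_gG: "decays \<psi>0 gG"
proof -
 have "decays \<psi>0 (%w. exp (- w / 2) * (1 - 1 / (1 + of_real 1 * exp w)))"
 proof (rule decays_mult_bounded[OF decays_inv_sqrt])
  note d = decays_resolvent[of 1 \<psi>0]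
  show "(%w. 1 - 1 / (1 + complex_of_real 1 * exp w)) holomorphic_on {w. \<bar>Im w\<bar> < \<psi>0}"
   using d(1) th0 by (intro holomorphic_intros) (auto simp: decays_def gG_eq)
  show "norm (1 - 1 / (1 + complex_of_real 1 * exp w)) <= 1 + 1 / cos (\<psi>0 / 2)" if "\<bar>Im w\<bar> < \<psi>0" for w
   using norm_triangle_ineq4[of 1 "1 / (1 + complex_of_real 1 * exp w)"] d(2)[of w] that th0 by simp
 qed
 then show ?thesis by (simp add: gG_def[abs_def])
qed

lemma gG_bounded: assumes w: "\<bar>Im w\<bar> < \<psi>0" shows "norm (gG w) <= 1 / cos (\<psi>0 / 2)"
proof -
 have c: "cos (\<psi>0 / 2) > 0" using th0 by (intro cos_gt_zero_pi) auto
 have "cos (\<psi>0 / 2) * (1 + 1 * exp (Re w)) <= norm (1 + of_real 1 * exp w)"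
  by (rule one_plus_exp_bound) (use w th0 in auto)
 moreover have "cos (\<psi>0 / 2) * (1 + exp (Re w)) > 0" using c by (simp add: add_pos_pos)
 ultimately have "norm (gG w) <= exp (Re w / 2) / (cos (\<psi>0 / 2) * (1 + exp (Re w)))"
  unfolding gG_eq[OF w] norm_divide by (intro frac_le) auto
 also have "... = (1 / cos (\<psi>0 / 2)) * (exp (Re w / 2) / (1 + exp (Re w)))" by simp
 also have "... <= (1 / cos (\<psi>0 / 2)) * 1"
 proof (rule mult_left_mono)
  have "exp (Re w / 2) / (1 + exp (Re w)) <= exp (- (1/2) * \<bar>Re w\<bar>)" using exp_half_le[of 1 "Re w"] by simp
  also have "... <= 1" by simp
  finally show "exp (Re w / 2) / (1 + exp (Re w)) <= 1" .
 qed (use c in simp)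
 finally show ?thesis by simp
qed

text \<open>On the contour \<open>\<lambda>^(-1/2)\<close> times the regularised square root is
  \<open>1 / (1 + \<lambda>)\<close>. With the injectivity of \<open>K\<close> this makes
  \<open>J\<close> a two-sided inverse of the square root.\<close>

lemma J_G: "J o\<^sub>L G = K" "G o\<^sub>L J = K"
proof -
 have "J o\<^sub>L G = \<Phi> th0 (%w. exp (- w / 2) * gG w)"
  unfolding J_def G_def using th0 by (intro fc_mult[OF decays_inv_sqrt decays_gG gG_bounded]) auto
 also have "... = K"
  unfolding K_def
 proof (rule fc_cong)
  fix x t assume t: "ray th0 t"
  let ?w = "Complex x t"
  have w: "\<bar>Im ?w\<bar> < \<psi>0" using t th0 by auto
  have "exp (- ?w / 2) * exp (?w / 2) = 1" by (simp flip: exp_add)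
  then show "exp (- ?w / 2) * gG ?w = 1 / (1 + of_real 1 * exp ?w)" unfolding gG_eq[OF w] by simp
 qed
 finally show "J o\<^sub>L G = K" .
 moreover have "J o\<^sub>L G = G o\<^sub>L J"
  unfolding J_def G_def using th0 by (intro fc_fc_commute[OF decays_inv_sqrt[of \<psi>0] decays_gG]) auto
 ultimately show "G o\<^sub>L J = K" by simp
qed

lemma J_K: "J o\<^sub>L K = K o\<^sub>L J"
 unfolding J_def K_def using th0 by (intro fc_fc_commute[OF decays_inv_sqrt[of \<psi>0] decays_resolvent(1)[of 1 \<psi>0]]) auto

lemma sect_calc_eq: "sect_calc B ((sect_angle B + pi) / 2) (%z. csqrt z / (1 + z)) = G"
proof (rule cfunctional_eqI)
 fix m :: "('a \<Rightarrow>\<^sub>L 'a) => complex" assume m: "cfunctional m"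
 have fg: "csqrt (cexp x t) / (1 + cexp x t) = gG (Complex x t)" if "ray th0 t" for x t
  using that th0 csqrt_exp[of "Complex x t"] gG_eq[of "Complex x t"] by auto
 have I: "m (bochner leb_pos (%r. (csqrt (rcis r t) / (1 + rcis r t) * cis t) *\<^sub>C resolvent (rcis r t) B)) =
   (LINT x|lborel. gG (Complex x t) * cexp x t * m (resolvent (cexp x t) B))"
  if t: "ray th0 t" for t
  by (rule ray_integral(2)[OF decays_gG th0(1,2,4) t, where f = "%z. csqrt z / (1 + z)"]) (use fg[OF t] m in auto)
 show "m (sect_calc B ((sect_angle B + pi) / 2) (%z. csqrt z / (1 + z))) = m G"
  unfolding sect_calc_def th0_def[symmetric] cfunctionalD(2,4)[OF m] I[OF disjI1[OF refl]] I[OF disjI2[OF refl]]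
   G_def fc_functional[OF decays_gG m th0(1,2,4)] ..
qed

lemma dom_sqrt: "dom (sqrt_op B) = {x. blinfun_apply G x \<in> dom B}"
 and app_sqrt: "blinfun_apply G x \<in> dom B ==> app (sqrt_op B) x = blinfun_apply G x + app B (blinfun_apply G x)"
 unfolding sqrt_op_def sect_calc_eq Let_def by (auto simp: dom_def app_def)

lemma sqrt_J: "blinfun_apply J w \<in> dom (sqrt_op B)" "app (sqrt_op B) (blinfun_apply J w) = w"
proof -
 have e: "blinfun_apply G (blinfun_apply J w) = blinfun_apply K w" by (metis J_G(2) blinfun_apply_blinfun_compose)
 show "blinfun_apply J w \<in> dom (sqrt_op B)" unfolding dom_sqrt using e K(1) by simp
 show "app (sqrt_op B) (blinfun_apply J w) = w" using app_sqrt[of "blinfun_apply J w"] K(1,2) unfolding e by simp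
qed

lemma J_sqrt: assumes x: "x \<in> dom (sqrt_op B)" shows "blinfun_apply J (app (sqrt_op B) x) = x"
proof -
 have d: "blinfun_apply G x \<in> dom B" using x dom_sqrt by simp
 have "blinfun_apply K (app (sqrt_op B) x) = blinfun_apply G x" unfolding app_sqrt[OF d] by (rule K(3)[OF d])
 then have "blinfun_apply J (blinfun_apply K (app (sqrt_op B) x)) = blinfun_apply K x"
  by (metis J_G(1) blinfun_apply_blinfun_compose)
 then have "blinfun_apply K (blinfun_apply J (app (sqrt_op B) x)) = blinfun_apply K x"
  by (metis J_K blinfun_apply_blinfun_compose)
 then show ?thesis by (rule K_inj)
qed

lemma inv_sqrt: "inv_op (sqrt_op B) = J"
 by (rule boundedly_invertibleI(2)[OF sqrt_J J_sqrt])

section \<open>Resolvents of the square root\<close>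

definition H :: "real => 'a \<Rightarrow>\<^sub>L 'a" where "H r = \<Phi> th0 (%w. 1 / (of_real r + exp (w / 2)))"

lemma sqrt_plus_bounds:
 assumes r: "r > 0" and w: "\<bar>Im w\<bar> < pi"
 shows "norm (1 / (of_real r + exp (w / 2))) <= 1 / r" "norm (1 / (of_real r + exp (w / 2))) <= 1 * exp (- Re w / 2)"
  "of_real r + exp (w / 2) ~= 0"
proof -
 have c: "Re (exp (w / 2)) > 0" using w by (simp add: Re_exp cos_gt_zero_pi)
 have n1: "r <= norm (of_real r + exp (w / 2))"
  using c complex_Re_le_cmod[of "of_real r + exp (w / 2)"] by simp
 have n2: "norm (exp (w / 2)) <= norm (of_real r + exp (w / 2))"
 proof (rule power2_le_imp_le)
  show "(norm (exp (w / 2)))\<^sup>2 <= (norm (of_real r + exp (w / 2)))\<^sup>2"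
   unfolding cmod_power2 using c r by (simp add: power_mono)
 qed simp
 show "norm (1 / (of_real r + exp (w / 2))) <= 1 / r" unfolding norm_divide using n1 r by (intro frac_le) auto
 have "norm (1 / (of_real r + exp (w / 2))) <= 1 / norm (exp (w / 2))" unfolding norm_divide using n2 by (intro frac_le) auto
 also have "... = exp (- Re w / 2)" by (simp add: exp_minus inverse_eq_divide)
 finally show "norm (1 / (of_real r + exp (w / 2))) <= 1 * exp (- Re w / 2)" by simp
 show "of_real r + exp (w / 2) ~= 0" using n1 r by auto
qed

lemma decays_sqrt_plus: assumes r: "r > 0" shows "decays pi (%w. 1 / (of_real r + exp (w / 2)))"
 unfolding decays_def
proof
 show "(%w. 1 / (complex_of_real r + exp (w / 2))) holomorphic_on {w. \<bar>Im w\<bar> < pi}"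
  using sqrt_plus_bounds(3)[OF r] by (intro holomorphic_intros) auto
 show "\<exists>c. \<forall>w. \<bar>Im w\<bar> < pi --> norm (1 / (complex_of_real r + exp (w / 2))) <= c * exp (- Re w / 2)"
  using sqrt_plus_bounds(2)[OF r] by blast
qed

text \<open>Comes from the scalar identity \<open>r * \<lambda>^(-1/2) / (r + \<lambda>^(1/2)) =
  \<lambda>^(-1/2) - 1 / (r + \<lambda>^(1/2))\<close>. The terms with coefficient 0 in the proof
  merely bring it into the shape of \<open>fc_lincomb\<close>.\<close>

lemma J_H: assumes r: "r > 0" shows "of_real r *\<^sub>C (J o\<^sub>L H r) = J - H r" "J o\<^sub>L H r = H r o\<^sub>L J"
proof -
 note dH = decays_sqrt_plus[OF r]
 have "J o\<^sub>L H r = \<Phi> th0 (%w. exp (- w / 2) * (1 / (of_real r + exp (w / 2))))"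
  unfolding J_def H_def using th0 by (intro fc_mult[OF decays_inv_sqrt dH sqrt_plus_bounds(1)[OF r]]) auto
 moreover have dJH: "decays pi (%w. exp (- w / 2) * (1 / (of_real r + exp (w / 2))))"
  by (rule decays_mult_bounded[OF decays_inv_sqrt _ sqrt_plus_bounds(1)[OF r]]) (use dH in \<open>auto simp: decays_def\<close>)
 ultimately have "of_real r *\<^sub>C (J o\<^sub>L H r) = of_real r *\<^sub>C \<Phi> th0 (%w. exp (- w / 2) * (1 / (of_real r + exp (w / 2)))) +
   0 *\<^sub>C \<Phi> th0 (%w. 1 / (of_real r + exp (w / 2)))" by simp
 also have "... = \<Phi> th0 (%w. of_real r * (exp (- w / 2) * (1 / (of_real r + exp (w / 2)))) + 0 * (1 / (of_real r + exp (w / 2))))"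
  by (rule fc_lincomb[OF dJH dH, symmetric]) (use th0 in auto)
 also have "... = \<Phi> th0 (%w. 1 * exp (- w / 2) + (- 1) * (1 / (of_real r + exp (w / 2))))"
 proof (rule fc_cong)
  fix x t assume t: "ray th0 t"
  let ?w = "Complex x t"
  have "of_real r + exp (?w / 2) ~= 0" by (rule sqrt_plus_bounds(3)[OF r]) (use t th0 in auto)
  moreover have "exp (- ?w / 2) * exp (?w / 2) = 1" by (simp flip: exp_add)
  moreover have "rr * (a * (1 / (rr + b))) + 0 * c = 1 * a + (- 1) * (1 / (rr + b))" if "rr + b ~= 0" "a * b = 1" for a b c rr :: complex
  proof -
   have "a * (1 / (rr + b)) * (rr + b) = a" using that(1) by simp
   then show ?thesis using that by (simp add: field_simps)
  qed
  ultimately show "of_real r * (exp (- ?w / 2) * (1 / (of_real r + exp (?w / 2)))) + 0 * (1 / (of_real r + exp (?w / 2)))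
    = 1 * exp (- ?w / 2) + (- 1) * (1 / (of_real r + exp (?w / 2)))" by blast
 qed
 also have "... = 1 *\<^sub>C J + (- 1) *\<^sub>C H r"
  unfolding J_def H_def by (rule fc_lincomb[OF decays_inv_sqrt dH]) (use th0 in auto)
 finally show "of_real r *\<^sub>C (J o\<^sub>L H r) = J - H r" by simp
 show "J o\<^sub>L H r = H r o\<^sub>L J"
  unfolding J_def H_def using th0 by (intro fc_fc_commute[OF decays_inv_sqrt[of \<psi>0] dH]) auto
qed

text \<open>From \<open>r J H = J - H\<close> one gets \<open>H = J (1 - r H)\<close>. This places
  the range of \<open>H\<close> in the range of \<open>J\<close>, hence in the domain of the square
  root, and shows what the square root does there.\<close>

lemma inv_sqrt_plus:
 assumes r: "r > 0"
 shows "boundedly_invertible (op_plus (sqrt_op B) (of_real r))" "inv_op (op_plus (sqrt_op B) (of_real r)) = H r"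
proof -
 have jh: "complex_of_real r *\<^sub>C blinfun_apply J (blinfun_apply (H r) y) = blinfun_apply J y - blinfun_apply (H r) y" for y
  using arg_cong[OF J_H(1)[OF r], of "%T. blinfun_apply T y"] by (simp add: scaleC_blinfun.rep_eq blinfun.diff_left)
 have Jc: "J \<in> cblinfuns" and Hc: "H r \<in> cblinfuns"
  unfolding J_def H_def using th0 by (intro fc_cblinfuns[OF decays_inv_sqrt[of \<psi>0]] fc_cblinfuns[OF decays_sqrt_plus[OF r]]; simp)+
 have hJ: "blinfun_apply (H r) y = blinfun_apply J (y - complex_of_real r *\<^sub>C blinfun_apply (H r) y)" for y
  by (simp add: blinfun.diff_right cblinfunsD[OF Jc] jh)
 have *: "blinfun_apply (H r) y \<in> dom (op_plus (sqrt_op B) (of_real r))"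
  "app (op_plus (sqrt_op B) (of_real r)) (blinfun_apply (H r) y) = y" for y
 proof -
  have d: "blinfun_apply (H r) y \<in> dom (sqrt_op B)" and a: "app (sqrt_op B) (blinfun_apply (H r) y) = y - complex_of_real r *\<^sub>C blinfun_apply (H r) y"
   using sqrt_J[of "y - complex_of_real r *\<^sub>C blinfun_apply (H r) y"] hJ[of y] by simp_all
  show "blinfun_apply (H r) y \<in> dom (op_plus (sqrt_op B) (of_real r))" using d by simp
  show "app (op_plus (sqrt_op B) (of_real r)) (blinfun_apply (H r) y) = y" using d a by simp
 qed
 moreover have "blinfun_apply (H r) (app (op_plus (sqrt_op B) (of_real r)) x) = x" if x: "x \<in> dom (op_plus (sqrt_op B) (of_real r))" for x
 proof -
  define w where "w = app (sqrt_op B) x"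
  have xw: "x = blinfun_apply J w" using J_sqrt x by (simp add: w_def)
  have "blinfun_apply (H r) (app (op_plus (sqrt_op B) (of_real r)) x) = blinfun_apply (H r) (w + of_real r *\<^sub>C blinfun_apply J w)"
   using x by (simp add: w_def[symmetric] xw[symmetric])
  also have "... = blinfun_apply (H r) w + of_real r *\<^sub>C blinfun_apply (H r) (blinfun_apply J w)"
   by (simp add: blinfun.add_right cblinfunsD[OF Hc])
  also have "blinfun_apply (H r) (blinfun_apply J w) = blinfun_apply J (blinfun_apply (H r) w)"
   using J_H(2)[OF r] by (metis blinfun_apply_blinfun_compose)
  finally show ?thesis using jh[of w] xw by simp
 qed
 ultimately show "boundedly_invertible (op_plus (sqrt_op B) (of_real r))" "inv_op (op_plus (sqrt_op B) (of_real r)) = H r"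
  using boundedly_invertibleI[of "H r" "op_plus (sqrt_op B) (of_real r)"] by blast+
qed

end

section \<open>The holomorphic semigroup\<close>

lemma FTC_line:
 fixes F f :: "real => complex"
 assumes der: "!!x. (F has_vector_derivative f x) (at x)" and int: "integrable lborel f"
  and A: "(F \<longlongrightarrow> A) at_bot" and B: "(F \<longlongrightarrow> B) at_top"
 shows "(LINT x|lborel. f x) = B - A"
proof -
 have "integral {- real n..real n} f = F (real n) - F (- real n)" for n
  by (intro integral_unique fundamental_theorem_of_calculus) (auto intro: has_vector_derivative_at_within der)
 then have "(%n. F (real n) - F (- real n)) \<longlonglongrightarrow> (LINT x|lborel. f x)" using LINT_limit[OF int] by simp
 moreover have "(%n. F (real n) - F (- real n)) \<longlonglongrightarrow> B - A"
  by (intro tendsto_diff filterlim_compose[OF B] filterlim_compose[OF A] filterlim_real_sequentially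
    filterlim_compose[OF filterlim_uminus_at_bot_at_top])
 ultimately show ?thesis by (rule LIMSEQ_unique)
qed

lemma FTC_pos:
 fixes F f :: "real => complex"
 assumes der: "!!x. x > 0 ==> (F has_vector_derivative f x) (at x)"
  and int: "integrable lborel (%x. exp x *\<^sub>R f (exp x))"
  and A: "(F \<longlongrightarrow> A) (at_right 0)" and B: "(F \<longlongrightarrow> B) at_top"
 shows "(LINT x|leb_pos. f x) = B - A"
proof -
 have "(LINT x|lborel. exp x *\<^sub>R f (exp x)) = B - A"
 proof (rule FTC_line[OF _ int])
  fix x :: real
  have "((F \<circ> exp) has_vector_derivative exp x *\<^sub>R f (exp x)) (at x)"
   by (rule vector_diff_chain_at[OF _ der]) (auto intro!: derivative_eq_intros simp flip: has_real_derivative_iff_has_vector_derivative)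
  then show "((%x. F (exp x)) has_vector_derivative exp x *\<^sub>R f (exp x)) (at x)" by (simp add: o_def)
  have "filterlim (exp :: real => real) (at_right 0) at_bot"
   by (auto simp: filterlim_at exp_at_bot)
  then show "((%x. F (exp x)) \<longlongrightarrow> A) at_bot" by (rule filterlim_compose[OF A])
  show "((%x. F (exp x)) \<longlongrightarrow> B) at_top" by (rule filterlim_compose[OF B exp_at_top])
 qed
 then show ?thesis using exp_subst(2)[OF int] by simp
qed

lemma exp_pexp_integrable:
 fixes k s C :: real
 assumes k: "k > 0" and j: "j >= - 1" and s: "s > 0"
 shows "integrable lborel (%x. exp (of_int j * x / 2 - k * exp (x / 2)) * exp x * (C / (s + exp x)))"
proof -
 let ?c = "fact (nat (j + 1)) / k ^ nat (j + 1)"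
 have "integrable lborel (%x::real. (\<bar>C\<bar> * ?c * max 1 (1 / s)) * exp (- (1/2) * \<bar>x\<bar>))"
  by (intro integrable_mult_right integrable_exp_abs) simp
 then show ?thesis
 proof (rule integrable_le)
  show "AE x in lborel. norm (exp (of_int j * x / 2 - k * exp (x / 2)) * exp x * (C / (s + exp x)))
    <= norm ((\<bar>C\<bar> * ?c * max 1 (1 / s)) * exp (- (1/2) * \<bar>x\<bar>))"
  proof (rule AE_I2)
   fix x :: real
   have sp: "s + exp x > 0" using s by (simp add: add_pos_pos)
   have "norm (exp (of_int j * x / 2 - k * exp (x / 2)) * exp x * (C / (s + exp x)))
     = exp (of_int j * x / 2 - k * exp (x / 2)) * (exp x * (\<bar>C\<bar> / (s + exp x)))" using sp by (simp add: abs_mult)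
   also have "... <= (?c * exp (- x / 2)) * (exp x * (\<bar>C\<bar> / (s + exp x)))"
    using sp by (intro mult_right_mono exp_pexp_decay[OF k j]) auto
   also have "... = (\<bar>C\<bar> * ?c) * (exp (x / 2) / (s + exp x))"
   proof -
    have e: "exp (x / 2) = exp (- x / 2) * exp x" by (simp flip: exp_add)
    show ?thesis by (subst e) (simp add: mult_ac)
   qed
   also have "... <= (\<bar>C\<bar> * ?c) * (max 1 (1 / s) * exp (- (1/2) * \<bar>x\<bar>))"
    using k by (intro mult_left_mono exp_half_le s) auto
   also have "... = (\<bar>C\<bar> * ?c * max 1 (1 / s)) * exp (- (1/2) * \<bar>x\<bar>)" by (simp only: mult.assoc)
   also have "... <= norm ((\<bar>C\<bar> * ?c * max 1 (1 / s)) * exp (- (1/2) * \<bar>x\<bar>))" by (simp only: real_norm_def abs_ge_self)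
   finally show "norm (exp (of_int j * x / 2 - k * exp (x / 2)) * exp x * (C / (s + exp x)))
    <= norm ((\<bar>C\<bar> * ?c * max 1 (1 / s)) * exp (- (1/2) * \<bar>x\<bar>))" .
  qed
  have ne: "s + exp x ~= 0" for x using s by (smt (verit) exp_gt_zero)
  have "continuous_on UNIV (%x. exp (of_int j * x / 2 - k * exp (x / 2)) * exp x * (C / (s + exp x)))"
   using ne by (intro continuous_intros) auto
  from borel_measurable_continuous_onI[OF this]
  show "(%x. exp (of_int j * x / 2 - k * exp (x / 2)) * exp x * (C / (s + exp x))) \<in> borel_measurable lborel" by simp
 qed
qed

text \<open>Half of the decay rate at \<open>z0\<close> survives for every \<open>z\<close> within
  that distance, so one majorant serves a whole ball.\<close>

lemma norm_pexp_near:
 assumes w: "\<bar>Im w\<bar> <= th" "\<bar>Arg z0\<bar> + th / 2 <= pi" and z: "dist z0 z <= sect_mod th z0 / 2"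
 shows "norm (pexp j z w) <= exp (of_int j * Re w / 2 - (sect_mod th z0 / 2) * exp (Re w / 2))"
proof -
 have "Re ((z0 - z) * exp (w / 2)) <= norm ((z0 - z) * exp (w / 2))" by (rule complex_Re_le_cmod)
 also have "... = dist z0 z * exp (Re w / 2)" by (simp add: norm_mult dist_norm)
 also have "... <= sect_mod th z0 / 2 * exp (Re w / 2)" using z by (intro mult_right_mono) auto
 finally have "Re (z0 * exp (w / 2)) - Re (z * exp (w / 2)) <= sect_mod th z0 / 2 * exp (Re w / 2)" by (simp add: algebra_simps)
 then have "(sect_mod th z0 / 2) * exp (Re w / 2) <= Re (z * exp (w / 2))" using sect_mod_le[OF w] by linarith
 then show ?thesis by (simp add: pexp_def)
qed

lemma pexp_has_derivative:
 "((%z. pexp j z w) has_derivative (%h. h * (- pexp (j + 1) z w))) (at z)"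
proof -
 have 1: "((%z. pexp j z w) has_field_derivative pexp j z w * (- exp (w / 2))) (at z)"
  unfolding pexp_def by (auto intro!: derivative_eq_intros)
 have 2: "pexp j z w * (- exp (w / 2)) = - pexp (j + 1) z w"
  unfolding pexp_def mult_minus_right exp_add[symmetric] by (simp add: algebra_simps add_divide_distrib)
 have 3: "(*) (- pexp (j + 1) z w) = (%h. h * (- pexp (j + 1) z w))" by (rule ext) (rule mult.commute)
 show ?thesis using 1 unfolding 2 has_field_derivative_def 3 .
qed

lemma pexp_line_continuous: "continuous_on UNIV (%x. pexp j z (Complex x t))"
 unfolding pexp_def by (intro continuous_intros) auto

lemma fc_integrand_cmult: "fc_integrand R th (%w. h * f w) x = h *\<^sub>C fc_integrand R th f x"
 by (simp add: fc_integrand_def scaleC_diff_right scaleC_scaleC mult_ac)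

lemma fc_integrand_has_derivative:
 assumes "!!t. ray th t ==> ((%z. f z (Complex x t)) has_derivative (%h. h * g (Complex x t))) (at z)"
 shows "((%z. fc_integrand R th (f z) x) has_derivative (%h. h *\<^sub>C fc_integrand R th g x)) (at z)"
proof -
 have d: "((%z. (f z (Complex x t) * cexp x t) *\<^sub>C R (cexp x t)) has_derivative
   (%h. (h * g (Complex x t) * cexp x t) *\<^sub>C R (cexp x t))) (at z)" if "ray th t" for t
  by (intro bounded_linear.has_derivative[OF bounded_linear_scaleC_left] has_derivative_mult_left assms that)
 have "((%z. fc_integrand R th (f z) x) has_derivative (%h. fc_integrand R th (%w. h * g w) x)) (at z)"
  unfolding fc_integrand_def
  by (intro bounded_linear.has_derivative[OF bounded_linear_scaleC] has_derivative_diff d) auto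
 then show ?thesis unfolding fc_integrand_cmult .
qed

text \<open>Differentiation in \<open>z\<close> multiplies by \<open>- \<lambda>^(1/2)\<close>,
  which raises the index by one. The majorant is uniform on a ball around \<open>z0\<close>, as
  \<open>bochner_has_derivative\<close> asks.\<close>

lemma fc_pexp_has_derivative:
 fixes R :: "complex => 'b::complex_banach"
 assumes z: "z0 ~= 0" "\<bar>Arg z0\<bar> + th / 2 < pi / 2" and th: "0 < th" and j: "j >= - 1" and s: "s > 0"
  and Rc: "!!t. ray th t ==> continuous_on UNIV (%x. R (cexp x t))"
  and R: "!!x t. ray th t ==> norm (R (cexp x t)) <= C / (s + exp x)"
 shows "((%z. fc R th (pexp j z)) has_derivative (%h. h *\<^sub>C (- fc R th (pexp (j + 1) z0)))) (at z0)"
proof -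
 let ?k = "sect_mod th z0 / 2"
 have k: "?k > 0" using sect_mod_pos[OF z(1) less_imp_le[OF th] z(2)] by simp
 have Arg: "\<bar>Arg z0\<bar> + th / 2 <= pi" using z(2) pi_gt_zero by linarith
 have near: "norm (pexp i z (Complex x t)) <= exp (of_int i * x / 2 - ?k * exp (x / 2))"
  if "ray th t" "z \<in> ball z0 ?k" for i z x t
  using norm_pexp_near[of "Complex x t" th z0 z i] that th Arg by auto
 have cont: "continuous_on UNIV (fc_integrand R th (pexp i z))" for i z
  by (rule fc_integrand_continuous[OF Rc pexp_line_continuous])
 have le: "norm (fc_integrand R th (pexp i z) x) <= (1 / pi) * (exp (of_int i * x / 2 - ?k * exp (x / 2)) * exp x * (C / (s + exp x)))"
  if z: "z \<in> ball z0 ?k" for i z x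
  by (rule norm_fc_integrand_le; erule R near[OF _ z])
 have int: "integrable lborel (%x. (1 / pi) * (exp (of_int i * x / 2 - ?k * exp (x / 2)) * exp x * (C / (s + exp x))))" if "i >= - 1" for i
  by (intro integrable_mult_right exp_pexp_integrable k that s)
 have bi: "bochner_integrable lborel (fc_integrand R th (pexp i z))" if "i >= - 1" "z \<in> ball z0 ?k" for i z
  by (rule bochner_integrable_continuous_lborel[OF cont int[OF that(1)] le[OF that(2)]])
 have meas: "\<phi> \<in> borel_measurable lborel" if "continuous_on UNIV \<phi>" for \<phi> :: "real => 'b"
  using borel_measurable_continuous_onI[OF that] by simp
 have z0: "z0 \<in> ball z0 ?k" using k by simp
 have neg: "bounded_linear (%x::'b. h *\<^sub>C (- x))" for h
  by (rule bounded_linear_compose[OF bounded_linear_scaleC bounded_linear_minus[OF bounded_linear_ident]])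
 have jj: "j + 1 >= - 1" using j by simp
 note bi1 = bi[OF jj z0]
 have "((%z. bochner lborel (fc_integrand R th (pexp j z))) has_derivative
   (%h. bochner lborel (%x. h *\<^sub>C (- fc_integrand R th (pexp (j + 1) z0) x)))) (at z0)"
 proof (rule bochner_has_derivative[where U = "ball z0 ?k" and D = "%z x h. h *\<^sub>C (- fc_integrand R th (pexp (j + 1) z) x)"
   and g = "%x. (1 / pi) * (exp (of_int (j + 1) * x / 2 - ?k * exp (x / 2)) * exp x * (C / (s + exp x)))"])
  show "bochner_integrable lborel (%x. h *\<^sub>C (- fc_integrand R th (pexp (j + 1) z0) x))" for h
   by (rule bochner_bounded_linear(1)[OF neg bi1])
  show "((%p. fc_integrand R th (pexp j p) x) has_derivative (%h. h *\<^sub>C - fc_integrand R th (pexp (j + 1) p) x)) (at p)" for p x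
  proof -
   have "fc_integrand R th (%w. - pexp (j + 1) p w) x = - fc_integrand R th (pexp (j + 1) p) x"
    using fc_integrand_cmult[of R th "- 1" "pexp (j + 1) p" x] by simp
   then show ?thesis using fc_integrand_has_derivative[of th "pexp j" x "%w. - pexp (j + 1) p w" p R] pexp_has_derivative by simp
  qed
  show "norm (h *\<^sub>C - fc_integrand R th (pexp (j + 1) p) x)
   <= 1 / pi * (exp (of_int (j + 1) * x / 2 - ?k * exp (x / 2)) * exp x * (C / (s + exp x))) * norm h" if "p \<in> ball z0 ?k" for p x h
   unfolding norm_scaleC norm_minus_cancel mult.commute[of "norm h"] by (intro mult_right_mono le[OF that]) simp
  show "(%x. fc_integrand R th (pexp j p) x - fc_integrand R th (pexp j z0) x - h *\<^sub>C - fc_integrand R th (pexp (j + 1) z0) x) \<in> borel_measurable lborel" for p h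
   by (intro meas continuous_intros cont)
  show "(%x. fc_integrand R th (pexp j p) x - fc_integrand R th (pexp j z0) x) \<in> borel_measurable lborel" for p
   by (intro meas continuous_intros cont)
  show "(%x. h *\<^sub>C - fc_integrand R th (pexp (j + 1) z0) x + k *\<^sub>C - fc_integrand R th (pexp (j + 1) z0) x) \<in> borel_measurable lborel" for h k
   by (intro meas continuous_intros cont)
 qed (use bi j z0 int[OF jj] in \<open>auto simp del: mem_ball\<close>)
 then show ?thesis unfolding fc_def bochner_bounded_linear(2)[OF neg bi1] .
qed

lemma norm_exp_minus_one_le:
 assumes "Re a >= 0" shows "norm (exp (- a) - 1) <= norm a"
proof -
 have "norm (exp (- a) - exp 0) <= 1 * norm (- a - 0)"
 proof (rule field_differentiable_bound[where S = "{z. Re z <= 0}" and f' = exp])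
  show "convex {z. Re z <= 0}" by (rule convex_halfspace_Re_le)
  show "(exp has_field_derivative exp z) (at z within {z. Re z <= 0})" for z
   by (rule has_field_derivative_at_within[OF DERIV_exp])
 qed (use assms in auto)
 then show ?thesis by simp
qed

section \<open>Sectors of half-angle at most pi/2\<close>

lemma sector_half_iff:
 assumes "0 <= th" "th < pi"
 shows "z \<in> half_sector th \<longleftrightarrow> z ~= 0 \<and> \<bar>Arg z\<bar> + th / 2 < pi / 2"
proof -
 have "Arg z = pi" if "z \<in> \<real>\<^sub>\<le>\<^sub>0" "z ~= 0" using that by (auto simp: complex_nonpos_Reals_iff Arg_eq_pi complex_eq_iff)
 then show ?thesis using assms by (auto simp: sector_def field_simps)
qed

lemma sector_half_add:
 assumes th: "0 <= th" "th < pi" and z: "z \<in> half_sector th" and w: "w \<in> half_sector th"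
 shows "z + w \<in> half_sector th"
proof -
 let ?p = "(pi - th) / 2"
 have p: "0 < ?p" "?p < pi" "cos ?p >= 0" using th by (auto intro!: cos_ge_zero)
 have zw: "cos ?p * norm z < Re z" "cos ?p * norm w < Re w" using z w sector_iff[OF p(1,2)] by auto
 have "cos ?p * norm (z + w) <= cos ?p * (norm z + norm w)" using p by (intro mult_left_mono norm_triangle_ineq)
 also have "... < Re (z + w)" using zw by (simp add: distrib_left)
 finally have l: "cos ?p * norm (z + w) < Re (z + w)" .
 moreover have "z + w ~= 0"
 proof
  assume e: "z + w = 0"
  show False using l unfolding e by simp
 qed
 ultimately show ?thesis using sector_iff[OF p(1,2)] by blast
qed

lemma of_real_in_sector: "t > 0 ==> 0 < \<phi> ==> complex_of_real t \<in> sector \<phi>"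
 by (simp add: sector_def complex_nonpos_Reals_iff)

lemma open_convex_sector:
 assumes "0 < \<phi>" "\<phi> <= pi / 2"
 shows "open (sector \<phi>)" "convex (sector \<phi>)"
proof -
 have p: "0 < \<phi>" "\<phi> < pi" using assms pi_gt_zero by linarith+
 have c: "cos \<phi> >= 0" using assms by (intro cos_ge_zero) auto
 have eq: "sector \<phi> = {z. cos \<phi> * norm z < Re z}"
 proof (rule set_eqI)
  fix z show "z \<in> sector \<phi> \<longleftrightarrow> z \<in> {z. cos \<phi> * norm z < Re z}"
   unfolding sector_iff[OF p, of z] by (cases "z = 0") simp_all
 qed
 show "open (sector \<phi>)" unfolding eq by (intro open_Collect_less continuous_intros)
 show "convex (sector \<phi>)"
  unfolding eq convex_alt
 proof (intro ballI allI impI)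
  fix x y :: complex and u :: real assume x: "x \<in> {z. cos \<phi> * norm z < Re z}" and y: "y \<in> {z. cos \<phi> * norm z < Re z}" and u: "0 <= u \<and> u <= 1"
  have "cos \<phi> * norm ((1 - u) *\<^sub>R x + u *\<^sub>R y) <= cos \<phi> * ((1 - u) * norm x + u * norm y)"
   using c u norm_triangle_ineq[of "(1 - u) *\<^sub>R x" "u *\<^sub>R y"] by (intro mult_left_mono) auto
  also have "... = (1 - u) * (cos \<phi> * norm x) + u * (cos \<phi> * norm y)" by (simp add: algebra_simps)
  also have "... < (1 - u) * Re x + u * Re y"
  proof (cases "u = 0")
   case False
   then have "u * (cos \<phi> * norm y) < u * Re y" using u y by auto
   moreover have "(1 - u) * (cos \<phi> * norm x) <= (1 - u) * Re x" using u x by (intro mult_left_mono) auto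
   ultimately show ?thesis by linarith
  qed (use x in auto)
  finally show "(1 - u) *\<^sub>R x + u *\<^sub>R y \<in> {z. cos \<phi> * norm z < Re z}" by simp
 qed
qed

text \<open>The integral of \<open>exp (- p * t)\<close> over \<open>t > 0\<close>, in the
  coordinate \<open>t = exp y\<close>.\<close>

lemma LINT_exp_pos:
 assumes p: "Re p > 0"
 shows "integrable lborel (%y. exp y *\<^sub>R exp (- p * of_real (exp y)))"
  "(LINT y|lborel. exp y *\<^sub>R exp (- p * of_real (exp y))) = 1 / p"
proof -
 show int: "integrable lborel (%y. exp y *\<^sub>R exp (- p * of_real (exp y)))"
 proof (rule integrable_exp_decay[where c = 1 and N = 0 and C = "max 1 (2 / (Re p)\<^sup>2)"])
  show "continuous_on UNIV (%y. exp y *\<^sub>R exp (- p * complex_of_real (exp y)))" by (intro continuous_intros)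
  fix y :: real
  have n: "norm (exp y *\<^sub>R exp (- p * complex_of_real (exp y))) = exp y * exp (- Re p * exp y)" by simp
  show "norm (exp y *\<^sub>R exp (- p * complex_of_real (exp y))) <= max 1 (2 / (Re p)\<^sup>2) * exp (- 1 * \<bar>y\<bar>)"
  proof (cases "y >= 0")
   case True
   have "exp y ^ 2 * exp (- Re p * exp y) <= fact 2 / Re p ^ 2" by (rule power_exp_le_fact) (use p in auto)
   then have "exp (- y) * (exp y ^ 2 * exp (- Re p * exp y)) <= exp (- y) * (2 / Re p ^ 2)" by (intro mult_left_mono) (auto simp: fact_numeral)
   moreover have "exp (- y) * (exp y ^ 2 * exp (- Re p * exp y)) = exp y * exp (- Re p * exp y)"
    by (simp add: power2_eq_square exp_minus)
   ultimately have "exp y * exp (- Re p * exp y) <= exp (- y) * (2 / Re p ^ 2)" by (simp only:)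
   also have "... <= exp (- y) * max 1 (2 / Re p ^ 2)" by (intro mult_left_mono) auto
   finally show ?thesis unfolding n using True by (simp add: mult.commute)
  next
   case False
   have "exp y * exp (- Re p * exp y) <= exp y * 1" using p by (intro mult_left_mono) auto
   also have "... <= max 1 (2 / Re p ^ 2) * exp y" by simp
   finally show ?thesis unfolding n using False by simp
  qed
 qed simp
 have "(LINT y|lborel. exp y *\<^sub>R exp (- p * of_real (exp y))) = 0 - (- 1 / p)"
 proof (rule FTC_line[OF _ int, where F = "%y. - exp (- p * of_real (exp y)) / p"])
  have p0: "p ~= 0" using p by auto
  fix x :: real
  have "((%z. - exp (- p * z) / p) has_field_derivative exp (- p * of_real (exp x))) (at (of_real (exp x)))"
   using p0 by (auto intro!: derivative_eq_intros)
  moreover have "((%y. complex_of_real (exp y)) has_vector_derivative of_real (exp x)) (at x)"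
   by (auto intro!: derivative_eq_intros has_vector_derivative_of_real simp flip: has_real_derivative_iff_has_vector_derivative)
  ultimately have "((%z. - exp (- p * z) / p) \<circ> (%y. complex_of_real (exp y)) has_vector_derivative of_real (exp x) * exp (- p * of_real (exp x))) (at x)"
   by (intro field_vector_diff_chain_at)
  then show "((%y. - exp (- p * of_real (exp y)) / p) has_vector_derivative exp x *\<^sub>R exp (- p * of_real (exp x))) (at x)"
   by (simp add: o_def scaleR_conv_of_real)
  have "((%y. - exp (- p * of_real (exp y)) / p) \<longlongrightarrow> - exp (- p * of_real 0) / p) at_bot"
   by (intro tendsto_intros exp_at_bot p0)
  then show "((%y. - exp (- p * of_real (exp y)) / p) \<longlongrightarrow> - 1 / p) at_bot" by simp
  show "((%y. - exp (- p * of_real (exp y)) / p) \<longlongrightarrow> 0) at_top"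
  proof (rule Lim_null_comparison)
   have "filterlim (%y. - (Re p * exp y)) at_bot at_top"
    unfolding filterlim_uminus_at_bot minus_minus by (intro filterlim_tendsto_pos_mult_at_top[OF tendsto_const p exp_at_top])
   then have "((%y. exp (- (Re p * exp y))) \<longlongrightarrow> 0) at_top" by (rule filterlim_compose[OF exp_at_bot])
   then have "((%y. exp (- (Re p * exp y)) / norm p) \<longlongrightarrow> 0 / norm p) at_top" using p0 by (intro tendsto_divide tendsto_const) auto
   then show "((%y. exp (- (Re p * exp y)) / norm p) \<longlongrightarrow> 0) at_top" by simp
   show "\<forall>\<^sub>F y in at_top. norm (- exp (- p * of_real (exp y)) / p) <= exp (- (Re p * exp y)) / norm p"
    by (simp add: norm_divide)
  qed
 qed
 then show "(LINT y|lborel. exp y *\<^sub>R exp (- p * of_real (exp y))) = 1 / p" by simp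
qed

text \<open>After applying a functional, the difference of the two semigroups is bounded and
  continuous on the positive axis and its Laplace transform vanishes at the positive integers;
  \<open>laplace_unique_real\<close> is applied to its real and imaginary parts. The identity
  theorem then covers the sector. This pins down \<open>holo_exp\<close>, which is defined by
  choice.\<close>

lemma bdd_holo_semigroup_unique:
 fixes S T :: "complex => 'a::complex_banach \<Rightarrow>\<^sub>L 'a"
 assumes \<phi>: "0 < \<phi>" "\<phi> <= pi / 2" and S: "bdd_holo_semigroup C \<phi> S" and T: "bdd_holo_semigroup C \<phi> T"
  and z: "z \<in> sector \<phi>"
 shows "S z = T z"
proof (rule cfunctional_eqI)
 fix m :: "('a \<Rightarrow>\<^sub>L 'a) => complex" assume m: "cfunctional m"
 note os = open_convex_sector[OF \<phi>]
 interpret m: bounded_linear m by (rule cfunctionalD(1)[OF m])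
 have hol: "(%z. m (Q z)) holomorphic_on sector \<phi>" if Q: "bdd_holo_semigroup C \<phi> Q" for Q
 proof (rule holomorphic_onI)
  fix z assume z: "z \<in> sector \<phi>"
  obtain D where "(Q has_derivative (%h. h *\<^sub>C D)) (at z within sector \<phi>)"
   using Q z unfolding bdd_holo_semigroup_def vector_holomorphic_on_def by blast
  then have "((%z. m (Q z)) has_derivative (%h. m (h *\<^sub>C D))) (at z within sector \<phi>)" by (rule m.has_derivative)
  moreover have "(%h. m (h *\<^sub>C D)) = (*) (m D)" by (rule ext) (simp only: cfunctionalD(2)[OF m] mult.commute)
  ultimately show "(%z. m (Q z)) field_differentiable at z within sector \<phi>"
   unfolding field_differentiable_def has_field_derivative_def by auto
 qed
 have lap: "integrable leb_pos (%t. exp (- r * t) *\<^sub>R m (Q (of_real t)))"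
   "(LINT t|leb_pos. exp (- r * t) *\<^sub>R m (Q (of_real t))) = m (inv_op (op_plus C (complex_of_real r)))"
  if "bdd_holo_semigroup C \<phi> Q" "r > 0" for Q r
 proof -
  have "has_bochner leb_pos (%t. exp (- r * t) *\<^sub>R Q (complex_of_real t)) (inv_op (op_plus C (complex_of_real r)))"
   using that unfolding bdd_holo_semigroup_def by blast
  from has_bochner_bounded_linear[OF cfunctionalD(1)[OF m] this]
  have "has_bochner_integral leb_pos (%t. exp (- r * t) *\<^sub>R m (Q (of_real t))) (m (inv_op (op_plus C (complex_of_real r))))"
   by (simp add: has_bochner_iff_has_bochner_integral m.scaleR)
  then show "integrable leb_pos (%t. exp (- r * t) *\<^sub>R m (Q (of_real t)))"
   "(LINT t|leb_pos. exp (- r * t) *\<^sub>R m (Q (of_real t))) = m (inv_op (op_plus C (complex_of_real r)))"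
   by (auto simp: has_bochner_integral_iff)
 qed
 have bdd: "\<exists>B. \<forall>t>0. norm (m (Q (of_real t))) <= B" if "bdd_holo_semigroup C \<phi> Q" for Q
 proof -
  have "bounded (Q ` sector (\<phi> / 2))" using that \<phi> unfolding bdd_holo_semigroup_def by auto
  then have "bounded (m ` (Q ` sector (\<phi> / 2)))" by (rule bounded_linear_image[OF _ m.bounded_linear_axioms])
  then obtain B where "\<forall>y \<in> m ` (Q ` sector (\<phi> / 2)). norm y <= B" unfolding bounded_iff by blast
  then show ?thesis using of_real_in_sector[of _ "\<phi> / 2"] \<phi> by (intro exI[of _ B]) auto
 qed
 define h where "h t = m (S (of_real t)) - m (T (of_real t))" for t
 have hc: "continuous_on {0<..} h"
  unfolding h_def
  by (intro continuous_intros continuous_on_compose2[OF holomorphic_on_imp_continuous_on[OF hol[OF S]]]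
    continuous_on_compose2[OF holomorphic_on_imp_continuous_on[OF hol[OF T]]]) (use of_real_in_sector \<phi> in auto)
 obtain B1 B2 where B: "\<forall>t>0. norm (m (S (of_real t))) <= B1" "\<forall>t>0. norm (m (T (of_real t))) <= B2"
  using bdd[OF S] bdd[OF T] by blast
 have hb: "norm (h t) <= B1 + B2" if "t > 0" for t
  unfolding h_def using B that norm_triangle_ineq4 by (metis add_mono order_trans)
 have hl: "integrable leb_pos (%t. exp (- real n * t) *\<^sub>R h t)"
   "(LINT t|leb_pos. exp (- real n * t) *\<^sub>R h t) = 0" if "n >= 1" for n :: nat
  unfolding h_def scaleR_diff_right using lap[OF S, of "real n"] lap[OF T, of "real n"] that by auto
 have "Re (h t) = 0" if "t > 0" for t
 proof (rule laplace_unique_real[where B = "B1 + B2", OF _ _ _ that])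
  show "continuous_on {0<..} (%t. Re (h t))" by (intro continuous_intros hc)
  show "\<bar>Re (h t)\<bar> <= B1 + B2" if "t > 0" for t using hb[OF that] abs_Re_le_cmod order_trans by blast
  show "(LINT t|leb_pos. exp (- real n * t) * Re (h t)) = 0" if "n >= 1" for n :: nat
   using integral_Re[OF hl(1)[OF that]] hl(2)[OF that] by simp
 qed
 moreover have "Im (h t) = 0" if "t > 0" for t
 proof (rule laplace_unique_real[where B = "B1 + B2", OF _ _ _ that])
  show "continuous_on {0<..} (%t. Im (h t))" by (intro continuous_intros hc)
  show "\<bar>Im (h t)\<bar> <= B1 + B2" if "t > 0" for t using hb[OF that] abs_Im_le_cmod order_trans by blast
  show "(LINT t|leb_pos. exp (- real n * t) * Im (h t)) = 0" if "n >= 1" for n :: nat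
   using integral_Im[OF hl(1)[OF that]] hl(2)[OF that] by simp
 qed
 ultimately have h0: "h t = 0" if "t > 0" for t using that by (simp add: complex_eq_iff)
 have "m (S z) - m (T z) = 0"
 proof (rule analytic_continuation[where f = "%z. m (S z) - m (T z)" and S = "sector \<phi>" and U = "complex_of_real ` {0<..}" and \<xi> = 1])
  show "(%z. m (S z) - m (T z)) holomorphic_on sector \<phi>" by (intro holomorphic_intros hol S T)
  show "connected (sector \<phi>)" by (rule convex_connected[OF os(2)])
  show "1 islimpt complex_of_real ` {0<..}"
   unfolding islimpt_sequential
  proof (intro exI[of _ "%n. complex_of_real (1 + inverse (real (Suc n)))"] conjI allI)
   show "complex_of_real (1 + inverse (real (Suc n))) \<in> complex_of_real ` {0<..} - {1}" for n
   proof -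
    have p: "inverse (real (Suc n)) > 0" by simp
    then have "1 + inverse (real (Suc n)) ~= 1" by linarith
    then have "complex_of_real (1 + inverse (real (Suc n))) ~= 1" unfolding of_real_eq_1_iff .
    moreover have "1 + inverse (real (Suc n)) \<in> {0<..}" using p by (simp add: add_pos_pos)
    ultimately show ?thesis by blast
   qed
   have "(%n. complex_of_real (1 + inverse (real (Suc n)))) \<longlonglongrightarrow> of_real (1 + 0)"
    by (intro tendsto_intros LIMSEQ_inverse_real_of_nat)
   then show "(%n. complex_of_real (1 + inverse (real (Suc n)))) \<longlonglongrightarrow> 1" by simp
  qed
  show "complex_of_real ` {0<..} \<subseteq> sector \<phi>" using of_real_in_sector \<phi> by auto
  then show "1 \<in> sector \<phi>" using of_real_in_sector[of 1 \<phi>] \<phi> by simp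
  show "m (S z) - m (T z) = 0" if "z \<in> complex_of_real ` {0<..}" for z using h0 that by (auto simp: h_def)
 qed (use os z in auto)
 then show "m (S z) = m (T z)" by simp
qed

lemma exp_frac_le:
 fixes s x p c :: real
 assumes s: "s > 0" and p: "c <= p" "p <= 1 - c"
 shows "exp (p * x) / (s + exp x) <= max 1 (1 / s) * exp (- c * \<bar>x\<bar>)"
proof (cases "x >= 0")
 case True
 have "exp (p * x) / (s + exp x) <= exp (p * x) / exp x" using s by (intro divide_left_mono) (auto simp: add_pos_pos)
 also have "... = exp ((p - 1) * x)" by (simp add: left_diff_distrib flip: exp_diff)
 also have "... <= 1 * exp (- c * \<bar>x\<bar>)"
 proof -
  have "(p - 1) * x <= (- c) * x" using True p by (intro mult_right_mono) auto
  then show ?thesis using True by simp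
 qed
 also have "... <= max 1 (1 / s) * exp (- c * \<bar>x\<bar>)" by (intro mult_right_mono) auto
 finally show ?thesis .
next
 case False
 have "exp (p * x) / (s + exp x) <= exp (p * x) / s" using s by (intro divide_left_mono) (auto simp: add_pos_pos)
 also have "... <= exp (c * x) / s"
 proof -
  have "p * x <= c * x" using False p by (intro mult_right_mono_neg) auto
  then show ?thesis using s by (intro divide_right_mono) auto
 qed
 also have "... = (1 / s) * exp (- c * \<bar>x\<bar>)" using False by simp
 also have "... <= max 1 (1 / s) * exp (- c * \<bar>x\<bar>)" by (intro mult_right_mono) auto
 finally show ?thesis .
qed

lemma exp_neg_le_inv_sqrt:
 fixes c y :: real
 assumes c: "c > 0"
 shows "exp (- c * exp y) <= max 1 (1 / c) * exp (- y / 2)"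
proof (cases "y >= 0")
 case True
 have "exp y ^ 1 * exp (- c * exp y) <= fact 1 / c ^ 1" by (rule power_exp_le_fact) (use c in auto)
 then have "exp (- y) * (exp y * exp (- c * exp y)) <= exp (- y) * (1 / c)" by (intro mult_left_mono) auto
 moreover have "exp (- y) * (exp y * exp (- c * exp y)) = exp (- c * exp y)" by (simp add: exp_minus)
 ultimately have "exp (- c * exp y) <= exp (- y) * (1 / c)" by (simp only:)
 also have "... <= exp (- y / 2) * max 1 (1 / c)" using True c by (intro mult_mono) auto
 finally show ?thesis by (simp add: mult.commute)
next
 case False
 have "exp (- c * exp y) <= 1" using c by simp
 also have "1 <= 1 * exp (- y / 2)" using False by simp
 also have "... <= max 1 (1 / c) * exp (- y / 2)" by (intro mult_right_mono) auto
 finally show ?thesis .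
qed

text \<open>\<open>th\<close> is taken midway between \<omega> and \<open>pi - 2 * q\<close>, the
  angle up to which both points remain in the sector.\<close>

lemma sector_common_angle:
 assumes \<omega>: "0 <= \<omega>" "\<omega> < pi" and z: "z \<in> half_sector \<omega>" "w \<in> half_sector \<omega>"
 obtains th where "\<omega> < th" "th < pi" "z \<in> half_sector th" "w \<in> half_sector th"
proof -
 define q where "q = max \<bar>Arg z\<bar> \<bar>Arg w\<bar>"
 define th where "th = (\<omega> + (pi - 2 * q)) / 2"
 have z': "z ~= 0" "\<bar>Arg z\<bar> + \<omega> / 2 < pi / 2" "w ~= 0" "\<bar>Arg w\<bar> + \<omega> / 2 < pi / 2"
  using z sector_half_iff[OF \<omega>] by auto
 then have q: "q + \<omega> / 2 < pi / 2" "0 <= q" by (auto simp: q_def)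
 then have hth: "\<omega> < th" "th < pi" "q + th / 2 < pi / 2" using \<omega> by (auto simp: th_def field_simps)
 then have "\<bar>Arg z\<bar> + th / 2 < pi / 2" "\<bar>Arg w\<bar> + th / 2 < pi / 2" by (auto simp: q_def)
 then have "z \<in> half_sector th" "w \<in> half_sector th"
  using sector_half_iff[of th] hth \<omega> z' by auto
 then show ?thesis using that hth by blast
qed

section \<open>The semigroup as a contour integral\<close>

context inv_sect
begin

text \<open>The contour angle depends on \<open>z\<close>: it lies midway between the sectoriality
  angle and \<open>pi - 2 * |Arg z|\<close>, the limit for decay of \<open>pexp\<close> on both
  rays. By \<open>T_eq\<close> every admissible angle gives the same operator.\<close>

definition T :: "complex => 'a \<Rightarrow>\<^sub>L 'a" where
 "T z = \<Phi> ((sect_angle B + pi - 2 * \<bar>Arg z\<bar>) / 2) (pexp 0 z)"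

lemma pexp_adm:
 assumes th: "sect_angle B < th" "th < pi" and z: "z \<in> half_sector th"
 obtains \<psi> where "th < \<psi>" "\<psi> < pi" "0 <= \<psi>" "z ~= 0" "\<bar>Arg z\<bar> + \<psi> / 2 < pi / 2" "!!j. j >= - 1 ==> decays \<psi> (pexp j z)"
proof -
 have hth: "0 <= th" using th ang by simp
 have z: "z ~= 0" "\<bar>Arg z\<bar> + th / 2 < pi / 2" using z sector_half_iff[OF hth th(2)] by auto
 define \<psi> where "\<psi> = (th + (pi - 2 * \<bar>Arg z\<bar>)) / 2"
 have *: "th < \<psi>" "\<psi> < pi" "0 <= \<psi>" "\<bar>Arg z\<bar> + \<psi> / 2 < pi / 2" using z th hth by (auto simp: \<psi>_def field_simps)
 then have "decays \<psi> (pexp j z)" if "j >= - 1" for j using decays_pexp[OF z(1)] that by blast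
 then show ?thesis using that * z by blast
qed

lemma pexp_shift:
 assumes th: "sect_angle B < th" "th < pi" "z \<in> half_sector th"
  and th': "sect_angle B < th'" "th' < pi" "z \<in> half_sector th'" and j: "j >= - 1"
 shows "\<Phi> th (pexp j z) = \<Phi> th' (pexp j z)"
proof -
 obtain \<psi> where \<psi>: "th < \<psi>" "\<psi> < pi" "decays \<psi> (pexp j z)" using pexp_adm[OF th] j by blast
 obtain \<psi>' where \<psi>': "th' < \<psi>'" "\<psi>' < pi" "decays \<psi>' (pexp j z)" using pexp_adm[OF th'] j by blast
 show ?thesis
  by (rule fc_shift[where \<psi> = "max \<psi> \<psi>'"]) (use \<psi> \<psi>' th th' in \<open>auto simp: max_def\<close>)
qed

lemma T_eq:
 assumes th: "sect_angle B < th" "th < pi" "z \<in> half_sector th"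
 shows "T z = \<Phi> th (pexp 0 z)"
 unfolding T_def
proof (rule pexp_shift[OF _ _ _ th])
 have hth: "0 <= th" using th ang by simp
 have z: "z ~= 0" "\<bar>Arg z\<bar> + th / 2 < pi / 2" using th(3) sector_half_iff[OF hth th(2)] by auto
 let ?t = "(sect_angle B + pi - 2 * \<bar>Arg z\<bar>) / 2"
 have t: "sect_angle B < ?t" "?t < pi" "\<bar>Arg z\<bar> + ?t / 2 < pi / 2" using z th ang by (auto simp: field_simps)
 then show "sect_angle B < ?t" "?t < pi" by auto
 have "0 <= ?t" using t(1) ang by linarith
 then show "z \<in> half_sector ?t" using sector_half_iff[of ?t z] t z by blast
qed simp

lemma ray_bound:
 assumes th: "sect_angle B < th" "th < pi"
 shows "\<exists>C\<ge>0. \<forall>x t. ray th t --> norm (resolvent (cexp x t) B) <= C / (s + exp x)"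
proof -
 obtain C where C: "!!w. th <= \<bar>Im w\<bar> \<and> \<bar>Im w\<bar> <= 2 * pi - th ==> norm (resolvent (exp w) B) <= C / (s + exp (Re w))"
  using bound[OF th] by blast
 have C': "norm (resolvent (cexp x t) B) <= \<bar>C\<bar> / (s + exp x)" if "ray th t" for x t
 proof -
  have "norm (resolvent (cexp x t) B) <= C / (s + exp x)" using C[of "Complex x t"] that th ang by auto
  also have "... <= \<bar>C\<bar> / (s + exp x)" using s by (intro divide_right_mono) (auto simp: add_pos_pos less_imp_le)
  finally show ?thesis .
 qed
 show ?thesis by (intro exI[of _ "\<bar>C\<bar>"]) (use C' in auto)
qed

lemma fc_pexp_derivative:
 assumes th: "sect_angle B < th" "th < pi" "z \<in> half_sector th" and j: "j >= - 1"
 shows "((%z. \<Phi> th (pexp j z)) has_derivative (%h. h *\<^sub>C (- \<Phi> th (pexp (j + 1) z)))) (at z)"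
proof -
 have hth: "0 < th" using th ang by simp
 have z: "z ~= 0" "\<bar>Arg z\<bar> + th / 2 < pi / 2" using th(3) sector_half_iff[OF less_imp_le[OF hth] th(2)] by auto
 obtain C where "\<forall>x t. ray th t --> norm (resolvent (cexp x t) B) <= C / (s + exp x)"
  using ray_bound[OF th(1,2)] by blast
 then have C: "norm (resolvent (cexp x t) B) <= C / (s + exp x)" if "ray th t" for x t using that by blast
 show ?thesis
  by (rule fc_pexp_has_derivative[OF z hth j s R_line_continuous[OF th(1,2)] C])
qed

lemma pexp_mult_fc:
 assumes th: "sect_angle B < th" "th < pi" and z: "z \<in> half_sector th" "w \<in> half_sector th" and j: "j >= - 1"
 shows "\<Phi> th (pexp j z) o\<^sub>L \<Phi> th (pexp 0 w) = \<Phi> th (pexp j (z + w))"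
proof -
 obtain \<psi> where \<psi>: "th < \<psi>" "\<psi> < pi" "0 <= \<psi>" "!!j. j >= - 1 ==> decays \<psi> (pexp j z)" using pexp_adm[OF th z(1)] by blast
 obtain \<psi>' where \<psi>': "th < \<psi>'" "\<psi>' < pi" "0 <= \<psi>'" "\<bar>Arg w\<bar> + \<psi>' / 2 < pi / 2" "!!j. j >= - 1 ==> decays \<psi>' (pexp j w)" using pexp_adm[OF th z(2)] by blast
 have "\<Phi> th (pexp j z) o\<^sub>L \<Phi> th (pexp 0 w) = \<Phi> th (%u. pexp j z u * pexp 0 w u)"
 proof (rule fc_mult[where \<psi> = "min \<psi> \<psi>'" and b = 1])
  show "decays (min \<psi> \<psi>') (pexp j z)" by (rule decays_mono[OF \<psi>(4)[OF j]]) simp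
  show "decays (min \<psi> \<psi>') (pexp 0 w)" by (rule decays_mono[OF \<psi>'(5)]) simp_all
  show "norm (pexp 0 w u) <= 1" if "\<bar>Im u\<bar> < min \<psi> \<psi>'" for u
   by (rule norm_pexp0_le_1[of u \<psi>' w]) (use that \<psi>' in auto)
 qed (use \<psi> \<psi>' th in auto)
 then show ?thesis unfolding pexp_mult by simp
qed

lemma J_eq: assumes th: "sect_angle B < th" "th < pi" shows "J = \<Phi> th (%w. exp (- w / 2))"
 unfolding J_def by (rule fc_shift[OF decays_inv_sqrt[of pi]]) (use th th0 in auto)

text \<open>The semigroup times the inverse square root, the operator under the integral in
  \<open>U_op\<close>, becomes a single contour integral.\<close>

lemma T_J:
 assumes th: "sect_angle B < th" "th < pi" "z \<in> half_sector th"
 shows "T z o\<^sub>L J = \<Phi> th (pexp (- 1) z)"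
proof -
 obtain \<psi> where \<psi>: "th < \<psi>" "\<psi> < pi" "0 <= \<psi>" "\<bar>Arg z\<bar> + \<psi> / 2 < pi / 2" "!!j. j >= - 1 ==> decays \<psi> (pexp j z)"
  using pexp_adm[OF th] by blast
 have d: "decays \<psi> (pexp 0 z)" by (rule \<psi>(5)) simp
 have "T z o\<^sub>L J = J o\<^sub>L T z"
  unfolding T_eq[OF th] J_eq[OF th(1,2)] by (rule fc_fc_commute[OF d decays_inv_sqrt[of \<psi>]]) (use \<psi> th in auto)
 also have "... = \<Phi> th (%w. exp (- w / 2) * pexp 0 z w)"
  unfolding T_eq[OF th] J_eq[OF th(1,2)]
 proof (rule fc_mult[OF decays_inv_sqrt d])
  show "norm (pexp 0 z w) <= 1" if "\<bar>Im w\<bar> < \<psi>" for w by (rule norm_pexp0_le_1[OF that \<psi>(3,4)])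
 qed (use \<psi> th in auto)
 also have "(%w. exp (- w / 2) * pexp 0 z w) = pexp (- 1) z"
  unfolding pexp_def exp_add[symmetric] by simp
 finally show ?thesis .
qed

text \<open>Estimating the contour integral directly loses a logarithm as \<open>z\<close> tends to
  0. Subtracting \<open>1 / (1 + norm z^2 * \<lambda>)\<close>, whose value under the calculus is an
  explicit resolvent, leaves a function bounded by a multiple of the smaller of \<open>\<nu>\<close>
  and \<open>1 / \<nu>\<close>, where \<open>\<nu> = norm z * |\<lambda>|^(1/2)\<close>. The
  integral of that majorant over \<open>ln |\<lambda>|\<close> does not depend on
  \<open>z\<close>.\<close>

lemma T_bounded:
 assumes \<omega>: "sect_angle B <= \<omega>" "\<omega> < pi" and \<delta>: "0 < \<delta>" "\<delta> < (pi - \<omega>) / 2"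
 shows "bounded (T ` sector \<delta>)"
proof -
 define th where "th = (\<omega> + (pi - 2 * \<delta>)) / 2"
 have th: "\<omega> < th" "th < pi" "\<delta> + th / 2 < pi / 2" "sect_angle B < th" "0 < th"
  using \<omega> \<delta> ang by (auto simp: th_def field_simps)
 obtain C where C1: "0 <= C" "\<forall>x t. ray th t --> norm (resolvent (cexp x t) B) <= C / (s + exp x)"
  using ray_bound[OF th(4,2)] by blast
 then have C: "0 <= C" "ray th t ==> norm (resolvent (cexp x t) B) <= C / (s + exp x)" for x t by blast+
 obtain C' where C': "!!w. th <= \<bar>Im w\<bar> \<and> \<bar>Im w\<bar> <= 2 * pi - th ==> norm (resolvent (exp w) B) <= C' / (s + exp (Re w))"
  using bound[OF th(4,2)] by blast
 define c1 where "c1 = cos (\<delta> + th / 2)"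
 define c2 where "c2 = cos (th / 2)"
 have c12: "c1 > 0" "c2 > 0" unfolding c1_def c2_def using th \<delta> by (auto intro!: cos_gt_zero_pi)
 \<comment> \<open>The sum of the constants of the two cases \<open>\<nu> <= 1\<close> and
   \<open>\<nu> > 1\<close> below.\<close>
 define c where "c = (1 + 1 / c2) + (1 / c1 + 1 / c2)"
 have "1 / c1 > 0" "1 / c2 > 0" using c12 by simp_all
 then have c0: "c >= 0" and cA: "1 + 1 / c2 <= c" and cB: "1 / c1 + 1 / c2 <= c" unfolding c_def by linarith+
 define I where "I = (LINT y::real|lborel. exp (- 1 * \<bar>y\<bar>))"
 have "norm (T z) <= (1 / pi) * (c * C * (2 * I)) + \<bar>C'\<bar>" if zs: "z \<in> sector \<delta>" for z
 proof -
  let ?h = "%x. exp (- 1 * \<bar>ln (norm z) + (1/2) * x\<bar>)"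
  let ?H = "%x. c * exp (- 1 * \<bar>ln (norm z) + (1/2) * x\<bar>) * exp x * (C / (s + exp x))"
  have z0: "z ~= 0" "\<bar>Arg z\<bar> < \<delta>" using zs \<delta> by (auto simp: sector_def split: if_splits)
  have z: "z \<in> half_sector th" using sector_half_iff[of th z] th z0 by auto
  obtain \<psi> where \<psi>: "th < \<psi>" "\<psi> < pi" "0 <= \<psi>" "\<bar>Arg z\<bar> + \<psi> / 2 < pi / 2" "!!j. j >= - 1 ==> decays \<psi> (pexp j z)"
   using pexp_adm[OF th(4,2) z] by blast
  have d: "decays \<psi> (pexp 0 z)" by (rule \<psi>(5)) simp
  define \<rho> where "\<rho> = (norm z)\<^sup>2"
  have \<rho>: "\<rho> > 0" using z0 by (simp add: \<rho>_def)
  define rs where "rs w = 1 / (1 + complex_of_real \<rho> * exp w)" for w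
  have drs: "decays \<psi> rs" unfolding rs_def[abs_def] by (rule decays_resolvent(1)[OF \<rho> \<psi>(3,2)])
  define D where "D w = pexp 0 z w - rs w" for w
  have TzE: "T z = \<Phi> th D + \<Phi> th rs"
  proof -
   have "\<Phi> th (%w. 1 * pexp 0 z w + (- 1) * rs w) = 1 *\<^sub>C \<Phi> th (pexp 0 z) + (- 1) *\<^sub>C \<Phi> th rs"
    by (rule fc_lincomb[OF d drs]) (use th \<psi> in auto)
   then show ?thesis unfolding T_eq[OF th(4,2) z] D_def[abs_def] by simp
  qed
  have "norm (\<Phi> th rs) <= \<bar>C'\<bar>"
  proof -
   have r: "\<Phi> th rs = (- 1 / of_real \<rho>) *\<^sub>C resolvent (of_real (- 1 / \<rho>)) B"
    unfolding rs_def[abs_def] by (rule fc_resolvent[OF \<rho> drs[unfolded rs_def[abs_def]]]) (use th \<psi> in auto)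
   have ex: "cexp (- ln \<rho>) pi = of_real (- 1 / \<rho>)" using \<rho> by (simp add: exp_eq_polar exp_minus divide_inverse)
   have "norm (resolvent (of_real (- 1 / \<rho>)) B) <= C' / (s + 1 / \<rho>)"
    using C'[of "Complex (- ln \<rho>) pi"] th \<rho> unfolding ex by (simp add: exp_minus inverse_eq_divide)
   also have "... <= \<bar>C'\<bar> / (1 / \<rho>)" using s \<rho> by (intro frac_le) auto
   finally have "norm (resolvent (of_real (- 1 / \<rho>)) B) <= \<bar>C'\<bar> * \<rho>" by simp
   then show ?thesis unfolding r norm_scaleC using \<rho> by (simp add: norm_divide divide_le_eq)
  qed
  moreover have "norm (\<Phi> th D) <= (1 / pi) * (c * C * (2 * I))"
  proof -
   have Db: "norm (D (Complex x t)) <= c * ?h x" if t: "ray th t" for x t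
   proof -
    let ?w = "Complex x t"
    define \<nu> where "\<nu> = norm z * exp (x / 2)"
    have \<nu>: "\<nu> > 0" using z0 by (simp add: \<nu>_def)
    have ln\<nu>: "ln \<nu> = ln (norm z) + (1/2) * x" using z0 by (simp add: \<nu>_def ln_mult)
    have Iw: "\<bar>Im ?w\<bar> <= th" using t th by auto
    have Arg: "\<bar>Arg z\<bar> + th / 2 <= pi" using z0 th pi_gt_zero by linarith
    have "c1 <= cos (\<bar>Arg z\<bar> + th / 2)" unfolding c1_def using z0 th by (intro cos_monotone_0_pi_le) auto
    then have "c1 * \<nu> <= cos (\<bar>Arg z\<bar> + th / 2) * \<nu>" using \<nu> by (intro mult_right_mono) auto
    also have "... = sect_mod th z * exp (Re ?w / 2)" by (simp add: sect_mod_def \<nu>_def)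
    also have "... <= Re (z * exp (?w / 2))" by (rule sect_mod_le[OF Iw Arg])
    finally have Re: "c1 * \<nu> <= Re (z * exp (?w / 2))" .
    have re0: "0 <= c1 * \<nu>" using c12 \<nu> by simp
    have rho: "\<rho> * exp x = \<nu>\<^sup>2"
    proof -
     have "exp x = exp (x / 2) * exp (x / 2)" by (simp flip: exp_add)
     then show ?thesis by (simp add: \<rho>_def \<nu>_def power2_eq_square)
    qed
    have den: "c2 * (1 + \<nu>\<^sup>2) <= norm (1 + complex_of_real \<rho> * exp ?w)"
     using one_plus_exp_bound[of \<rho> ?w th] \<rho> Iw th rho by (simp add: c2_def)
    have denpos: "c2 * (1 + \<nu>\<^sup>2) > 0" using c12 by (simp add: add_pos_nonneg)
    have am: "2 * \<nu> <= 1 + \<nu>\<^sup>2" using zero_le_power2[of "\<nu> - 1"] by (simp add: power2_eq_square algebra_simps)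
    have rs1: "norm (rs ?w) <= 1 / (c2 * \<nu>)"
    proof -
     have "norm (rs ?w) <= 1 / (c2 * (1 + \<nu>\<^sup>2))" unfolding rs_def norm_divide using den denpos by (intro frac_le) auto
     also have "... <= 1 / (c2 * \<nu>)" using c12 \<nu> am by (intro frac_le mult_left_mono) auto
     finally show ?thesis .
    qed
    have rs2: "norm (1 - rs ?w) <= \<nu> / c2"
    proof -
     have ne: "1 + complex_of_real \<rho> * exp ?w ~= 0" using den denpos by auto
     then have "1 - rs ?w = complex_of_real \<rho> * exp ?w / (1 + complex_of_real \<rho> * exp ?w)" by (simp add: rs_def field_simps)
     then have "norm (1 - rs ?w) = \<nu>\<^sup>2 / norm (1 + complex_of_real \<rho> * exp ?w)"
      using \<rho> rho by (simp add: norm_divide norm_mult)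
     also have "... <= \<nu>\<^sup>2 / (c2 * (1 + \<nu>\<^sup>2))" using den denpos by (intro divide_left_mono) (auto intro: mult_pos_pos less_le_trans)
     also have "... <= \<nu>\<^sup>2 / (c2 * \<nu>)" using c12 \<nu> am by (intro frac_le mult_left_mono) auto
     also have "... = \<nu> / c2" using \<nu> by (simp add: power2_eq_square)
     finally show ?thesis .
    qed
    have p0: "pexp 0 z ?w = exp (- (z * exp (?w / 2)))" by (simp add: pexp_def)
    have ez: "norm (z * exp (?w / 2)) = \<nu>" by (simp add: norm_mult \<nu>_def)
    show ?thesis
    \<comment> \<open>For small \<open>\<nu>\<close> both functions are close to 1 and are compared
      with it; for large \<open>\<nu>\<close> each of them is small by itself.\<close>
    proof (cases "\<nu> <= 1")
     case True
     have "norm (pexp 0 z ?w - 1) <= \<nu>" unfolding p0 ez[symmetric] by (rule norm_exp_minus_one_le) (use Re re0 in linarith)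
     moreover have "D ?w = (pexp 0 z ?w - 1) + (1 - rs ?w)" by (simp add: D_def)
     ultimately have "norm (D ?w) <= \<nu> + \<nu> / c2" using rs2 norm_triangle_ineq[of "pexp 0 z ?w - 1" "1 - rs ?w"] by simp
     also have "... = (1 + 1 / c2) * \<nu>" by (simp add: distrib_right)
     also have "... <= c * \<nu>" using \<nu> by (intro mult_right_mono cA) auto
     also have "\<nu> = exp (- 1 * \<bar>ln \<nu>\<bar>)" using True \<nu> by (simp add: abs_of_nonpos)
     finally show ?thesis unfolding ln\<nu> .
    next
     case False
     have "norm (pexp 0 z ?w) <= exp (- c1 * \<nu>)" unfolding p0 norm_exp_eq_Re using Re by simp
     also have "... <= 1 / (c1 * \<nu>)"
      using power_exp_le_fact[of \<nu> c1 1] \<nu> c12 by (simp add: field_simps)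
     finally have "norm (D ?w) <= 1 / (c1 * \<nu>) + 1 / (c2 * \<nu>)"
      unfolding D_def using rs1 norm_triangle_ineq4[of "pexp 0 z ?w" "rs ?w"] by linarith
     also have "... = (1 / c1 + 1 / c2) * (1 / \<nu>)" using c12 \<nu> by (simp add: field_simps)
     also have "... <= c * (1 / \<nu>)" using \<nu> by (intro mult_right_mono cB) auto
     also have "1 / \<nu> = exp (- 1 * \<bar>ln \<nu>\<bar>)" using False \<nu> by (simp add: exp_minus inverse_eq_divide)
     finally show ?thesis unfolding ln\<nu> .
    qed
   qed
   have e: "exp x * (C / (s + exp x)) <= C" for x
   proof -
    have "exp x * (C / (s + exp x)) = C * (exp x / (s + exp x))" by simp
    also have "... <= C * 1" using s C(1) by (intro mult_left_mono) (auto simp: divide_le_eq add_pos_pos)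
    finally show ?thesis by simp
   qed
   have lin: "integrable lborel (%x::real. ?h x)"
    by (rule lborel_integrable_real_affine[OF integrable_exp_abs]) auto
   have lin2: "(LINT x|lborel. ?h x) = 2 * I"
    using lborel_integral_real_affine[of "1/2" "%y::real. exp (- 1 * \<bar>y\<bar>)" "ln (norm z)"] by (simp add: I_def)
   have maj: "integrable lborel (%x. c * C * ?h x)" by (intro integrable_mult_right lin)
   have int: "integrable lborel (%x. ?H x)"
   proof (rule integrable_le[OF maj])
    have ne: "s + exp x ~= 0" for x using s by (smt (verit) exp_gt_zero)
    have "continuous_on UNIV (%x. ?H x)"
     using ne by (intro continuous_intros) auto
    from borel_measurable_continuous_onI[OF this]
    show "(%x. ?H x) \<in> borel_measurable lborel" by simp
    show "AE x in lborel. norm (?H x)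
      <= norm (c * C * ?h x)"
    proof (rule AE_I2)
     fix x :: real
     have sp: "s + exp x > 0" using s by (simp add: add_pos_pos)
     have "(c * ?h x) * (exp x * (C / (s + exp x))) <= (c * ?h x) * C"
      using c0 by (intro mult_left_mono e) auto
     then show "norm (?H x)
      <= norm (c * C * ?h x)"
      using c0 C(1) sp by (simp add: abs_mult mult_ac)
    qed
   qed
   have "norm (\<Phi> th D) <= (1 / pi) * (LINT x|lborel. ?H x)"
   proof (rule fc_bound(2)[OF _ _ C(2) Db int])
    show "continuous_on UNIV (%x. resolvent (cexp x t) B)" if "ray th t" for t
     by (rule R_line_continuous[OF th(4,2) that])
    show "continuous_on UNIV (%x. D (Complex x t))" if "ray th t" for t
     unfolding D_def using that th \<psi> by (intro continuous_intros decays_line[OF d] decays_line[OF drs]) auto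
   qed
   also have "... <= (1 / pi) * (LINT x|lborel. c * C * ?h x)"
   proof (intro mult_left_mono integral_mono[OF int maj])
    fix x :: real
    have "(c * ?h x) * (exp x * (C / (s + exp x))) <= (c * ?h x) * C"
     using c0 by (intro mult_left_mono e) auto
    then show "?H x <= c * C * ?h x"
     by (simp add: mult_ac)
   qed simp
   also have "... = (1 / pi) * (c * C * (2 * I))" unfolding integral_mult_right_zero lin2 ..
   finally show ?thesis .
  qed
  ultimately show ?thesis unfolding TzE using norm_triangle_ineq[of "\<Phi> th D" "\<Phi> th rs"] by linarith
 qed
 then show ?thesis unfolding bounded_iff by blast
qed

text \<open>Fubini exchanges the time integral and the contour integral, and
  \<open>exp (- r * t) * exp (- t * \<lambda>^(1/2))\<close> integrates to
  \<open>1 / (r + \<lambda>^(1/2))\<close>, the function that defines \<open>H r\<close>. Time is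
  written as \<open>exp y\<close>, so that both variables run over the real line.\<close>

lemma T_laplace:
 assumes r: "r > 0"
 shows "has_bochner leb_pos (%t. exp (- r * t) *\<^sub>R T (complex_of_real t)) (H r)"
proof -
 have pos: "complex_of_real t \<in> half_sector th0" if "t > 0" for t using that th0 by (intro of_real_in_sector) auto
 have Tt: "T (of_real t) = \<Phi> th0 (pexp 0 (of_real t))" if "t > 0" for t by (rule T_eq[OF th0(1,4) pos[OF that]])
 have "bounded (T ` sector ((pi - th0) / 2 / 2))"
  by (rule T_bounded[of th0]) (use th0 in auto)
 then obtain M where "\<forall>y\<in>T ` sector ((pi - th0) / 2 / 2). norm y <= M" unfolding bounded_iff by blast
 then have M: "norm (T (of_real t)) <= M" if "t > 0" for t
  using of_real_in_sector[OF that, of "(pi - th0) / 2 / 2"] th0 by auto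
 have M0: "M >= 0" using order_trans[OF norm_ge_zero M[of 1]] by simp
 have Tc: "continuous_on {0<..} (%t. T (of_real t))"
 proof -
  have "continuous_on {0<..} (%t. \<Phi> th0 (pexp 0 (complex_of_real t)))"
  proof (intro continuous_at_imp_continuous_on ballI)
   fix t :: real assume t: "t \<in> {0<..}"
   have "isCont (%z. \<Phi> th0 (pexp 0 z)) (of_real t)"
    by (rule has_derivative_continuous[OF fc_pexp_derivative[OF th0(1,4) pos]]) (use t in auto)
   then show "isCont (%t. \<Phi> th0 (pexp 0 (complex_of_real t))) t"
    by (rule isCont_o2[where f = complex_of_real and g = "%z. \<Phi> th0 (pexp 0 z)", rotated])
     (rule continuous_of_real[OF continuous_ident])
  qed
  then show ?thesis by (rule continuous_on_eq) (simp add: Tt)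
 qed
 define f where "f t = exp (- r * t) *\<^sub>R T (complex_of_real t)" for t
 have fc: "continuous_on {0<..} f" unfolding f_def by (intro continuous_intros Tc)
 have ei: "integrable lborel (%y. exp y * exp (- r * exp y))"
  using integrable_norm[OF LINT_exp_pos(1)[of "of_real r"]] r by simp
 have fi: "bochner_integrable leb_pos f"
 proof (rule bochner_integrable_continuous_lebesgue_on[OF fc])
  show "integrable leb_pos (%t. M * exp (- r * t))"
   by (intro integrable_mult_right exp_subst(1)) (use ei in simp)
  show "norm (f t) <= M * exp (- r * t)" if "t \<in> {0<..}" for t
   using M[of t] that by (simp add: f_def mult.commute mult_right_mono)
 qed simp
 have "bochner leb_pos f = H r"
 proof (rule cfunctional_eqI)
  fix m :: "('a \<Rightarrow>\<^sub>L 'a) => complex" assume m: "cfunctional m"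
  interpret m: bounded_linear m by (rule cfunctionalD(1)[OF m])
  obtain K where K: "K > 0" "!!T. norm (m T) <= norm T * K" using m.pos_bounded by blast
  define \<kappa> where "\<kappa> = 1 / (2 * complex_of_real pi * \<i>)"
  define \<rho> where "\<rho> w = m (resolvent (exp w) B)" for w
  obtain C where C: "0 <= C" "!!w. th0 <= \<bar>Im w\<bar> ==> \<bar>Im w\<bar> <= 2 * pi - th0 ==> norm (\<rho> w) <= C * (1 / (s + exp (Re w)))"
   using functional_R_bound[OF m th0(1,4)] unfolding \<rho>_def by blast
  define e where "e t x y = exp y *\<^sub>R exp (- (of_real r + exp (Complex x t / 2)) * of_real (exp y))" for t x y
  define k where "k t x = cexp x t * \<rho> (Complex x t)" for t x
  define D where "D y x = \<kappa> * (e (- th0) x y * k (- th0) x - e th0 x y * k th0 x)" for y x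
  have Rep: "0 < Re (of_real r + exp (Complex x t / 2))" if "ray th0 t" for x t
  proof -
   have "cos (t / 2) > 0" using that th0 by (intro cos_gt_zero_pi) auto
   then show ?thesis using r by (simp add: Re_exp add_pos_pos)
  qed
  have line: "pexp 0 (of_real (exp y)) (Complex x t) * cexp x t * \<rho> (Complex x t) * (exp y *\<^sub>R exp (- r * exp y)) = e t x y * k t x" for y x t
  proof -
   have "pexp 0 (of_real (exp y)) (Complex x t) * of_real (exp (- r * exp y)) = exp (- (of_real r + exp (Complex x t / 2)) * of_real (exp y))"
    unfolding pexp_def exp_of_real[of "- r * exp y", symmetric] exp_add[symmetric] by (simp add: algebra_simps)
   then show ?thesis by (simp add: e_def k_def scaleR_conv_of_real mult_ac)
  qed
  have fm: "exp y *\<^sub>R m (f (exp y)) = (LINT x|lborel. D y x)" for y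
  proof -
   have ye: "exp y > (0::real)" by simp
   obtain \<psi> where \<psi>: "th0 < \<psi>" "\<psi> < pi" "!!j. j >= - 1 ==> decays \<psi> (pexp j (of_real (exp y)))"
    using pexp_adm[OF th0(1,4) pos[OF ye]] by blast
   have d: "decays \<psi> (pexp 0 (of_real (exp y)))" by (rule \<psi>(3)) simp
   note li = line_integrable[OF d m th0(1) \<psi>(1) th0(4)]
   have "m (T (of_real (exp y))) = \<kappa> * ((LINT x|lborel. pexp 0 (of_real (exp y)) (Complex x (- th0)) * cexp x (- th0) * \<rho> (Complex x (- th0))) -
     (LINT x|lborel. pexp 0 (of_real (exp y)) (Complex x th0) * cexp x th0 * \<rho> (Complex x th0)))"
    unfolding Tt[OF ye] \<kappa>_def \<rho>_def by (rule fc_functional[OF d m th0(1) \<psi>(1) th0(4)])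
   also have "... = (LINT x|lborel. \<kappa> * (pexp 0 (of_real (exp y)) (Complex x (- th0)) * cexp x (- th0) * \<rho> (Complex x (- th0)) -
     pexp 0 (of_real (exp y)) (Complex x th0) * cexp x th0 * \<rho> (Complex x th0)))"
    unfolding integral_mult_right_zero using li[OF disjI2[OF refl]] li[OF disjI1[OF refl]] unfolding \<rho>_def
    by (subst LINT_diff) auto
   finally have "m (T (of_real (exp y))) * of_real (exp y * exp (- r * exp y)) = (LINT x|lborel. \<kappa> * (pexp 0 (of_real (exp y)) (Complex x (- th0)) * cexp x (- th0) * \<rho> (Complex x (- th0)) -
     pexp 0 (of_real (exp y)) (Complex x th0) * cexp x th0 * \<rho> (Complex x th0)) * of_real (exp y * exp (- r * exp y)))"
    by (simp only: integral_mult_left_zero)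
   also have "... = (LINT x|lborel. D y x)"
    unfolding D_def line[symmetric] by (simp add: scaleR_conv_of_real algebra_simps)
   finally show ?thesis by (simp add: f_def m.scaleR scaleR_conv_of_real mult_ac)
  qed
  define Q where "Q = max 1 (1 / cos (th0 / 2))"
  have cpos: "cos (th0 / 2) > 0" using th0 by (intro cos_gt_zero_pi) auto
  \<comment> \<open>The double exponential in \<open>y + x / 2\<close> is spent as
    \<open>exp (- (y + x / 2) / 2)\<close>. This changes the powers just enough for a product
    majorant, with \<open>exp (y / 2)\<close> on the time side and \<open>exp ((3/4) * x)\<close> on
    the contour side.\<close>
  have tb: "norm (e t x y * k t x) <= (exp (y / 2) * exp (- r * exp y)) * (Q * C * (exp ((3/4) * x) / (s + exp x)))"
   if t: "ray th0 t" for t x y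
  proof -
   have "norm (e t x y) = exp y * exp (- r * exp y) * exp (- cos (t / 2) * exp (y + x / 2))"
    unfolding e_def by (simp add: Re_exp algebra_simps flip: exp_add)
   also have "cos (t / 2) = cos (th0 / 2)" using t by auto
   also have "exp y * exp (- r * exp y) * exp (- cos (th0 / 2) * exp (y + x / 2)) <= exp y * exp (- r * exp y) * (Q * exp (- (y + x / 2) / 2))"
    unfolding Q_def by (intro mult_left_mono exp_neg_le_inv_sqrt cpos) auto
   finally have 1: "norm (e t x y) <= exp y * exp (- r * exp y) * (Q * exp (- (y + x / 2) / 2))" .
   have 2: "norm (k t x) <= exp x * (C * (1 / (s + exp x)))"
    unfolding k_def norm_mult norm_exp_eq_Re complex.sel using C(2)[of "Complex x t"] t th0 by (intro mult_left_mono) auto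
   have "norm (e t x y * k t x) <= (exp y * exp (- r * exp y) * (Q * exp (- (y + x / 2) / 2))) * (exp x * (C * (1 / (s + exp x))))"
    unfolding norm_mult using 1 2 by (intro mult_mono) (auto simp: Q_def intro!: mult_nonneg_nonneg)
   also have "... = (exp y * exp (- (y + x / 2) / 2) * exp x) * exp (- r * exp y) * Q * C * (1 / (s + exp x))" by (simp only: mult_ac)
   also have "exp y * exp (- (y + x / 2) / 2) * exp x = exp (y / 2) * exp ((3/4) * x)"
    unfolding exp_add[symmetric] by (rule arg_cong[of _ _ exp]) (simp add: field_simps)
   finally show ?thesis by (simp add: mult_ac)
  qed
  have gi: "integrable lborel (%y. exp (y / 2) * exp (- r * exp y))"
  proof (rule integrable_le[OF integrable_mult_right[OF integrable_exp_abs[of "1/2"], of "max 1 (1 / r)"]])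
   show "AE y in lborel. norm (exp (y / 2) * exp (- r * exp y)) <= norm (max 1 (1 / r) * exp (- (1 / 2) * \<bar>y\<bar>))"
   proof (rule AE_I2)
    fix y :: real
    have "exp (y / 2) * exp (- r * exp y) <= max 1 (1 / r) * exp (- (1 / 2) * \<bar>y\<bar>)"
    proof (cases "y >= 0")
     case True
     have "exp y ^ 1 * exp (- r * exp y) <= fact 1 / r ^ 1" by (rule power_exp_le_fact) (use r in auto)
     then have "exp (- y / 2) * (exp y * exp (- r * exp y)) <= exp (- y / 2) * (1 / r)" by (intro mult_left_mono) auto
     moreover have "exp (- y / 2) * (exp y * exp (- r * exp y)) = exp (y / 2) * exp (- r * exp y)"
      unfolding mult.assoc[symmetric] exp_add[symmetric] by simp
     ultimately have "exp (y / 2) * exp (- r * exp y) <= exp (- y / 2) * (1 / r)" by (simp only:)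
     also have "... <= exp (- y / 2) * max 1 (1 / r)" by (intro mult_left_mono) auto
     finally show ?thesis using True by (simp add: mult.commute)
    next
     case False
     have "exp (y / 2) * exp (- r * exp y) <= exp (y / 2) * 1" using r by (intro mult_left_mono) auto
     also have "... <= max 1 (1 / r) * exp (y / 2)" by simp
     finally show ?thesis using False by simp
    qed
    then show "norm (exp (y / 2) * exp (- r * exp y)) <= norm (max 1 (1 / r) * exp (- (1 / 2) * \<bar>y\<bar>))" by (simp add: abs_mult)
   qed
  qed auto
  have hi: "integrable lborel (%x. norm \<kappa> * 2 * (Q * C * (exp ((3/4) * x) / (s + exp x))))"
  proof -
   have "integrable lborel (%x. exp ((3/4) * x) / (s + exp x))"
   proof (rule integrable_le[OF integrable_mult_right[OF integrable_exp_abs[of "1/4"], of "max 1 (1 / s)"]])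
    show "AE x in lborel. norm (exp ((3/4) * x) / (s + exp x)) <= norm (max 1 (1 / s) * exp (- (1 / 4) * \<bar>x\<bar>))"
     using exp_frac_le[OF s, of "1/4" "3/4"] s by (auto intro!: AE_I2 simp: abs_mult add_pos_pos)
   qed auto
   then show ?thesis by (intro integrable_mult_right)
  qed
  have Dle: "norm (D y x) <= (exp (y / 2) * exp (- r * exp y)) * (norm \<kappa> * 2 * (Q * C * (exp ((3/4) * x) / (s + exp x))))" for y x
  proof -
   let ?b = "(exp (y / 2) * exp (- r * exp y)) * (Q * C * (exp ((3/4) * x) / (s + exp x)))"
   have "norm (D y x) <= norm \<kappa> * (?b + ?b)"
    unfolding D_def norm_mult[of \<kappa>] by (intro mult_left_mono order_trans[OF norm_triangle_ineq4] add_mono tb) auto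
   then show ?thesis by (simp add: mult_ac)
  qed
  have kc: "continuous_on UNIV (k t)" if "ray th0 t" for t
   unfolding k_def \<rho>_def using that by (intro continuous_intros functional_R_line_continuous[OF m th0(1,4)]) auto
  have Dc: "continuous_on UNIV (%z. D (fst z) (snd z))"
   unfolding D_def e_def by (intro continuous_intros continuous_on_compose2[OF kc]) auto
  have meas: "(%(y, x). D y x) \<in> borel_measurable (lborel \<Otimes>\<^sub>M lborel)"
   using borel_measurable_continuous_onI[OF Dc] by (simp add: lborel_prod case_prod_beta)
  have "m (bochner leb_pos f) = (LINT t|leb_pos. m (f t))"
   by (rule bochner_functional(2)[OF fi m])
  also have "... = (LINT y|lborel. exp y *\<^sub>R m (f (exp y)))"
  proof (rule exp_subst(2))
   have "integrable lborel (%y. M * K * (exp y * exp (- r * exp y)))" by (intro integrable_mult_right ei)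
   then show "integrable lborel (%y. exp y *\<^sub>R m (f (exp y)))"
   proof (rule integrable_le)
    have "continuous_on UNIV (%y. exp y *\<^sub>R m (f (exp y)))"
     by (intro continuous_intros m.continuous_on continuous_on_compose2[OF fc]) auto
    from borel_measurable_continuous_onI[OF this] show "(%y. exp y *\<^sub>R m (f (exp y))) \<in> borel_measurable lborel" by simp
    show "AE y in lborel. norm (exp y *\<^sub>R m (f (exp y))) <= norm (M * K * (exp y * exp (- r * exp y)))"
    proof (rule AE_I2)
     fix y :: real
     have "norm (m (f (exp y))) <= norm (f (exp y)) * K" by (rule K)
     also have "... <= (exp (- r * exp y) * M) * K"
      using M[of "exp y"] K(1) by (intro mult_right_mono) (auto simp: f_def)
     finally show "norm (exp y *\<^sub>R m (f (exp y))) <= norm (M * K * (exp y * exp (- r * exp y)))"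
      using M0 K(1) by (simp add: abs_mult mult_ac)
    qed
   qed
  qed
  also have "... = (LINT y|lborel. LINT x|lborel. D y x)" unfolding fm ..
  also have "... = (LINT x|lborel. LINT y|lborel. D y x)" by (rule fubini_dominated[OF meas gi hi Dle])
  also have "... = (LINT x|lborel. \<kappa> * ((1 / (of_real r + exp (Complex x (- th0) / 2))) * k (- th0) x - (1 / (of_real r + exp (Complex x th0 / 2))) * k th0 x))"
  proof (rule LINT_cong[OF refl])
   fix x
   have ie: "integrable lborel (e t x)" "(LINT y|lborel. e t x y) = 1 / (of_real r + exp (Complex x t / 2))" if "ray th0 t" for t
    unfolding e_def[abs_def] using LINT_exp_pos[OF Rep[OF that, of x]] by auto
   show "(LINT y|lborel. D y x) = \<kappa> * ((1 / (of_real r + exp (Complex x (- th0) / 2))) * k (- th0) x - (1 / (of_real r + exp (Complex x th0 / 2))) * k th0 x)"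
    unfolding D_def integral_mult_right_zero
     LINT_diff[OF integrable_mult_left[OF ie(1)[OF disjI2[OF refl]]] integrable_mult_left[OF ie(1)[OF disjI1[OF refl]]]]
     integral_mult_left_zero ie(2)[OF disjI2[OF refl]] ie(2)[OF disjI1[OF refl]] ..
  qed
  also have "... = m (H r)"
  proof -
   note li = line_integrable[OF decays_sqrt_plus[OF r] m th0(1,4,4)]
   have "(1 / (of_real r + exp (Complex x t / 2))) * k t x = 1 / (of_real r + exp (Complex x t / 2)) * cexp x t * m (resolvent (cexp x t) B)" for t x
    by (simp add: k_def \<rho>_def)
   then show ?thesis
    unfolding H_def fc_functional[OF decays_sqrt_plus[OF r] m th0(1,4,4)] \<kappa>_def[symmetric] integral_mult_right_zero
    using li[OF disjI2[OF refl]] li[OF disjI1[OF refl]] by (simp only: LINT_diff)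
  qed
  finally show "m (bochner leb_pos f) = m (H r)" .
 qed
 then show ?thesis using has_bochner_bochner[OF fi] by (simp add: f_def[abs_def])
qed

text \<open>The sector is allowed to come from any \<omega> at least \<open>sect_angle B\<close>: a
  shift \<open>A + s\<close> may have a smaller angle than \<open>A\<close>, while
  \<open>U_integrand\<close> uses the same sector for all \<open>s\<close>.\<close>

lemma T_semigroup:
 assumes \<omega>: "sect_angle B <= \<omega>" "\<omega> < pi"
 shows "bdd_holo_semigroup (sqrt_op B) ((pi - \<omega>) / 2) T"
 unfolding bdd_holo_semigroup_def
proof (intro conjI ballI allI impI)
 have om: "0 <= \<omega>" using \<omega> ang by simp
 let ?S = "half_sector \<omega>"
 fix z assume z: "z \<in> ?S"
 obtain th where "\<omega> < th" and th: "th < pi" "z \<in> half_sector th"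
  using sector_common_angle[OF om \<omega>(2) z z] by blast
 then have th': "sect_angle B < th" using \<omega> by simp
 obtain \<psi> where \<psi>: "th < \<psi>" "!!j. j >= - 1 ==> decays \<psi> (pexp j z)" using pexp_adm[OF th' th] by blast
 show "T z \<in> cblinfuns"
  unfolding T_eq[OF th' th] using \<psi> by (intro fc_cblinfuns[OF \<psi>(2)] th' th) auto
 fix w assume w: "w \<in> ?S"
 obtain \<eta> where "\<omega> < \<eta>" and \<eta>: "\<eta> < pi" "z \<in> half_sector \<eta>" "w \<in> half_sector \<eta>"
  using sector_common_angle[OF om \<omega>(2) z w] by blast
 then have \<eta>': "sect_angle B < \<eta>" "0 <= \<eta>" using \<omega> om by simp_all
 show "T (z + w) = T z o\<^sub>L T w"
  unfolding T_eq[OF \<eta>'(1) \<eta>(1,2)] T_eq[OF \<eta>'(1) \<eta>(1,3)] T_eq[OF \<eta>'(1) \<eta>(1) sector_half_add[OF \<eta>'(2) \<eta>]]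
  by (rule pexp_mult_fc[OF \<eta>'(1) \<eta>, symmetric]) simp
next
 have om: "0 <= \<omega>" using \<omega> ang by simp
 show "vector_holomorphic_on T (half_sector \<omega>)"
  unfolding vector_holomorphic_on_def
 proof
  fix z assume z: "z \<in> half_sector \<omega>"
  obtain th where "\<omega> < th" and th: "th < pi" "z \<in> half_sector th"
   using sector_common_angle[OF om \<omega>(2) z z] by blast
  then have th': "sect_angle B < th" "0 < th" using \<omega> om by simp_all
  have os: "open (half_sector th)" by (rule open_convex_sector) (use th th' in auto)
  have "((%z. \<Phi> th (pexp 0 z)) has_derivative (%h. h *\<^sub>C (- \<Phi> th (pexp (0 + 1) z)))) (at z)"
   by (rule fc_pexp_derivative[OF th'(1) th]) simp
  then have "(T has_derivative (%h. h *\<^sub>C (- \<Phi> th (pexp (0 + 1) z)))) (at z)"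
   by (rule has_derivative_transform_within_open[OF _ os th(2)]) (simp add: T_eq[OF th'(1) th(1)])
  then show "\<exists>D. (T has_derivative (%h. h *\<^sub>C D)) (at z within half_sector \<omega>)"
   using has_derivative_at_withinI by blast
 qed
next
 fix th assume "0 < th \<and> th < (pi - \<omega>) / 2"
 then show "bounded (T ` sector th)" using T_bounded[OF \<omega>] by blast
next
 fix r :: real assume r: "0 < r"
 show "boundedly_invertible (op_plus (sqrt_op B) (complex_of_real r))" by (rule inv_sqrt_plus(1)[OF r])
 show "has_bochner leb_pos (%t. exp (- r * t) *\<^sub>R T (complex_of_real t)) (inv_op (op_plus (sqrt_op B) (complex_of_real r)))"
  unfolding inv_sqrt_plus(2)[OF r] by (rule T_laplace[OF r])
qed

lemma holo_exp_eq:
 assumes \<omega>: "sect_angle B <= \<omega>" "\<omega> < pi" and z: "z \<in> half_sector \<omega>"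
 shows "holo_exp ((pi - \<omega>) / 2) (sqrt_op B) z = T z"
proof (rule bdd_holo_semigroup_unique[OF _ _ _ T_semigroup[OF \<omega>] z])
 show "0 < (pi - \<omega>) / 2" "(pi - \<omega>) / 2 <= pi / 2" using \<omega> ang by auto
 show "bdd_holo_semigroup (sqrt_op B) ((pi - \<omega>) / 2) (holo_exp ((pi - \<omega>) / 2) (sqrt_op B))"
  unfolding holo_exp_def by (rule someI[of "bdd_holo_semigroup (sqrt_op B) ((pi - \<omega>) / 2)", OF T_semigroup[OF \<omega>]])
qed

end

section \<open>Shifted sectorial operators\<close>

lemma minus_op_op_plus: "minus_op z (op_plus A c) = minus_op (z - c) A"
 by (rule ext) (simp add: minus_op_def op_plus_def option.map_comp o_def scaleC_diff_left algebra_simps)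

lemma resolvent_op_plus:
 "resolvent z (op_plus A c) = resolvent (z - c) A" "z \<in> resolvent_set (op_plus A c) \<longleftrightarrow> z - c \<in> resolvent_set A"
 by (simp_all add: resolvent_def resolvent_set_def minus_op_op_plus)

context inv_sect
begin

text \<open>Factor the function of index \<open>- 1\<close> as \<open>1 / (1 + \<lambda>)\<close>
  times \<open>f\<close>, the sum of those of index \<open>- 1\<close> and 1. The first factor
  becomes \<open>K\<close>, whose range is the domain of \<open>B\<close>, and \<open>f\<close>
  tells what \<open>1 + B\<close> yields.\<close>

lemma fc_pexp_minus_one_dom:
 assumes th: "sect_angle B < th" "th < pi" "z \<in> half_sector th"
 shows "blinfun_apply (\<Phi> th (pexp (- 1) z)) y \<in> dom B"
  "app B (blinfun_apply (\<Phi> th (pexp (- 1) z)) y) = blinfun_apply (\<Phi> th (pexp 1 z)) y"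
proof -
 obtain \<psi> where \<psi>: "th < \<psi>" "\<psi> < pi" "0 <= \<psi>" "!!j. j >= - 1 ==> decays \<psi> (pexp j z)"
  using pexp_adm[OF th] by blast
 define f where "f w = 1 * pexp (- 1) z w + 1 * pexp 1 z w" for w
 have d1: "decays \<psi> (pexp (- 1) z)" "decays \<psi> (pexp 1 z)" by (rule \<psi>(4); simp)+
 have df: "decays \<psi> f"
  unfolding f_def[abs_def] by (intro decays_add decays_cmult d1)
 have dK: "decays \<psi> (%w. 1 / (1 + of_real 1 * exp w))" by (rule decays_resolvent(1)) (use \<psi> in auto)
 have KE: "K = \<Phi> th (%w. 1 / (1 + of_real 1 * exp w))"
  unfolding K_def by (rule fc_shift[where \<psi> = "max \<psi> \<psi>0"]) (use decays_resolvent(1)[of 1 "max \<psi> \<psi>0"] \<psi> th th0 in auto)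
 have e: "f w * (1 / (1 + of_real 1 * exp w)) = pexp (- 1) z w" if "w \<in> {w. \<bar>Im w\<bar> < \<psi>}" for w
 proof -
  have "cos (\<psi> / 2) > 0" using \<psi> by (intro cos_gt_zero_pi) auto
  then have "0 < cos (\<psi> / 2) * (1 + 1 * exp (Re w))" by (simp add: add_pos_pos)
  also have "... <= norm (1 + of_real 1 * exp w)" by (rule one_plus_exp_bound) (use that \<psi> in auto)
  finally have ne: "1 + exp w ~= 0" by auto
  have "pexp 1 z w = pexp (- 1) z w * exp w" by (simp add: pexp_def flip: exp_add)
  then have "f w = pexp (- 1) z w * (1 + exp w)" by (simp add: f_def algebra_simps)
  then show ?thesis using ne by simp
 qed
 have "\<Phi> th f o\<^sub>L K = \<Phi> th (%w. f w * (1 / (1 + of_real 1 * exp w)))"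
  unfolding KE by (rule fc_mult[OF df dK decays_resolvent(2)]) (use \<psi> th in auto)
 also have "... = \<Phi> th (pexp (- 1) z)" by (rule fc_cong) (rule e, use \<psi> th ang in auto)
 finally have "\<Phi> th f o\<^sub>L K = \<Phi> th (pexp (- 1) z)" .
 moreover have "K o\<^sub>L \<Phi> th f = \<Phi> th f o\<^sub>L K"
  unfolding KE by (rule fc_fc_commute[OF dK df]) (use \<psi> th in auto)
 ultimately have KV: "\<Phi> th (pexp (- 1) z) = K o\<^sub>L \<Phi> th f" by simp
 have fV: "\<Phi> th f = \<Phi> th (pexp (- 1) z) + \<Phi> th (pexp 1 z)"
  unfolding f_def[abs_def] by (subst fc_lincomb[OF d1]) (use \<psi> th in auto)
 have V: "blinfun_apply (\<Phi> th (pexp (- 1) z)) y = blinfun_apply K (blinfun_apply (\<Phi> th f) y)" by (simp add: KV)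
 show "blinfun_apply (\<Phi> th (pexp (- 1) z)) y \<in> dom B" unfolding V by (rule K)
 have "blinfun_apply (\<Phi> th (pexp (- 1) z)) y + app B (blinfun_apply (\<Phi> th (pexp (- 1) z)) y) = blinfun_apply (\<Phi> th f) y"
  unfolding V by (rule K)
 then show "app B (blinfun_apply (\<Phi> th (pexp (- 1) z)) y) = blinfun_apply (\<Phi> th (pexp 1 z)) y"
  by (simp add: fV blinfun.add_left)
qed

end

section \<open>Positive shifts of the given operator\<close>

locale sect_op =
 fixes A :: "'a::complex_banach \<rightharpoonup> 'a" and \<omega> :: real
 assumes A: "A \<in> Sect \<omega>" and \<omega>: "0 <= \<omega>" "\<omega> < pi"
begin

lemma lin: "linear_operator A" using A by (simp add: Sect_def sectorial_def)

text \<open>Translation by \<open>- s\<close> keeps a point off the sector, and the modulus of the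
  result is comparable to \<open>s + norm z\<close>. The constant is independent of
  \<open>s\<close>, on which the later integration over \<open>s\<close> relies.\<close>

lemma shift_bound:
 assumes \<phi>: "\<omega> < \<phi>" "\<phi> < pi"
 shows "\<exists>C\<ge>0. \<forall>s>0. \<forall>z. z \<notin> sector \<phi> --> z - of_real s \<in> resolvent_set A \<and>
  norm (resolvent (z - of_real s) A) <= C / (s + norm z)"
proof -
 have "sectorial A" and sa: "sect_angle A < \<phi>" using A \<phi> by (auto simp: Sect_def)
 obtain M where M: "M >= 0" "!!z. z ~= 0 ==> z \<notin> sector \<phi> ==> z \<in> resolvent_set A \<and> norm (resolvent z A) <= M / norm z"
  using resolvent_bound_outside_sector[OF sectorial_angles_nonempty[OF \<open>sectorial A\<close>] sa \<phi>(2)] by blast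
 define q where "q = sin (\<phi> / 2)"
 have ph: "0 < \<phi>" using \<omega> \<phi> by simp
 have q: "q > 0" unfolding q_def using \<phi> ph by (intro sin_gt_zero) auto
 have main: "z - of_real s \<in> resolvent_set A \<and> norm (resolvent (z - of_real s) A) <= M / q / (s + norm z)"
  if s: "s > 0" and z: "z \<notin> sector \<phi>" for s z
 proof -
  have l: "q * (s + norm z) <= norm (z - of_real s)" unfolding q_def by (rule norm_diff_of_real_outside_sector[OF ph \<phi>(2) z s])
  have p: "0 < q * (s + norm z)" using q s by (intro mult_pos_pos) (auto simp: add_pos_nonneg)
  have out: "z - of_real s \<notin> sector \<phi>" using sector_add_pos[OF ph \<phi>(2), of "z - of_real s" s] s z by auto
  have ne: "z - of_real s ~= 0" using l p by (metis norm_zero not_le)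
  have "norm (resolvent (z - of_real s) A) <= M / norm (z - of_real s)" using M(2)[OF ne out] by simp
  also have "... <= M / (q * (s + norm z))" using l p M(1) by (intro divide_left_mono) (auto intro: mult_pos_pos less_le_trans)
  finally show ?thesis using M(2)[OF ne out] by simp
 qed
 show ?thesis by (intro exI[of _ "M / q"]) (use main M(1) q in auto)
qed

lemma ray_bound:
 assumes th: "\<omega> < th" "th < pi"
 shows "\<exists>C\<ge>0. \<forall>s>0. \<forall>w. th <= \<bar>Im w\<bar> \<and> \<bar>Im w\<bar> <= 2 * pi - th --> exp w - of_real s \<in> resolvent_set A \<and>
  norm (resolvent (exp w - of_real s) A) <= C / (s + exp (Re w))"
proof -
 obtain C where C: "C >= 0" "!!s z. s > 0 ==> z \<notin> sector th ==> z - of_real s \<in> resolvent_set A \<and>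
  norm (resolvent (z - of_real s) A) <= C / (s + norm z)" using shift_bound[OF th] by blast
 have "exp w - of_real s \<in> resolvent_set A \<and> norm (resolvent (exp w - of_real s) A) <= C / (s + exp (Re w))"
  if "s > 0" "th <= \<bar>Im w\<bar>" "\<bar>Im w\<bar> <= 2 * pi - th" for s w
  using C(2)[OF that(1) exp_notin_sector[OF _ th(2) that(2,3)]] th \<omega> by simp
 then show ?thesis using C(1) by blast
qed

abbreviation "B s \<equiv> op_plus A (complex_of_real s)"

lemma angles_shift:
 assumes s: "s > 0" and \<phi>: "\<omega> < \<phi>" "\<phi> < pi"
 shows "\<phi> \<in> angles (B s)"
proof -
 have "spectrum (B s) \<subseteq> closure (sector \<phi>)"
 proof
  fix z assume "z \<in> spectrum (B s)"
  then have "z - of_real s \<notin> resolvent_set A" by (simp add: spectrum_def resolvent_op_plus)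
  then have "z \<in> sector \<phi>" using shift_bound[OF \<phi>] s by blast
  then show "z \<in> closure (sector \<phi>)" using closure_subset by blast
 qed
 moreover have "bdd_above ((%z. norm (z *\<^sub>C resolvent z (B s))) ` {z. z \<notin> sector \<phi>' \<and> z ~= 0})" if "\<phi> < \<phi>'" "\<phi>' < pi" for \<phi>'
 proof -
  have "\<omega> < \<phi>'" "\<phi>' < pi" using that \<phi> by simp_all
  then obtain C where C: "C >= 0" "!!s z. s > 0 ==> z \<notin> sector \<phi>' ==> norm (resolvent (z - of_real s) A) <= C / (s + norm z)"
   using shift_bound[of \<phi>'] by blast
  have "norm (z *\<^sub>C resolvent z (B s)) <= C" if "z \<notin> sector \<phi>'" for z
  proof -
   have "norm (z *\<^sub>C resolvent z (B s)) <= norm z * (C / (s + norm z))"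
    unfolding norm_scaleC resolvent_op_plus by (intro mult_left_mono C s that) simp
   also have "... = C * (norm z / (s + norm z))" by simp
   also have "... <= C * 1" using s C(1) by (intro mult_left_mono) (auto simp: divide_le_eq add_pos_nonneg)
   finally show ?thesis by simp
  qed
  then show ?thesis by (intro bdd_aboveI2[where M = C]) auto
 qed
 ultimately show ?thesis using \<phi> \<omega> by (simp add: angles_def)
qed

lemma sect_angle_shift:
 assumes s: "s > 0"
 shows "0 <= sect_angle (B s)" "sect_angle (B s) <= \<omega>"
proof -
 have ne: "(\<omega> + pi) / 2 \<in> angles (B s)" by (rule angles_shift[OF s]) (use \<omega> in auto)
 have nn: "x >= 0" if "x \<in> angles (B s)" for x using that by (simp add: angles_def)
 show "0 <= sect_angle (B s)" unfolding sect_angle_eq by (rule cInf_greatest) (use ne nn in auto)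
 have "bdd_below (angles (B s))" by (rule bdd_belowI[of _ 0]) (rule nn)
 then have le: "sect_angle (B s) <= \<phi>" if "\<omega> < \<phi>" "\<phi> < pi" for \<phi>
  unfolding sect_angle_eq by (intro cInf_lower angles_shift s that)
 show "sect_angle (B s) <= \<omega>"
 proof (rule ccontr)
  assume n: "\<not> ?thesis"
  \<comment> \<open>A test angle strictly between \<omega> and the supposedly larger value; the
    minimum with \<open>pi\<close> keeps it admissible.\<close>
  have "sect_angle (B s) <= (min (sect_angle (B s)) pi + \<omega>) / 2" by (rule le) (use n \<omega> in auto)
  then show False using n by (auto simp: min_def split: if_splits)
 qed
qed

text \<open>The angle of \<open>A + s\<close> may be smaller than \<omega>, so
  \<open>shift_bound\<close> does not reach all rays the locale asks for. The bound comes from the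
  sectoriality of \<open>A + s\<close> away from 0 and from perturbation of its bounded inverse near
  0; its constant may depend on \<open>s\<close>.\<close>

lemma inv_sect_shift:
 assumes s: "s > 0"
 shows "inv_sect (B s) s"
proof -
 note ang = sect_angle_shift[OF s]
 have ne: "angles (B s) ~= {}" using angles_shift[OF s, of "(\<omega> + pi) / 2"] \<omega> by auto
 have linB: "linear_operator (B s)" by (rule linear_operator_op_plus[OF lin])
 have om: "\<omega> < (\<omega> + pi) / 2" "(\<omega> + pi) / 2 < pi" using \<omega> by auto
 have "(0::complex) \<notin> sector ((\<omega> + pi) / 2)" using om \<omega> sector_iff[of "(\<omega> + pi) / 2" 0] by auto
 then have zr: "0 \<in> resolvent_set (B s)" unfolding resolvent_op_plus using shift_bound[OF om] s by blast
 have res: "exp w \<in> resolvent_set (B s)" if w: "w \<in> co_strip (sect_angle (B s))" for w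
 proof -
  define th where "th = (sect_angle (B s) + min \<bar>Im w\<bar> (2 * pi - \<bar>Im w\<bar>)) / 2"
  have w': "sect_angle (B s) < \<bar>Im w\<bar>" "\<bar>Im w\<bar> < 2 * pi - sect_angle (B s)" using w by (auto simp: co_strip_def)
  have hth: "sect_angle (B s) < th" "th < pi" "th <= \<bar>Im w\<bar>" "\<bar>Im w\<bar> <= 2 * pi - th"
   using w' ang \<omega> unfolding th_def min_def by (auto simp: field_simps split: if_splits)
  have "exp w \<notin> sector th" by (rule exp_notin_sector[OF _ hth(2-4)]) (use hth ang in simp)
  then show ?thesis using resolvent_bound_outside_sector[OF ne hth(1,2)] exp_not_eq_zero[of w] by blast
 qed
 show ?thesis
 proof
  show "0 <= sect_angle (B s)" "sect_angle (B s) < pi" "0 < s" using ang \<omega> s by auto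
  show "linear_operator (B s)" by (rule linB)
  show "exp w \<in> resolvent_set (B s)" if "w \<in> co_strip (sect_angle (B s))" for w by (rule res[OF that])
  show "resolvent (exp w) (B s) \<in> cblinfuns" if "w \<in> co_strip (sect_angle (B s))" for w
   by (rule resolvent_cblinfuns[OF linB res[OF that]])
  show "resolvent (exp w) (B s) - resolvent (exp v) (B s) = (exp v - exp w) *\<^sub>C (resolvent (exp w) (B s) o\<^sub>L resolvent (exp v) (B s))"
   if "w \<in> co_strip (sect_angle (B s))" "v \<in> co_strip (sect_angle (B s))" for w v
   by (rule resolvent_identity[OF linB res[OF that(1)] res[OF that(2)]])
  fix th assume th: "sect_angle (B s) < th" "th < pi"
  have hth: "0 < th" using th ang by simp
  obtain M where M: "M >= 0" "!!z. z ~= 0 ==> z \<notin> sector th ==> norm (resolvent z (B s)) <= M / norm z"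
   using resolvent_bound_outside_sector[OF ne th] by blast
  define N where "N = norm (resolvent 0 (B s))"
  define r where "r = 1 / (2 * (N + 1))"
  have N: "N >= 0" and r: "r > 0" by (simp_all add: N_def r_def add_nonneg_pos)
  define C where "C = (M / r + 2 * N) * (s + r)"
  have mr: "M / r >= 0" using M(1) r by simp
  have main: "norm (resolvent z (B s)) <= C / (s + norm z)" if z: "z ~= 0" "z \<notin> sector th" for z
  proof (cases "norm z <= r")
   case True
   have "N * norm z <= N * r" using True N by (rule mult_left_mono)
   also have "... <= 1 / 2" using N by (simp add: r_def field_simps)
   finally have "norm (resolvent 0 (B s)) * norm (z - 0) <= 1 / 2" by (simp add: N_def)
   from resolvent_neumann(2)[OF linB zr this] have "norm (resolvent z (B s)) <= 2 * N" by (simp add: N_def)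
   also have "... <= M / r + 2 * N" using mr by simp
   also have "... <= C / (s + norm z)"
   proof -
    have "(M / r + 2 * N) * (s + norm z) <= C" unfolding C_def using True mr N by (intro mult_left_mono) auto
    then show ?thesis using s by (simp add: le_divide_eq add_pos_nonneg)
   qed
   finally show ?thesis .
  next
   case False
   have "norm (resolvent z (B s)) <= M / norm z" by (rule M(2)[OF z])
   also have "... <= C / (s + norm z)"
   proof -
    have "r * (s + norm z) <= (s + r) * norm z"
    proof -
     have "r * s <= norm z * s" using False s by (intro mult_right_mono) auto
     then show ?thesis by (simp add: algebra_simps)
    qed
    then have "M / r * (r * (s + norm z)) <= M / r * ((s + r) * norm z)" by (rule mult_left_mono[OF _ mr])
    then have "M * (s + norm z) <= M / r * (s + r) * norm z" using r by (simp add: mult.assoc)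
    also have "... <= C * norm z" unfolding C_def using N mr s r by (intro mult_right_mono) auto
    finally show ?thesis using False r s z(1) by (simp add: divide_le_eq le_divide_eq add_pos_nonneg)
   qed
   finally show ?thesis .
  qed
  show "\<exists>C. \<forall>w. th <= \<bar>Im w\<bar> \<and> \<bar>Im w\<bar> <= 2 * pi - th --> norm (resolvent (exp w) (B s)) <= C / (s + exp (Re w))"
   by (intro exI[of _ C] allI impI) (use main[OF exp_not_eq_zero exp_notin_sector[OF hth th(2)]] in auto)
 qed
qed

text \<open>The operators \<open>\<Phi>_s(E_j)\<close> with an explicit contour angle, expressed by
  the resolvent of \<open>A\<close> so that bounds uniform in \<open>s\<close> and derivatives in
  \<open>s\<close> are at hand.\<close>

definition V :: "real => int => complex => real => 'a \<Rightarrow>\<^sub>L 'a" where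
 "V th j z s = fc (%\<zeta>. resolvent (\<zeta> - complex_of_real s) A) th (pexp j z)"

lemma V_eq: "V th j z s = fc (%\<zeta>. resolvent \<zeta> (B s)) th (pexp j z)"
 by (simp add: V_def resolvent_op_plus)

context
 fixes th s :: real
 assumes th: "\<omega> < th" "th < pi" and s: "s > 0"
begin

interpretation I: inv_sect "B s" s by (rule inv_sect_shift[OF s])

lemma angle_less: "sect_angle (B s) < th" using sect_angle_shift[OF s] th by simp

text \<open>Replaces the chosen semigroup, the operator square root and its inverse by one contour
  integral; the later estimates concern \<open>V\<close> alone.\<close>

lemma U_integrand_eq:
 assumes z: "z \<in> half_sector th"
 shows "U_integrand A \<omega> \<alpha> z s = (of_real s powr (\<alpha> - 1/2)) *\<^sub>C V th (- 1) z s"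
proof -
 have hth: "0 <= th" using th \<omega> by simp
 have z': "z ~= 0" "\<bar>Arg z\<bar> + th / 2 < pi / 2" using z sector_half_iff[OF hth th(2)] by auto
 have "z \<in> half_sector \<omega>" using sector_half_iff[OF \<omega>] z' th by auto
 from I.holo_exp_eq[OF sect_angle_shift(2)[OF s] \<omega>(2) this]
 show ?thesis unfolding U_integrand_def Let_def V_eq
  by (simp add: I.inv_sqrt I.T_J[OF angle_less th(2) z])
qed

lemma V_cblinfuns:
 assumes z: "z \<in> half_sector th" and j: "j >= - 1"
 shows "V th j z s \<in> cblinfuns"
proof -
 obtain \<psi> where \<psi>: "th < \<psi>" "!!j. j >= - 1 ==> decays \<psi> (pexp j z)" using I.pexp_adm[OF angle_less th(2) z] by blast
 show ?thesis unfolding V_eq by (rule I.fc_cblinfuns[OF \<psi>(2)[OF j] angle_less \<psi>(1) th(2)])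
qed

lemma V_has_derivative:
 assumes z: "z \<in> half_sector th" and j: "j >= - 1"
 shows "((%z. V th j z s) has_derivative (%h. h *\<^sub>C (- V th (j + 1) z s))) (at z)"
 unfolding V_eq by (rule I.fc_pexp_derivative[OF angle_less th(2) z j])

lemma V_mult:
 assumes "z \<in> half_sector th" "w \<in> half_sector th" "j >= - 1"
 shows "V th j z s o\<^sub>L V th 0 w s = V th j (z + w) s"
 unfolding V_eq by (rule I.pexp_mult_fc[OF angle_less th(2) assms])

lemma V_dom:
 assumes z: "z \<in> half_sector th"
 shows "blinfun_apply (V th (- 1) z s) y \<in> dom A"
  "app A (blinfun_apply (V th (- 1) z s) y) = blinfun_apply (V th 1 z s) y - of_real s *\<^sub>C blinfun_apply (V th (- 1) z s) y"
 using I.fc_pexp_minus_one_dom[OF angle_less th(2) z, of y] unfolding V_eq[symmetric] by (auto simp: algebra_simps)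

end

lemma U_integrand_V:
 assumes "\<omega> < th" "th < pi" "z \<in> half_sector th" "s > 0"
 shows "U_integrand A \<omega> \<alpha> z s = (of_real s powr (\<alpha> - 1/2)) *\<^sub>C V th (- 1) z s"
 using U_integrand_eq assms by blast

end

section \<open>Estimates uniform in the shift\<close>

lemma integrable_exp_minus_exp:
 assumes q: "q > 0"
 shows "integrable lborel (%x::real. exp (q * x - exp (x / 2)))"
proof -
 define n where "n = nat \<lceil>2 * q\<rceil> + 2"
 have n: "real n >= 2 * q + 2" unfolding n_def by linarith
 define c where "c = min q 1"
 have c: "c > 0" "c <= q" "c <= 1" using q by (auto simp: c_def)
 have le: "exp (q * x - exp (x / 2)) <= fact n * exp (- c * \<bar>x\<bar>)" for x :: real
 proof (cases "x >= 0")
  case True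
  have "exp (x / 2) ^ n * exp (- 1 * exp (x / 2)) <= fact n / 1 ^ n" by (rule power_exp_le_fact) auto
  then have "exp (real n * (x / 2)) * exp (- exp (x / 2)) <= fact n" by (simp only: exp_of_nat_mult) simp
  then have "exp (q * x - real n * (x / 2)) * (exp (real n * (x / 2)) * exp (- exp (x / 2))) <= exp (q * x - real n * (x / 2)) * fact n"
   by (rule mult_left_mono) simp
  also have "... <= exp (- c * x) * fact n"
  proof -
   have "(2 * q + 2) * x <= real n * x" using n True by (rule mult_right_mono)
   moreover have "c * x <= 1 * x" using True c by (intro mult_right_mono) auto
   ultimately have "q * x - real n * (x / 2) <= - c * x" by (simp add: algebra_simps)
   then show ?thesis by simp
  qed
  finally show ?thesis using True by (simp add: mult.commute flip: exp_add)
 next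
  case False
  have "exp (q * x - exp (x / 2)) <= exp (q * x)" by simp
  also have "... <= exp (- c * \<bar>x\<bar>)"
  proof -
   have "q * x <= c * x" using False c by (intro mult_right_mono_neg) auto
   then show ?thesis using False by simp
  qed
  also have "... = 1 * exp (- c * \<bar>x\<bar>)" by simp
  also have "... <= fact n * exp (- c * \<bar>x\<bar>)" by (intro mult_right_mono) (auto simp: fact_ge_1)
  finally show ?thesis .
 qed
 show ?thesis
 proof (rule integrable_le[OF integrable_mult_right[OF integrable_exp_abs[OF c(1)], of "fact n"]])
  show "AE x in lborel. norm (exp (q * x - exp (x / 2))) <= norm (fact n * exp (- c * \<bar>x\<bar>))"
   using le by (auto intro!: AE_I2)
 qed simp
qed

text \<open>A weighted geometric mean is at most the sum:
  \<open>s^p * \<lambda>^(1 - p) <= s + \<lambda>\<close>. The parameter \<open>p\<close>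
  distributes the resolvent decay between \<open>s\<close> and \<lambda>.\<close>

lemma young_exp_le:
 fixes s x p :: real
 assumes s: "s > 0" and p: "0 <= p" "p <= 1"
 shows "exp x / (s + exp x) <= exp (p * x - p * ln s)"
proof -
 have "(1 - p) * x + p * ln s <= (1 - p) * max x (ln s) + p * max x (ln s)"
  using p by (intro add_mono mult_left_mono) auto
 also have "... = max x (ln s)" by (simp add: algebra_simps)
 finally have "exp ((1 - p) * x + p * ln s) <= exp (max x (ln s))" by simp
 also have "... <= s + exp x" using s by (auto simp: max_def)
 finally have 1: "exp ((1 - p) * x + p * ln s) <= s + exp x" .
 have "exp x = exp (p * x - p * ln s) * exp ((1 - p) * x + p * ln s)" by (simp add: algebra_simps flip: exp_add)
 also have "... <= exp (p * x - p * ln s) * (s + exp x)" using 1 by (rule mult_left_mono) simp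
 finally show ?thesis using s by (simp add: divide_le_eq add_pos_pos)
qed

lemma integrable_exp_abs_ln_shift:
 assumes c: "c > 0"
 shows "integrable leb_pos (%s::real. exp (- c * \<bar>ln s + b\<bar>) / s)"
  "(LINT s|leb_pos. exp (- c * \<bar>ln s + b\<bar>) / s) = (LINT x|lborel. exp (- c * \<bar>x\<bar>))"
proof -
 have e: "exp x *\<^sub>R (exp (- c * \<bar>ln (exp x) + b\<bar>) / exp x) = exp (- c * \<bar>b + 1 * x\<bar>)" for x :: real by (simp add: add.commute)
 have i: "integrable lborel (%x. exp x *\<^sub>R (exp (- c * \<bar>ln (exp x) + b\<bar>) / exp x))"
  unfolding e by (rule lborel_integrable_real_affine[OF integrable_exp_abs[OF c]]) simp
 show "integrable leb_pos (%s::real. exp (- c * \<bar>ln s + b\<bar>) / s)"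
  "(LINT s|leb_pos. exp (- c * \<bar>ln s + b\<bar>) / s) = (LINT x|lborel. exp (- c * \<bar>x\<bar>))"
  using exp_subst[OF i] lborel_integral_real_affine[of 1 "%x::real. exp (- c * \<bar>x\<bar>)" b] unfolding e by simp_all
qed

context sect_op
begin

lemma sect_mod_sector_pos:
 assumes "\<omega> < th" "th < pi" "z \<in> half_sector th"
 shows "sect_mod th z > 0" "z ~= 0" "\<bar>Arg z\<bar> + th / 2 < pi / 2"
proof -
 have "0 <= th" using assms \<omega> by simp
 then show "z ~= 0" "\<bar>Arg z\<bar> + th / 2 < pi / 2" using sector_half_iff[of th z] assms by auto
 then show "sect_mod th z > 0" using \<open>0 <= th\<close> by (intro sect_mod_pos)
qed

lemma R_line_cont:
 assumes "\<omega> < th" "th < pi" "s > 0" "ray th t"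
 shows "continuous_on UNIV (%x. resolvent (cexp x t - of_real s) A)"
proof -
 interpret I: inv_sect "B s" s by (rule inv_sect_shift[OF assms(3)])
 show ?thesis using I.R_line_continuous[OF angle_less[OF assms(1-3)] assms(2,4)] by (simp add: resolvent_op_plus)
qed

lemma R_line_bound:
 assumes th: "\<omega> < th" "th < pi"
 obtains C where "C >= 0" "!!s x t. s > 0 ==> ray th t ==> cexp x t - of_real s \<in> resolvent_set A"
  "!!s x t. s > 0 ==> ray th t ==> norm (resolvent (cexp x t - of_real s) A) <= C / (s + exp x)"
proof -
 obtain C where C: "C >= 0" "\<forall>s>0. \<forall>w. th <= \<bar>Im w\<bar> \<and> \<bar>Im w\<bar> <= 2 * pi - th --> exp w - of_real s \<in> resolvent_set A \<and>
  norm (resolvent (exp w - of_real s) A) <= C / (s + exp (Re w))" using ray_bound[OF th] by blast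
 have "th <= \<bar>Im (Complex x t)\<bar> \<and> \<bar>Im (Complex x t)\<bar> <= 2 * pi - th" if "ray th t" for x t
  using that th \<omega> by auto
 then show ?thesis using that[OF C(1)] C(2) by (metis complex.sel(1))
qed

text \<open>Scaling \<lambda> by the square of \<open>\<kappa> = sect_mod th z\<close> makes all
  dependence on \<open>z\<close> and \<open>s\<close> factor out as
  \<open>\<kappa>^(- j) * (s * \<kappa>^2)^(- p)\<close>. What remains is a fixed integral with
  exponent \<open>q = j / 2 + p\<close>; positivity of \<open>q\<close> is convergence at the
  origin.\<close>

lemma V_bound_power:
 assumes th: "\<omega> < th" "th < pi" and p: "0 < p" "p <= 1" and j: "j >= - 1" "of_int j / 2 + p > 0"
 shows "\<exists>C\<ge>0. \<forall>z\<in>half_sector th. \<forall>s>0.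
  norm (V th j z s) <= C * exp (- of_int j * ln (sect_mod th z) - p * (ln s + 2 * ln (sect_mod th z)))"
proof -
 obtain C where C: "C >= 0" "!!s x t. s > 0 ==> ray th t ==> norm (resolvent (cexp x t - of_real s) A) <= C / (s + exp x)"
  using R_line_bound[OF th] by metis
 define q where "q = of_int j / 2 + p"
 define I where "I = (LINT x::real|lborel. exp (q * x - exp (x / 2)))"
 have q: "q > 0" using j by (simp add: q_def)
 have hth: "0 <= th" using th \<omega> by simp
 have "norm (V th j z s) <= ((1 / pi) * C * I) * exp (- of_int j * ln (sect_mod th z) - p * (ln s + 2 * ln (sect_mod th z)))"
  if z: "z \<in> half_sector th" and s: "s > 0" for z s
 proof -
  define \<kappa> where "\<kappa> = sect_mod th z"
  define k where "k = ln \<kappa>"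
  have \<kappa>: "\<kappa> > 0" and Arg: "\<bar>Arg z\<bar> + th / 2 <= pi" using sect_mod_sector_pos[OF th z] pi_gt_zero unfolding \<kappa>_def by linarith+
  have i1: "integrable lborel (%x. exp (of_int j * x / 2 - \<kappa> * exp (x / 2)) * exp x * (C / (s + exp x)))"
   by (rule exp_pexp_integrable[OF \<kappa> j(1) s])
  have i2: "integrable lborel (%x. C * exp (- 2 * k * q - p * ln s) * exp (q * (2 * k + 1 * x) - exp ((2 * k + 1 * x) / 2)))"
   by (intro integrable_mult_right lborel_integrable_real_affine[OF integrable_exp_minus_exp[OF q]]) simp
  have "norm (V th j z s) <= (1 / pi) * (LINT x|lborel. exp (of_int j * x / 2 - \<kappa> * exp (x / 2)) * exp x * (C / (s + exp x)))"
   unfolding V_def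
  proof (rule fc_bound(2)[OF _ _ _ _ i1])
   show "norm (pexp j z (Complex x t)) <= exp (of_int j * x / 2 - \<kappa> * exp (x / 2))" if "ray th t" for x t
    using norm_pexp_le[of "Complex x t" th z j] that hth Arg by (auto simp: \<kappa>_def)
  qed (auto intro: R_line_cont[OF th s] pexp_line_continuous C(2)[OF s])
  also have "... <= (1 / pi) * (LINT x|lborel. C * exp (- 2 * k * q - p * ln s) * exp (q * (2 * k + 1 * x) - exp ((2 * k + 1 * x) / 2)))"
  proof (intro mult_left_mono integral_mono[OF i1 i2])
   fix x :: real
   have kx: "\<kappa> * exp (x / 2) = exp ((2 * k + 1 * x) / 2)" using \<kappa> by (simp add: k_def add_divide_distrib exp_add)
   have "exp (of_int j * x / 2 - \<kappa> * exp (x / 2)) * exp x * (C / (s + exp x)) =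
    C * exp (of_int j * x / 2 - exp ((2 * k + 1 * x) / 2)) * (exp x / (s + exp x))" unfolding kx by simp
   also have "... <= C * exp (of_int j * x / 2 - exp ((2 * k + 1 * x) / 2)) * exp (p * x - p * ln s)"
    using C(1) p s by (intro mult_left_mono young_exp_le) auto
   also have "... = C * exp (- 2 * k * q - p * ln s) * exp (q * (2 * k + 1 * x) - exp ((2 * k + 1 * x) / 2))"
    unfolding mult.assoc exp_add[symmetric] by (simp add: q_def algebra_simps)
   finally show "exp (of_int j * x / 2 - \<kappa> * exp (x / 2)) * exp x * (C / (s + exp x)) <=
    C * exp (- 2 * k * q - p * ln s) * exp (q * (2 * k + 1 * x) - exp ((2 * k + 1 * x) / 2))" .
  qed simp
  also have "... = (1 / pi) * (C * exp (- 2 * k * q - p * ln s) * I)"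
   using lborel_integral_real_affine[of 1 "%x. exp (q * x - exp (x / 2))" "2 * k"] unfolding integral_mult_right_zero I_def by simp
  also have "- 2 * k * q - p * ln s = - of_int j * ln (sect_mod th z) - p * (ln s + 2 * ln (sect_mod th z))"
   by (simp add: q_def k_def \<kappa>_def field_simps)
  finally show ?thesis by (simp add: mult_ac)
 qed
 moreover have "(1 / pi) * C * I >= 0" unfolding I_def using C(1) by (intro mult_nonneg_nonneg LINT_nonneg) auto
 ultimately show ?thesis by blast
qed

lemma V_bound_power3:
 assumes th: "\<omega> < th" "th < pi" and j: "j >= - 1"
 shows "\<exists>C\<ge>0. \<forall>z\<in>half_sector th. \<forall>s>0.
  norm (V th j z s) <= C * exp (- of_int j * ln (sect_mod th z) - 3 * (ln s + 2 * ln (sect_mod th z)))"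
proof -
 have jr: "real_of_int j >= - 1" using j by linarith
 obtain C where C: "C >= 0" "\<forall>z\<in>half_sector th. \<forall>s>0.
  norm (V th j z s) <= C * exp (- of_int j * ln (sect_mod th z) - 1 * (ln s + 2 * ln (sect_mod th z)))"
  using V_bound_power[OF th, of 1 j] j jr by auto
 obtain D where D: "D >= 0" "\<forall>z\<in>half_sector th. \<forall>s>0.
  norm (V th 0 z s) <= D * exp (- of_int 0 * ln (sect_mod th z) - 1 * (ln s + 2 * ln (sect_mod th z)))"
  using V_bound_power[OF th, of 1 0] by auto
 \<comment> \<open>The power \<open>3^(j + 6)\<close> is the price of replacing
   \<open>sect_mod th z\<close> by a third of it: \<open>j\<close> from the first factor and two
   from each of the three factors \<open>1 / (s * sect_mod^2)\<close>.\<close>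
 have "norm (V th j z s) <= (C * D * D * exp ((of_int j + 6) * ln 3)) * exp (- of_int j * ln (sect_mod th z) - 3 * (ln s + 2 * ln (sect_mod th z)))"
  if z: "z \<in> half_sector th" and s: "s > 0" for z s
 proof -
  define y where "y = z / 3"
  have hth: "0 <= th" using th \<omega> by simp
  have Ay: "Arg y = Arg z" using Arg_times_of_real2[of "1/3" z] by (simp add: y_def)
  have "y ~= 0 \<and> \<bar>Arg y\<bar> + th / 2 < pi / 2" unfolding Ay using sect_mod_sector_pos[OF th z] by (simp add: y_def)
  then have y1: "y \<in> half_sector th" using sector_half_iff[OF hth th(2), of y] by blast
  note y = y1 sector_half_add[OF hth th(2) y1 y1]
  have k: "ln (sect_mod th y) = ln (sect_mod th z) - ln 3"
  proof -
   have "sect_mod th y = sect_mod th z / 3" unfolding sect_mod_def Ay by (simp add: y_def norm_divide)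
   moreover have "ln (sect_mod th z / 3) = ln (sect_mod th z) - ln 3" using sect_mod_sector_pos(1)[OF th z] ln_div[of "sect_mod th z" 3] by simp
   ultimately show ?thesis by (simp only:)
  qed
  let ?c = "exp (- of_int j * ln (sect_mod th y) - 1 * (ln s + 2 * ln (sect_mod th y)))"
  let ?d = "exp (- of_int 0 * ln (sect_mod th y) - 1 * (ln s + 2 * ln (sect_mod th y)))"
  have "V th j z s = (V th j y s o\<^sub>L V th 0 y s) o\<^sub>L V th 0 y s"
   unfolding V_mult[OF th s y(1) y(1) j] V_mult[OF th s y(2) y(1) j] by (simp add: y_def)
  then have "norm (V th j z s) <= (norm (V th j y s) * norm (V th 0 y s)) * norm (V th 0 y s)"
   by (simp only:) (intro order_trans[OF norm_blinfun_compose] mult_right_mono norm_blinfun_compose norm_ge_zero)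
  also have "... <= ((C * ?c) * (D * ?d)) * (D * ?d)"
   using C D y s by (intro mult_mono) auto
  also have "... = C * D * D * (?c * ?d * ?d)" by (simp only: mult_ac)
  also have "?c * ?d * ?d = exp ((of_int j + 6) * ln 3) * exp (- of_int j * ln (sect_mod th z) - 3 * (ln s + 2 * ln (sect_mod th z)))"
   unfolding k exp_add[symmetric] by (simp add: algebra_simps)
  finally show ?thesis by (simp add: mult_ac)
 qed
 moreover have "C * D * D * exp ((of_int j + 6) * ln 3) >= 0" using C D by simp
 ultimately show ?thesis by blast
qed

text \<open>Apart from a power of \<open>sect_mod th z\<close>, the bound depends only on
  \<open>y = ln s + 2 * ln (sect_mod th z)\<close>. For \<open>y <= 0\<close> the order
  \<open>p\<close> is used, for \<open>y > 0\<close> the order 3; the conditions on \<open>c\<close>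
  are the resulting rates \<open>\<beta> + 1 - p\<close> and \<open>2 - \<beta>\<close>. The factor
  \<open>1 / s\<close> is the density of \<open>ln s\<close>.\<close>

lemma V_weighted_bound:
 assumes th: "\<omega> < th" "th < pi" and j: "j >= - 1" and p: "1 / 2 < p" "p <= 1" and c: "c <= \<beta> + 1 - p" "c <= 2 - \<beta>"
 shows "\<exists>C\<ge>0. \<forall>z\<in>half_sector th. \<forall>s>0. s powr \<beta> * norm (V th j z s) <=
  C * exp (- (of_int j + 2 * \<beta> + 2) * ln (sect_mod th z)) * (exp (- c * \<bar>ln s + 2 * ln (sect_mod th z)\<bar>) / s)"
proof -
 have jr: "real_of_int j >= - 1" using j by linarith
 obtain C where C: "C >= 0" "\<forall>z\<in>half_sector th. \<forall>s>0.
  norm (V th j z s) <= C * exp (- of_int j * ln (sect_mod th z) - p * (ln s + 2 * ln (sect_mod th z)))"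
  using V_bound_power[OF th, of p j] j jr p by auto
 obtain D where D: "D >= 0" "\<forall>z\<in>half_sector th. \<forall>s>0.
  norm (V th j z s) <= D * exp (- of_int j * ln (sect_mod th z) - 3 * (ln s + 2 * ln (sect_mod th z)))"
  using V_bound_power3[OF th j] by auto
 have "s powr \<beta> * norm (V th j z s) <=
  (C + D) * exp (- (of_int j + 2 * \<beta> + 2) * ln (sect_mod th z)) * (exp (- c * \<bar>ln s + 2 * ln (sect_mod th z)\<bar>) / s)"
  if z: "z \<in> half_sector th" and s: "s > 0" for z s
 proof -
  define k where "k = ln (sect_mod th z)"
  define y where "y = ln s + 2 * k"
  have es: "exp (ln s) = s" using s by simp
  have sb: "s powr \<beta> = exp (\<beta> * ln s)" using s by (simp add: powr_def)
  have inv: "exp u / s = exp (u - ln s)" for u using s by (simp add: exp_diff)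
  show ?thesis
  proof (cases "y <= 0")
   case True
   have "s powr \<beta> * norm (V th j z s) <= exp (\<beta> * ln s) * (C * exp (- of_int j * k - p * y))"
    unfolding sb k_def y_def using C z s by (intro mult_left_mono) auto
   also have "... = C * (exp (- (of_int j + 2 * \<beta> + 2) * k) * (exp ((\<beta> + 1 - p) * y) / s))"
    unfolding inv mult.left_commute[of "exp (\<beta> * ln s)"] exp_add[symmetric] y_def by (simp add: algebra_simps)
   also have "... <= (C + D) * (exp (- (of_int j + 2 * \<beta> + 2) * k) * (exp (- c * \<bar>y\<bar>) / s))"
   proof -
    have "(\<beta> + 1 - p) * y <= c * y" using c(1) True by (rule mult_right_mono_neg)
    then show ?thesis using C(1) D(1) s True by (intro mult_mono divide_right_mono) auto
   qed
   finally show ?thesis unfolding k_def y_def by (simp only: mult_ac)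
  next
   case False
   have "s powr \<beta> * norm (V th j z s) <= exp (\<beta> * ln s) * (D * exp (- of_int j * k - 3 * y))"
    unfolding sb k_def y_def using D z s by (intro mult_left_mono) auto
   also have "... = D * (exp (- (of_int j + 2 * \<beta> + 2) * k) * (exp ((\<beta> - 2) * y) / s))"
    unfolding inv mult.left_commute[of "exp (\<beta> * ln s)"] exp_add[symmetric] y_def by (simp add: algebra_simps)
   also have "... <= (C + D) * (exp (- (of_int j + 2 * \<beta> + 2) * k) * (exp (- c * \<bar>y\<bar>) / s))"
   proof -
    have "(\<beta> - 2) * y <= - c * y" using c(2) False by (intro mult_right_mono) auto
    then show ?thesis using C(1) D(1) s False by (intro mult_mono divide_right_mono) auto
   qed
   finally show ?thesis unfolding k_def y_def by (simp only: mult_ac)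
  qed
 qed
 moreover have "C + D >= 0" using C D by simp
 ultimately show ?thesis by blast
qed

section \<open>Derivative with respect to the shift\<close>

definition V' :: "real => int => complex => real => 'a \<Rightarrow>\<^sub>L 'a" where
 "V' th j z s = fc (%\<zeta>. resolvent (\<zeta> - complex_of_real s) A o\<^sub>L resolvent (\<zeta> - complex_of_real s) A) th (pexp j z)"

text \<open>Two applications of the resolvent identity make the remainder equal to
  \<open>(y - s)^2\<close> times a product of three resolvents, each bounded by
  \<open>D\<close>.\<close>

lemma resolvent_shift_has_derivative:
 assumes D: "!!s. s > 0 ==> \<zeta> - of_real s \<in> resolvent_set A" "!!s. s > 0 ==> norm (resolvent (\<zeta> - of_real s) A) <= D"
  and s: "s > 0"
 shows "((%s. resolvent (\<zeta> - of_real s) A) has_derivative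
  (%h. h *\<^sub>R (resolvent (\<zeta> - of_real s) A o\<^sub>L resolvent (\<zeta> - of_real s) A))) (at s)"
proof (rule has_derivativeI_sandwich[OF s])
 define R where "R s = resolvent (\<zeta> - of_real s) A" for s
 fix y assume y: "y \<in> UNIV" "y ~= s" "dist y s < s"
 then have y0: "y > 0" by (auto simp: dist_real_def)
 have D0: "D >= 0" using D(2)[OF s] norm_ge_zero by (rule order_trans[rotated])
 have id1: "R a - R b = (a - b) *\<^sub>R (R a o\<^sub>L R b)" if "a > 0" "b > 0" for a b
  using resolvent_identity[OF lin D(1)[OF that(1)] D(1)[OF that(2)]] by (simp add: R_def scaleR_scaleC)
 have "R y - R s - (y - s) *\<^sub>R (R s o\<^sub>L R s) = (y - s) *\<^sub>R ((R y - R s) o\<^sub>L R s)"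
  by (subst id1[OF y0 s]) (simp add: bounded_bilinear.diff_left[OF bounded_bilinear_blinfun_compose] scaleR_diff_right)
 also have "... = (y - s) *\<^sub>R (y - s) *\<^sub>R (R y o\<^sub>L R s o\<^sub>L R s)"
  by (subst id1[OF y0 s]) (simp add: bounded_bilinear.scaleR_left[OF bounded_bilinear_blinfun_compose])
 finally have "norm (R y - R s - (y - s) *\<^sub>R (R s o\<^sub>L R s)) = norm (y - s) * (norm (y - s) * norm (R y o\<^sub>L R s o\<^sub>L R s))"
  by simp
 moreover have "norm (R y o\<^sub>L R s o\<^sub>L R s) <= D * D * D"
  by (intro order_trans[OF norm_blinfun_compose] mult_mono norm_ge_zero mult_nonneg_nonneg D0)
   (use D y0 s in \<open>auto simp: R_def\<close>)
 ultimately have "norm (R y - R s - (y - s) *\<^sub>R (R s o\<^sub>L R s)) <= norm (y - s) * (norm (y - s) * (D * D * D))"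
  by (simp add: mult_left_mono)
 then show "norm (resolvent (\<zeta> - of_real y) A - resolvent (\<zeta> - of_real s) A -
   (y - s) *\<^sub>R (resolvent (\<zeta> - of_real s) A o\<^sub>L resolvent (\<zeta> - of_real s) A)) / norm (y - s) <= norm (y - s) * (D * D * D)"
  using y by (simp add: R_def divide_le_eq mult_ac)
next
 show "bounded_linear (%h::real. h *\<^sub>R (resolvent (\<zeta> - of_real s) A o\<^sub>L resolvent (\<zeta> - of_real s) A))"
  by (rule bounded_linear_scaleR_left)
 have "((%y. norm (y - s) * (D * D * D)) \<longlongrightarrow> norm (s - s) * (D * D * D)) (at s)" by (intro tendsto_intros)
 then show "((%y. norm (y - s) * (D * D * D)) \<longlongrightarrow> 0) (at s)" by simp
qed

lemma V_shift_derivative: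
 assumes th: "\<omega> < th" "th < pi" and z: "z \<in> half_sector th" and j: "j >= - 1" and s0: "s0 > 0"
 shows "(V th j z has_vector_derivative V' th j z s0) (at s0)"
  "bochner_integrable lborel (fc_integrand (%\<zeta>. resolvent (\<zeta> - complex_of_real s0) A o\<^sub>L resolvent (\<zeta> - complex_of_real s0) A) th (pexp j z))"
proof -
 obtain C where C: "C >= 0" "!!s x t. s > 0 ==> ray th t ==> cexp x t - of_real s \<in> resolvent_set A"
  "!!s x t. s > 0 ==> ray th t ==> norm (resolvent (cexp x t - of_real s) A) <= C / (s + exp x)"
  using R_line_bound[OF th] by metis
 have hth: "0 <= th" using th \<omega> by simp
 define \<kappa> where "\<kappa> = sect_mod th z"
 have \<kappa>: "\<kappa> > 0" and Arg: "\<bar>Arg z\<bar> + th / 2 <= pi" using sect_mod_sector_pos[OF th z] pi_gt_zero unfolding \<kappa>_def by linarith+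
 have pb: "norm (pexp j z (Complex x t)) <= exp (of_int j * x / 2 - \<kappa> * exp (x / 2))" if "ray th t" for x t
  using norm_pexp_le[of "Complex x t" th z j] that hth Arg by (auto simp: \<kappa>_def)
 define S where "S s \<zeta> = resolvent (\<zeta> - complex_of_real s) A" for s \<zeta>
 define Q where "Q s \<zeta> = S s \<zeta> o\<^sub>L S s \<zeta>" for s \<zeta>
 \<comment> \<open>For \<open>s > s0 / 2\<close> one factor of the squared resolvent is bounded by
   the constant \<open>C / (s0 / 2)\<close>, and the other supplies the decay in
   \<open>x\<close>.\<close>
 define g where "g x = (1 / pi) * (exp (of_int j * x / 2 - \<kappa> * exp (x / 2)) * exp x * (C * C / (s0 / 2) / (s0 / 2 + exp x)))" for x
 have g: "integrable lborel g" unfolding g_def by (intro integrable_mult_right exp_pexp_integrable \<kappa> j) (use s0 in simp)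
 have Sc: "continuous_on UNIV (fc_integrand (S s) th (pexp j z))" "continuous_on UNIV (fc_integrand (Q s) th (pexp j z))" if "s > 0" for s
  unfolding Q_def S_def by (intro fc_integrand_continuous bounded_bilinear.continuous_on[OF bounded_bilinear_blinfun_compose] R_line_cont[OF th that] pexp_line_continuous; assumption)+
 have Si: "bochner_integrable lborel (fc_integrand (S s) th (pexp j z))" if s: "s > 0" for s
 proof (rule fc_bound(1)[OF _ _ _ pb exp_pexp_integrable[OF \<kappa> j s]])
  show "continuous_on UNIV (%x. S s (cexp x t))" if "ray th t" for t
   unfolding S_def by (rule R_line_cont[OF th s that])
  show "norm (S s (cexp x t)) <= C / (s + exp x)" if "ray th t" for t x
   unfolding S_def by (rule C(3)[OF s that])
 qed (rule pexp_line_continuous)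
 have Qb: "norm (fc_integrand (Q s) th (pexp j z) x) <= g x" if s: "s > s0 / 2" for s x
  unfolding g_def
 proof (rule norm_fc_integrand_le)
  fix t assume t: "ray th t"
  show "norm (pexp j z (Complex x t)) <= exp (of_int j * x / 2 - \<kappa> * exp (x / 2))" by (rule pb[OF t])
  have sp: "s > 0" using s s0 by simp
  have "norm (S s (cexp x t)) <= C / (s + exp x)" unfolding S_def by (rule C(3)[OF sp t])
  also have "... <= C / (s0 / 2 + exp x)" using C(1) s s0 by (intro divide_left_mono) (auto simp: add_pos_pos)
  finally have 1: "norm (S s (cexp x t)) <= C / (s0 / 2 + exp x)" .
  also have "... <= C / (s0 / 2)" using C(1) s0 by (intro divide_left_mono) (auto simp: add_pos_pos)
  finally have 2: "norm (S s (cexp x t)) <= C / (s0 / 2)" .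
  have "norm (Q s (cexp x t)) <= norm (S s (cexp x t)) * norm (S s (cexp x t))"
   unfolding Q_def by (rule norm_blinfun_compose)
  also have "... <= (C / (s0 / 2)) * (C / (s0 / 2 + exp x))" by (intro mult_mono 1 2) (use C(1) s0 in auto)
  also have "... = C * C / (s0 / 2) / (s0 / 2 + exp x)" by simp
  finally show "norm (Q s (cexp x t)) <= C * C / (s0 / 2) / (s0 / 2 + exp x)" .
 qed
 have Qi: "bochner_integrable lborel (fc_integrand (Q s0) th (pexp j z))"
  by (rule bochner_integrable_continuous_lborel[OF Sc(2)[OF s0] g Qb]) (use s0 in simp)
 then show "bochner_integrable lborel (fc_integrand (%\<zeta>. resolvent (\<zeta> - complex_of_real s0) A o\<^sub>L resolvent (\<zeta> - complex_of_real s0) A) th (pexp j z))"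
  by (simp add: Q_def[abs_def] S_def)
 have meas: "f \<in> borel_measurable lborel" if "continuous_on UNIV f" for f :: "real => 'a \<Rightarrow>\<^sub>L 'a"
  using borel_measurable_continuous_onI[OF that] by simp
 have Sder: "((%s. S s (cexp x t)) has_derivative (%h. h *\<^sub>R Q s (cexp x t))) (at s)"
  if "s > 0" "ray th t" for s x t
  unfolding S_def Q_def
 proof (rule resolvent_shift_has_derivative[OF C(2)[OF _ that(2)] _ that(1)])
  fix s :: real assume s: "s > 0"
  have "norm (resolvent (cexp x t - of_real s) A) <= C / (s + exp x)" by (rule C(3)[OF s that(2)])
  also have "... <= C / exp x" using C(1) s by (intro divide_left_mono) (auto simp: add_pos_pos)
  finally show "norm (resolvent (cexp x t - of_real s) A) <= C / exp x" .
 qed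
 have der: "((%s. fc_integrand (S s) th (pexp j z) x) has_derivative (%h. h *\<^sub>R fc_integrand (Q s) th (pexp j z) x)) (at s)"
  if s: "s > 0" for s x
 proof -
  have 1: "((%s. (a * b) *\<^sub>C S s (cexp x t)) has_derivative (%h. (a * b) *\<^sub>C (h *\<^sub>R Q s (cexp x t)))) (at s)"
   if "ray th t" for t a b
   by (rule bounded_linear.has_derivative[OF bounded_linear_scaleC Sder[OF s that]])
  have 2: "((%s. fc_integrand (S s) th (pexp j z) x) has_derivative (%h. (1 / (2 * of_real pi * \<i>)) *\<^sub>C
  ((pexp j z (Complex x (- th)) * cexp x (- th)) *\<^sub>C (h *\<^sub>R Q s (cexp x (- th))) -
   (pexp j z (Complex x th) * cexp x th) *\<^sub>C (h *\<^sub>R Q s (cexp x th))))) (at s)"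
   unfolding fc_integrand_def
   by (rule bounded_linear.has_derivative[OF bounded_linear_scaleC has_derivative_diff[OF 1[OF disjI2[OF refl]] 1[OF disjI1[OF refl]]]])
  show ?thesis
   by (rule has_derivative_eq_rhs[OF 2])
    (auto simp: fun_eq_iff fc_integrand_def scaleR_scaleC scaleC_scaleC scaleC_diff_right mult_ac)
 qed
 have "((%s. bochner lborel (fc_integrand (S s) th (pexp j z))) has_derivative
   (%h. bochner lborel (%x. h *\<^sub>R fc_integrand (Q s0) th (pexp j z) x))) (at s0)"
 proof (rule bochner_has_derivative[where U = "{s0 / 2<..}" and g = g and D = "%s x h. h *\<^sub>R fc_integrand (Q s) th (pexp j z) x"])
  show "open {s0 / 2<..}" "convex {s0 / 2<..}" "s0 \<in> {s0 / 2<..}" using s0 by auto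
  show "integrable lborel g" by (rule g)
  fix h :: real
  show "bochner_integrable lborel (%x. h *\<^sub>R fc_integrand (Q s0) th (pexp j z) x)"
   by (rule bochner_bounded_linear(1)[OF bounded_linear_scaleR_right Qi])
  fix k :: real
  show "(%x. h *\<^sub>R fc_integrand (Q s0) th (pexp j z) x + k *\<^sub>R fc_integrand (Q s0) th (pexp j z) x) \<in> borel_measurable lborel"
   by (intro meas continuous_intros Sc s0)
 next
  fix s assume "s \<in> {s0 / 2<..}"
  then have s: "s > s0 / 2" "s > 0" using s0 by auto
  show "bochner_integrable lborel (fc_integrand (S s) th (pexp j z))" by (rule Si[OF s(2)])
  show "(%x. fc_integrand (S s) th (pexp j z) x - fc_integrand (S s0) th (pexp j z) x) \<in> borel_measurable lborel"
   by (intro meas continuous_intros Sc s s0)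
  fix h :: real
  show "(%x. fc_integrand (S s) th (pexp j z) x - fc_integrand (S s0) th (pexp j z) x - h *\<^sub>R fc_integrand (Q s0) th (pexp j z) x) \<in> borel_measurable lborel"
   by (intro meas continuous_intros Sc s s0)
  fix x :: real
  show "((%s. fc_integrand (S s) th (pexp j z) x) has_derivative (%h. h *\<^sub>R fc_integrand (Q s) th (pexp j z) x)) (at s)"
   by (rule der[OF s(2)])
  show "norm (h *\<^sub>R fc_integrand (Q s) th (pexp j z) x) <= g x * norm h"
   using mult_left_mono[OF Qb[OF s(1), of x], of "norm h"] by (simp add: mult.commute)
 qed
 moreover have "bochner lborel (%x. h *\<^sub>R fc_integrand (Q s0) th (pexp j z) x) = h *\<^sub>R V' th j z s0" for h
  using bochner_bounded_linear(2)[OF bounded_linear_scaleR_right Qi] by (simp add: V'_def fc_def Q_def[abs_def] S_def)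
 moreover have "V th j z = (%s. bochner lborel (fc_integrand (S s) th (pexp j z)))"
  by (rule ext) (simp add: V_def fc_def S_def[abs_def])
 ultimately show "(V th j z has_vector_derivative V' th j z s0) (at s0)"
  by (simp add: has_vector_derivative_def)
qed

lemma V_continuous_on:
 assumes th: "\<omega> < th" "th < pi" and z: "z \<in> half_sector th" and j: "j >= - 1"
 shows "continuous_on {0<..} (V th j z)"
 by (intro continuous_at_imp_continuous_on ballI has_vector_derivative_continuous[OF V_shift_derivative(1)[OF th z j]]) simp

end

section \<open>Integration over the shift\<close>

text \<open>For fixed \<open>c\<close> and \<open>x\<close> the defect of homogeneity is a bounded
  linear function of the operator, so it commutes with the integral.\<close>

lemma bochner_cblinfuns:
 fixes f :: "'m => 'a::complex_normed_vector \<Rightarrow>\<^sub>L 'a"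
 assumes f: "bochner_integrable M f" and c: "!!x. x \<in> space M ==> f x \<in> cblinfuns"
 shows "bochner M f \<in> cblinfuns"
 unfolding cblinfuns_def
proof (intro CollectI allI)
 fix c x
 define L where "L T = blinfun_apply T (c *\<^sub>C x) - c *\<^sub>C blinfun_apply T x" for T :: "'a \<Rightarrow>\<^sub>L 'a"
 have L: "bounded_linear L"
  unfolding L_def by (intro bounded_linear_sub bounded_linear_compose[OF bounded_linear_scaleC] blinfun.bounded_linear_left)
 have "L (bochner M f) = bochner M (%x. L (f x))" by (rule bochner_bounded_linear(2)[OF L f, symmetric])
 also have "... = bochner M (%x. 0)" by (rule bochner_cong) (use c in \<open>auto simp: L_def cblinfunsD\<close>)
 also have "... = 0" by (rule bochner_bounded_linear(2)[OF bounded_linear_zero f])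
 finally show "blinfun_apply (bochner M f) (c *\<^sub>C x) = c *\<^sub>C blinfun_apply (bochner M f) x" by (simp add: L_def)
qed

lemma of_real_powr_eq_exp: "s > 0 ==> complex_of_real s powr b = exp (b * of_real (ln s))"
 by (simp add: powr_def Ln_of_real)

lemma norm_of_real_powr: "s > 0 ==> norm (complex_of_real s powr b) = s powr Re b"
 by (simp add: norm_powr_real_powr)

lemma continuous_on_of_real_powr: "continuous_on {0<..} (%s. complex_of_real s powr b)"
proof -
 have "continuous_on {0<..} (%s. exp (b * complex_of_real (ln s)))" by (intro continuous_intros) auto
 then show ?thesis by (rule continuous_on_eq) (simp add: of_real_powr_eq_exp)
qed

lemma of_real_powr_has_derivative:
 assumes s: "s > 0"
 shows "((%s. complex_of_real s powr b) has_vector_derivative b * of_real s powr (b - 1)) (at s)"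
proof -
 have "((%z. z powr b) has_field_derivative b * of_real s powr (b - 1)) (at (complex_of_real s))"
  by (rule has_field_derivative_powr) (use s in \<open>simp add: complex_nonpos_Reals_iff\<close>)
 from has_vector_derivative_real_field[OF this] show ?thesis .
qed

text \<open>Caratheodory's form of differentiability, the increment of \<open>f\<close> being
  factored through that of \<open>a\<close>. The resolvent identity along a path has exactly this
  shape.\<close>

lemma has_vector_derivative_factor:
 fixes f G :: "real => 'b::complex_normed_vector"
 assumes f: "!!y. f y - f x = (a y - a x) *\<^sub>C G y" and a: "(a has_vector_derivative a') (at x)" and G: "isCont G x"
 shows "(f has_vector_derivative a' *\<^sub>C G x) (at x)"
 unfolding has_vector_derivative_def
proof (rule has_derivativeI_sandwich[of 1])
 show "bounded_linear (%h::real. h *\<^sub>R a' *\<^sub>C G x)" by (rule bounded_linear_scaleR_left)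
 define N where "N y = norm (a y - a x - (y - x) *\<^sub>R a') / norm (y - x)" for y
 have N: "(N \<longlongrightarrow> 0) (at x)" using a by (simp add: has_vector_derivative_def has_derivative_iff_norm N_def[abs_def])
 have "((%y. N y * norm (G y) + norm a' * norm (G y - G x)) \<longlongrightarrow> 0 * norm (G x) + norm a' * norm (G x - G x)) (at x)"
  using N G unfolding isCont_def by (intro tendsto_intros)
 then show "((%y. N y * norm (G y) + norm a' * norm (G y - G x)) \<longlongrightarrow> 0) (at x)" by simp
 fix y assume y: "y ~= x"
 have "f y - f x - (y - x) *\<^sub>R a' *\<^sub>C G x = (a y - a x - (y - x) *\<^sub>R a') *\<^sub>C G y + (of_real (y - x) * a') *\<^sub>C (G y - G x)"
 proof -
  have 1: "(y - x) *\<^sub>R a' *\<^sub>C G x = (of_real (y - x) * a') *\<^sub>C G x" "(y - x) *\<^sub>R a' = of_real (y - x) * a'"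
   by (simp only: scaleR_scaleC scaleC_scaleC) (rule scaleR_conv_of_real)
  show ?thesis unfolding f 1 by (simp only: scaleC_diff_left scaleC_diff_right) (simp add: algebra_simps)
 qed
 then have "norm (f y - f x - (y - x) *\<^sub>R a' *\<^sub>C G x) <= norm (a y - a x - (y - x) *\<^sub>R a') * norm (G y) + norm (y - x) * norm a' * norm (G y - G x)"
  using norm_triangle_ineq[of "(a y - a x - (y - x) *\<^sub>R a') *\<^sub>C G y" "(of_real (y - x) * a') *\<^sub>C (G y - G x)"]
  by (simp add: norm_scaleC norm_mult norm_of_real del: of_real_diff)
 then have "norm (f y - f x - (y - x) *\<^sub>R a' *\<^sub>C G x) / norm (y - x) <=
   (norm (a y - a x - (y - x) *\<^sub>R a') * norm (G y) + norm (y - x) * norm a' * norm (G y - G x)) / norm (y - x)"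
  by (rule divide_right_mono) simp
 also have "... = N y * norm (G y) + norm a' * norm (G y - G x)"
  using y by (simp add: N_def add_divide_distrib)
 finally show "norm (f y - f x - (y - x) *\<^sub>R a' *\<^sub>C G x) / norm (y - x) <= N y * norm (G y) + norm a' * norm (G y - G x)" .
qed simp

context sect_op
begin

lemma resolvent_path_derivative:
 fixes \<gamma> :: "real => complex"
 assumes \<gamma>: "!!y. \<gamma> y \<in> resolvent_set A" "(\<gamma> has_vector_derivative \<gamma>') (at x)"
  and c: "isCont (%y. resolvent (\<gamma> y) A) x"
 shows "((%y. resolvent (\<gamma> y) A) has_vector_derivative - \<gamma>' *\<^sub>C (resolvent (\<gamma> x) A o\<^sub>L resolvent (\<gamma> x) A)) (at x)"
proof (rule has_vector_derivative_factor[where a = "%y. - \<gamma> y" and G = "%y. resolvent (\<gamma> y) A o\<^sub>L resolvent (\<gamma> x) A"])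
 show "resolvent (\<gamma> y) A - resolvent (\<gamma> x) A = (- \<gamma> y - - \<gamma> x) *\<^sub>C (resolvent (\<gamma> y) A o\<^sub>L resolvent (\<gamma> x) A)" for y
  using resolvent_identity[OF lin \<gamma>(1) \<gamma>(1)] by simp
 show "((%y. - \<gamma> y) has_vector_derivative - \<gamma>') (at x)" by (rule has_vector_derivative_minus[OF \<gamma>(2)])
 show "isCont (%y. resolvent (\<gamma> y) A o\<^sub>L resolvent (\<gamma> x) A) x"
  by (rule bounded_bilinear.isCont[OF bounded_bilinear_blinfun_compose c]) simp
qed

text \<open>Integration by parts along each ray. Up to the factor \<open>exp w\<close>, the
  derivative of \<open>E_0 * R\<close> is \<open>- (z / 2) * E_(-1) * R - E_0 * R^2\<close>. Since
  \<open>E_0\<close> tends to 1 at \<lambda> = 0, the boundary value there is the resolvent of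
  \<open>A\<close> at \<open>- s\<close>; it is the same on both rays and cancels in their
  difference. At infinity both boundary terms vanish.\<close>

lemma V'_eq:
 assumes th: "\<omega> < th" "th < pi" and z: "z \<in> half_sector th" and s: "s > 0"
 shows "V' th 0 z s = (- z / 2) *\<^sub>C V th (- 1) z s"
proof (rule cfunctional_eqI)
 fix m :: "('a \<Rightarrow>\<^sub>L 'a) => complex" assume m: "cfunctional m"
 interpret m: bounded_linear m by (rule cfunctionalD(1)[OF m])
 let ?Rs = "resolvent (- of_real s) A"
 let ?R = "%\<zeta>. resolvent (\<zeta> - complex_of_real s) A"
 let ?Q = "%\<zeta>. ?R \<zeta> o\<^sub>L ?R \<zeta>"
 interpret I: inv_sect "B s" s by (rule inv_sect_shift[OF s])
 obtain L where L: "L > 0" "!!T. norm (m T) <= norm T * L" using m.pos_bounded by blast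
 obtain C where C: "C >= 0" "!!s x t. s > 0 ==> ray th t ==> cexp x t - of_real s \<in> resolvent_set A"
  "!!s x t. s > 0 ==> ray th t ==> norm (resolvent (cexp x t - of_real s) A) <= C / (s + exp x)"
  using R_line_bound[OF th] by metis
 have hth: "0 <= th" using th \<omega> by simp
 define \<kappa> where "\<kappa> = 1 / (2 * complex_of_real pi * \<i>)"
 define S where "S x t = resolvent (cexp x t - of_real s) A" for x t
 define \<phi> where "\<phi> t x = m (S x t)" for t x
 define P where "P j t x = pexp j z (Complex x t)" for j t x
 define g where "g t x = (- z / 2) * (P (- 1) t x * cexp x t * \<phi> t x) - P 0 t x * cexp x t * m (S x t o\<^sub>L S x t)" for t x
 have cd: "((%x. Complex x t) has_vector_derivative 1) (at x)" for t x
 proof -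
  have "((%x. complex_of_real x + \<i> * of_real t) has_vector_derivative 1) (at x)"
   by (auto intro!: derivative_eq_intros)
  then show ?thesis by (simp add: Complex_eq)
 qed
 have P0: "(P 0 t has_vector_derivative (- z / 2) * (P (- 1) t x * cexp x t)) (at x)" for t x
 proof -
  have "(pexp 0 z has_field_derivative (- z / 2) * (pexp (- 1) z w * exp w)) (at w)" for w
   unfolding pexp_def by (auto intro!: derivative_eq_intros simp flip: exp_add)
  from field_vector_diff_chain_at[OF cd[of t x] this] show ?thesis by (simp add: P_def[abs_def] o_def)
 qed
 have der: "((%x. P 0 t x * \<phi> t x) has_vector_derivative g t x) (at x)" if t: "ray th t" for t x
 proof -
  have "((%x. cexp x t - of_real s) has_vector_derivative cexp x t) (at x)"
  proof -
   have "((%w. exp w - of_real s) has_field_derivative cexp x t) (at (Complex x t))" by (auto intro!: derivative_eq_intros)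
   from field_vector_diff_chain_at[OF cd[of t x] this] show ?thesis by (simp add: o_def)
  qed
  moreover have "isCont (%x. resolvent (cexp x t - of_real s) A) x"
   using R_line_cont[OF th s t] by (simp add: continuous_on_eq_continuous_at)
  ultimately have "((%x. S x t) has_vector_derivative - cexp x t *\<^sub>C (S x t o\<^sub>L S x t)) (at x)"
   unfolding S_def by (intro resolvent_path_derivative C(2)[OF s t])
  from m.has_vector_derivative[OF this] have "(\<phi> t has_vector_derivative - (cexp x t * m (S x t o\<^sub>L S x t))) (at x)"
   by (simp add: \<phi>_def[abs_def] cfunctionalD(2,6)[OF m])
  from has_vector_derivative_mult[OF P0 this] show ?thesis
   by (rule has_vector_derivative_eq_rhs) (simp add: g_def algebra_simps)
 qed
 have i0: "has_bochner lborel (fc_integrand ?Q th (pexp 0 z)) (V' th 0 z s)"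
  unfolding V'_def fc_def by (rule has_bochner_bochner[OF V_shift_derivative(2)[OF th z _ s]]) simp
 obtain \<psi> where \<psi>: "th < \<psi>" "!!j. j >= - 1 ==> decays \<psi> (pexp j z)" using I.pexp_adm[OF angle_less[OF th s] th(2) z] by blast
 have "bochner_integrable lborel (fc_integrand (%\<zeta>. resolvent \<zeta> (B s)) th (pexp (- 1) z))"
  by (rule I.fc_integrable[OF \<psi>(2) angle_less[OF th s] \<psi>(1) th(2)]) simp
 then have i1: "has_bochner lborel (fc_integrand ?R th (pexp (- 1) z)) (V th (- 1) z s)"
  using has_bochner_bochner unfolding V_def fc_def resolvent_op_plus by blast
 have bl: "bounded_linear (%x. (- z / 2) * m x)" by (rule bounded_linear_compose[OF bounded_linear_mult_right cfunctionalD(1)[OF m]])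
 have e: "(- z / 2) * m (fc_integrand ?R th (pexp (- 1) z) x) -
   m (fc_integrand ?Q th (pexp 0 z) x)
   = \<kappa> * g (- th) x - \<kappa> * g th x" for x
  unfolding fc_integrand_def cfunctionalD(2,4)[OF m] g_def \<kappa>_def P_def \<phi>_def S_def by (simp add: field_simps)
 have hb: "has_bochner_integral lborel (%x. (- z / 2) * m (fc_integrand ?R th (pexp (- 1) z) x) -
   m (fc_integrand ?Q th (pexp 0 z) x))
   ((- z / 2) * m (V th (- 1) z s) - m (V' th 0 z s))"
  using has_bochner_bounded_linear[OF bl i1] has_bochner_bounded_linear[OF cfunctionalD(1)[OF m] i0]
  unfolding has_bochner_iff_has_bochner_integral by (rule has_bochner_integral_diff)
 have lim: "((%x. P 0 t x * \<phi> t x) \<longlongrightarrow> m ?Rs) at_bot" "((%x. P 0 t x * \<phi> t x) \<longlongrightarrow> 0) at_top"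
  if t: "ray th t" for t
 proof -
  have zt: "\<bar>Arg z\<bar> + th / 2 < pi / 2" "sect_mod th z > 0" by (rule sect_mod_sector_pos[OF th z])+
  have E: "((%x. cexp x t) \<longlongrightarrow> 0) at_bot" "((%x. exp (Complex x t / 2)) \<longlongrightarrow> 0) at_bot"
  proof -
   have "filterlim (%x::real. (1/2) * x) at_bot at_bot"
    by (rule filterlim_tendsto_pos_mult_at_bot[OF tendsto_const _ filterlim_ident]) simp
   then have "filterlim (%x::real. x / 2) at_bot at_bot" by simp
   then have "((%x::real. exp (x / 2)) \<longlongrightarrow> 0) at_bot" by (rule filterlim_compose[OF exp_at_bot])
   then show "((%x. exp (Complex x t / 2)) \<longlongrightarrow> 0) at_bot" by (rule Lim_null_comparison[rotated]) (simp add: norm_exp_eq_Re)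
   show "((%x. cexp x t) \<longlongrightarrow> 0) at_bot" by (rule Lim_null_comparison[OF _ exp_at_bot]) (simp add: norm_exp_eq_Re)
  qed
  have "((%x. exp (- (z * exp (Complex x t / 2)))) \<longlongrightarrow> exp (- (z * 0))) at_bot" by (intro tendsto_intros E)
  then have Pb: "((%x. P 0 t x) \<longlongrightarrow> 1) at_bot" by (simp add: P_def pexp_def)
  have "(0::complex) \<notin> sector th" using th \<omega> sector_iff[of th 0] by auto
  then have sr: "- complex_of_real s \<in> resolvent_set A" using shift_bound[OF th] s by (metis diff_0)
  have "((%x. S x t) \<longlongrightarrow> ?Rs) at_bot"
  proof -
   have l0: "((%x. norm (cexp x t) * (C / s * norm ?Rs)) \<longlongrightarrow> 0 * (C / s * norm ?Rs)) at_bot"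
    using tendsto_norm[OF E(1)] by (intro tendsto_mult tendsto_const) simp
   have le: "norm (S x t - ?Rs) <= norm (cexp x t) * (C / s * norm ?Rs)" for x
   proof -
    have "S x t - ?Rs = (- cexp x t) *\<^sub>C (S x t o\<^sub>L ?Rs)"
     unfolding S_def resolvent_identity[OF lin C(2)[OF s t] sr] by simp
    moreover have "norm (S x t) <= C / s"
     unfolding S_def using C(1) s by (intro order_trans[OF C(3)[OF s t]] divide_left_mono) (auto simp: add_pos_pos)
    then have "norm (S x t o\<^sub>L ?Rs) <= C / s * norm ?Rs"
     by (rule order_trans[OF norm_blinfun_compose mult_right_mono]) simp
    ultimately show ?thesis by (simp only: norm_scaleC norm_minus_cancel) (rule mult_left_mono, simp_all)
   qed
   have "((%x. S x t - ?Rs) \<longlongrightarrow> 0) at_bot"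
    by (rule Lim_null_comparison[OF always_eventually[OF allI[OF le]]]) (use l0 in simp)
   then show ?thesis by (rule Lim_null[THEN iffD2])
  qed
  then have "((%x. \<phi> t x) \<longlongrightarrow> m ?Rs) at_bot" unfolding \<phi>_def by (rule m.tendsto)
  from tendsto_mult[OF Pb this] show "((%x. P 0 t x * \<phi> t x) \<longlongrightarrow> m ?Rs) at_bot" by simp
  have l1: "((%x. C * L * exp (- x)) \<longlongrightarrow> C * L * 0) at_top"
   by (rule tendsto_mult[OF tendsto_const filterlim_compose[OF exp_at_bot filterlim_uminus_at_bot_at_top]])
  have le: "norm (P 0 t x * \<phi> t x) <= C * L * exp (- x)" for x
  proof -
   have "norm (P 0 t x) <= exp (of_int 0 * x / 2 - sect_mod th z * exp (x / 2))"
    using norm_pexp_le[of "Complex x t" th z 0] t hth zt pi_gt_zero by (auto simp: P_def)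
   also have "... <= 1" using zt by simp
   finally have "norm (P 0 t x * \<phi> t x) <= 1 * norm (\<phi> t x)" unfolding norm_mult by (rule mult_right_mono) simp
   also have "1 * norm (\<phi> t x) <= norm (S x t) * L" using L(2) by (simp add: \<phi>_def)
   also have "... <= C / exp x * L"
    unfolding S_def using C(1) s L(1) by (intro mult_right_mono order_trans[OF C(3)[OF s t]] divide_left_mono) (auto simp: add_pos_pos)
   finally show ?thesis by (simp add: exp_minus field_simps)
  qed
  show "((%x. P 0 t x * \<phi> t x) \<longlongrightarrow> 0) at_top"
   by (rule Lim_null_comparison[OF always_eventually[OF allI[OF le]]]) (use l1 in simp)
 qed
 note b = lim[OF disjI2[OF refl]] and tp = lim[OF disjI1[OF refl]]
 let ?F = "%x. \<kappa> * (P 0 (- th) x * \<phi> (- th) x) - \<kappa> * (P 0 th x * \<phi> th x)"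
 have "(LINT x|lborel. \<kappa> * g (- th) x - \<kappa> * g th x) = (\<kappa> * 0 - \<kappa> * 0) -
   (\<kappa> * m ?Rs - \<kappa> * m ?Rs)"
 proof (rule FTC_line)
  show "(?F has_vector_derivative \<kappa> * g (- th) x - \<kappa> * g th x) (at x)" for x
   by (intro has_vector_derivative_diff has_vector_derivative_mult_right der) auto
  show "integrable lborel (%x. \<kappa> * g (- th) x - \<kappa> * g th x)" using hb unfolding e by (simp add: has_bochner_integral_iff)
  show "(?F \<longlongrightarrow> \<kappa> * m ?Rs - \<kappa> * m ?Rs) at_bot"
   by (intro tendsto_intros b tp)
  show "(?F \<longlongrightarrow> \<kappa> * 0 - \<kappa> * 0) at_top"
   by (intro tendsto_intros b tp)
 qed
 moreover have "(LINT x|lborel. \<kappa> * g (- th) x - \<kappa> * g th x) = (- z / 2) * m (V th (- 1) z s) - m (V' th 0 z s)"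
  using hb unfolding e by (simp add: has_bochner_integral_iff)
 ultimately show "m (V' th 0 z s) = m ((- z / 2) *\<^sub>C V th (- 1) z s)"
  unfolding cfunctionalD(2)[OF m] by simp
qed

end

section \<open>Weighted integrals over the shift\<close>

locale sect_ivp = sect_op A \<omega> for A :: "'a::complex_banach \<rightharpoonup> 'a" and \<omega> :: real +
 fixes \<alpha> :: complex
 assumes \<alpha>: "0 < Re \<alpha>" "Re \<alpha> < 1"
begin

lemma weighted_bound:
 assumes th: "\<omega> < th" "th < pi" and j: "j >= - 1" and b: "b = \<alpha> - 1/2 \<or> b = \<alpha> + 1/2"
 shows "\<exists>C\<ge>0. \<forall>z\<in>half_sector th. \<forall>s>0. norm (of_real s powr b *\<^sub>C V th j z s) <=
  C * exp (- (of_int j + 2 * Re b + 2) * ln (sect_mod th z)) * (exp (- (Re \<alpha> / 2) * \<bar>ln s + 2 * ln (sect_mod th z)\<bar>) / s)"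
proof -
 \<comment> \<open>Here \<open>p = 1/2 + Re \<alpha> / 2\<close>: strictly above the threshold 1/2
   that index \<open>- 1\<close> imposes, and still leaving the rate \<open>Re \<alpha> / 2\<close>
   towards \<open>s = 0\<close>.\<close>
 have "Re \<alpha> / 2 <= Re b + 1 - (1/2 + Re \<alpha> / 2)" "Re \<alpha> / 2 <= 2 - Re b" using b \<alpha> by auto
 from V_weighted_bound[OF th j _ _ this] \<alpha> show ?thesis by (simp add: norm_scaleC norm_of_real_powr)
qed

lemma powr_V_continuous:
 assumes "\<omega> < th" "th < pi" "j >= - 1" "z \<in> half_sector th"
 shows "continuous_on {0<..} (%s. of_real s powr b *\<^sub>C V th j z s)"
 by (intro bounded_bilinear.continuous_on[OF bounded_bilinear_scaleC] continuous_on_of_real_powr V_continuous_on assms)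

lemma powr_V_integrable:
 assumes th: "\<omega> < th" "th < pi" and j: "j >= - 1" and b: "b = \<alpha> - 1/2 \<or> b = \<alpha> + 1/2" and z: "z \<in> half_sector th"
 shows "bochner_integrable leb_pos (%s. of_real s powr b *\<^sub>C V th j z s)"
proof -
 obtain C where C: "\<forall>z\<in>half_sector th. \<forall>s>0. norm (of_real s powr b *\<^sub>C V th j z s) <=
  C * exp (- (of_int j + 2 * Re b + 2) * ln (sect_mod th z)) * (exp (- (Re \<alpha> / 2) * \<bar>ln s + 2 * ln (sect_mod th z)\<bar>) / s)"
  using weighted_bound[OF th j b] by blast
 show ?thesis
 proof (rule bochner_integrable_continuous_lebesgue_on[OF powr_V_continuous[OF th j z]])
  show "integrable leb_pos (%s. C * exp (- (of_int j + 2 * Re b + 2) * ln (sect_mod th z)) * (exp (- (Re \<alpha> / 2) * \<bar>ln s + 2 * ln (sect_mod th z)\<bar>) / s))"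
   by (intro integrable_mult_right integrable_exp_abs_ln_shift) (use \<alpha> in simp)
 qed (use C z in auto)
qed

lemma U_integrable:
 assumes z: "z \<in> half_sector \<omega>"
 shows "bochner_integrable leb_pos (U_integrand A \<omega> \<alpha> z)" "U_op A \<omega> \<alpha> z \<in> cblinfuns"
proof -
 obtain th where th: "\<omega> < th" "th < pi" "z \<in> half_sector th" using sector_common_angle[OF \<omega> z z] by blast
 have sp: "space leb_pos = {0::real<..}" by simp
 have e: "U_integrand A \<omega> \<alpha> z s = of_real s powr (\<alpha> - 1/2) *\<^sub>C V th (- 1) z s" if "s \<in> space leb_pos" for s
  using that unfolding sp by (intro U_integrand_V[OF th]) simp
 show i: "bochner_integrable leb_pos (U_integrand A \<omega> \<alpha> z)"
 proof -
  have "bochner_integrable leb_pos (U_integrand A \<omega> \<alpha> z) \<longleftrightarrow>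
    bochner_integrable leb_pos (%s. of_real s powr (\<alpha> - 1/2) *\<^sub>C V th (- 1) z s)"
   by (rule bochner_cong(2)) (rule e)
  then show ?thesis using powr_V_integrable[OF th(1,2) _ _ th(3), of "- 1" "\<alpha> - 1/2"] by simp
 qed
 have scale: "c *\<^sub>C T \<in> cblinfuns" if "T \<in> cblinfuns" for c and T :: "'a \<Rightarrow>\<^sub>L 'a"
  using that by (simp add: cblinfuns_def scaleC_blinfun.rep_eq scaleC_scaleC mult.commute)
 have "bochner leb_pos (U_integrand A \<omega> \<alpha> z) \<in> cblinfuns"
 proof (rule bochner_cblinfuns[OF i])
  fix s :: real assume s: "s \<in> space leb_pos"
  show "U_integrand A \<omega> \<alpha> z s \<in> cblinfuns"
   unfolding e[OF s] by (intro scale V_cblinfuns th) (use s in auto)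
 qed
 then show "U_op A \<omega> \<alpha> z \<in> cblinfuns" unfolding U_op_def by (rule scale)
qed

end

lemma tendsto_exp_abs_ln:
 assumes c: "c > 0"
 shows "((%s::real. exp (- c * \<bar>ln s + b\<bar>)) \<longlongrightarrow> 0) (at_right 0)" "((%s::real. exp (- c * \<bar>ln s + b\<bar>)) \<longlongrightarrow> 0) at_top"
proof -
 have "filterlim (%s::real. c * ln s) at_bot (at_right 0)"
  by (rule filterlim_tendsto_pos_mult_at_bot[OF tendsto_const c ln_at_0])
 then have 1: "((%s::real. exp (c * \<bar>b\<bar>) * exp (c * ln s)) \<longlongrightarrow> 0) (at_right 0)"
  by (intro tendsto_mult_right_zero filterlim_compose[OF exp_at_bot])
 have "filterlim (%s::real. c * ln s) at_top at_top"
  by (rule filterlim_tendsto_pos_mult_at_top[OF tendsto_const c ln_at_top])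
 then have "filterlim (%s::real. - (c * ln s)) at_bot at_top" by (rule filterlim_compose[OF filterlim_uminus_at_bot_at_top])
 then have 2: "((%s::real. exp (c * \<bar>b\<bar>) * exp (- (c * ln s))) \<longlongrightarrow> 0) at_top"
  by (intro tendsto_mult_right_zero filterlim_compose[OF exp_at_bot])
 have le1: "norm (exp (- c * \<bar>ln s + b\<bar>)) <= exp (c * \<bar>b\<bar>) * exp (c * ln s)"
  and le2: "norm (exp (- c * \<bar>ln s + b\<bar>)) <= exp (c * \<bar>b\<bar>) * exp (- (c * ln s))" for s :: real
 proof -
  have "c * (- \<bar>ln s + b\<bar>) <= c * (\<bar>b\<bar> + ln s)" "c * (- \<bar>ln s + b\<bar>) <= c * (\<bar>b\<bar> - ln s)"
   using c by (intro mult_left_mono; linarith)+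
  then show "norm (exp (- c * \<bar>ln s + b\<bar>)) <= exp (c * \<bar>b\<bar>) * exp (c * ln s)"
   "norm (exp (- c * \<bar>ln s + b\<bar>)) <= exp (c * \<bar>b\<bar>) * exp (- (c * ln s))"
   unfolding exp_add[symmetric] by (simp_all add: algebra_simps)
 qed
 show "((%s::real. exp (- c * \<bar>ln s + b\<bar>)) \<longlongrightarrow> 0) (at_right 0)" by (rule Lim_null_comparison[OF always_eventually[OF allI[OF le1]] 1])
 show "((%s::real. exp (- c * \<bar>ln s + b\<bar>)) \<longlongrightarrow> 0) at_top" by (rule Lim_null_comparison[OF always_eventually[OF allI[OF le2]] 2])
qed

lemma integrable_exp_subst_abs_ln:
 fixes f :: "real => complex"
 assumes f: "continuous_on {0<..} f" and c: "c > 0" and le: "!!s. s > 0 ==> norm (f s) <= C * (exp (- c * \<bar>ln s + b\<bar>) / s)"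
 shows "integrable lborel (%x. exp x *\<^sub>R f (exp x))"
proof (rule integrable_le)
 show "integrable lborel (%x. C * exp (- c * \<bar>b + 1 * x\<bar>))"
  by (intro integrable_mult_right lborel_integrable_real_affine[OF integrable_exp_abs[OF c]]) simp
 have "continuous_on UNIV (%x. exp x *\<^sub>R f (exp x))"
  by (intro continuous_intros continuous_on_compose2[OF f]) auto
 from borel_measurable_continuous_onI[OF this] show "(%x. exp x *\<^sub>R f (exp x)) \<in> borel_measurable lborel" by simp
 show "AE x in lborel. norm (exp x *\<^sub>R f (exp x)) <= norm (C * exp (- c * \<bar>b + 1 * x\<bar>))"
 proof (rule AE_I2)
  fix x :: real
  have "norm (exp x *\<^sub>R f (exp x)) <= exp x * (C * (exp (- c * \<bar>ln (exp x) + b\<bar>) / exp x))"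
   unfolding norm_scaleR abs_exp_cancel by (intro mult_left_mono le) auto
  also have "... = C * exp (- c * \<bar>b + 1 * x\<bar>)" by (simp add: add.commute)
  finally show "norm (exp x *\<^sub>R f (exp x)) <= norm (C * exp (- c * \<bar>b + 1 * x\<bar>))" by simp
 qed
qed

section \<open>The integrals on the positive time axis\<close>

context sect_ivp
begin

definition th1 :: real where "th1 = (\<omega> + pi) / 2"
definition v :: "int => real => real => 'a \<Rightarrow>\<^sub>L 'a" where "v j t s = V th1 j (of_real t) s"
text \<open>\<open>W (\<alpha> - 1/2) (- 1)\<close> is the function \<open>w\<close> of the
  overview. The other weight and the other indices arise from applying \<open>A\<close> and from
  differentiating in \<open>t\<close>.\<close>

definition W :: "complex => int => real => 'a \<Rightarrow>\<^sub>L 'a" where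
 "W b j t = bochner leb_pos (%s. of_real s powr b *\<^sub>C v j t s)"

lemma th1: "\<omega> < th1" "th1 < pi" "0 < th1" using \<omega> by (auto simp: th1_def)

lemma pos_sector: "t > 0 ==> complex_of_real t \<in> half_sector th1"
 by (rule of_real_in_sector) (use th1 in auto)

text \<open>For real \<open>t > 0\<close> the number \<open>sect_mod th1 t\<close> is just
  \<open>q * t\<close>, so the bounds become powers of \<open>t\<close>.\<close>

definition q :: real where "q = cos (th1 / 2)"

lemma q: "0 < q" "q <= 1" unfolding q_def using th1 by (auto intro!: cos_gt_zero_pi)

lemma ln_sect_mod: "t > 0 ==> ln (sect_mod th1 (of_real t)) = ln t + ln q"
 using q by (simp add: sect_mod_def q_def[symmetric] ln_mult Arg_of_real)

lemma v_bound:
 assumes j: "j >= - 1" and b: "b = \<alpha> - 1/2 \<or> b = \<alpha> + 1/2"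
 shows "\<exists>C\<ge>0. \<forall>t>0. \<forall>s>0. norm (of_real s powr b *\<^sub>C v j t s) <=
  C * exp (- (of_int j + 2 * Re b + 2) * (ln t + ln q)) * (exp (- (Re \<alpha> / 2) * \<bar>ln s + 2 * (ln t + ln q)\<bar>) / s)"
proof -
 obtain C where C: "C >= 0" "\<forall>z\<in>half_sector th1. \<forall>s>0. norm (of_real s powr b *\<^sub>C V th1 j z s) <=
  C * exp (- (of_int j + 2 * Re b + 2) * ln (sect_mod th1 z)) * (exp (- (Re \<alpha> / 2) * \<bar>ln s + 2 * ln (sect_mod th1 z)\<bar>) / s)"
  using weighted_bound[OF th1(1,2) j b] by blast
 then show ?thesis unfolding v_def using pos_sector by (intro exI[of _ C]) (simp add: ln_sect_mod[symmetric])
qed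

lemma powr_v_integrable:
 assumes "j >= - 1" "b = \<alpha> - 1/2 \<or> b = \<alpha> + 1/2" "t > 0"
 shows "bochner_integrable leb_pos (%s. of_real s powr b *\<^sub>C v j t s)"
 unfolding v_def by (rule powr_V_integrable[OF th1(1,2) assms(1,2) pos_sector[OF assms(3)]])

lemma powr_v_continuous:
 assumes "j >= - 1" "t > 0"
 shows "continuous_on {0<..} (%s. of_real s powr b *\<^sub>C v j t s)"
 unfolding v_def by (rule powr_V_continuous[OF th1(1,2) assms(1) pos_sector[OF assms(2)]])

lemma v_time_derivative:
 assumes j: "j >= - 1" and t: "t > 0" and s: "s > 0"
 shows "((%t. v j t s) has_derivative (%h. h *\<^sub>R (- v (j + 1) t s))) (at t)"
 unfolding v_def
 by (rule has_derivative_eq_rhs[OF has_derivative_compose[OF has_derivative_of_real[OF has_derivative_ident]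
    V_has_derivative[OF th1(1,2) s pos_sector[OF t] j]]])
  (simp add: scaleR_scaleC)

text \<open>Dominated differentiation under the integral: when \<open>t\<close> varies in a compact
  part of the half-line, \<open>ln t\<close> only shifts the two-sided exponential by a bounded
  amount, which changes the constant but not the rate.\<close>

lemma W_has_derivative:
 assumes j: "j >= - 1" and b: "b = \<alpha> - 1/2 \<or> b = \<alpha> + 1/2" and t0: "t0 > 0"
 shows "(W b j has_vector_derivative - W b (j + 1) t0) (at t0)"
proof -
 let ?e = "%s. exp (- (Re \<alpha> / 2) * \<bar>ln s + 0\<bar>) / s"
 have j1: "j + 1 >= - 1" using j by simp
 obtain C where C: "C >= 0" "\<forall>t>0. \<forall>s>0. norm (of_real s powr b *\<^sub>C v (j + 1) t s) <=
  C * exp (- (of_int (j + 1) + 2 * Re b + 2) * (ln t + ln q)) * (exp (- (Re \<alpha> / 2) * \<bar>ln s + 2 * (ln t + ln q)\<bar>) / s)"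
  using v_bound[OF j1 b] by blast
 define a where "a = - (of_int (j + 1) + 2 * Re b + 2)"
 \<comment> \<open>A bound for \<open>|ln t + ln q|\<close> valid for all \<open>t\<close> between
   \<open>t0 / 2\<close> and \<open>2 * t0\<close>.\<close>
 define k where "k = \<bar>ln t0\<bar> + ln 2 + \<bar>ln q\<bar>"
 define M where "M = C * exp (\<bar>a\<bar> * k) * exp (Re \<alpha> * k)"
 have bound: "norm (of_real s powr b *\<^sub>C v (j + 1) t s) <= M * ?e s"
  if t: "t0 / 2 < t" "t < 2 * t0" and s: "s > 0" for t s
 proof -
  have tp: "t > 0" using t t0 by simp
  have "ln (t0 / 2) <= ln t" "ln t <= ln (2 * t0)" using t t0 tp by (auto intro!: ln_mono)
  then have lt: "\<bar>ln t + ln q\<bar> <= k" using t0 by (simp add: ln_div ln_mult k_def)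
  have "a * (ln t + ln q) <= \<bar>a\<bar> * k"
  proof -
   have "a * (ln t + ln q) <= \<bar>a\<bar> * \<bar>ln t + ln q\<bar>" by (metis abs_ge_self abs_mult)
   also have "... <= \<bar>a\<bar> * k" by (rule mult_left_mono[OF lt]) simp
   finally show ?thesis .
  qed
  moreover have "- (Re \<alpha> / 2) * \<bar>ln s + 2 * (ln t + ln q)\<bar> <= Re \<alpha> * k - (Re \<alpha> / 2) * \<bar>ln s + 0\<bar>"
  proof -
   have "\<bar>ln s + 0\<bar> - 2 * k <= \<bar>ln s + 2 * (ln t + ln q)\<bar>"
    using lt abs_triangle_ineq4[of "ln s + 2 * (ln t + ln q)" "2 * (ln t + ln q)"] by (simp add: abs_mult)
   then have "(Re \<alpha> / 2) * (\<bar>ln s + 0\<bar> - 2 * k) <= (Re \<alpha> / 2) * \<bar>ln s + 2 * (ln t + ln q)\<bar>" using \<alpha> by (intro mult_left_mono) auto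
   then show ?thesis by (simp add: algebra_simps)
  qed
  ultimately have "C * exp (a * (ln t + ln q)) * (exp (- (Re \<alpha> / 2) * \<bar>ln s + 2 * (ln t + ln q)\<bar>) / s) <=
    C * exp (\<bar>a\<bar> * k) * (exp (Re \<alpha> * k - (Re \<alpha> / 2) * \<bar>ln s + 0\<bar>) / s)"
   using C(1) s by (intro mult_mono divide_right_mono) auto
  also have "... = M * ?e s" by (simp only: M_def diff_conv_add_uminus exp_add minus_mult_left mult.assoc times_divide_eq_right)
  finally show ?thesis using C(2) tp s unfolding a_def by fastforce
 qed
 define F where "F t s = of_real s powr b *\<^sub>C v j t s" for t s
 define E where "E t s = of_real s powr b *\<^sub>C v (j + 1) t s" for t s
 have Fc: "continuous_on {0<..} (F t)" and Ec: "continuous_on {0<..} (E t)" if "t > 0" for t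
  unfolding F_def E_def by (rule powr_v_continuous[OF j that] powr_v_continuous[OF j1 that])+
 have Ei: "bochner_integrable leb_pos (E t)" if "t > 0" for t
  unfolding E_def by (rule powr_v_integrable[OF j1 b that])
 note meas = borel_measurable_continuous_lebesgue_on[OF _ borel_open[OF open_greaterThan]]
 have sp: "space leb_pos = {0::real<..}" by simp
 have "((%t. bochner leb_pos (F t)) has_derivative
   (%h. bochner leb_pos (%s. h *\<^sub>R (- E t0 s)))) (at t0)"
 proof (rule bochner_has_derivative[where U = "{t0 / 2<..<2 * t0}" and D = "%t s h. h *\<^sub>R (- E t s)" and g = "%s. M * ?e s"])
  show "open {t0 / 2<..<2 * t0}" "convex {t0 / 2<..<2 * t0}" "t0 \<in> {t0 / 2<..<2 * t0}" using t0 by auto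
  show "integrable leb_pos (%s. M * ?e s)"
   by (intro integrable_mult_right integrable_exp_abs_ln_shift(1)) (use \<alpha> in simp)
  fix h :: real
  show "bochner_integrable leb_pos (%s. h *\<^sub>R (- E t0 s))"
   by (rule bochner_bounded_linear(1)[OF bounded_linear_compose[OF bounded_linear_scaleR_right bounded_linear_minus[OF bounded_linear_ident]] Ei[OF t0]])
  fix k :: real
  show "(%s. h *\<^sub>R (- E t0 s) + k *\<^sub>R (- E t0 s)) \<in> borel_measurable leb_pos"
   by (intro meas continuous_intros Ec t0)
 next
  fix t assume "t \<in> {t0 / 2<..<2 * t0}"
  then have t: "t0 / 2 < t" "t < 2 * t0" "t > 0" using t0 by auto
  show "bochner_integrable leb_pos (F t)" unfolding F_def by (rule powr_v_integrable[OF j b t(3)])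
  show "(%s. F t s - F t0 s) \<in> borel_measurable leb_pos" by (intro meas continuous_intros Fc t t0)
  fix h :: real
  show "(%s. F t s - F t0 s - h *\<^sub>R (- E t0 s)) \<in> borel_measurable leb_pos" by (intro meas continuous_intros Fc Ec t t0)
  fix s :: real assume "s \<in> space leb_pos"
  then have s: "s > 0" unfolding sp by simp
  show "((%t. F t s) has_derivative (%h. h *\<^sub>R (- E t s))) (at t)"
   unfolding F_def E_def
   by (rule has_derivative_eq_rhs[OF bounded_linear.has_derivative[OF bounded_linear_scaleC v_time_derivative[OF j t(3) s]]])
    (simp add: scaleR_scaleC scaleC_scaleC mult.commute)
  have "norm (E t s) * norm h <= M * ?e s * norm h"
   unfolding E_def by (rule mult_right_mono[OF bound[OF t(1,2) s]]) simp
  then show "norm (h *\<^sub>R (- E t s)) <= M * ?e s * norm h"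
   by (simp only: norm_scaleR norm_minus_cancel real_norm_def mult.commute)
 qed
 moreover have "bochner leb_pos (%s. h *\<^sub>R (- E t0 s)) = h *\<^sub>R (- W b (j + 1) t0)" for h
  using bochner_bounded_linear(2)[OF bounded_linear_compose[OF bounded_linear_scaleR_right bounded_linear_minus[OF bounded_linear_ident]] Ei[OF t0]]
  by (simp add: W_def E_def[abs_def])
 moreover have "W b j = (%t. bochner leb_pos (F t))" by (rule ext) (simp add: W_def F_def[abs_def])
 ultimately show ?thesis by (simp add: has_vector_derivative_def)
qed

text \<open>Instead of taking the unbounded \<open>A\<close> through the integral, the bounded
  operator \<open>S\<close>, the resolvent at \<open>- 1\<close>, is pulled out. Each integrand is
  \<open>S\<close> applied to an integrable function, so the integral lies in the range of
  \<open>S\<close>, and inverting \<open>S\<close> shows what \<open>A\<close> does to it.\<close>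

lemma W_dom:
 assumes t: "t > 0"
 shows "blinfun_apply (W (\<alpha> - 1/2) (- 1) t) y \<in> dom A"
  "app A (blinfun_apply (W (\<alpha> - 1/2) (- 1) t) y) = blinfun_apply (W (\<alpha> - 1/2) 1 t) y - blinfun_apply (W (\<alpha> + 1/2) (- 1) t) y"
proof -
 have mr: "- 1 \<in> resolvent_set A" using A by (auto simp: Sect_def sectorial_def dest: spec[of _ "- 1"])
 note r = resolvent[OF mr]
 define S where "S = resolvent (- 1) A"
 define b where "b = \<alpha> - 1/2"
 have b1: "\<alpha> + 1/2 = b + 1" by (simp add: b_def)
 define L where "L T = S o\<^sub>L T" for T :: "'a \<Rightarrow>\<^sub>L 'a"
 have L: "bounded_linear L" unfolding L_def by (rule bounded_linear_compose_right)
 \<comment> \<open>The weighted value of \<open>- u - A u\<close>, with \<open>A u\<close> replaced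
   by \<open>V_1 - s u\<close>; the factor \<open>s\<close> raises the exponent \<open>b\<close> to
   \<open>b + 1\<close>.\<close>
 define X where "X s = (of_real s powr (b + 1) *\<^sub>C v (- 1) t s - of_real s powr b *\<^sub>C v 1 t s) - of_real s powr b *\<^sub>C v (- 1) t s" for s
 have pt: "of_real s powr b *\<^sub>C v (- 1) t s = L (X s)" if s: "s > 0" for s
 proof (rule blinfun_eqI)
  fix y
  define u where "u = blinfun_apply (v (- 1) t s) y"
  have u: "u \<in> dom A" "app A u = blinfun_apply (v 1 t s) y - of_real s *\<^sub>C u"
   unfolding u_def v_def by (rule V_dom[OF th1(1,2) s pos_sector[OF t]])+
  have Sc: "blinfun_apply S (c *\<^sub>C x) = c *\<^sub>C blinfun_apply S x" for c x
   unfolding S_def by (rule cblinfunsD[OF resolvent_cblinfuns[OF lin mr]])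
  have "blinfun_apply (X s) y = (of_real s powr b) *\<^sub>C ((- 1) *\<^sub>C u - app A u)"
   using s unfolding X_def u(2) by (simp add: blinfun.diff_left scaleC_blinfun.rep_eq u_def[symmetric] scaleC_diff_right scaleC_scaleC powr_add mult.commute)
  then have "blinfun_apply (L (X s)) y = (of_real s powr b) *\<^sub>C u"
   using r(3)[OF u(1)] by (simp add: L_def Sc) (simp add: S_def)
  then show "blinfun_apply (of_real s powr b *\<^sub>C v (- 1) t s) y = blinfun_apply (L (X s)) y"
   by (simp add: scaleC_blinfun.rep_eq u_def)
 qed
 have i: "bochner_integrable leb_pos (%s. of_real s powr (b + 1) *\<^sub>C v (- 1) t s)"
  "bochner_integrable leb_pos (%s. of_real s powr b *\<^sub>C v 1 t s)"
  "bochner_integrable leb_pos (%s. of_real s powr b *\<^sub>C v (- 1) t s)"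
  by (rule powr_v_integrable[OF _ _ t]; simp add: b_def)+
 note meas = borel_measurable_continuous_lebesgue_on[OF _ borel_open[OF open_greaterThan]]
 have j1: "bochner_integrable leb_pos (%s. of_real s powr (b + 1) *\<^sub>C v (- 1) t s - of_real s powr b *\<^sub>C v 1 t s)"
  by (intro bochner_integrable_diff i meas continuous_on_diff powr_v_continuous t) auto
 have Xi: "bochner_integrable leb_pos X"
  unfolding X_def[abs_def] by (intro bochner_integrable_diff j1 i meas continuous_on_diff powr_v_continuous t) auto
 have XE: "bochner leb_pos X = (W (b + 1) (- 1) t - W b 1 t) - W b (- 1) t"
  unfolding W_def bochner_diff[OF i(1,2) j1, symmetric] using bochner_diff[OF j1 i(3)] Xi unfolding X_def[abs_def] by blast
 have sp: "space leb_pos = {0::real<..}" by simp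
 have "W b (- 1) t = bochner leb_pos (%s. L (X s))"
  unfolding W_def by (rule bochner_cong(1)) (use pt sp in simp)
 also have "... = S o\<^sub>L ((W (b + 1) (- 1) t - W b 1 t) - W b (- 1) t)"
  using bochner_bounded_linear(2)[OF L Xi] unfolding XE by (simp only: L_def)
 finally have WE: "blinfun_apply (W b (- 1) t) y = blinfun_apply S (blinfun_apply ((W (b + 1) (- 1) t - W b 1 t) - W b (- 1) t) y)"
  by (metis blinfun_apply_blinfun_compose)
 show "blinfun_apply (W (\<alpha> - 1/2) (- 1) t) y \<in> dom A"
  unfolding b_def[symmetric] by (subst WE) (unfold S_def, rule r)
 have "(- 1) *\<^sub>C blinfun_apply (W b (- 1) t) y - app A (blinfun_apply (W b (- 1) t) y) =
   blinfun_apply ((W (b + 1) (- 1) t - W b 1 t) - W b (- 1) t) y"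
  unfolding WE[unfolded S_def] using r(2) by (metis)
 then show "app A (blinfun_apply (W (\<alpha> - 1/2) (- 1) t) y) = blinfun_apply (W (\<alpha> - 1/2) 1 t) y - blinfun_apply (W (\<alpha> + 1/2) (- 1) t) y"
  unfolding b_def[symmetric] b1 by (simp add: blinfun.diff_left blinfun.add_left algebra_simps)
qed

text \<open>The function differentiated in \<open>s\<close> is \<open>s^(\<alpha> + 1/2)\<close>
  times \<open>v 0 t s\<close>; the two-sided bound makes it vanish at 0 and at infinity. The
  relation eliminates the weight \<open>\<alpha> + 1/2\<close> from the formula for \<open>A\<close>
  in \<open>W_dom\<close>.\<close>

lemma W_parts:
 assumes t: "t > 0"
 shows "of_real t *\<^sub>C W (\<alpha> + 1/2) (- 1) t = (2 * \<alpha> + 1) *\<^sub>C W (\<alpha> - 1/2) 0 t"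
proof (rule cfunctional_eqI)
 fix m :: "('a \<Rightarrow>\<^sub>L 'a) => complex" assume m: "cfunctional m"
 interpret m: bounded_linear m by (rule cfunctionalD(1)[OF m])
 obtain L where L: "L > 0" "!!T. norm (m T) <= norm T * L" using m.pos_bounded by blast
 let ?k = "2 * (ln t + ln q)" and ?c = "Re \<alpha> / 2"
 have c: "?c > 0" using \<alpha> by simp
 let ?F = "%s. of_real s powr (\<alpha> + 1/2) * m (v 0 t s)"
 obtain C where C: "!!s. s > 0 ==> norm (of_real s powr (\<alpha> - 1/2) *\<^sub>C v 0 t s) <= C * (exp (- ?c * \<bar>ln s + ?k\<bar>) / s)"
  using v_bound[of 0 "\<alpha> - 1/2"] t by auto
 obtain D where D: "!!s. s > 0 ==> norm (of_real s powr (\<alpha> + 1/2) *\<^sub>C v (- 1) t s) <= D * (exp (- ?c * \<bar>ln s + ?k\<bar>) / s)"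
  using v_bound[of "- 1" "\<alpha> + 1/2"] t by auto
 define a where "a s = of_real s powr (\<alpha> - 1/2) * m (v 0 t s)" for s :: real
 define d where "d s = of_real s powr (\<alpha> + 1/2) * m (v (- 1) t s)" for s :: real
 have aE: "a s = m (of_real s powr (\<alpha> - 1/2) *\<^sub>C v 0 t s)" and dE: "d s = m (of_real s powr (\<alpha> + 1/2) *\<^sub>C v (- 1) t s)" for s
  by (simp_all add: a_def d_def cfunctionalD(2)[OF m])
 have ab: "norm (a s) <= (C * L) * (exp (- ?c * \<bar>ln s + ?k\<bar>) / s)" and db: "norm (d s) <= (D * L) * (exp (- ?c * \<bar>ln s + ?k\<bar>) / s)" if s: "s > 0" for s
  unfolding aE dE using order_trans[OF L(2) mult_right_mono[OF C[OF s] less_imp_le[OF L(1)]]] order_trans[OF L(2) mult_right_mono[OF D[OF s] less_imp_le[OF L(1)]]]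
  by (simp_all add: mult_ac)
 have ac: "continuous_on {0<..} a" and dc: "continuous_on {0<..} d"
  unfolding aE[abs_def] dE[abs_def] by (intro m.continuous_on powr_v_continuous t; simp)+
 have ai: "integrable lborel (%x. exp x *\<^sub>R a (exp x))" and di: "integrable lborel (%x. exp x *\<^sub>R d (exp x))"
  by (rule integrable_exp_subst_abs_ln[OF ac c ab] integrable_exp_subst_abs_ln[OF dc c db]; simp)+
 have FE: "?F s = of_real s * a s" if "s > 0" for s
 proof -
  have e: "\<alpha> + 1/2 = (\<alpha> - 1/2) + 1" by simp
  show ?thesis using that unfolding e powr_add by (simp add: a_def)
 qed
 have Fb: "norm (?F s) <= (C * L) * exp (- ?c * \<bar>ln s + ?k\<bar>)" if s: "s > 0" for s
 proof -
  have "norm (complex_of_real s * a s) <= s * ((C * L) * (exp (- ?c * \<bar>ln s + ?k\<bar>) / s))"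
   unfolding norm_mult using ab[OF s] s by (simp del: times_divide_eq_right)
  then show ?thesis unfolding FE[OF s] using s by simp
 qed
 have lim: "(?F \<longlongrightarrow> 0) (at_right 0)" "(?F \<longlongrightarrow> 0) at_top"
 proof -
  have z: "((%s. (C * L) * exp (- ?c * \<bar>ln s + ?k\<bar>)) \<longlongrightarrow> 0) (at_right 0)" "((%s. (C * L) * exp (- ?c * \<bar>ln s + ?k\<bar>)) \<longlongrightarrow> 0) at_top"
   by (rule tendsto_mult_right_zero, rule tendsto_exp_abs_ln[OF c])+
  show "(?F \<longlongrightarrow> 0) (at_right 0)"
   by (rule Lim_null_comparison[OF _ z(1)]) (use eventually_at_right_less[of 0] in eventually_elim, rule Fb)
  show "(?F \<longlongrightarrow> 0) at_top"
   by (rule Lim_null_comparison[OF _ z(2)]) (use eventually_gt_at_top[of 0] in eventually_elim, rule Fb)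
 qed
 have "(LINT s|leb_pos. (\<alpha> + 1/2) * a s - (of_real t / 2) * d s) = 0 - 0"
 proof (rule FTC_pos[OF _ _ lim])
  fix s :: real assume s: "s > 0"
  have "(v 0 t has_vector_derivative (- of_real t / 2) *\<^sub>C v (- 1) t s) (at s)"
   using V_shift_derivative(1)[OF th1(1,2) pos_sector[OF t] _ s, of 0] unfolding V'_eq[OF th1(1,2) pos_sector[OF t] s] v_def[abs_def] by simp
  from m.has_vector_derivative[OF this] have "((%s. m (v 0 t s)) has_vector_derivative (- of_real t / 2) * m (v (- 1) t s)) (at s)"
   by (simp only: cfunctionalD(2)[OF m])
  from has_vector_derivative_mult[OF of_real_powr_has_derivative[OF s] this]
  show "(?F has_vector_derivative (\<alpha> + 1/2) * a s - (of_real t / 2) * d s) (at s)"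
   by (rule has_vector_derivative_eq_rhs) (simp add: a_def d_def algebra_simps)
 next
  have "integrable lborel (%x. (\<alpha> + 1/2) * (exp x *\<^sub>R a (exp x)) - (of_real t / 2) * (exp x *\<^sub>R d (exp x)))"
   by (intro integrable_sub integrable_mult_right ai di)
  then show "integrable lborel (%x. exp x *\<^sub>R ((\<alpha> + 1/2) * a (exp x) - (of_real t / 2) * d (exp x)))"
   by (simp add: scaleR_diff_right)
 qed
 moreover have "(LINT s|leb_pos. (\<alpha> + 1/2) * a s - (of_real t / 2) * d s) = (\<alpha> + 1/2) * m (W (\<alpha> - 1/2) 0 t) - (of_real t / 2) * m (W (\<alpha> + 1/2) (- 1) t)"
 proof -
  have i: "bochner_integrable leb_pos (%s. of_real s powr (\<alpha> - 1/2) *\<^sub>C v 0 t s)"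
   "bochner_integrable leb_pos (%s. of_real s powr (\<alpha> + 1/2) *\<^sub>C v (- 1) t s)"
   by (rule powr_v_integrable[OF _ _ t]; simp)+
  note f1 = bochner_functional[OF i(1) m] and f2 = bochner_functional[OF i(2) m]
  show ?thesis
   unfolding W_def f1(2) f2(2) aE dE
   by (subst LINT_diff) (use f1(1) f2(1) in auto)
 qed
 ultimately have "(\<alpha> + 1/2) * m (W (\<alpha> - 1/2) 0 t) - (of_real t / 2) * m (W (\<alpha> + 1/2) (- 1) t) = 0" by simp
 then have "2 * ((of_real t / 2) * m (W (\<alpha> + 1/2) (- 1) t)) = 2 * ((\<alpha> + 1/2) * m (W (\<alpha> - 1/2) 0 t))" by (metis eq_iff_diff_eq_0)
 moreover have "2 * ((of_real t / 2) * w) = of_real t * w" "2 * ((\<alpha> + 1/2) * w) = (2 * \<alpha> + 1) * w" for w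
  by (simp_all add: algebra_simps)
 ultimately show "m (of_real t *\<^sub>C W (\<alpha> + 1/2) (- 1) t) = m ((2 * \<alpha> + 1) *\<^sub>C W (\<alpha> - 1/2) 0 t)"
  unfolding cfunctionalD(2)[OF m] by (simp only:)
qed

end

section \<open>Boundedness and the initial value\<close>

text \<open>The integrand is \<open>s^(\<alpha> - 1) * exp (- t * s^(1/2))\<close>, and the
  substitution \<open>s^(1/2) = r / t\<close> leads to Euler's integral. In logarithmic form this is
  \<open>y = - 2 * ln t + 2 * u\<close>, whose Jacobian gives the factor 2.\<close>

lemma LINT_powr_exp_sqrt:
 assumes \<alpha>: "0 < Re \<alpha>" and t: "t > 0"
 defines "f \<equiv> %s. complex_of_real s powr (\<alpha> - 1/2) * exp (- of_real (ln s) / 2 - of_real t * exp (of_real (ln s) / 2))"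
 shows "integrable leb_pos f"
  "(LINT s|leb_pos. f s) * of_real t powr (2 * \<alpha>) = 2 * Gamma (2 * \<alpha>)"
proof -
 define h where "h u = exp (2 * \<alpha> * of_real u) * exp (- complex_of_real (exp u))" for u :: real
 have hc: "continuous_on UNIV h" unfolding h_def by (intro continuous_intros)
 have h: "integrable lborel h"
 proof (rule integrable_le)
  show "integrable lborel (%u. exp (Re \<alpha> * (0 + 2 * u) - exp ((0 + 2 * u) / 2)))"
   by (rule lborel_integrable_real_affine[OF integrable_exp_minus_exp[OF \<alpha>]]) simp
  show "h \<in> borel_measurable lborel" using borel_measurable_continuous_onI[OF hc] by simp
  show "AE u in lborel. norm (h u) <= norm (exp (Re \<alpha> * (0 + 2 * u) - exp ((0 + 2 * u) / 2)))"
   by (rule AE_I2) (simp add: h_def norm_mult norm_exp_eq_Re Re_exp flip: exp_add)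
 qed
 define g where "g r = complex_of_real r powr (2 * \<alpha> - 1) / of_real (exp r)" for r
 have ge: "exp u *\<^sub>R g (exp u) = h u" for u
 proof -
  have 1: "complex_of_real (exp u) * exp ((2 * \<alpha> - 1) * of_real u) = exp (2 * \<alpha> * of_real u)"
   unfolding exp_of_real[symmetric] exp_add[symmetric] by (simp add: algebra_simps)
  have 2: "1 / complex_of_real (exp (exp u)) = exp (- of_real (exp u))"
   by (simp add: exp_minus exp_of_real inverse_eq_divide)
  show ?thesis
   unfolding h_def 1[symmetric] 2[symmetric] using of_real_powr_eq_exp[of "exp u" "2 * \<alpha> - 1"] by (simp add: g_def scaleR_conv_of_real)
 qed
 have "(LINT r|leb_pos. g r) = Gamma (2 * \<alpha>)"
 proof -
  have gi: "integrable leb_pos g" by (rule exp_subst(1)) (unfold ge, rule h)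
  have "(g has_integral Gamma (2 * \<alpha>)) {0<..}" unfolding g_def by (rule Gamma_integral_complex') (use \<alpha> in simp)
  then show ?thesis using lebesgue_integral_eq_integral[OF gi] by (simp add: integral_unique)
 qed
 moreover have "(LINT r|leb_pos. g r) = (LINT u|lborel. h u)"
  using exp_subst(2)[of g] h unfolding ge by simp
 ultimately have hG: "(LINT u|lborel. h u) = Gamma (2 * \<alpha>)" by simp
 define F where "F y = exp (\<alpha> * of_real y) * exp (- of_real t * exp (complex_of_real y / 2))" for y :: real
 have fe: "exp y *\<^sub>R f (exp y) = F y" for y
 proof -
  have "exp y *\<^sub>R f (exp y) = exp (of_real y) * (exp ((\<alpha> - 1/2) * of_real y) * exp (- of_real y / 2 - of_real t * exp (of_real y / 2)))"
   using of_real_powr_eq_exp[of "exp y" "\<alpha> - 1/2"] by (simp add: f_def scaleR_conv_of_real exp_of_real)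
  also have "... = F y" unfolding F_def exp_add[symmetric] by (simp add: algebra_simps)
  finally show ?thesis .
 qed
 define C where "C = exp (- 2 * \<alpha> * of_real (ln t))"
 have Fe: "F (- 2 * ln t + 2 * u) = C * h u" for u
 proof -
  have "complex_of_real t * exp (complex_of_real (- 2 * ln t + 2 * u) / 2) = of_real (t * exp (- ln t + u))"
  proof -
   have "complex_of_real (- 2 * ln t + 2 * u) / 2 = of_real (- ln t + u)" by simp
   then show ?thesis by (simp only: exp_of_real of_real_mult)
  qed
  also have "t * exp (- ln t + u) = exp u" using t by (simp only: exp_add exp_minus exp_ln) simp
  finally have 1: "complex_of_real t * exp (complex_of_real (- 2 * ln t + 2 * u) / 2) = of_real (exp u)" .
  have "F (- 2 * ln t + 2 * u) = exp (\<alpha> * of_real (- 2 * ln t + 2 * u)) * exp (- complex_of_real (exp u))"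
   unfolding F_def 1[symmetric] by simp
  also have "exp (\<alpha> * of_real (- 2 * ln t + 2 * u)) = C * exp (2 * \<alpha> * of_real u)"
   unfolding C_def exp_add[symmetric] by (simp add: algebra_simps)
  finally show ?thesis by (simp add: h_def)
 qed
 have Fi: "integrable lborel F"
 proof -
  have "integrable lborel (%u. F (- 2 * ln t + 2 * u))" unfolding Fe by (intro integrable_mult_right h)
  then show ?thesis by (subst (asm) lborel_integrable_real_affine_iff) simp_all
 qed
 have "integrable lborel (%y. exp y *\<^sub>R f (exp y))" unfolding fe by (rule Fi)
 note sub = exp_subst[OF this]
 show "integrable leb_pos f" by (rule sub(1))
 have "(LINT s|leb_pos. f s) = 2 * (C * Gamma (2 * \<alpha>))"
  unfolding sub(2) fe using lborel_integral_real_affine[of 2 F "- 2 * ln t"] unfolding Fe integral_mult_right_zero hG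
  by (simp add: scaleR_conv_of_real)
 moreover have "C * of_real t powr (2 * \<alpha>) = 1"
  using t unfolding C_def of_real_powr_eq_exp[OF t] exp_add[symmetric] by simp
 ultimately show "(LINT s|leb_pos. f s) * of_real t powr (2 * \<alpha>) = 2 * Gamma (2 * \<alpha>)"
  by (metis (no_types, lifting) mult.assoc mult.commute mult.right_neutral)
qed

text \<open>Scaling \<lambda> by \<open>s\<close> extracts the power \<open>s^(-3/2)\<close>.
  Against the weight \<open>s^(Re \<alpha> - 1/2)\<close> this is integrable at infinity, because
  \<open>Re \<alpha> < 1\<close>.\<close>

lemma LINT_kernel_scaling:
 fixes s D :: real
 assumes s: "s > 0"
 shows "integrable lborel (%x. exp (- x / 2) * exp x * (D / (s + exp x) / (s + exp x)))"
  "(LINT x|lborel. exp (- x / 2) * exp x * (D / (s + exp x) / (s + exp x))) =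
   D * exp (- (3/2) * ln s) * (LINT y|lborel. exp (y / 2) / (1 + exp y) / (1 + exp y))"
proof -
 define h where "h y = exp (y / 2) / (1 + exp y) / (1 + exp y)" for y :: real
 have h: "integrable lborel h"
 proof (rule integrable_le[OF integrable_exp_abs[of "1/2"]])
  have ne: "1 + exp y ~= 0" for y :: real by (smt (verit) exp_gt_zero)
  have "continuous_on UNIV h" unfolding h_def using ne by (intro continuous_intros) auto
  from borel_measurable_continuous_onI[OF this] show "h \<in> borel_measurable lborel" by simp
  show "AE y in lborel. norm (h y) <= norm (exp (- (1/2) * \<bar>y\<bar>))"
  proof (rule AE_I2)
   fix y :: real
   have p: "1 + exp y > 0" by (simp add: add_pos_pos)
   have "h y <= (exp (y / 2) / (1 + exp y)) / 1" unfolding h_def using p by (intro divide_left_mono) (auto simp: less_imp_le)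
   also have "... <= max 1 (1 / 1) * exp (- (1/2) * \<bar>y\<bar>)" using exp_frac_le[of 1 "1/2" "1/2" y] by simp
   finally show "norm (h y) <= norm (exp (- (1/2) * \<bar>y\<bar>))" using p by (simp add: h_def)
  qed
 qed simp
 have e: "exp (- x / 2) * exp x * (D / (s + exp x) / (s + exp x)) = (D * exp (- (3/2) * ln s)) * h (- ln s + 1 * x)" for x :: real
 proof -
  have d: "s + exp x = exp (ln s) * (1 + exp (- ln s + 1 * x))" using s unfolding distrib_left exp_add[symmetric] by simp
  have p: "1 + exp (- ln s + 1 * x) > 0" by (simp add: add_pos_pos)
  have "exp (- x / 2) * exp x = exp (- (3/2) * ln s) * exp (ln s) * exp (ln s) * exp ((- ln s + 1 * x) / 2)"
   unfolding exp_add[symmetric] by (simp add: field_simps)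
  moreover have "(a * E * E * b) * (D / (E * Q) / (E * Q)) = (D * a) * (b / Q / Q)" if "E ~= 0" "Q ~= 0" for a b E Q :: real
   using that by simp
  ultimately show ?thesis unfolding d h_def using p by (metis exp_not_eq_zero less_irrefl)
 qed
 show "integrable lborel (%x. exp (- x / 2) * exp x * (D / (s + exp x) / (s + exp x)))"
  unfolding e by (intro integrable_mult_right lborel_integrable_real_affine[OF h]) simp
 show "(LINT x|lborel. exp (- x / 2) * exp x * (D / (s + exp x) / (s + exp x))) =
   D * exp (- (3/2) * ln s) * (LINT y|lborel. exp (y / 2) / (1 + exp y) / (1 + exp y))"
  unfolding e integral_mult_right_zero using lborel_integral_real_affine[of 1 h "- ln s"] by (simp add: h_def)
qed

section \<open>The solution operator: bound and initial value\<close>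

context sect_ivp
begin

definition U :: "real => 'a \<Rightarrow>\<^sub>L 'a" where
 "U t = (of_real t powr (2 * \<alpha>) / (2 * Gamma (2 * \<alpha>))) *\<^sub>C W (\<alpha> - 1/2) (- 1) t"

lemma U_op_eq:
 assumes t: "t > 0"
 shows "U_op A \<omega> \<alpha> (of_real t) = U t"
proof -
 have "bochner leb_pos (U_integrand A \<omega> \<alpha> (of_real t)) = W (\<alpha> - 1/2) (- 1) t"
  unfolding W_def by (rule bochner_cong(1)) (simp add: v_def U_integrand_V[OF th1(1,2) pos_sector[OF t]])
 then show ?thesis by (simp add: U_op_def U_def)
qed

lemma Gamma_ne: "Gamma (2 * \<alpha>) ~= 0"
proof -
 have "2 * \<alpha> \<notin> \<int>\<^sub>\<le>\<^sub>0" using \<alpha> by (auto simp: nonpos_Ints_def complex_eq_iff)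
 then show ?thesis by (simp add: Gamma_eq_zero_iff)
qed

text \<open>The bound for the integral scales like \<open>t^(- 2 * Re \<alpha>)\<close> and is
  cancelled exactly by the prefactor; the rest is the fixed integral \<open>I\<close>.\<close>

lemma U_bounded: "\<exists>K. \<forall>t>0. norm (U t) <= K"
proof -
 define b where "b = \<alpha> - 1/2"
 obtain C where C: "C >= 0" "\<forall>t>0. \<forall>s>0. norm (of_real s powr b *\<^sub>C v (- 1) t s) <=
  C * exp (- (of_int (- 1) + 2 * Re b + 2) * (ln t + ln q)) * (exp (- (Re \<alpha> / 2) * \<bar>ln s + 2 * (ln t + ln q)\<bar>) / s)"
  using v_bound[of "- 1" b] by (auto simp: b_def)
 define I where "I = (LINT x::real|lborel. exp (- (Re \<alpha> / 2) * \<bar>x\<bar>))"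
 have c: "Re \<alpha> / 2 > 0" using \<alpha> by simp
 have "norm (U t) <= exp (- 2 * Re \<alpha> * ln q) / norm (2 * Gamma (2 * \<alpha>)) * C * I" if t: "t > 0" for t
 proof -
  let ?a = "- (of_int (- 1) + 2 * Re b + 2) * (ln t + ln q)"
  have "norm (W b (- 1) t) <= (LINT s|leb_pos. C * exp ?a * (exp (- (Re \<alpha> / 2) * \<bar>ln s + 2 * (ln t + ln q)\<bar>) / s))"
   unfolding W_def
  proof (rule bochner_norm_le)
   show "bochner_integrable leb_pos (%s. of_real s powr b *\<^sub>C v (- 1) t s)"
    by (rule powr_v_integrable[OF _ _ t]) (auto simp: b_def)
   show "integrable leb_pos (%s. C * exp ?a * (exp (- (Re \<alpha> / 2) * \<bar>ln s + 2 * (ln t + ln q)\<bar>) / s))"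
    by (intro integrable_mult_right integrable_exp_abs_ln_shift(1) c)
  qed (use C t in auto)
  also have "... = C * exp ?a * I" unfolding integral_mult_right_zero integrable_exp_abs_ln_shift(2)[OF c] I_def ..
  finally have w: "norm (W b (- 1) t) <= C * exp ?a * I" .
  have "norm (U t) = exp (2 * Re \<alpha> * ln t) / norm (2 * Gamma (2 * \<alpha>)) * norm (W b (- 1) t)"
   unfolding U_def norm_scaleC norm_divide norm_of_real_powr[OF t] b_def using t by (simp add: powr_def)
  also have "... <= exp (2 * Re \<alpha> * ln t) / norm (2 * Gamma (2 * \<alpha>)) * (C * exp ?a * I)" by (rule mult_left_mono[OF w]) simp
  also have "... = (exp (2 * Re \<alpha> * ln t) * exp ?a) / norm (2 * Gamma (2 * \<alpha>)) * C * I" by simp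
  also have "exp (2 * Re \<alpha> * ln t) * exp ?a = exp (- 2 * Re \<alpha> * ln q)"
   unfolding exp_add[symmetric] by (simp add: b_def algebra_simps)
  finally show ?thesis .
 qed
 then show ?thesis by blast
qed

text \<open>For \<zeta> = \<lambda> - s one has
  \<open>R(\<zeta>) x = x / \<zeta> + R(\<zeta>) A x / \<zeta>\<close>. The first term carries a
  scalar Cauchy kernel whose pole \<lambda> = s lies inside the contour and produces the subtracted
  multiple of \<open>x\<close>. The second gains a factor of decay, and its contribution is of size
  \<open>s^(-3/2)\<close> uniformly in \<open>t\<close>.\<close>

lemma v_on_dom:
 assumes x: "x \<in> dom A"
 shows "\<exists>C\<ge>0. \<forall>t>0. \<forall>s>0. norm (blinfun_apply (v (- 1) t s) x -
  exp (- of_real (ln s) / 2 - of_real t * exp (of_real (ln s) / 2)) *\<^sub>C x) <= C * exp (- (3/2) * ln s)"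
proof -
 let ?k = "%t s. exp (- of_real (ln s) / 2 - of_real t * exp (of_real (ln s) / 2))"
 obtain C where C: "C >= 0" "!!s x t. s > 0 ==> ray th1 t ==> cexp x t - of_real s \<in> resolvent_set A"
  "!!s x t. s > 0 ==> ray th1 t ==> norm (resolvent (cexp x t - of_real s) A) <= C / (s + exp x)"
  using R_line_bound[OF th1(1,2)] by metis
 define y where "y = app A x"
 define p where "p = sin (th1 / 2)"
 have p: "p > 0" unfolding p_def using th1 by (intro sin_gt_zero) auto
 define I where "I = (LINT y::real|lborel. exp (y / 2) / (1 + exp y) / (1 + exp y))"
 define D where "D = C * norm y / p"
 have D: "D >= 0" using C p by (simp add: D_def)
 have "norm (blinfun_apply (v (- 1) t s) x - ?k t s *\<^sub>C x) <= (1 / pi) * D * I * exp (- (3/2) * ln s)"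
  if t: "t > 0" and s: "s > 0" for t s
 proof -
  interpret I: inv_sect "B s" s by (rule inv_sect_shift[OF s])
  obtain \<psi> where \<psi>: "th1 < \<psi>" "\<psi> < pi" "0 <= \<psi>" "!!j. j >= - 1 ==> decays \<psi> (pexp j (of_real t))"
   using I.pexp_adm[OF angle_less[OF th1(1,2) s] th1(2) pos_sector[OF t]] by blast
  define f where "f = pexp (- 1) (of_real t)"
  have df: "decays \<psi> f" unfolding f_def by (rule \<psi>(4)) simp
  define S where "S \<zeta> = resolvent (\<zeta> - complex_of_real s) A" for \<zeta>
  define k where "k \<zeta> = (1 / (\<zeta> - complex_of_real s)) *\<^sub>C x" for \<zeta>
  define E where "E \<zeta> = (1 / (\<zeta> - complex_of_real s)) *\<^sub>C blinfun_apply (S \<zeta>) y" for \<zeta>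
  have out: "cexp z r \<notin> sector th1" if "ray th1 r" for z r
   by (rule exp_notin_sector) (use that th1 in auto)
  have low: "p * (s + exp z) <= norm (cexp z r - of_real s)" if "ray th1 r" for z r
   using norm_diff_of_real_outside_sector[OF th1(3,2) out[OF that, of z] s] by (simp add: p_def)
  have lpos: "0 < p * (s + exp z)" for z using p s by (simp add: add_pos_pos)
  have ne: "cexp z r - of_real s ~= 0" if "ray th1 r" for z r
   using low[OF that, of z] lpos[of z] by auto
  have split: "blinfun_apply (S (cexp z r)) x = k (cexp z r) + E (cexp z r)" if r: "ray th1 r" for z r
  proof -
   define \<zeta> where "\<zeta> = cexp z r - of_real s"
   have "blinfun_apply (resolvent \<zeta> A) (\<zeta> *\<^sub>C x - y) = x"
    unfolding y_def by (rule resolvent(3)[OF _ x]) (unfold \<zeta>_def, rule C(2)[OF s r])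
   then have "\<zeta> *\<^sub>C blinfun_apply (resolvent \<zeta> A) x = x + blinfun_apply (resolvent \<zeta> A) y"
    using cblinfunsD[OF resolvent_cblinfuns[OF lin C(2)[OF s r, of z]]] by (simp add: blinfun.diff_right \<zeta>_def algebra_simps)
   then have "(1 / \<zeta>) *\<^sub>C \<zeta> *\<^sub>C blinfun_apply (resolvent \<zeta> A) x = k (cexp z r) + E (cexp z r)"
    by (simp add: k_def E_def S_def \<zeta>_def scaleC_add_right)
   then show ?thesis using ne[OF r, of z] by (simp add: scaleC_scaleC S_def \<zeta>_def)
  qed
  have fcont: "continuous_on UNIV (%z. f (Complex z r))" for r unfolding f_def by (rule pexp_line_continuous)
  have Scont: "continuous_on UNIV (%z. S (cexp z r))" if "ray th1 r" for r
   unfolding S_def by (rule R_line_cont[OF th1(1,2) s that])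
  have icont: "continuous_on UNIV (%z. 1 / (cexp z r - complex_of_real s))" if "ray th1 r" for r
   using ne[OF that] by (intro continuous_intros) auto
  have Econt: "continuous_on UNIV (%z. E (cexp z r))" if "ray th1 r" for r
   unfolding E_def by (intro bounded_bilinear.continuous_on[OF bounded_bilinear_scaleC] icont[OF that] blinfun.continuous_on Scont[OF that] continuous_intros)
  have fb: "norm (f (Complex z r)) <= exp (- z / 2)" if "ray th1 r" for z r
  proof -
   have "norm (f (Complex z r)) <= exp (of_int (- 1) * z / 2 - sect_mod th1 (of_real t) * exp (z / 2))"
    unfolding f_def using norm_pexp_le[of "Complex z r" th1 "of_real t" "- 1"] that th1 t by (auto simp: Arg_of_real)
   also have "... <= exp (- z / 2)" using sect_mod_sector_pos(1)[OF th1(1,2) pos_sector[OF t]] by simp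
   finally show ?thesis .
  qed
  have Eb: "norm (E (cexp z r)) <= D / (s + exp z) / (s + exp z)" if "ray th1 r" for z r
  proof -
   have 1: "norm (1 / (cexp z r - complex_of_real s)) <= 1 / (p * (s + exp z))"
    using low[OF that, of z] lpos[of z] by (simp add: norm_divide frac_le)
   have "norm (blinfun_apply (S (cexp z r)) y) <= norm (S (cexp z r)) * norm y" by (rule norm_blinfun)
   also have "... <= C / (s + exp z) * norm y" unfolding S_def by (intro mult_right_mono C(3)[OF s that]) simp
   finally have "norm (E (cexp z r)) <= 1 / (p * (s + exp z)) * (C / (s + exp z) * norm y)"
    unfolding E_def norm_scaleC using 1 lpos[of z] by (intro mult_mono) auto
   also have "... = D / (s + exp z) / (s + exp z)" by (simp add: D_def field_simps)
   finally show ?thesis .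
  qed
  note kern = LINT_kernel_scaling[OF s, of D]
  note Ebd = fc_bound[where R = E and f = f and th = th1 and a = "%z. exp (- z / 2)" and b = "%z. D / (s + exp z) / (s + exp z)", OF Econt fcont Eb fb kern(1)]
  have Ei: "bochner_integrable lborel (fc_integrand E th1 f)" by (rule Ebd(1))
  have En: "norm (fc E th1 f) <= (1 / pi) * D * I * exp (- (3/2) * ln s)"
   using Ebd(2) unfolding kern(2) I_def by (simp add: mult_ac)
  have "blinfun_apply (v (- 1) t s) x - ?k t s *\<^sub>C x = fc E th1 f"
  proof (rule cfunctional_eqI)
   fix m :: "'a => complex" assume m: "cfunctional m"
   define m' where "m' T = m (blinfun_apply T x)" for T :: "'a \<Rightarrow>\<^sub>L 'a"
   have m': "cfunctional m'"
    unfolding cfunctional_def m'_def using cfunctionalD(2)[OF m]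
    by (auto simp: scaleC_blinfun.rep_eq intro!: bounded_linear_compose[OF cfunctionalD(1)[OF m]] blinfun.bounded_linear_left)
   define \<kappa> where "\<kappa> = 1 / (2 * complex_of_real pi * \<i>)"
   define K where "K r z = f (Complex z r) * cexp z r / (cexp z r - exp (complex_of_real (ln s)))" for r z
   have fv: "f (of_real (ln s)) = ?k t s" by (simp add: f_def pexp_def)
   have es: "exp (complex_of_real (ln s)) = of_real s" using s by (simp add: exp_of_real)
   have Ki: "integrable lborel (K r)" if "ray th1 r" for r
    unfolding K_def
   proof (rule cauchy_kernel_integrable[OF fcont])
    show "norm (f (Complex z r)) <= 1 * exp (- z / 2)" for z using fb[OF that] by simp
    show "cexp z r ~= exp (complex_of_real (ln s))" for z unfolding es using ne[OF that, of z] by simp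
   qed
   have Kc: "(LINT z|lborel. K (- th1) z) - (LINT z|lborel. K th1 z) = 2 * pi * \<i> * f (of_real (ln s))"
    unfolding K_def
   proof (rule cauchy_exp[where a = "- \<psi>" and b = \<psi> and C = "\<bar>c\<bar>" for c])
    have "{w. - \<psi> < Im w \<and> Im w < \<psi>} = {w. \<bar>Im w\<bar> < \<psi>}" by auto
    then show "f holomorphic_on {w. - \<psi> < Im w \<and> Im w < \<psi>}" using df by (simp add: decays_def)
    show "\<psi> - - \<psi> <= 2 * pi" "- \<psi> < - th1" "- th1 < Im (complex_of_real (ln s))" "Im (complex_of_real (ln s)) < th1" "th1 < \<psi>"
     using \<psi> th1 by auto
    show "norm (f w) <= \<bar>1\<bar> * exp (- Re w / 2)" if "- th1 <= Im w" "Im w <= th1" for w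
    proof -
     have "norm (f w) <= exp (of_int (- 1) * Re w / 2 - sect_mod th1 (of_real t) * exp (Re w / 2))"
      unfolding f_def using norm_pexp_le[of w th1 "of_real t" "- 1"] that th1 t by (auto simp: Arg_of_real)
     also have "... <= exp (- Re w / 2)" using sect_mod_sector_pos(1)[OF th1(1,2) pos_sector[OF t]] by simp
     finally show ?thesis by simp
    qed
   qed
   have pt: "m' (fc_integrand S th1 f z) = \<kappa> * (K (- th1) z - K th1 z) * m x + m (fc_integrand E th1 f z)" for z
   proof -
    have "blinfun_apply (fc_integrand S th1 f z) x = fc_integrand (%\<zeta>. blinfun_apply (S \<zeta>) x) th1 f z"
     by (simp add: fc_integrand_def scaleC_blinfun.rep_eq blinfun.diff_left)
    also have "... = fc_integrand (%\<zeta>. k \<zeta> + E \<zeta>) th1 f z" by (simp add: fc_integrand_def split)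
    finally show ?thesis
     by (simp add: m'_def fc_integrand_def cfunctionalD(2,3,4)[OF m] scaleC_add_right k_def K_def es \<kappa>_def algebra_simps)
   qed
   have Si: "bochner_integrable lborel (fc_integrand S th1 f)"
    using I.fc_integrable[OF df angle_less[OF th1(1,2) s] \<psi>(1) th1(2)] unfolding resolvent_op_plus S_def[abs_def] .
   have "m (blinfun_apply (v (- 1) t s) x) = m' (bochner lborel (fc_integrand S th1 f))"
    by (simp add: m'_def v_def V_def fc_def S_def[abs_def] f_def)
   also have "... = (LINT z|lborel. \<kappa> * (K (- th1) z - K th1 z) * m x + m (fc_integrand E th1 f z))"
    unfolding bochner_functional(2)[OF Si m'] pt ..
   also have "... = (LINT z|lborel. \<kappa> * (K (- th1) z - K th1 z) * m x) + (LINT z|lborel. m (fc_integrand E th1 f z))"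
    by (intro LINT_add integrable_mult_left integrable_mult_right integrable_sub Ki bochner_functional(1)[OF Ei m]) auto
   also have "(LINT z|lborel. m (fc_integrand E th1 f z)) = m (fc E th1 f)" unfolding fc_def bochner_functional(2)[OF Ei m] ..
   also have "(LINT z|lborel. \<kappa> * (K (- th1) z - K th1 z) * m x) = f (of_real (ln s)) * m x"
    unfolding integral_mult_left_zero integral_mult_right_zero
    by (subst LINT_diff[OF Ki Ki]) (auto simp: Kc \<kappa>_def)
   finally show "m (blinfun_apply (v (- 1) t s) x - ?k t s *\<^sub>C x) = m (fc E th1 f)"
    using fv by (simp add: cfunctionalD(2,4)[OF m])
  qed
  then show ?thesis using En by simp
 qed
 moreover have "(1 / pi) * D * I >= 0" unfolding I_def using D by (intro mult_nonneg_nonneg LINT_nonneg) auto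
 ultimately show ?thesis by blast
qed

text \<open>The scalar part integrates to 1 after normalisation, so \<open>U t x - x\<close> is the
  normalised integral of the difference \<open>?D\<close>. For \<open>s <= 1\<close> the two parts
  are bounded separately, for \<open>s > 1\<close> by \<open>v_on_dom\<close>; the total is of order
  \<open>t^(Re \<alpha>)\<close>.\<close>

lemma U_initial_dom:
 assumes x: "x \<in> dom A"
 shows "((%t. blinfun_apply (U t) x) \<longlongrightarrow> x) (at_right 0)"
proof -
 define kk where "kk t s = exp (- complex_of_real (ln s) / 2 - complex_of_real t * exp (complex_of_real (ln s) / 2))" for t s :: real
 let ?D = "%t s. blinfun_apply (v (- 1) t s) x - kk t s *\<^sub>C x" and ?G = "2 * Gamma (2 * \<alpha>)"
  and ?K = "%t s. of_real s powr (\<alpha> - 1/2) * kk t s"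
 obtain C where C: "C >= 0" "!!t s. t > 0 ==> s > 0 ==> norm (?D t s) <= C * exp (- (3/2) * ln s)"
  using v_on_dom[OF x] unfolding kk_def by blast
 define p where "p = 1/2 + Re \<alpha> / 2"
 have p: "0 < p" "p <= 1" "of_int (- 1) / 2 + p > 0" using \<alpha> by (auto simp: p_def)
 have "\<exists>C\<ge>0. \<forall>z\<in>half_sector th1. \<forall>s>0.
  norm (V th1 (- 1) z s) <= C * exp (- of_int (- 1) * ln (sect_mod th1 z) - p * (ln s + 2 * ln (sect_mod th1 z)))"
  by (rule V_bound_power[OF th1(1,2) p(1,2) _ p(3)]) simp
 then obtain M where M: "M >= 0" "\<forall>z\<in>half_sector th1. \<forall>s>0.
  norm (V th1 (- 1) z s) <= M * exp (- of_int (- 1) * ln (sect_mod th1 z) - p * (ln s + 2 * ln (sect_mod th1 z)))" by blast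
 \<comment> \<open>The rates available at the two ends: \<open>Re \<alpha> / 2\<close> towards
   \<open>s = 0\<close> and \<open>1 - Re \<alpha>\<close> towards infinity.\<close>
 define c where "c = min (Re \<alpha> / 2) (1 - Re \<alpha>)"
 have c: "c > 0" "c <= Re \<alpha> / 2" "c <= 1 - Re \<alpha>"
  unfolding c_def by (use \<alpha> in simp) (rule min.cobounded1, rule min.cobounded2)
 define N where "N = C + (M + 1) * norm x"
 define I where "I = (LINT y::real|lborel. exp (- c * \<bar>y\<bar>))"
 \<comment> \<open>Of order \<open>t^(- Re \<alpha>)\<close>, so half of the prefactor
   \<open>t^(2 * Re \<alpha>)\<close> survives. It is at least 1 for \<open>t <= 1\<close> and
   therefore also absorbs the bounds that do not involve \<open>t\<close>.\<close>
 define r where "r t = exp (- Re \<alpha> * (ln t + ln q))" for t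
 have main: "norm (of_real s powr (\<alpha> - 1/2) *\<^sub>C (?D t s)) <= r t * N * (exp (- c * \<bar>ln s + 0\<bar>) / s)"
  if t: "0 < t" "t <= 1" and s: "s > 0" for t s
 proof -
  have lnq: "ln t + ln q <= 0" using t q by (simp add: add_nonpos_nonpos)
  have "Re \<alpha> * (ln t + ln q) <= 0" using \<alpha> lnq by (intro mult_nonneg_nonpos) auto
  then have r1: "1 <= r t" by (simp add: r_def)
  have nn: "N >= 0" "C <= N" "(M + 1) * norm x <= N" using C(1) M(1) by (auto simp: N_def)
  have es: "exp (ln s) = s" using s by simp
  have inv: "exp u / s = exp (u - ln s)" for u using s by (simp add: exp_diff)
  have pw: "norm (complex_of_real s powr (\<alpha> - 1/2)) = exp ((Re \<alpha> - 1/2) * ln s)" using s by (simp add: norm_of_real_powr powr_def)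
  show ?thesis
  proof (cases "ln s <= 0")
   case True
   have "norm (v (- 1) t s) <= M * exp (- of_int (- 1) * (ln t + ln q) - p * (ln s + 2 * (ln t + ln q)))"
    unfolding v_def using M(2) pos_sector[OF t(1)] s by (simp add: ln_sect_mod[OF t(1), symmetric])
   also have "... = r t * (M * exp (- p * ln s))"
    unfolding r_def mult.left_commute[of _ M] exp_add[symmetric] by (simp add: p_def algebra_simps)
   finally have v: "norm (v (- 1) t s) <= r t * (M * exp (- p * ln s))" .
   have "norm (kk t s) <= exp (- ln s / 2)" unfolding kk_def using t by (simp add: Re_exp)
   also have "... <= exp (- p * ln s)"
   proof -
    have "(p - 1/2) * ln s <= 0" using True \<alpha> by (intro mult_nonneg_nonpos) (auto simp: p_def)
    then show ?thesis by (simp add: algebra_simps)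
   qed
   also have "... <= r t * exp (- p * ln s)" using r1 by simp
   finally have k: "norm (kk t s) <= r t * exp (- p * ln s)" .
   have "norm (?D t s) <= norm (v (- 1) t s) * norm x + norm (kk t s) * norm x"
    by (rule order_trans[OF norm_triangle_ineq4 add_mono[OF norm_blinfun]]) (simp add: norm_scaleC)
   also have "... <= r t * (M * exp (- p * ln s)) * norm x + r t * exp (- p * ln s) * norm x"
    by (intro add_mono mult_right_mono v k) auto
   also have "... = r t * ((M + 1) * norm x) * exp (- p * ln s)" by (simp add: algebra_simps)
   also have "... <= r t * N * exp (- p * ln s)" using nn r1 by (intro mult_right_mono mult_left_mono) auto
   finally have "norm (of_real s powr (\<alpha> - 1/2) *\<^sub>C (?D t s)) <= exp ((Re \<alpha> - 1/2) * ln s) * (r t * N * exp (- p * ln s))"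
    unfolding norm_scaleC pw by (rule mult_left_mono) simp
   also have "... = r t * N * exp ((Re \<alpha> - 1/2) * ln s + - p * ln s)" by (simp only: exp_add mult_ac)
   also have "(Re \<alpha> - 1/2) * ln s + - p * ln s = (Re \<alpha> / 2) * ln s - ln s" by (simp add: p_def algebra_simps)
   also have "r t * N * exp ((Re \<alpha> / 2) * ln s - ln s) <= r t * N * exp (c * ln s - ln s)"
   proof -
    have "(Re \<alpha> / 2) * ln s <= c * ln s" using c True by (intro mult_right_mono_neg) auto
    then show ?thesis using nn r1 by (intro mult_left_mono) auto
   qed
   finally show ?thesis using True by (simp add: inv)
  next
   case False
   have "norm (of_real s powr (\<alpha> - 1/2) *\<^sub>C (?D t s)) <= exp ((Re \<alpha> - 1/2) * ln s) * (C * exp (- (3/2) * ln s))"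
    unfolding norm_scaleC pw by (rule mult_left_mono[OF C(2)[OF t(1) s]]) simp
   also have "... = C * exp (- (1 - Re \<alpha>) * ln s - ln s)"
    unfolding mult.left_commute[of _ C] exp_add[symmetric] by (simp add: algebra_simps)
   also have "... <= (r t * N) * exp (- c * ln s - ln s)"
   proof (rule mult_mono)
    have "1 * C <= r t * N" using r1 nn C(1) by (intro mult_mono) auto
    then show "C <= r t * N" by simp
    have "c * ln s <= (1 - Re \<alpha>) * ln s" using c False by (intro mult_right_mono) auto
    then show "exp (- (1 - Re \<alpha>) * ln s - ln s) <= exp (- c * ln s - ln s)"
     unfolding exp_le_cancel_iff mult_minus_left by (intro diff_right_mono le_imp_neg_le)
   qed (use nn r1 in auto)
   finally show ?thesis using False by (simp add: inv)
  qed
 qed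
 have est: "norm (blinfun_apply (U t) x - x) <= norm (1 / ?G) * exp (- Re \<alpha> * ln q) * N * I * exp (Re \<alpha> * ln t)" if t: "0 < t" "t <= 1" for t
 proof -
  define \<gamma> where "\<gamma> = complex_of_real t powr (2 * \<alpha>) / ?G"
  have sp: "space leb_pos = {0::real<..}" by simp
  have i1: "bochner_integrable leb_pos (%s. blinfun_apply (of_real s powr (\<alpha> - 1/2) *\<^sub>C v (- 1) t s) x)"
   "bochner leb_pos (%s. blinfun_apply (of_real s powr (\<alpha> - 1/2) *\<^sub>C v (- 1) t s) x) = blinfun_apply (W (\<alpha> - 1/2) (- 1) t) x"
   unfolding W_def using bochner_bounded_linear[OF blinfun.bounded_linear_left powr_v_integrable[OF _ _ t(1), of "- 1" "\<alpha> - 1/2"], of x] by simp_all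
  note G = LINT_powr_exp_sqrt[OF \<alpha>(1) t(1), folded kk_def]
  have bl: "bounded_linear (%c. c *\<^sub>C x)" by (rule bounded_linear_scaleC_left)
  have Gb: "bochner_integrable leb_pos (%s. ?K t s)"
   "bochner leb_pos (%s. ?K t s) = (LINT s|leb_pos. ?K t s)"
   using G(1) bochner_eqI[of "leb_pos" "%s. ?K t s"]
   unfolding bochner_integrable_def has_bochner_iff_has_bochner_integral by (auto simp: has_bochner_integral_iff)
  note i2 = bochner_bounded_linear[OF bl Gb(1), unfolded Gb(2)]
  define d where "d s = of_real s powr (\<alpha> - 1/2) *\<^sub>C (?D t s)" for s
  have de: "d s = blinfun_apply (of_real s powr (\<alpha> - 1/2) *\<^sub>C v (- 1) t s) x - (?K t s) *\<^sub>C x" for s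
   by (simp add: d_def scaleC_diff_right scaleC_scaleC scaleC_blinfun.rep_eq)
  have dc: "continuous_on {0<..} d"
  proof -
   have "continuous_on {0<..} (kk t)" unfolding kk_def by (intro continuous_intros) auto
   then show ?thesis
    unfolding d_def v_def
    by (intro bounded_bilinear.continuous_on[OF bounded_bilinear_scaleC] continuous_on_of_real_powr continuous_on_diff
      blinfun.continuous_on V_continuous_on th1 pos_sector t continuous_on_const) auto
  qed
  have gi: "integrable leb_pos (%s. r t * N * (exp (- c * \<bar>ln s + 0\<bar>) / s))"
   by (intro integrable_mult_right integrable_exp_abs_ln_shift(1) c)
  have db: "norm (d s) <= r t * N * (exp (- c * \<bar>ln s + 0\<bar>) / s)" if "s \<in> {0<..}" for s
   unfolding d_def using that by (intro main t) auto
  have di: "bochner_integrable leb_pos d"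
   by (rule bochner_integrable_continuous_lebesgue_on[OF dc _ gi db]) auto
  have "bochner leb_pos d = blinfun_apply (W (\<alpha> - 1/2) (- 1) t) x - (LINT s|leb_pos. ?K t s) *\<^sub>C x"
   using bochner_diff[OF i1(1) i2(1)] di i1(2) i2(2) unfolding de[abs_def] by simp
  then have "\<gamma> *\<^sub>C bochner leb_pos d = blinfun_apply (U t) x - (\<gamma> * (LINT s|leb_pos. ?K t s)) *\<^sub>C x"
   by (simp add: scaleC_diff_right scaleC_scaleC U_def \<gamma>_def scaleC_blinfun.rep_eq)
  also have "\<gamma> * (LINT s|leb_pos. ?K t s) = 1"
   unfolding \<gamma>_def using G(2) Gamma_ne by (simp add: mult.commute)
  finally have "norm (blinfun_apply (U t) x - x) = norm \<gamma> * norm (bochner leb_pos d)"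
   by (metis norm_scaleC scaleC_simps(3))
  also have "... <= norm \<gamma> * (LINT s|leb_pos. r t * N * (exp (- c * \<bar>ln s + 0\<bar>) / s))"
   by (intro mult_left_mono bochner_norm_le[OF di gi]) (use db sp in auto)
  also have "... = norm \<gamma> * (r t * N * I)" unfolding integral_mult_right_zero integrable_exp_abs_ln_shift(2)[OF c(1)] I_def ..
  also have "norm \<gamma> = norm (1 / ?G) * exp (2 * Re \<alpha> * ln t)"
   unfolding \<gamma>_def using t by (simp add: norm_divide norm_of_real_powr powr_def)
  also have "norm (1 / ?G) * exp (2 * Re \<alpha> * ln t) * (r t * N * I) =
    norm (1 / ?G) * N * I * (exp (2 * Re \<alpha> * ln t) * r t)" by (simp only: mult_ac)
  also have "exp (2 * Re \<alpha> * ln t) * r t = exp (- Re \<alpha> * ln q) * exp (Re \<alpha> * ln t)"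
   unfolding r_def exp_add[symmetric] by (simp add: algebra_simps)
  finally show ?thesis by (simp only: mult_ac)
 qed
 have ev: "\<forall>\<^sub>F t in at_right (0::real). 0 < t \<and> t <= 1"
  by (rule eventually_at_rightI[of 0 1]) auto
 have "filterlim (%t::real. Re \<alpha> * ln t) at_bot (at_right 0)"
  by (rule filterlim_tendsto_pos_mult_at_bot[OF tendsto_const \<alpha>(1) ln_at_0])
 then have "((%t::real. norm (1 / ?G) * exp (- Re \<alpha> * ln q) * N * I * exp (Re \<alpha> * ln t)) \<longlongrightarrow> 0) (at_right 0)"
  by (intro tendsto_mult_right_zero filterlim_compose[OF exp_at_bot])
 then have "((%t. blinfun_apply (U t) x - x) \<longlongrightarrow> 0) (at_right 0)"
  by (rule Lim_null_comparison[rotated]) (rule eventually_mono[OF ev], rule est, auto)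
 then show ?thesis by (rule Lim_null[THEN iffD2])
qed

lemma U_initial:
 assumes dense: "closure (dom A) = UNIV"
 shows "((%t. blinfun_apply (U t) x) \<longlongrightarrow> x) (at_right 0)"
proof (rule tendstoI)
 fix e :: real assume e: "e > 0"
 obtain K where K: "!!t. t > 0 ==> norm (U t) <= K" using U_bounded by blast
 have K0: "K >= 0" using order_trans[OF norm_ge_zero K[of 1]] by simp
 \<comment> \<open>Makes \<open>K * d + d\<close> equal to \<open>e / 2\<close>, the joint
   contribution of \<open>U t (x - y)\<close> and \<open>y - x\<close>.\<close>
 define d where "d = e / (2 * (K + 1))"
 have d: "d > 0" using e K0 by (simp add: d_def)
 have "x \<in> closure (dom A)" using dense by simp
 then obtain y where y: "y \<in> dom A" "dist y x < d" using d closure_approachable by blast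
 have "\<forall>\<^sub>F t in at_right 0. dist (blinfun_apply (U t) y) y < e / 2" by (rule tendstoD[OF U_initial_dom[OF y(1)]]) (use e in simp)
 moreover have "\<forall>\<^sub>F t in at_right (0::real). 0 < t" by (simp add: eventually_at_right_less)
 ultimately show "\<forall>\<^sub>F t in at_right 0. dist (blinfun_apply (U t) x) x < e"
 proof eventually_elim
  case (elim t)
  have "norm (blinfun_apply (U t) x - x) = norm (blinfun_apply (U t) (x - y) + (blinfun_apply (U t) y - y) + (y - x))"
   by (simp add: blinfun.diff_right)
  also have "... <= norm (blinfun_apply (U t) (x - y)) + norm (blinfun_apply (U t) y - y) + norm (y - x)"
   by (intro order_trans[OF norm_triangle_ineq add_mono] norm_triangle_ineq order_refl)
  also have "... < (K * d + e / 2) + d"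
  proof -
   have "norm (blinfun_apply (U t) (x - y)) <= norm (U t) * norm (x - y)" by (rule norm_blinfun)
   also have "... <= K * d" using y K[OF elim(2)] K0 by (intro mult_mono) (auto simp: dist_norm norm_minus_commute)
   finally show ?thesis using elim(1) y by (simp add: dist_norm)
  qed
  also have "(K * d + e / 2) + d = (K + 1) * d + e / 2" by (simp add: distrib_right)
  also have "(K + 1) * d = e / 2"
  proof -
   have "k * (e / (2 * k)) = e / 2" if "k ~= 0" for k :: real using that by simp
   from this[of "K + 1"] show ?thesis using K0 by (simp only: d_def)
  qed
  also have "e / 2 + e / 2 = e" by simp
  finally show ?case by (simp add: dist_norm)
 qed
qed

end

section \<open>The differential equation\<close>

lemma bound_of_compact_support:
 fixes f :: "real => 'b::real_normed_vector"
 assumes f: "continuous_on {0<..} f" and a: "0 < a" and z: "!!t. t > 0 ==> t \<notin> {a..b} ==> f t = 0"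
 obtains C where "!!s. s > 0 ==> norm (f s) <= C * (exp (- 1 * \<bar>ln s + 0\<bar>) / s)"
proof -
 have "continuous_on {a..b} (%s. norm (f s) * s * exp \<bar>ln s\<bar>)"
  using a by (intro continuous_intros continuous_on_subset[OF f]) auto
 then have "bounded ((%s. norm (f s) * s * exp \<bar>ln s\<bar>) ` {a..b})"
  by (intro compact_imp_bounded compact_continuous_image) auto
 then obtain M where M: "!!s. s \<in> {a..b} ==> norm (norm (f s) * s * exp \<bar>ln s\<bar>) <= M" unfolding bounded_iff by blast
 have "norm (f s) <= \<bar>M\<bar> * (exp (- 1 * \<bar>ln s + 0\<bar>) / s)" if s: "s > 0" for s
 proof (cases "s \<in> {a..b}")
  case True
  then have "norm (f s) * s * exp \<bar>ln s\<bar> <= \<bar>M\<bar>" using M[OF True] unfolding real_norm_def by linarith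
  then show ?thesis using s by (simp add: exp_minus field_simps)
 next
  case False
  then show ?thesis using z[OF s] s by simp
 qed
 then show ?thesis using that by blast
qed

text \<open>Two integrations by parts against a test function, done at once through a primitive.
  Compact support of the test function removes all questions of integrability and the boundary
  terms.\<close>

lemma weak_of_classical:
 fixes u u1 u2 f :: "real => 'a::complex_banach"
 assumes \<phi>: "test_function \<phi>"
  and u: "!!t. t > 0 ==> (u has_vector_derivative u1 t) (at t)" "!!t. t > 0 ==> (u1 has_vector_derivative u2 t) (at t)"
  and ode: "!!t. t > 0 ==> u2 t + ((1 - 2 * \<alpha>) / of_real t) *\<^sub>C u1 t = f t" and f: "continuous_on {0<..} f"
 shows "bochner leb_pos
     (%t. vderiv (vderiv \<phi>) t *\<^sub>C u t - vderiv (%t. (1 - 2 * \<alpha>) / complex_of_real t * \<phi> t) t *\<^sub>C u t) =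
    bochner leb_pos (%t. \<phi> t *\<^sub>C f t)"
proof -
 obtain K where K: "compact K" "K \<subseteq> {0<..}" "!!t. t \<notin> K ==> \<phi> t = 0" using \<phi> unfolding test_function_def by blast
 have "\<exists>a b. 0 < a \<and> K \<subseteq> {a..b}"
 proof (cases "K = {}")
  case False
  obtain a where a: "a \<in> K" "!!t. t \<in> K ==> a <= t" using compact_attains_inf[OF K(1) False] by blast
  obtain b where b: "b \<in> K" "!!t. t \<in> K ==> t <= b" using compact_attains_sup[OF K(1) False] by blast
  show ?thesis using a b K(2) by (intro exI[of _ a] exI[of _ b]) auto
 qed (auto intro: exI[of _ 1])
 then obtain a b where a: "0 < a" and Kab: "K \<subseteq> {a..b}" by blast
 have diff: "((vderiv ^^ n) \<phi>) differentiable (at t)" for n t using \<phi> by (simp add: test_function_def)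
 define p1 where "p1 = vderiv \<phi>"
 define p2 where "p2 = vderiv p1"
 have d: "(\<phi> has_vector_derivative p1 t) (at t)" "(p1 has_vector_derivative p2 t) (at t)" "isCont p2 t" for t
  using diff[of 0 t] diff[of 1 t] diff[of 2 t]
  by (simp_all add: p1_def p2_def vderiv_def[symmetric] vector_derivative_works numeral_2_eq_2 has_vector_derivative_continuous)
 have \<phi>0: "\<phi> t = 0" if "t \<notin> {a..b}" for t using K(3) Kab that by blast
 have van: "(g has_vector_derivative g' t) (at t) ==> (!!t. t \<notin> {a..b} ==> g t = 0) ==> t \<notin> {a..b} ==> g' t = 0"
  for g g' :: "real => complex" and t
 proof -
  assume g: "(g has_vector_derivative g' t) (at t)" "!!t. t \<notin> {a..b} ==> g t = 0" and t: "t \<notin> {a..b}"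
  have "((%_. 0) has_vector_derivative g' t) (at t)"
   by (rule has_vector_derivative_transform_within_open[OF g(1), of "- {a..b}"]) (use g(2) t in auto)
  then show "g' t = 0" using vector_derivative_unique_at has_vector_derivative_const by blast
 qed
 have p10: "p1 t = 0" if "t \<notin> {a..b}" for t by (rule van[where g = \<phi> and g' = p1, OF d(1) \<phi>0 that])
 have p20: "p2 t = 0" if "t \<notin> {a..b}" for t by (rule van[where g = p1 and g' = p2, OF d(2) p10 that])
 define c where "c = 1 - 2 * \<alpha>"
 define q where "q t = c * p1 t / of_real t - c * \<phi> t / of_real t ^ 2" for t
 have inv: "((%t. c / complex_of_real t) has_vector_derivative - c / of_real t ^ 2) (at t)" if "t > 0" for t
 proof -
  have "((%z. c / z) has_field_derivative - c / of_real t ^ 2) (at (complex_of_real t))"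
   using that by (auto intro!: derivative_eq_intros simp: power2_eq_square)
  from has_vector_derivative_real_field[OF this] show ?thesis .
 qed
 have dq: "((%t. c / complex_of_real t * \<phi> t) has_vector_derivative q t) (at t)" if "t > 0" for t
  by (rule has_vector_derivative_eq_rhs[OF has_vector_derivative_mult[OF inv[OF that] d(1)]]) (simp add: q_def)
 have cont: "continuous_on {0<..} g" if "!!t. t > 0 ==> (g has_vector_derivative g' t) (at t)" for g g' :: "real => 'b::real_normed_vector"
  using that by (intro continuous_at_imp_continuous_on ballI has_vector_derivative_continuous) auto
 have uc: "continuous_on {0<..} u" by (rule cont[OF u(1)])
 have \<phi>c: "continuous_on {0<..} \<phi>" and p1c: "continuous_on {0<..} p1" by (rule cont[OF d(1)], rule cont[OF d(2)])
 have p2c: "continuous_on {0<..} p2" using d(3) by (intro continuous_at_imp_continuous_on) auto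
 have qc: "continuous_on {0<..} q" unfolding q_def by (intro continuous_intros \<phi>c p1c) auto
 define X where "X t = p2 t *\<^sub>C u t - q t *\<^sub>C u t" for t
 define Y where "Y t = \<phi> t *\<^sub>C f t" for t
 have Xc: "continuous_on {0<..} X" and Yc: "continuous_on {0<..} Y"
  unfolding X_def Y_def by (intro continuous_on_diff bounded_bilinear.continuous_on[OF bounded_bilinear_scaleC] uc p2c qc \<phi>c f)+
 have X0: "X t = 0" and Y0: "Y t = 0" if "t \<notin> {a..b}" for t
  using \<phi>0[OF that] p10[OF that] p20[OF that] by (simp_all add: X_def Y_def q_def)
 have int: "bochner_integrable leb_pos g" if g: "continuous_on {0<..} g" "!!t. t \<notin> {a..b} ==> g t = 0" for g :: "real => 'a"
 proof -
  obtain C where C: "!!s. s > 0 ==> norm (g s) <= C * (exp (- 1 * \<bar>ln s + 0\<bar>) / s)"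
   using bound_of_compact_support[OF g(1) a g(2)] by blast
  show ?thesis
   by (rule bochner_integrable_continuous_lebesgue_on[OF g(1) _ integrable_mult_right[OF integrable_exp_abs_ln_shift(1)[OF zero_less_one, of 0], of C]])
    (use C in auto)
 qed
 have Xi: "bochner_integrable leb_pos X" and Yi: "bochner_integrable leb_pos Y"
  by (rule int[OF Xc X0] int[OF Yc Y0]; assumption)+
 have sp: "space leb_pos = {0::real<..}" by simp
 have XE: "bochner leb_pos (%t. vderiv (vderiv \<phi>) t *\<^sub>C u t - vderiv (%t. (1 - 2 * \<alpha>) / complex_of_real t * \<phi> t) t *\<^sub>C u t) = bochner leb_pos X"
  by (rule bochner_cong(1)) (use sp vector_derivative_at[OF dq] in \<open>auto simp: X_def p1_def p2_def vderiv_def c_def\<close>)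
 have "bochner leb_pos X = bochner leb_pos Y"
 proof (rule cfunctional_eqI)
  fix m :: "'a => complex" assume m: "cfunctional m"
  interpret m: bounded_linear m by (rule cfunctionalD(1)[OF m])
  \<comment> \<open>Green's identity: the derivative of \<open>G\<close> is the difference of the
    two integrands seen through \<open>m\<close>, and \<open>G\<close> vanishes near 0 and near
    infinity together with the test function.\<close>
  define G where "G t = (p1 t * m (u t) - \<phi> t * m (u1 t)) - (c / complex_of_real t * \<phi> t) * m (u t)" for t
  have dG: "(G has_vector_derivative m (X t) - m (Y t)) (at t)" if t: "t > 0" for t
  proof -
   note mu = m.has_vector_derivative[OF u(1)[OF t]] and mu1 = m.has_vector_derivative[OF u(2)[OF t]]
   have "(G has_vector_derivative ((p1 t * m (u1 t) + p2 t * m (u t)) - (\<phi> t * m (u2 t) + p1 t * m (u1 t))) -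
     ((c / complex_of_real t * \<phi> t) * m (u1 t) + q t * m (u t))) (at t)"
    unfolding G_def by (intro has_vector_derivative_diff has_vector_derivative_mult d mu mu1 dq t)
   then show ?thesis
    by (rule has_vector_derivative_eq_rhs)
     (simp add: X_def Y_def ode[OF t, symmetric] cfunctionalD(2,3,4)[OF m] c_def algebra_simps)
  qed
  have G0: "G t = 0" if "t \<notin> {a..b}" for t using \<phi>0[OF that] p10[OF that] by (simp add: G_def)
  have "(LINT t|leb_pos. m (X t) - m (Y t)) = 0 - 0"
  proof (rule FTC_pos[OF dG])
   have gc: "continuous_on {0<..} (%t. m (X t) - m (Y t))" by (intro continuous_on_diff m.continuous_on Xc Yc)
   obtain C where C: "!!s. s > 0 ==> norm (m (X s) - m (Y s)) <= C * (exp (- 1 * \<bar>ln s + 0\<bar>) / s)"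
    using bound_of_compact_support[OF gc a, of b] X0 Y0 m.zero by auto
   show "integrable lborel (%x. exp x *\<^sub>R (m (X (exp x)) - m (Y (exp x))))"
    by (rule integrable_exp_subst_abs_ln[OF gc zero_less_one C])
   have "\<forall>\<^sub>F t in at_right 0. G t = 0" by (rule eventually_at_rightI[of 0 a]) (use a G0 in auto)
   then show "(G \<longlongrightarrow> 0) (at_right 0)" by (rule tendsto_eventually)
   have "\<forall>\<^sub>F t in at_top. G t = 0" using eventually_gt_at_top[of b] by eventually_elim (rule G0, simp)
   then show "(G \<longlongrightarrow> 0) at_top" by (rule tendsto_eventually)
  qed
  moreover have "(LINT t|leb_pos. m (X t) - m (Y t)) = m (bochner leb_pos X) - m (bochner leb_pos Y)"
   unfolding bochner_functional(2)[OF Xi m] bochner_functional(2)[OF Yi m]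
   by (rule LINT_diff) (rule bochner_functional(1)[OF Xi m], rule bochner_functional(1)[OF Yi m])
  ultimately show "m (bochner leb_pos X) = m (bochner leb_pos Y)" by simp
 qed
 then show ?thesis unfolding XE Y_def .
qed

context sect_ivp
begin

text \<open>For \<open>t > 0\<close> the function is twice differentiable and satisfies the equation
  classically, so the weak form follows from \<open>weak_of_classical\<close>. Density of the domain
  enters through continuity at \<open>t = 0\<close>.\<close>

lemma U_is_solution:
 assumes dense: "closure (dom A) = UNIV"
 shows "is_solution A \<alpha> x (%t. if t = 0 then x else blinfun_apply (U_op A \<omega> \<alpha> (complex_of_real t)) x)"
proof -
 define g where "g = 1 / (2 * Gamma (2 * \<alpha>))"
 define P where "P k t = complex_of_real t powr (2 * \<alpha> - k)" for k t
 define w where "w j t = blinfun_apply (W (\<alpha> - 1/2) j t) x" for j t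
 define u where "u t = blinfun_apply (U t) x" for t
 define u1 where "u1 t = g *\<^sub>C ((2 * \<alpha> * P 1 t) *\<^sub>C w (- 1) t - P 0 t *\<^sub>C w 0 t)" for t
 define u2 where "u2 t = g *\<^sub>C ((2 * \<alpha> * ((2 * \<alpha> - 1) * P 2 t)) *\<^sub>C w (- 1) t - (2 * \<alpha> * P 1 t) *\<^sub>C w 0 t -
  ((2 * \<alpha> * P 1 t) *\<^sub>C w 0 t - P 0 t *\<^sub>C w 1 t))" for t
 \<comment> \<open>The value of \<open>A u\<close>, already freed of the weight
   \<open>\<alpha> + 1/2\<close> by \<open>W_parts\<close>; \<open>dm\<close> proves the
   identification.\<close>
 define f where "f t = g *\<^sub>C P 0 t *\<^sub>C (w 1 t - ((2 * \<alpha> + 1) / of_real t) *\<^sub>C w 0 t)" for t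
 define uu where "uu t = (if t = 0 then x else blinfun_apply (U_op A \<omega> \<alpha> (complex_of_real t)) x)" for t
 have uu: "uu t = u t" if "t > 0" for t using that by (simp add: uu_def u_def U_op_eq)
 have uE: "u t = g *\<^sub>C P 0 t *\<^sub>C w (- 1) t" for t
  by (simp add: u_def U_def scaleC_blinfun.rep_eq scaleC_scaleC g_def P_def w_def)
 have dP: "(P k has_vector_derivative (2 * \<alpha> - k) * P (k + 1) t) (at t)" if "t > 0" for k t
  using of_real_powr_has_derivative[OF that, of "2 * \<alpha> - k"] by (simp add: P_def[abs_def] diff_diff_eq)
 have Pt: "P k t = of_real t * P (k + 1) t" if "t > 0" for k t
 proof -
  have "2 * \<alpha> - k = (2 * \<alpha> - (k + 1)) + 1" by simp
  then have "P k t = complex_of_real t powr ((2 * \<alpha> - (k + 1)) + 1)" unfolding P_def by (rule arg_cong)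
  then show ?thesis using that unfolding powr_add by (simp add: P_def mult.commute)
 qed
 have dw: "(w j has_vector_derivative - w (j + 1) t) (at t)" if "t > 0" "j >= - 1" for j t
  using bounded_linear.has_vector_derivative[OF blinfun.bounded_linear_left W_has_derivative[OF that(2) _ that(1)], of "\<alpha> - 1/2" x]
  by (simp add: w_def[abs_def] blinfun.minus_left)
 note prod = bounded_bilinear.has_vector_derivative[OF bounded_bilinear_scaleC]
 note scl = bounded_linear.has_vector_derivative[OF bounded_linear_scaleC]
 have du: "(u has_vector_derivative u1 t) (at t)" if t: "t > 0" for t
  unfolding uE[abs_def]
  by (rule has_vector_derivative_eq_rhs[OF scl[OF prod[OF dP[OF t] dw[OF t]]]]) (simp_all add: u1_def algebra_simps)
 have du1: "(u1 has_vector_derivative u2 t) (at t)" if t: "t > 0" for t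
 proof -
  have 1: "((%t. 2 * \<alpha> * P 1 t) has_vector_derivative 2 * \<alpha> * ((2 * \<alpha> - 1) * P (1 + 1) t)) (at t)"
   by (rule has_vector_derivative_mult_right[OF dP[OF t]])
  have 2: "(u1 has_vector_derivative g *\<^sub>C (((2 * \<alpha> * P 1 t) *\<^sub>C (- w (- 1 + 1) t) + (2 * \<alpha> * ((2 * \<alpha> - 1) * P (1 + 1) t)) *\<^sub>C w (- 1) t) -
    (P 0 t *\<^sub>C (- w (0 + 1) t) + ((2 * \<alpha> - 0) * P (0 + 1) t) *\<^sub>C w 0 t))) (at t)"
   unfolding u1_def[abs_def] by (intro scl has_vector_derivative_diff prod 1 dP[OF t] dw[OF t]) simp_all
  show ?thesis by (rule has_vector_derivative_eq_rhs[OF 2]) (simp add: u2_def algebra_simps)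
 qed
 have ode: "u2 t + ((1 - 2 * \<alpha>) / of_real t) *\<^sub>C u1 t = f t" if t: "t > 0" for t
 proof -
  have P1: "P 1 t = of_real t * P 2 t" and P0: "P 0 t = of_real t * of_real t * P 2 t"
   using Pt[OF t, of 1] Pt[OF t, of 0] by simp_all
  have tn: "complex_of_real t ~= 0" using t by simp
  show ?thesis
  \<comment> \<open>A functional turns the vector identity into one between complex numbers, where
    field arithmetic applies.\<close>
  proof (rule cfunctional_eqI)
   fix m :: "'a => complex" assume m: "cfunctional m"
   show "m (u2 t + ((1 - 2 * \<alpha>) / of_real t) *\<^sub>C u1 t) = m (f t)"
    unfolding u1_def u2_def f_def cfunctionalD(2,3,4)[OF m] P1 P0 using tn by (simp add: divide_simps) (simp add: algebra_simps)
  qed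
 qed
 have dm: "u t \<in> dom A" "app A (u t) = f t" if t: "t > 0" for t
 proof -
  note D = W_dom[OF t, of x, folded w_def] and LD = linear_operatorD(4,5)[OF lin]
  show "u t \<in> dom A" unfolding uE by (intro LD D)
  have "of_real t *\<^sub>C blinfun_apply (W (\<alpha> + 1/2) (- 1) t) x = (2 * \<alpha> + 1) *\<^sub>C w 0 t"
   using arg_cong[OF W_parts[OF t], of "%T. blinfun_apply T x"] by (simp add: scaleC_blinfun.rep_eq w_def)
  then have "(1 / of_real t) *\<^sub>C of_real t *\<^sub>C blinfun_apply (W (\<alpha> + 1/2) (- 1) t) x = (1 / of_real t) *\<^sub>C (2 * \<alpha> + 1) *\<^sub>C w 0 t"
   by (rule arg_cong)
  then have "blinfun_apply (W (\<alpha> + 1/2) (- 1) t) x = ((2 * \<alpha> + 1) / of_real t) *\<^sub>C w 0 t"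
   using t by (simp add: scaleC_scaleC)
  then show "app A (u t) = f t" unfolding uE f_def using D by (simp add: LD)
 qed
 have wc: "continuous_on {0<..} (w j)" if "j >= - 1" for j
  using dw that by (intro continuous_at_imp_continuous_on ballI has_vector_derivative_continuous) auto
 have fc: "continuous_on {0<..} f"
  unfolding f_def P_def
  by (intro bounded_bilinear.continuous_on[OF bounded_bilinear_scaleC] continuous_on_of_real_powr continuous_on_diff wc continuous_intros) auto
 have sp: "space leb_pos = {0::real<..}" by simp
 show ?thesis
  unfolding is_solution_def uu_def[symmetric]
 proof (intro conjI allI impI)
  obtain K where K: "!!t. t > 0 ==> norm (U t) <= K" using U_bounded by blast
  have "norm (uu t) <= max (norm x) (K * norm x)" if "t >= 0" for t
  proof (cases "t = 0")
   case False
   then have t: "t > 0" using that by simp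
   have "norm (u t) <= norm (U t) * norm x" unfolding u_def by (rule norm_blinfun)
   also have "... <= K * norm x" by (intro mult_right_mono K t) simp
   finally show ?thesis unfolding uu[OF t] by simp
  qed (simp add: uu_def)
  then show "bounded (uu ` {0..})" unfolding bounded_iff by (intro exI[of _ "max (norm x) (K * norm x)"]) auto
  show "continuous_on {0..} uu"
   unfolding continuous_on_def
  proof
   fix t :: real assume "t \<in> {0..}"
   show "(uu \<longlongrightarrow> uu t) (at t within {0..})"
   proof (cases "t = 0")
    case True
    have "(u \<longlongrightarrow> x) (at_right 0)" unfolding u_def by (rule U_initial[OF dense])
    moreover have "\<forall>\<^sub>F t in at_right 0. u t = uu t" using eventually_at_right_less[of 0] by eventually_elim (simp add: uu)
    ultimately have "(uu \<longlongrightarrow> x) (at_right 0)" by (rule Lim_transform_eventually)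
    then show ?thesis using True by (simp add: at_within_Ici_at_right uu_def)
   next
    case False
    then have t: "t > 0" using \<open>t \<in> {0..}\<close> by simp
    have "(uu has_vector_derivative u1 t) (at t)"
     by (rule has_vector_derivative_transform_within_open[OF du[OF t], of "{0<..}"]) (use t uu in auto)
    then have "isCont uu t" by (rule has_vector_derivative_continuous)
    then show ?thesis unfolding isCont_def by (rule tendsto_within_subset) simp
   qed
  qed
  show "uu 0 = x" by (simp add: uu_def)
  show "uu t \<in> dom A" if "0 < t" for t unfolding uu[OF that] by (rule dm(1)[OF that])
  fix K :: "real set" assume K: "compact K \<and> K \<subseteq> {0<..}"
  have Kc: "continuous_on K f" using fc K continuous_on_subset by blast
  have "bounded (f ` K)" using K by (intro compact_imp_bounded compact_continuous_image Kc) auto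
  then obtain M where M: "!!t. t \<in> K ==> norm (f t) <= M" unfolding bounded_iff by blast
  interpret fm: finite_measure "lebesgue_on K" using K by (intro finite_measure_lebesgue_on lmeasurable_compact) auto
  have "bochner_integrable (lebesgue_on K) f"
   by (rule bochner_integrable_continuous_lebesgue_on[OF Kc _ fm.integrable_const M]) (use K in \<open>auto intro: borel_closed compact_imp_closed\<close>)
  moreover have "bochner_integrable (lebesgue_on K) (%t. app A (uu t)) \<longleftrightarrow> bochner_integrable (lebesgue_on K) f"
   by (rule bochner_cong(2)) (use K dm uu in auto)
  ultimately show "bochner_integrable (lebesgue_on K) (%t. app A (uu t))" by simp
 next
  fix \<phi> assume "test_function \<phi>"
  from weak_of_classical[OF this du du1 ode fc]
  have "bochner leb_pos
     (%t. vderiv (vderiv \<phi>) t *\<^sub>C u t - vderiv (%t. (1 - 2 * \<alpha>) / complex_of_real t * \<phi> t) t *\<^sub>C u t) =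
    bochner leb_pos (%t. \<phi> t *\<^sub>C f t)" by blast
  moreover have "bochner leb_pos
     (%t. vderiv (vderiv \<phi>) t *\<^sub>C uu t - vderiv (%t. (1 - 2 * \<alpha>) / complex_of_real t * \<phi> t) t *\<^sub>C uu t) =
    bochner leb_pos
     (%t. vderiv (vderiv \<phi>) t *\<^sub>C u t - vderiv (%t. (1 - 2 * \<alpha>) / complex_of_real t * \<phi> t) t *\<^sub>C u t)"
   "bochner leb_pos (%t. \<phi> t *\<^sub>C app A (uu t)) = bochner leb_pos (%t. \<phi> t *\<^sub>C f t)"
   by (rule bochner_cong(1); simp add: uu dm)+
  ultimately show "bochner leb_pos
     (%t. vderiv (vderiv \<phi>) t *\<^sub>C uu t - vderiv (%t. (1 - 2 * \<alpha>) / complex_of_real t * \<phi> t) t *\<^sub>C uu t) =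
    bochner leb_pos (%t. \<phi> t *\<^sub>C app A (uu t))" by simp
 qed
qed

end

theorem theorem4p9:
  fixes A :: "'a::complex_banach \<rightharpoonup> 'a" and \<omega> :: real and \<alpha> :: complex and x :: 'a
  assumes "0 \<le> \<omega>" and "\<omega> < pi" and "A \<in> Sect \<omega>"
    and "0 < Re \<alpha>" and "Re \<alpha> < 1"
    and "closure (dom A) = UNIV"
  shows "(\<forall>z\<in>sector ((pi - \<omega>) / 2).
            bochner_integrable (lebesgue_on {0<..}) (U_integrand A \<omega> \<alpha> z) \<and>
            U_op A \<omega> \<alpha> z \<in> cblinfuns) \<and>
         is_solution A \<alpha> x (\<lambda>t. if t = 0 then x else blinfun_apply (U_op A \<omega> \<alpha> (complex_of_real t)) x)"
proof -
 interpret sect_ivp A \<omega> \<alpha> by unfold_locales (use assms in auto)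
 show ?thesis using U_integrable U_is_solution[OF assms(6)] by blast
qed

end
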